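(* Let $n$ be an integer with $n\ge4$, let $X$ be a periodic interval, and let $a_0>0$. Let $u_0\in H^n$ with $u_0(x)>a_0$ for all $x\in X$. Then there exist $T>0$ and $u\in C([0,T];H^n)$ such that $u(x,t)>a_0/2$ for all $x\in X$, $t\in[0,T]$, and $u$ is the unique solution of the Harry Dym initial value problem $$u_t=u^3u_{xxx},\qquad u(x,0)=u_0(x).$$ Moreover, let $0\le n'<n$ and $\epsilon>0$. There exists $\delta>0$ such that for any $v_0\in H^n$ with $v_0(x)>a_0$ for all $x\in X$ and $\|v_0-u_0\|_{H^n}\le\delta$, the solution $v$ of $v_t=v^3v_{xxx}$ with $v(x,0)=v_0(x)$ satisfies $v\in C([0,T];H^n)$ and $$\sup_{t\in[0,T]}\|u(\cdot,t)-v(\cdot,t)\|_{H^{n'}}<\epsilon.$$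
   Context: $H^s$ denotes the Sobolev space of periodic functions on $X$. *)

theory Defs
  imports "HOL-Analysis.Analysis"
begin

text \<open>The periodic interval X is modelled as the real line with period L > 0
  (i.e. the circle of length L); functions on X are L-periodic functions real => real.
  A space-time function u x t is represented as u :: real => real => real.\<close>

definition periodic_fun :: "real \<Rightarrow> (real \<Rightarrow> real) \<Rightarrow> bool" where
  "periodic_fun L f \<longleftrightarrow> (\<forall>x. f (x + L) = f x)"

definition fcoeff :: "real \<Rightarrow> (real \<Rightarrow> real) \<Rightarrow> int \<Rightarrow> complex" where
  "fcoeff L f k = (LBINT x=0..L. complex_of_real (f x) * cis (- 2 * pi * real_of_int k * x / L))
                   / complex_of_real L"

definition sobolev :: "real \<Rightarrow> real \<Rightarrow> (real \<Rightarrow> real) \<Rightarrow> bool" where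
  "sobolev L s f \<longleftrightarrow> periodic_fun L f \<and> f \<in> borel_measurable lborel
     \<and> set_integrable lborel {0..L} (\<lambda>x. (f x)\<^sup>2)
     \<and> (\<lambda>k::int. (1 + (real_of_int k)\<^sup>2) powr s * (cmod (fcoeff L f k))\<^sup>2) summable_on UNIV"

definition hnorm :: "real \<Rightarrow> real \<Rightarrow> (real \<Rightarrow> real) \<Rightarrow> real" where
  "hnorm L s f = sqrt (\<Sum>\<^sub>\<infinity>k::int. (1 + (real_of_int k)\<^sup>2) powr s * (cmod (fcoeff L f k))\<^sup>2)"

definition cont_Hs :: "real \<Rightarrow> real \<Rightarrow> real \<Rightarrow> (real \<Rightarrow> real \<Rightarrow> real) \<Rightarrow> bool" where
  "cont_Hs L s T u \<longleftrightarrow> (\<forall>t\<in>{0..T}. sobolev L s (\<lambda>x. u x t))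
     \<and> (\<forall>t\<in>{0..T}. \<forall>e>0. \<exists>d>0. \<forall>t'\<in>{0..T}. \<bar>t' - t\<bar> < d \<longrightarrow>
           hnorm L s (\<lambda>x. u x t' - u x t) < e)"

definition diff3 :: "(real \<Rightarrow> real) \<Rightarrow> bool" where
  "diff3 f \<longleftrightarrow> (\<forall>x. f differentiable at x) \<and> (\<forall>x. deriv f differentiable at x)
     \<and> (\<forall>x. deriv (deriv f) differentiable at x)"

text \<open>u is a solution of the Harry Dym initial value problem u_t = u^3 u_xxx, u(.,0) = u0
  on [0,T], in the class C([0,T]; H^n). The equation holds classically (one-sided time
  derivatives at the endpoints); the initial condition holds as equality in H^n,
  i.e. almost everywhere, since u0 is only an element of H^n.\<close>
definition dym_solution ::
  "real \<Rightarrow> nat \<Rightarrow> real \<Rightarrow> (real \<Rightarrow> real) \<Rightarrow> (real \<Rightarrow> real \<Rightarrow> real) \<Rightarrow> bool" where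
  "dym_solution L n T u0 u \<longleftrightarrow>
     cont_Hs L (real n) T u
     \<and> (\<forall>t\<in>{0..T}. diff3 (\<lambda>x. u x t))
     \<and> (\<forall>x. \<forall>t\<in>{0..T}. ((\<lambda>s. u x s) has_real_derivative
            ((u x t) ^ 3 * deriv (deriv (deriv (\<lambda>y. u y t))) x)) (at t within {0..T}))
     \<and> (AE x in lborel. u x 0 = u0 x)"

end

theory Submission
  imports Defs
begin

text \<open>Everything is done on Fourier coefficients. The equation is regularised by a term
  \<open>- \<epsilon> u\<^sub>x\<^sub>x\<^sub>x\<^sub>x\<close>, which makes Duhamel's formula a contraction for smooth data. Uniform bounds come from
  the weighted energy \<open>\<integral> u^(2n-3) (\<partial>\<^sup>n u)\<^sup>2\<close>: exactly for this exponent the terms of order \<open>n + 3\<close> and \<open>n + 2\<close> in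
  its time derivative integrate by parts to terms of order \<open>n\<close>. Differences of two solutions are controlled in \<open>L\<^sup>2\<close>
  with the weight \<open>u^(-3)\<close>, which symmetrises the leading operator; this gives uniqueness, convergence as
  \<open>\<epsilon> \<rightarrow> 0\<close>, and, by interpolation with the \<open>H\<^sup>n\<close> bound, the continuous dependence. Running the weighted energy
  for \<open>u - \<gamma>\<close>, where \<open>\<gamma>\<close> is a truncation of the data, yields right continuity in \<open>H\<^sup>n\<close> at time 0. Restarting carries
  it to every time, and the symmetry \<open>(x, t) \<mapsto> (- x, - t)\<close> of the equation turns it into left continuity.\<close>

section \<open>Weighted coefficient sequences\<close>

text \<open>The exponent comes from a count. For \<open>w = d^n u\<close> the equation reads
  \<open>w_t = u^3 w_xxx + 3 n u^2 u_x w_xx + ...\<close>, so the weight \<open>u^p\<close> produces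
  \<open>2 u^(p+3) w w_xxx + 6 n u^(p+2) u_x w w_xx\<close>. An expression
  \<open>2 F w w_xxx + 3 F_x w w_xx\<close> is a derivative up to a multiple of \<open>w^2\<close>;
  with \<open>F = u^(p+3)\<close> this forces \<open>3 (p + 3) = 6 n\<close>, that is
  \<open>p = 2 n - 3\<close>. The case n = 0 is the weight \<open>u^(-3)\<close> for differences.
  The bounds survive the limit only as bounds, since convergence is proved in weaker norms; strong
  continuity in \<open>H^n\<close> needs its own argument. Subtracting a smooth
  \<open>\<gamma>\<close> helps because the factor in front of the initial distance to
  \<open>\<gamma>\<close> is independent of \<open>\<gamma>\<close>, while the factor in front of t
  may be large: \<open>\<gamma>\<close> is fixed first, the time afterwards. With
  \<open>n \<ge> 4\<close> the function \<open>u_xxx\<close> is continuous. For n = 4 the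
  regularising term \<open>u_xxxx\<close> is of top order and known only in mean square: the energy
  estimate pays for it with the dissipation, and the limit is taken on single Fourier
  coefficients.\<close>

lemma summable_on_real_le:
  fixes f :: "'a \<Rightarrow> 'b::banach"
  assumes "g summable_on A" "\<And>k. k \<in> A \<Longrightarrow> norm (f k) \<le> g k"
  shows "f summable_on A" "(\<lambda>k. norm (f k)) summable_on A"
proof -
  show *: "(\<lambda>k. norm (f k)) summable_on A"
    by (rule Infinite_Sum.abs_summable_on_comparison_test'[OF assms])
  show "f summable_on A" by (rule Infinite_Sum.abs_summable_summable[OF *])
qed

text \<open>Along \<open>int_decode\<close> an unconditional sum over the integers becomes an
  ordinary series, the form in which \<open>has_field_derivative_series\<close> differentiates term
  by term.\<close>

lemma has_sum_nat_of_int: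
  fixes f :: "int \<Rightarrow> real"
  assumes "f summable_on UNIV"
  shows "summable (\<lambda>n. f (int_decode n))" "(\<Sum>\<^sub>\<infinity>k. f k) = (\<Sum>n. f (int_decode n))"
proof -
  have b: "bij_betw int_decode UNIV UNIV" by (simp add: bij_int_decode)
  have "(f has_sum (\<Sum>\<^sub>\<infinity>k. f k)) UNIV" using assms by simp
  then have "((\<lambda>n. f (int_decode n)) has_sum (\<Sum>\<^sub>\<infinity>k. f k)) UNIV"
    using has_sum_reindex_bij_betw[OF b, of f] by simp
  from has_sum_imp_sums[OF this] show "summable (\<lambda>n. f (int_decode n))" "(\<Sum>\<^sub>\<infinity>k. f k) = (\<Sum>n. f (int_decode n))"
    by (auto simp: sums_iff)
qed

lemma continuous_on_infsum:
  fixes f :: "'k \<Rightarrow> 'a::topological_space \<Rightarrow> 'b::banach"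
  assumes "\<And>k. continuous_on S (f k)" "\<And>k x. x \<in> S \<Longrightarrow> norm (f k x) \<le> M k" "M summable_on UNIV"
  shows "continuous_on S (\<lambda>x. \<Sum>\<^sub>\<infinity>k. f k x)"
proof (rule uniform_limit_theorem)
  show "uniform_limit S (\<lambda>X y. \<Sum>x\<in>X. f x y) (\<lambda>x. \<Sum>\<^sub>\<infinity>k. f k x) (finite_subsets_at_top UNIV)"
    by (rule Weierstrass_m_test_general) (use assms in auto)
qed (auto intro!: always_eventually continuous_on_sum assms)

lemma has_integral_infsum:
  fixes f :: "'k \<Rightarrow> real \<Rightarrow> 'b::banach"
  assumes "\<And>k. continuous_on {a..b} (f k)" "\<And>k x. x \<in> {a..b} \<Longrightarrow> norm (f k x) \<le> M k" "M summable_on UNIV"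
  shows "((\<lambda>k. integral {a..b} (f k)) has_sum integral {a..b} (\<lambda>x. \<Sum>\<^sub>\<infinity>k. f k x)) UNIV"
proof -
  have "uniform_limit {a..b} (\<lambda>X y. \<Sum>x\<in>X. f x y) (\<lambda>x. \<Sum>\<^sub>\<infinity>k. f k x) (finite_subsets_at_top UNIV)"
    by (rule Weierstrass_m_test_general) (use assms in auto)
  from uniform_limit_integral[OF this] obtain I J where
     I: "\<And>X. ((\<lambda>y. \<Sum>x\<in>X. f x y) has_integral I X) {a..b}"
    and J: "((\<lambda>x. \<Sum>\<^sub>\<infinity>k. f k x) has_integral J) {a..b}" and l: "(I \<longlongrightarrow> J) (finite_subsets_at_top UNIV)"
    using assms by (auto intro!: continuous_on_sum)
  have "I X = (\<Sum>k\<in>X. integral {a..b} (f k))" if "finite X" for X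
  proof -
    have "integral {a..b} (\<lambda>y. \<Sum>x\<in>X. f x y) = (\<Sum>k\<in>X. integral {a..b} (f k))"
      by (rule integral_sum) (use that assms in \<open>auto intro: integrable_continuous_real\<close>)
    then show ?thesis using I[of X] by (simp add: integral_unique)
  qed
  then have "((\<lambda>X. \<Sum>k\<in>X. integral {a..b} (f k)) \<longlongrightarrow> J) (finite_subsets_at_top UNIV)"
    using l by (rule_tac Lim_transform_eventually[OF l]) (auto intro!: eventually_finite_subsets_at_top_weakI)
  then show ?thesis using J by (simp add: has_sum_def integral_unique)
qed

lemma has_real_derivative_infsum:
  fixes f :: "int \<Rightarrow> real \<Rightarrow> real"
  assumes S: "convex S" "x \<in> S"
    and d: "\<And>k t. t \<in> S \<Longrightarrow> (f k has_real_derivative f' k t) (at t within S)"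
    and M: "\<And>k t. t \<in> S \<Longrightarrow> \<bar>f' k t\<bar> \<le> M k" "M summable_on UNIV"
    and N: "\<And>t. t \<in> S \<Longrightarrow> (\<lambda>k. f k t) summable_on UNIV"
  shows "((\<lambda>t. \<Sum>\<^sub>\<infinity>k. f k t) has_real_derivative (\<Sum>\<^sub>\<infinity>k. f' k x)) (at x within S)"
proof -
  let ?d = int_decode
  have u: "uniform_limit S (\<lambda>n x. \<Sum>i<n. f' (?d i) x) (\<lambda>x. \<Sum>i. f' (?d i) x) sequentially"
    by (rule Weierstrass_m_test[where M="\<lambda>n. M (?d n)"])
       (use M has_sum_nat_of_int(1)[OF M(2)] in auto)
  have "\<exists>g. \<forall>x\<in>S. (\<lambda>n. f (?d n) x) sums g x \<and> (g has_real_derivative (\<Sum>i. f' (?d i) x)) (at x within S)"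
    by (rule has_field_derivative_series[OF S(1) _ u S(2)])
       (use d has_sum_nat_of_int(1)[OF N] S in auto)
  then obtain g where g: "\<And>x. x\<in>S \<Longrightarrow> (\<lambda>n. f (?d n) x) sums g x"
     "\<And>x. x\<in>S \<Longrightarrow> (g has_real_derivative (\<Sum>i. f' (?d i) x)) (at x within S)" by blast
  have e: "g t = (\<Sum>\<^sub>\<infinity>k. f k t)" if "t \<in> S" for t
    using g(1)[OF that] has_sum_nat_of_int(2)[OF N[OF that]] by (simp add: sums_iff)
  have "(\<lambda>k. f' k x) summable_on UNIV" by (rule summable_on_real_le(1)[OF M(2)]) (use M S in auto)
  then have e': "(\<Sum>i. f' (?d i) x) = (\<Sum>\<^sub>\<infinity>k. f' k x)" by (simp add: has_sum_nat_of_int(2))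
  show ?thesis
    using has_field_derivative_transform_within[OF g(2)[OF S(2)] zero_less_one S(2), of "\<lambda>t. \<Sum>\<^sub>\<infinity>k. f k t"] e e'
    by auto
qed

text \<open>Submultiplicativity of this weight (\<open>wt_submult\<close>) is what turns weighted
  bounds on two sequences into a weighted bound on their convolution.\<close>

definition wt :: "int \<Rightarrow> real" where "wt k = 1 + \<bar>real_of_int k\<bar>"

lemma wt_ge1: "wt k \<ge> 1" by (simp add: wt_def)
lemma wt_pos: "wt k > 0" using wt_ge1[of k] by linarith
lemma wt_submult: "wt (j + k) \<le> wt j * wt k"
proof -
  have "wt j * wt k = 1 + \<bar>real_of_int j\<bar> + \<bar>real_of_int k\<bar> + \<bar>real_of_int j\<bar> * \<bar>real_of_int k\<bar>"
    by (simp only: wt_def ring_distribs mult_1_left mult_1_right)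
  moreover have "0 \<le> \<bar>real_of_int j\<bar> * \<bar>real_of_int k\<bar>" by (rule mult_nonneg_nonneg) auto
  moreover have "wt (j + k) \<le> 1 + \<bar>real_of_int j\<bar> + \<bar>real_of_int k\<bar>" by (simp add: wt_def)
  ultimately show ?thesis by linarith
qed
lemma wt_power_mono: "r \<le> s \<Longrightarrow> wt k ^ r \<le> wt k ^ s"
  by (rule power_increasing) (auto simp: wt_ge1)

lemma summable_wt2: "(\<lambda>k. 1 / wt k ^ 2) summable_on UNIV"
proof -
  have b: "bij_betw int_decode UNIV UNIV" by (simp add: bij_int_decode)
  \<comment> \<open>\<open>int_decode\<close> lists the integers as 0, -1, 1, -2, 2, ..., so the
    n-th one has absolute value about n / 2.\<close>
  have w: "wt (int_decode n) \<ge> (real n + 1) / 2" for n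
  proof -
    have "real n \<le> 2 * real (n div 2) + 1" by linarith
    then show ?thesis by (auto simp: int_decode_def sum_decode_def wt_def)
  qed
  have "summable (\<lambda>n. 4 * (1 / real (Suc n) ^ 2))"
    using inverse_squares_sums by (intro summable_mult) (auto simp: sums_iff)
  then have "summable (\<lambda>n. norm (1 / wt (int_decode n) ^ 2))"
  proof (rule summable_comparison_test'[where N=0])
    fix n
    have "((real n + 1)/2)^2 \<le> wt (int_decode n) ^ 2" using w[of n] by (intro power_mono) auto
    then have "1 / wt (int_decode n) ^ 2 \<le> 1 / ((real n + 1)/2)^2"
      using wt_pos[of "int_decode n"] by (intro divide_left_mono mult_pos_pos zero_less_power) auto
    also have "\<dots> = 4 * (1 / real (Suc n) ^ 2)" by (simp add: power_divide add.commute)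
    finally show "norm (norm (1 / wt (int_decode n) ^ 2)) \<le> 4 * (1 / real (Suc n) ^ 2)" by simp
  qed
  then have "(\<lambda>n. 1 / wt (int_decode n) ^ 2) summable_on UNIV"
    by (intro norm_summable_imp_summable_on)
  then show ?thesis using summable_on_reindex_bij_betw[OF b, of "\<lambda>k. 1 / wt k ^ 2"] by simp
qed

definition Zw :: real where "Zw = (\<Sum>\<^sub>\<infinity>k. 1 / wt k ^ 2)"

lemma Zw_nonneg: "Zw \<ge> 0" unfolding Zw_def by (rule infsum_nonneg) auto

text \<open>Decay of single coefficients rather than a square sum: Duhamel's formula acts on each
  frequency separately, so such bounds pass through it one frequency at a time.\<close>

definition bd :: "nat \<Rightarrow> real \<Rightarrow> (int \<Rightarrow> complex) \<Rightarrow> bool" where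
  "bd s C a \<longleftrightarrow> (\<forall>k. cmod (a k) * wt k ^ s \<le> C)"

definition asum :: "nat \<Rightarrow> (int \<Rightarrow> complex) \<Rightarrow> bool" where
  "asum s a \<longleftrightarrow> (\<lambda>k. wt k ^ s * cmod (a k)) summable_on UNIV"

text \<open>The reality condition for Fourier coefficients.\<close>

definition symm :: "(int \<Rightarrow> complex) \<Rightarrow> bool" where
  "symm a \<longleftrightarrow> (\<forall>k. a (- k) = cnj (a k))"

lemma bd_nonneg: "bd s C a \<Longrightarrow> C \<ge> 0"
  unfolding bd_def using wt_pos by (metis norm_ge_zero zero_le_mult_iff zero_le_power order_trans less_imp_le)

lemma bd_mono: "bd s C a \<Longrightarrow> r \<le> s \<Longrightarrow> C \<le> D \<Longrightarrow> bd r D a"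
  unfolding bd_def by (meson mult_left_mono norm_ge_zero order_trans wt_power_mono)

lemma bd_le: "bd s C a \<Longrightarrow> cmod (a k) \<le> C / wt k ^ s"
  unfolding bd_def using wt_pos by (simp add: pos_le_divide_eq)

lemma bd_asum: assumes "bd (s + 2) C a" shows "asum s a"
  unfolding asum_def
proof (rule summable_on_real_le(1))
  show "(\<lambda>k. C * (1 / wt k ^ 2)) summable_on UNIV" by (intro summable_on_cmult_right summable_wt2)
  fix k
  have "cmod (a k) * wt k ^ s * wt k ^ 2 \<le> C" using assms unfolding bd_def by (simp add: power_add mult.assoc del: power_Suc add_2_eq_Suc')
  then show "norm (wt k ^ s * cmod (a k)) \<le> C * (1 / wt k ^ 2)"
    using wt_pos[of k] by (simp add: pos_le_divide_eq abs_mult mult.commute)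
qed

lemma asum_mono: assumes "asum s a" "r \<le> s" shows "asum r a"
  unfolding asum_def
  by (rule summable_on_real_le(1)[OF assms(1)[unfolded asum_def]])
     (use wt_power_mono[OF assms(2)] wt_pos in \<open>auto simp: abs_mult mult_right_mono less_imp_le\<close>)

lemma asum0: "asum s a \<Longrightarrow> (\<lambda>k. cmod (a k)) summable_on UNIV"
  using asum_mono[of s a 0] by (simp add: asum_def)

lemma asum_diff: assumes "asum s a" "asum s b" shows "asum s (\<lambda>k. a k - b k)"
  unfolding asum_def
proof (rule summable_on_real_le(1))
  show "(\<lambda>k. wt k ^ s * cmod (a k) + wt k ^ s * cmod (b k)) summable_on UNIV"
    using assms unfolding asum_def by (rule summable_on_add)
  show "norm (wt k ^ s * cmod (a k - b k)) \<le> wt k ^ s * cmod (a k) + wt k ^ s * cmod (b k)" for k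
    using norm_triangle_ineq4[of "a k" "b k"] wt_pos[of k]
    by (simp add: abs_mult flip: distrib_left)
qed

lemma symm_diff: "symm a \<Longrightarrow> symm b \<Longrightarrow> symm (\<lambda>k. a k - b k)" by (simp add: symm_def)

lemma infsum_diff:
  fixes f g :: "'a \<Rightarrow> 'b::{topological_ab_group_add, t2_space}"
  assumes "f summable_on A" "g summable_on A"
  shows "(\<Sum>\<^sub>\<infinity>x\<in>A. f x - g x) = infsum f A - infsum g A"
proof -
  have "(\<lambda>x. - g x) summable_on A" using assms(2) by (simp add: summable_on_uminus)
  from infsum_add[OF assms(1) this] show ?thesis by (simp add: infsum_uminus)
qed

section \<open>Convolution of coefficient sequences\<close>

definition conv :: "(int \<Rightarrow> complex) \<Rightarrow> (int \<Rightarrow> complex) \<Rightarrow> int \<Rightarrow> complex" where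
  "conv a b k = (\<Sum>\<^sub>\<infinity>j. a j * b (k - j))"

text \<open>Submultiplicativity splits \<open>wt k ^ s\<close> between the two factors. The two
  surplus powers on the first factor leave the summable weight \<open>1 / wt j ^ 2\<close>, whose
  sum is \<open>Zw\<close>.\<close>

lemma conv_bound_term:
  assumes "bd (s + 2) A a" "bd s B b"
  shows "cmod (a j * b (k - j)) * wt k ^ s \<le> A * B * (1 / wt j ^ 2)"
proof -
  have "wt k ^ s \<le> (wt j * wt (k - j)) ^ s"
    using wt_submult[of j "k - j"] wt_pos[of k] by (intro power_mono) auto
  then have "cmod (a j * b (k - j)) * wt k ^ s \<le> cmod (a j) * cmod (b (k-j)) * (wt j ^ s * wt (k-j) ^ s)"
    by (simp add: norm_mult power_mult_distrib mult_left_mono)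
  also have "\<dots> = (cmod (a j) * wt j ^ (s+2)) * (cmod (b (k-j)) * wt (k-j) ^ s) * (1 / wt j ^ 2)"
    using wt_pos[of j] by (simp add: power_add field_simps power2_eq_square)
  also have "\<dots> \<le> A * B * (1 / wt j ^ 2)"
    using assms bd_nonneg[OF assms(1)] wt_pos unfolding bd_def
    by (intro mult_right_mono mult_mono) (auto simp: less_imp_le)
  finally show ?thesis .
qed

lemma conv_summable:
  assumes "bd (s + 2) A a" "bd s B b"
  shows "(\<lambda>j. a j * b (k - j)) summable_on UNIV" "(\<lambda>j. cmod (a j * b (k - j))) summable_on UNIV"
proof -
  have *: "(\<lambda>j. A * B * (1 / wt j ^ 2)) summable_on UNIV"
    by (intro summable_on_cmult_right summable_wt2)
  have **: "cmod (a j * b (k - j)) \<le> A * B * (1 / wt j ^ 2)" for j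
  proof -
    have "cmod (a j * b (k - j)) * 1 \<le> cmod (a j * b (k - j)) * wt k ^ s"
      by (rule mult_left_mono) (auto intro: wt_ge1 one_le_power)
    then show ?thesis using conv_bound_term[OF assms, of j k] by simp
  qed
  show "(\<lambda>j. a j * b (k - j)) summable_on UNIV" "(\<lambda>j. cmod (a j * b (k - j))) summable_on UNIV"
    by (rule summable_on_real_le[OF *]; use ** in simp)+
qed

lemma bd_conv:
  assumes "bd (s + 2) A a" "bd s B b"
  shows "bd s (A * B * Zw) (conv a b)"
  unfolding bd_def
proof
  fix k
  have s: "(\<lambda>j. A * B * (1 / wt j ^ 2)) summable_on UNIV"
    by (intro summable_on_cmult_right summable_wt2)
  have c: "cmod (conv a b k) \<le> (\<Sum>\<^sub>\<infinity>j. cmod (a j * b (k - j)))"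
    unfolding conv_def by (rule norm_infsum_bound) (use conv_summable(2)[OF assms] in simp)
  have "cmod (conv a b k) * wt k ^ s \<le> (\<Sum>\<^sub>\<infinity>j. cmod (a j * b (k - j))) * wt k ^ s"
    using c wt_pos by (intro mult_right_mono) (auto simp: less_imp_le)
  also have "\<dots> = (\<Sum>\<^sub>\<infinity>j. cmod (a j * b (k - j)) * wt k ^ s)"
    by (rule infsum_cmult_left[symmetric]) (use conv_summable(2)[OF assms] in simp)
  also have "\<dots> \<le> (\<Sum>\<^sub>\<infinity>j. A * B * (1 / wt j ^ 2))"
    by (rule infsum_mono) (use s conv_bound_term[OF assms] conv_summable(2)[OF assms] in \<open>auto intro!: summable_on_cmult_left\<close>)
  also have "\<dots> = A * B * Zw" unfolding Zw_def by (rule infsum_cmult_right) (use summable_wt2 in simp)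
  finally show "cmod (conv a b k) * wt k ^ s \<le> A * B * Zw" .
qed

lemma conv_diff:
  assumes "bd (s + 2) A a" "bd s B b" "bd (s + 2) A' a'" "bd s B' b'"
  shows "conv a b k - conv a' b' k = conv (\<lambda>k. a k - a' k) b k + conv a' (\<lambda>k. b k - b' k) k"
proof -
  note s = conv_summable(1)[OF assms(1,2)] conv_summable(1)[OF assms(3,4)] conv_summable(1)[OF assms(3,2)]
  have "conv (\<lambda>k. a k - a' k) b k = conv a b k - conv a' b k"
    unfolding conv_def using infsum_diff[OF s(1,3), of k] by (simp add: left_diff_distrib)
  moreover have "conv a' (\<lambda>k. b k - b' k) k = conv a' b k - conv a' b' k"
    unfolding conv_def using infsum_diff[OF s(3,2), of k] by (simp add: right_diff_distrib)
  ultimately show ?thesis by simp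
qed

lemma symm_conv: assumes "symm a" "symm b" shows "symm (conv a b)"
  unfolding symm_def
proof
  fix k
  have "conv a b (- k) = (\<Sum>\<^sub>\<infinity>j. a (- j) * b (- k - (- j)))"
    unfolding conv_def by (rule infsum_reindex_bij_betw[symmetric]) (rule bij_uminus)
  also have "\<dots> = (\<Sum>\<^sub>\<infinity>j. cnj (a j * b (k - j)))"
    using assms unfolding symm_def by (metis (no_types, opaque_lifting) complex_cnj_mult minus_diff_eq diff_minus_eq_add add.commute uminus_add_conv_diff)
  also have "\<dots> = cnj (conv a b k)" unfolding conv_def by (simp only: infsum_cnj)
  finally show "conv a b (- k) = cnj (conv a b k)" .
qed

lemma continuous_on_conv:
  fixes a b :: "'t::topological_space \<Rightarrow> int \<Rightarrow> complex"
  assumes "\<And>k. continuous_on S (\<lambda>t. a t k)" "\<And>k. continuous_on S (\<lambda>t. b t k)"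
   "\<And>t. t \<in> S \<Longrightarrow> bd (s + 2) A (a t)" "\<And>t. t \<in> S \<Longrightarrow> bd s B (b t)"
  shows "continuous_on S (\<lambda>t. conv (a t) (b t) k)"
  unfolding conv_def
proof (rule continuous_on_infsum[where M="\<lambda>j. A * B * (1 / wt j ^ 2)"])
  show "(\<lambda>j. A * B * (1 / wt j ^ 2)) summable_on UNIV"
    by (intro summable_on_cmult_right summable_wt2)
  fix t j assume t: "t \<in> S"
  have "cmod (a t j * b t (k - j)) * 1 \<le> cmod (a t j * b t (k - j)) * wt k ^ s"
      by (rule mult_left_mono) (auto intro: wt_ge1 one_le_power)
  then show "cmod (a t j * b t (k - j)) \<le> A * B * (1 / wt j ^ 2)"
    using conv_bound_term[OF assms(3,4)[OF t], of j k] by simp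
qed (intro continuous_intros assms)

section \<open>Fourier series on a circle\<close>

text \<open>A jet is a smooth function listed together with all its derivatives.\<close>

definition jet :: "(nat \<Rightarrow> real \<Rightarrow> real) \<Rightarrow> bool" where
  "jet f \<longleftrightarrow> (\<forall>j x. (f j has_real_derivative f (Suc j) x) (at x))"

locale circle =
  fixes L :: real
  assumes L_pos: "L > 0"
begin

definition kap :: real where "kap = 2 * pi / L"

lemma kap_pos: "kap > 0" using L_pos by (simp add: kap_def)

text \<open>Taking real parts makes the sum real for every sequence. For \<open>symm\<close>
  sequences nothing is lost, by \<open>fser_complex\<close>.\<close>

definition fser :: "(int \<Rightarrow> complex) \<Rightarrow> real \<Rightarrow> real" where
  "fser a x = (\<Sum>\<^sub>\<infinity>k. Re (a k * cis (kap * real_of_int k * x)))"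

definition dd :: "nat \<Rightarrow> (int \<Rightarrow> complex) \<Rightarrow> int \<Rightarrow> complex" where
  "dd j a k = (\<i> * complex_of_real (kap * real_of_int k)) ^ j * a k"

lemma dd_0 [simp]: "dd 0 a = a" by (auto simp: dd_def)
lemma dd_dd: "dd i (dd j a) = dd (i + j) a" by (auto simp: dd_def power_add)
lemma dd_diff: "dd j (\<lambda>k. a k - b k) = (\<lambda>k. dd j a k - dd j b k)"
  by (auto simp: dd_def right_diff_distrib)

lemma cmod_dd: "cmod (dd j a k) = kap ^ j * \<bar>real_of_int k\<bar> ^ j * cmod (a k)"
  using kap_pos by (simp add: dd_def norm_mult norm_power abs_mult power_mult_distrib)

lemma cmod_dd_le: "cmod (dd j a k) \<le> kap ^ j * (wt k ^ j * cmod (a k))"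
proof -
  have "\<bar>real_of_int k\<bar> ^ j \<le> wt k ^ j" by (intro power_mono) (auto simp: wt_def)
  then show ?thesis using kap_pos by (simp add: cmod_dd mult.assoc mult_left_mono mult_right_mono)
qed

lemma symm_dd: "symm a \<Longrightarrow> symm (dd j a)"
  by (simp add: symm_def dd_def)

lemma asum_dd: assumes "asum (s + j) a" shows "asum s (dd j a)"
  unfolding asum_def
proof (rule summable_on_real_le(1))
  show "(\<lambda>k. kap ^ j * (wt k ^ (s + j) * cmod (a k))) summable_on UNIV"
    using assms unfolding asum_def by (rule summable_on_cmult_right)
  show "norm (wt k ^ s * cmod (dd j a k)) \<le> kap ^ j * (wt k ^ (s + j) * cmod (a k))" for k
    using mult_left_mono[OF cmod_dd_le[of j a k], of "wt k ^ s"] wt_pos[of k]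
    by (simp add: power_add abs_mult mult_ac)
qed

lemma bd_dd: assumes "bd (s + j) C a" shows "bd s (kap ^ j * C) (dd j a)"
  unfolding bd_def
proof
  fix k
  have "cmod (dd j a k) * wt k ^ s \<le> kap ^ j * (wt k ^ j * cmod (a k)) * wt k ^ s"
    by (rule mult_right_mono[OF cmod_dd_le]) (use wt_pos in \<open>auto simp: less_imp_le\<close>)
  also have "\<dots> = kap ^ j * (cmod (a k) * wt k ^ (s + j))" by (simp add: power_add mult_ac)
  also have "\<dots> \<le> kap ^ j * C" using assms kap_pos by (intro mult_left_mono) (auto simp: bd_def)
  finally show "cmod (dd j a k) * wt k ^ s \<le> kap ^ j * C" .
qed

lemma fser_term_le: "\<bar>Re (a k * cis y)\<bar> \<le> cmod (a k)"
  using abs_Re_le_cmod[of "a k * cis y"] by (simp add: norm_mult)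

lemma fser_summable: "asum s a \<Longrightarrow> (\<lambda>k. Re (a k * cis (kap * real_of_int k * x))) summable_on UNIV"
  by (rule summable_on_real_le(1)[OF asum0], assumption, unfold real_norm_def, rule fser_term_le)

lemma fser_csummable: "asum s a \<Longrightarrow> (\<lambda>k. a k * cis (kap * real_of_int k * x)) summable_on UNIV"
  by (rule summable_on_real_le(1)[OF asum0], assumption) (simp add: norm_mult)

lemma fser_le: assumes "asum s a" shows "\<bar>fser a x\<bar> \<le> (\<Sum>\<^sub>\<infinity>k. cmod (a k))"
proof -
  have "norm (fser a x) \<le> (\<Sum>\<^sub>\<infinity>k. norm (Re (a k * cis (kap * real_of_int k * x))))"
    unfolding fser_def by (rule norm_infsum_bound)
      (rule summable_on_real_le(2)[OF asum0[OF assms]], unfold real_norm_def, rule fser_term_le)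
  also have "\<dots> \<le> (\<Sum>\<^sub>\<infinity>k. cmod (a k))"
  proof (rule infsum_mono)
    show "(\<lambda>k. norm (Re (a k * cis (kap * real_of_int k * x)))) summable_on UNIV"
      by (rule summable_on_real_le(2)[OF asum0[OF assms]], unfold real_norm_def, rule fser_term_le)
  qed (unfold real_norm_def, rule asum0[OF assms], rule fser_term_le)
  finally show ?thesis by simp
qed

lemma fser_diff: assumes "asum s a" "asum r b" shows "fser (\<lambda>k. a k - b k) x = fser a x - fser b x"
  unfolding fser_def using infsum_diff[OF fser_summable[OF assms(1), of x] fser_summable[OF assms(2), of x]]
  by (simp add: left_diff_distrib)

lemma kap_L: "kap * real_of_int k * L = 2 * pi * real_of_int k"
  using L_pos by (simp add: kap_def)

lemma cis_period: "cis (kap * real_of_int k * (x + L)) = cis (kap * real_of_int k * x)"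
proof -
  have "kap * real_of_int k * (x + L) = kap * real_of_int k * x + 2 * pi * real_of_int k"
    by (simp add: distrib_left kap_L)
  moreover have "cis (2 * pi * real_of_int k) = 1" by (simp add: cis_multiple_2pi)
  ultimately show ?thesis by (metis cis_mult mult.right_neutral)
qed

lemma fser_periodic: "fser a (x + L) = fser a x" by (simp add: fser_def cis_period)

lemma fser_deriv:
  assumes "asum 1 a"
  shows "(fser a has_real_derivative fser (dd 1 a) x) (at x)"
proof -
  have "((\<lambda>x. \<Sum>\<^sub>\<infinity>k. Re (a k * cis (kap * real_of_int k * x))) has_real_derivative
          (\<Sum>\<^sub>\<infinity>k. Re (dd 1 a k * cis (kap * real_of_int k * x)))) (at x within UNIV)"
  proof (rule has_real_derivative_infsum[where M="\<lambda>k. kap * (wt k ^ 1 * cmod (a k))"])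
    show "((\<lambda>x. Re (a k * cis (kap * real_of_int k * x))) has_real_derivative
            Re (dd 1 a k * cis (kap * real_of_int k * t))) (at t within UNIV)" for k t
      by (auto simp: dd_def cis.code algebra_simps intro!: derivative_eq_intros)
    show "\<bar>Re (dd 1 a k * cis (kap * real_of_int k * t))\<bar> \<le> kap * (wt k ^ 1 * cmod (a k))" for k t
      using cmod_dd_le[of 1 a k] fser_term_le[of "dd 1 a" k] by (rule_tac order_trans) auto
    show "(\<lambda>k. kap * (wt k ^ 1 * cmod (a k))) summable_on UNIV"
      using assms unfolding asum_def by (rule summable_on_cmult_right)
  qed (use fser_summable[OF assms] in auto)
  then show ?thesis by (simp add: fser_def[abs_def])
qed

lemma fser_deriv_dd:
  assumes "asum (Suc j) a"
  shows "(fser (dd j a) has_real_derivative fser (dd (Suc j) a) x) (at x)"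
  using fser_deriv[OF asum_dd[of 1 j a], of x] assms by (simp add: dd_dd)

lemma fser_cont: assumes "asum s a" shows "continuous_on S (fser a)"
  unfolding fser_def[abs_def]
  by (rule continuous_on_infsum[where M="\<lambda>k. cmod (a k)"])
     (use asum0[OF assms] in \<open>auto intro!: continuous_intros fser_term_le simp del: times_complex.sel\<close>)

lemma fser_cont_joint:
  assumes "\<And>k. continuous_on S (\<lambda>t. a t k)" "\<And>t k. t \<in> S \<Longrightarrow> cmod (a t k) \<le> M k" "M summable_on UNIV"
  shows "continuous_on (S \<times> U) (\<lambda>(t, x). fser (a t) x)"
  unfolding fser_def split_beta
proof (rule continuous_on_infsum[where M=M])
  fix k
  have "continuous_on (S \<times> U) (\<lambda>p. a (fst p) k)"
    by (rule continuous_on_compose2[OF assms(1) continuous_on_fst]) (auto intro: continuous_on_id)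
  then show "continuous_on (S \<times> U) (\<lambda>p. Re (a (fst p) k * cis (kap * real_of_int k * snd p)))"
    by (intro continuous_on_Re continuous_on_mult continuous_on_cis continuous_on_const continuous_on_snd continuous_on_id)
  show "norm (Re (a (fst p) k * cis (kap * real_of_int k * snd p))) \<le> M k" if "p \<in> S \<times> U" for p
  proof -
    have "\<bar>Re (a (fst p) k * cis (kap * real_of_int k * snd p))\<bar> \<le> cmod (a (fst p) k)" by (rule fser_term_le)
    also have "\<dots> \<le> M k" using assms(2) that by auto
    finally show ?thesis by simp
  qed
qed fact

text \<open>The substitution k to -k turns the sum into its own conjugate, so its imaginary part
  vanishes.\<close>

lemma fser_complex:
  assumes "asum s a" "symm a"
  shows "complex_of_real (fser a x) = (\<Sum>\<^sub>\<infinity>k. a k * cis (kap * real_of_int k * x))"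
proof -
  let ?f = "\<lambda>k. a k * cis (kap * real_of_int k * x)"
  have s: "?f summable_on UNIV" by (rule fser_csummable[OF assms(1)])
  have "infsum ?f UNIV = (\<Sum>\<^sub>\<infinity>k. ?f (- k))"
    by (rule infsum_reindex_bij_betw[symmetric]) (rule bij_uminus)
  also have "\<dots> = (\<Sum>\<^sub>\<infinity>k. cnj (?f k))" using assms(2) by (simp add: symm_def cis_cnj)
  also have "\<dots> = cnj (infsum ?f UNIV)" by (simp only: infsum_cnj)
  finally have "Im (infsum ?f UNIV) = 0" by (metis cnj.sel(2) minus_equation_iff neg_equal_zero)
  moreover have "Re (infsum ?f UNIV) = fser a x" unfolding fser_def using infsum_Re[OF s] by simp
  ultimately show ?thesis by (simp add: complex_eq_iff)
qed

lemma integral_cis: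
  "integral {0..L} (\<lambda>x. cis (kap * real_of_int k * x)) = (if k = 0 then complex_of_real L else 0)"
proof (cases "k = 0")
  case True then show ?thesis using L_pos by (simp add: scaleR_conv_of_real)
next
  case False
  let ?c = "kap * real_of_int k"
  have c: "?c \<noteq> 0" using False kap_pos by simp
  have "((\<lambda>x. cis (?c * x)) has_integral (cis (?c * L) / (\<i> * ?c) - cis (?c * 0) / (\<i> * ?c))) {0..L}"
  proof (rule fundamental_theorem_of_calculus)
    show "((\<lambda>x. cis (?c * x) / (\<i> * ?c)) has_vector_derivative cis (?c * x)) (at x within {0..L})" for x
    proof -
      have "((\<lambda>x. cis (?c * x)) has_vector_derivative (?c *\<^sub>R (\<i> * cis (?c * x)))) (at x within {0..L})"
        by (auto simp: has_vector_derivative_complex_iff cis.code intro!: derivative_eq_intros)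
      from has_vector_derivative_mult_left[OF this, of "1 / (\<i> * complex_of_real ?c)"] show ?thesis
        using c by (simp add: scaleR_conv_of_real field_simps)
    qed
  qed (use L_pos in auto)
  moreover have "cis (?c * L) = 1" by (simp only: kap_L cis_multiple_2pi Ints_of_int)
  ultimately show ?thesis using False by (simp add: integral_unique)
qed

lemma fcoeff_eq_integral:
  assumes "continuous_on {0..L} f"
  shows "fcoeff L f k = integral {0..L} (\<lambda>x. complex_of_real (f x) * cis (kap * real_of_int (- k) * x)) / L"
proof -
  have e: "cis (- 2 * pi * real_of_int k * x / L) = cis (kap * real_of_int (- k) * x)" for x
    by (simp add: kap_def)
  have "set_integrable lborel {0..L} (\<lambda>x. complex_of_real (f x) * cis (kap * real_of_int (- k) * x))"
    by (rule borel_integrable_atLeastAtMost')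
       (auto intro!: continuous_intros assms simp: cis.code complex_eq_iff)
  from interval_integral_eq_integral[OF less_imp_le[OF L_pos] this] show ?thesis
    unfolding fcoeff_def e by (simp add: zero_ereal_def)
qed

text \<open>Absolute summability permits integration term by term, and orthogonality of the modes
  keeps only the k-th term.\<close>

lemma fcoeff_fser:
  assumes "asum s a" "symm a"
  shows "fcoeff L (fser a) k = a k"
proof -
  let ?f = "\<lambda>j x. a j * cis (kap * real_of_int (j - k) * x)"
  have e: "complex_of_real (fser a x) * cis (kap * real_of_int (- k) * x) = (\<Sum>\<^sub>\<infinity>j. ?f j x)" for x
  proof -
    have "(\<Sum>\<^sub>\<infinity>j. a j * cis (kap * real_of_int j * x)) * cis (kap * real_of_int (- k) * x)
       = (\<Sum>\<^sub>\<infinity>j. a j * cis (kap * real_of_int j * x) * cis (kap * real_of_int (- k) * x))"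
      by (rule infsum_cmult_left[symmetric]) (use fser_csummable[OF assms(1)] in simp)
    also have "\<dots> = (\<Sum>\<^sub>\<infinity>j. ?f j x)"
      by (rule infsum_cong) (simp add: cis_mult mult.assoc algebra_simps)
    finally show ?thesis using fser_complex[OF assms] by simp
  qed
  have "((\<lambda>j. integral {0..L} (?f j)) has_sum integral {0..L} (\<lambda>x. \<Sum>\<^sub>\<infinity>j. ?f j x)) UNIV"
    by (rule has_integral_infsum[where M="\<lambda>j. cmod (a j)"])
       (use asum0[OF assms(1)] in \<open>auto intro!: continuous_intros simp: cis.code complex_eq_iff norm_mult simp flip: cis.code\<close>)
  moreover have "integral {0..L} (?f j) = (if j = k then L * a k else 0)" for j
    using integral_cis[of "j - k"] by (simp add: mult.commute)
  ultimately have "((\<lambda>j. if j = k then L * a k else 0) has_sum integral {0..L} (\<lambda>x. \<Sum>\<^sub>\<infinity>j. ?f j x)) UNIV" by simp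
  moreover have "((\<lambda>j. if j = k then L * a k else 0) has_sum (L * a k)) UNIV"
    using has_sum_finite_neutralI[of "{k}" UNIV "\<lambda>j. if j = k then L * a k else 0" "L * a k"] by auto
  ultimately have "integral {0..L} (\<lambda>x. \<Sum>\<^sub>\<infinity>j. ?f j x) = L * a k" by (rule has_sum_unique)
  then show ?thesis using L_pos e by (simp add: fcoeff_eq_integral[OF fser_cont[OF assms(1)]])
qed

lemma fser_eq_iff:
  assumes "asum s a" "symm a" "asum r b" "symm b" "fser a = fser b" shows "a = b"
  using fcoeff_fser[OF assms(1,2)] fcoeff_fser[OF assms(3,4)] assms(5) by (metis ext)

text \<open>Only the series of b is expanded. The bounded factor \<open>fser a\<close> preserves the
  dominating series, and each resulting integral is a Fourier coefficient of
  \<open>fser a\<close>.\<close>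

lemma parseval_prod:
  assumes "asum s a" "symm a" "asum r b" "symm b"
  shows "((\<lambda>k. L * Re (cnj (a k) * b k)) has_sum integral {0..L} (\<lambda>x. fser a x * fser b x)) UNIV"
proof -
  let ?f = "\<lambda>k x. fser a x * Re (b k * cis (kap * real_of_int k * x))"
  obtain B where B: "\<And>x. \<bar>fser a x\<bar> \<le> B" using fser_le[OF assms(1)] by blast
  have "((\<lambda>k. integral {0..L} (?f k)) has_sum integral {0..L} (\<lambda>x. \<Sum>\<^sub>\<infinity>k. ?f k x)) UNIV"
  proof (rule has_integral_infsum[where M="\<lambda>k. B * cmod (b k)"])
    show "continuous_on {0..L} (?f k)" for k
      by (intro continuous_on_mult fser_cont[OF assms(1)]) (auto intro!: continuous_intros simp: cis.code)
    show "norm (?f k x) \<le> B * cmod (b k)" for k x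
      unfolding real_norm_def abs_mult using B[of x] fser_term_le[of b k] by (intro mult_mono) (auto intro: order_trans[OF abs_ge_zero])
  qed (intro summable_on_cmult_right asum0[OF assms(3)])
  moreover have "(\<Sum>\<^sub>\<infinity>k. ?f k x) = fser a x * fser b x" for x
    unfolding fser_def[of b] by (rule infsum_cmult_right) (use fser_summable[OF assms(3)] in simp)
  moreover have "integral {0..L} (?f k) = L * Re (cnj (a k) * b k)" for k
  proof -
    have i: "(\<lambda>x. complex_of_real (fser a x) * cis (kap * real_of_int k * x)) integrable_on {0..L}"
      by (intro integrable_continuous_real continuous_intros fser_cont[OF assms(1)])
    have "a (- k) = integral {0..L} (\<lambda>x. complex_of_real (fser a x) * cis (kap * real_of_int k * x)) / L"
      using fcoeff_fser[OF assms(1,2), of "- k"] fcoeff_eq_integral[OF fser_cont[OF assms(1)], of "- k"] by simp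
    then have a: "integral {0..L} (\<lambda>x. complex_of_real (fser a x) * cis (kap * real_of_int k * x)) = L * cnj (a k)"
      using L_pos assms(2) by (simp add: field_simps symm_def)
    have "integral {0..L} (?f k) = integral {0..L} (\<lambda>x. Re (b k * (complex_of_real (fser a x) * cis (kap * real_of_int k * x))))"
      by (rule integral_cong) (simp add: algebra_simps)
    also have "\<dots> = Re (integral {0..L} (\<lambda>x. b k * (complex_of_real (fser a x) * cis (kap * real_of_int k * x))))"
      using integral_linear[OF _ bounded_linear_Re, of "\<lambda>x. b k * (complex_of_real (fser a x) * cis (kap * real_of_int k * x))" "{0..L}"] i
      by (simp add: o_def integrable_on_mult_right)
    also have "\<dots> = Re (b k * (L * cnj (a k)))" by (simp add: a)
    finally show ?thesis by (simp add: algebra_simps)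
  qed
  ultimately show ?thesis by simp
qed

lemma parseval:
  assumes "asum s a" "symm a"
  shows "((\<lambda>k. L * (cmod (a k))\<^sup>2) has_sum integral {0..L} (\<lambda>x. (fser a x)\<^sup>2)) UNIV"
proof -
  have "Re (cnj (a k) * a k) = (cmod (a k))\<^sup>2" for k
    by (metis Re_complex_of_real complex_norm_square mult.commute of_real_power)
  then show ?thesis using parseval_prod[OF assms assms] by (simp add: power2_eq_square)
qed

text \<open>The product of the two series is a double series; it converges absolutely, so it may be
  summed along the diagonals j + (k - j) = k instead of by rows.\<close>

lemma fser_conv:
  assumes a: "asum s a" "symm a" and b: "asum r b" "symm b" and c: "asum q (conv a b)"
  shows "fser (conv a b) x = fser a x * fser b x"
proof -
  let ?e = "\<lambda>k. cis (kap * real_of_int k * x)"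
  let ?h = "\<lambda>j k. a j * b (k - j) * ?e k"
  have bij: "bij_betw (\<lambda>k. k - j) UNIV (UNIV::int set)" for j
    by (rule bij_betwI[where g="\<lambda>k. k + j"]) auto
  have row: "(\<lambda>k. cmod (?h j k)) summable_on UNIV" "(\<Sum>\<^sub>\<infinity>k. cmod (?h j k)) = cmod (a j) * (\<Sum>\<^sub>\<infinity>k. cmod (b k))" for j
  proof -
    have "(\<lambda>k. cmod (b (k - j))) summable_on UNIV"
      using summable_on_reindex_bij_betw[OF bij, of "\<lambda>k. cmod (b k)"] asum0[OF b(1)] by simp
    moreover have "(\<Sum>\<^sub>\<infinity>k. cmod (b (k - j))) = (\<Sum>\<^sub>\<infinity>k. cmod (b k))"
      by (rule infsum_reindex_bij_betw[OF bij])
    ultimately show "(\<lambda>k. cmod (?h j k)) summable_on UNIV" "(\<Sum>\<^sub>\<infinity>k. cmod (?h j k)) = cmod (a j) * (\<Sum>\<^sub>\<infinity>k. cmod (b k))"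
      by (auto simp: norm_mult intro: summable_on_cmult_right) (metis infsum_cmult_right)
  qed
  have "(\<lambda>p. cmod (?h (fst p) (snd p))) summable_on (Sigma UNIV (\<lambda>_. UNIV))"
    by (rule Infinite_Sum.abs_summable_on_Sigma_iff[THEN iffD2])
       (use row summable_on_cmult_left[OF asum0[OF a(1)], of "\<Sum>\<^sub>\<infinity>k. cmod (b k)"] infsum_nonneg[of UNIV "\<lambda>k. cmod (b k)"] in \<open>simp add: abs_mult\<close>)
  then have sw: "(\<lambda>(j, k). ?h j k) summable_on UNIV \<times> UNIV"
    unfolding case_prod_unfold by (rule Infinite_Sum.abs_summable_summable)
  have "complex_of_real (fser a x * fser b x) = (\<Sum>\<^sub>\<infinity>j. a j * ?e j) * (\<Sum>\<^sub>\<infinity>k. b k * ?e k)"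
    using fser_complex[OF a] fser_complex[OF b] by simp
  also have "\<dots> = (\<Sum>\<^sub>\<infinity>j. a j * ?e j * (\<Sum>\<^sub>\<infinity>k. b k * ?e k))"
    by (rule infsum_cmult_left[symmetric]) (use fser_csummable[OF a(1)] in simp)
  also have "\<dots> = (\<Sum>\<^sub>\<infinity>j. \<Sum>\<^sub>\<infinity>k. ?h j k)"
  proof (rule infsum_cong)
    fix j
    have "a j * ?e j * (\<Sum>\<^sub>\<infinity>k. b k * ?e k) = a j * ?e j * (\<Sum>\<^sub>\<infinity>k. b (k - j) * ?e (k - j))"
      using infsum_reindex_bij_betw[OF bij, of "\<lambda>k. b k * ?e k" j] by simp
    also have "\<dots> = (\<Sum>\<^sub>\<infinity>k. a j * ?e j * (b (k - j) * ?e (k - j)))"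
      by (rule infsum_cmult_right[symmetric])
         (use summable_on_reindex_bij_betw[OF bij, of "\<lambda>k. b k * ?e k" j] fser_csummable[OF b(1)] in simp)
    also have "\<dots> = (\<Sum>\<^sub>\<infinity>k. ?h j k)"
    proof (rule infsum_cong)
      fix k
      have "?e j * ?e (k - j) = ?e k" by (simp add: cis_mult algebra_simps)
      then show "a j * ?e j * (b (k - j) * ?e (k - j)) = ?h j k" by (simp add: mult_ac)
    qed
    finally show "a j * ?e j * (\<Sum>\<^sub>\<infinity>k. b k * ?e k) = (\<Sum>\<^sub>\<infinity>k. ?h j k)" .
  qed
  also have "\<dots> = (\<Sum>\<^sub>\<infinity>k. \<Sum>\<^sub>\<infinity>j. ?h j k)" by (rule infsum_swap_banach[OF sw])
  also have "\<dots> = (\<Sum>\<^sub>\<infinity>k. conv a b k * ?e k)"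
  proof (rule infsum_cong)
    fix k
    have "(\<lambda>j. ?h j k) summable_on UNIV"
    proof (rule summable_on_real_le(1)[OF summable_on_cmult_left[OF asum0[OF a(1)]]])
      show "norm (?h j k) \<le> cmod (a j) * (\<Sum>\<^sub>\<infinity>k. cmod (b k))" for j
      proof -
        have "cmod (b (k - j)) \<le> (\<Sum>\<^sub>\<infinity>k. cmod (b k))"
          using finite_sum_le_infsum[OF asum0[OF b(1)], of "{k - j}"] by simp
        then show ?thesis by (simp add: norm_mult mult_left_mono)
      qed
    qed
    \<comment> \<open>Multiplication by the inverse phase removes \<open>?e k\<close> and leaves the
      terms of the convolution.\<close>
    then have "(\<lambda>j. ?h j k * cis (- (kap * real_of_int k * x))) summable_on UNIV" by (rule summable_on_cmult_left)
    then have "(\<lambda>j. a j * b (k - j)) summable_on UNIV" by (simp add: mult.assoc cis_mult)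
    then show "(\<Sum>\<^sub>\<infinity>j. ?h j k) = conv a b k * ?e k"
      unfolding conv_def by (intro infsum_cmult_left) simp
  qed
  also have "\<dots> = complex_of_real (fser (conv a b) x)"
    using fser_complex[OF c symm_conv[OF a(2) b(2)]] by simp
  finally show ?thesis by (metis of_real_eq_iff)
qed

section \<open>Fourier coefficients determine integrable functions\<close>

text \<open>Trigonometric polynomials, generated by single modes and sums. Closure under products is
  proved, so every real polynomial in \<open>cis (kap * x)\<close> belongs to the class and
  Stone-Weierstrass on the unit circle applies.\<close>

inductive trigp :: "(real \<Rightarrow> complex) \<Rightarrow> bool" where
  mono: "trigp (\<lambda>x. c * cis (kap * real_of_int k * x))"
| add: "trigp f \<Longrightarrow> trigp g \<Longrightarrow> trigp (\<lambda>x. f x + g x)"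

lemma trigp_mult_mono: "trigp f \<Longrightarrow> trigp (\<lambda>x. f x * (c * cis (kap * real_of_int k * x)))"
proof (induction rule: trigp.induct)
  case (mono d j)
  have *: "d * cis (kap * real_of_int j * x) * (c * cis (kap * real_of_int k * x))
      = (d * c) * cis (kap * real_of_int (j + k) * x)" for x
  proof -
    have *: "d * cis (kap * real_of_int j * x) * (c * cis (kap * real_of_int k * x))
      = (d * c) * (cis (kap * real_of_int j * x) * cis (kap * real_of_int k * x))" by (simp only: mult_ac)
    moreover have "kap * real_of_int j * x + kap * real_of_int k * x = kap * real_of_int (j + k) * x"
      by (simp add: algebra_simps)
    ultimately show ?thesis by (simp only: cis_mult)
  qed
  show ?case unfolding * by (rule trigp.mono)
next
  case (add f g)
  then show ?case using trigp.add by (simp add: distrib_right)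
qed

lemma trigp_mult: "trigp g \<Longrightarrow> trigp f \<Longrightarrow> trigp (\<lambda>x. f x * g x)"
proof (induction rule: trigp.induct)
  case (mono c k) then show ?case by (rule trigp_mult_mono)
next
  case (add g h) then show ?case using trigp.add[OF add.IH] by (simp add: distrib_left)
qed

lemma trigp_polynomial: "real_polynomial_function p \<Longrightarrow> trigp (\<lambda>x. complex_of_real (p (cis (kap * x))))"
proof (induction rule: real_polynomial_function.induct)
  case (linear f)
  interpret f: bounded_linear f by fact
  \<comment> \<open>A real linear functional of \<open>cis y\<close> equals
    \<open>f 1 * cos y + f \<i> * sin y\<close>; c is its Fourier coefficient at frequency
    1.\<close>
  define c where "c = (complex_of_real (f 1) - \<i> * f \<i>) / 2"
  have "complex_of_real (f (cis y)) = c * cis y + cnj c * cis (- y)" for y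
  proof -
    have "f (cis y) = f (cos y *\<^sub>R 1 + sin y *\<^sub>R \<i>)"
      by (rule arg_cong[of _ _ f]) (simp add: complex_eq_iff)
    also have "\<dots> = cos y * f 1 + sin y * f \<i>" by (simp add: f.add f.scaleR)
    finally show ?thesis by (simp add: c_def complex_eq_iff field_simps)
  qed
  then show ?case
    using trigp.add[OF trigp.mono[of c 1] trigp.mono[of "cnj c" "- 1"]] by simp
next
  case (const c) then show ?case using trigp.mono[of "complex_of_real c" 0] by simp
next
  case (add f g) then show ?case using trigp.add by simp
next
  case (mult f g) then show ?case using trigp_mult by simp
qed

lemma trigp_cont: "trigp f \<Longrightarrow> continuous_on S f"
  by (induction rule: trigp.induct) (auto intro!: continuous_intros)

lemma continuous_mult_set_integrable:
  fixes h :: "real \<Rightarrow> real" and g :: "real \<Rightarrow> 'a::euclidean_space"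
  assumes h: "set_integrable lborel {0..L} h" and g: "continuous_on {0..L} g"
  shows "set_integrable lborel {0..L} (\<lambda>x. h x *\<^sub>R g x)"
proof -
  obtain B where B: "\<And>x. x \<in> {0..L} \<Longrightarrow> norm (g x) \<le> B"
    using compact_continuous_image[OF g] compact_imp_bounded bounded_iff by (metis compact_Icc image_eqI)
  have [measurable]: "(\<lambda>x. indicator {0..L} x *\<^sub>R g x) \<in> borel_measurable lborel"
    using borel_measurable_continuous_on_indicator[OF _ g] by (simp add: borel_measurable_indicator)
  have i: "integrable lborel (\<lambda>x. indicator {0..L} x *\<^sub>R h x)" using h by (simp add: set_integrable_def)
  have [measurable]: "(\<lambda>x. indicator {0..L} x *\<^sub>R h x) \<in> borel_measurable lborel"
    using i by (rule borel_measurable_integrable)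
  have "integrable lborel (\<lambda>x. (indicator {0..L} x *\<^sub>R h x) *\<^sub>R (indicator {0..L} x *\<^sub>R g x))"
  proof (rule Bochner_Integration.integrable_bound)
    show "integrable lborel (\<lambda>x. B * (indicator {0..L} x *\<^sub>R h x))" using i by (rule integrable_mult_right)
    show "AE x in lborel. norm ((indicator {0..L} x *\<^sub>R h x) *\<^sub>R indicator {0..L} x *\<^sub>R g x)
      \<le> norm (B * (indicator {0..L} x *\<^sub>R h x))"
    proof (rule AE_I2)
      fix x
      show "norm ((indicator {0..L} x *\<^sub>R h x) *\<^sub>R indicator {0..L} x *\<^sub>R g x) \<le> norm (B * (indicator {0..L} x *\<^sub>R h x))"
      proof (cases "x \<in> {0..L}")
        case True
        then have "norm (g x) \<le> \<bar>B\<bar>" using B[OF True] by linarith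
        then have "\<bar>h x\<bar> * norm (g x) \<le> \<bar>h x\<bar> * \<bar>B\<bar>" by (rule mult_left_mono) simp
        then show ?thesis using True by (simp add: abs_mult mult.commute)
      qed simp
    qed
  qed measurable
  moreover have "(indicator {0..L} x *\<^sub>R h x) *\<^sub>R indicator {0..L} x *\<^sub>R g x = indicator {0..L} x *\<^sub>R (h x *\<^sub>R g x)" for x
    by (simp add: indicator_def)
  ultimately show ?thesis by (simp only: set_integrable_def)
qed

lemma approx_trig:
  assumes c: "continuous_on {0..L} \<psi>" and e: "\<psi> L = (\<psi> 0 :: real)" and "\<epsilon> > 0"
  obtains p where "trigp (\<lambda>x. complex_of_real (p x))" "\<And>x. x \<in> {0..L} \<Longrightarrow> \<bar>\<psi> x - p x\<bar> < \<epsilon>"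
proof -
  let ?q = "\<lambda>x. cis (kap * x)"
  \<comment> \<open>As the endpoint values of \<open>\<psi>\<close> agree, \<open>\<psi>\<close>
    descends along x to \<open>cis (kap * x)\<close> to a function on the unit circle.\<close>
  define F where "F z = \<psi> (Arg2pi z / kap)" for z
  have Fq: "F (?q x) = \<psi> x" if "x \<in> {0..L}" for x
  proof (cases "x = L")
    case True
    have "?q x = 1" using kap_L[of 1] True by simp
    then show ?thesis using True e by (simp add: F_def Arg2pi_real)
  next
    case False
    then have "x < L" using that by simp
    then have "kap * x < kap * L" using kap_pos by simp
    then have "kap * x < 2 * pi" using kap_L[of 1] by simp
    then have "Arg2pi (?q x) = kap * x"
      using that kap_pos Arg2pi_unique[of 1 "kap * x" "?q x"] by (simp add: cis_conv_exp)
    then show ?thesis using kap_pos by (simp add: F_def)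
  qed
  have surj: "sphere 0 1 = ?q ` {0..L}"
  proof
    show "?q ` {0..L} \<subseteq> sphere 0 1" by auto
    show "sphere 0 1 \<subseteq> ?q ` {0..L}"
    proof
      fix z :: complex assume "z \<in> sphere 0 1"
      then have z: "norm z = 1" by simp
      have "Arg2pi z / kap \<le> L" using Arg2pi[of z] kap_L[of 1] kap_pos by (simp add: pos_divide_le_eq mult.commute)
      moreover have "?q (Arg2pi z / kap) = z" using Arg2pi_eq[of z] z kap_pos by (simp add: cis_conv_exp)
      ultimately show "z \<in> ?q ` {0..L}" using Arg2pi[of z] kap_pos by (intro image_eqI[of _ _ "Arg2pi z / kap"]) auto
    qed
  qed
  have "continuous_on (sphere 0 1) F"
  \<comment> \<open>\<open>Arg2pi\<close> jumps at 1, so continuity of F is read off closed sets: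
    the preimage of B under F is the image of a compact subset of \<open>{0..L}\<close>.\<close>
  proof (subst continuous_on_closed_invariant, intro allI impI)
    fix B :: "real set" assume B: "closed B"
    have "compact ({0..L} \<inter> \<psi> -` B)"
      using continuous_closed_preimage[OF c _ B] by (simp add: compact_eq_bounded_closed bounded_Int)
    then have "closed (?q ` ({0..L} \<inter> \<psi> -` B))"
      by (intro compact_imp_closed compact_continuous_image) (auto intro!: continuous_intros)
    moreover have "?q ` ({0..L} \<inter> \<psi> -` B) \<inter> sphere 0 1 = F -` B \<inter> sphere 0 1"
      unfolding surj
    proof (intro set_eqI iffI)
      fix z assume "z \<in> F -` B \<inter> ?q ` {0..L}"
      then show "z \<in> ?q ` ({0..L} \<inter> \<psi> -` B) \<inter> ?q ` {0..L}" using Fq by auto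
    next
      fix z assume "z \<in> ?q ` ({0..L} \<inter> \<psi> -` B) \<inter> ?q ` {0..L}"
      then obtain x where "x \<in> {0..L}" "\<psi> x \<in> B" "z = ?q x" by blast
      then show "z \<in> F -` B \<inter> ?q ` {0..L}" using Fq[of x] by auto
    qed
    ultimately show "\<exists>A. closed A \<and> A \<inter> sphere 0 1 = F -` B \<inter> sphere 0 1" by blast
  qed
  from Stone_Weierstrass_real_polynomial_function[OF compact_sphere this \<open>\<epsilon> > 0\<close>] obtain g
    where g: "real_polynomial_function g" "\<And>z. z \<in> sphere 0 1 \<Longrightarrow> \<bar>F z - g z\<bar> < \<epsilon>" by blast
  show thesis
  proof (rule that[of "\<lambda>x. g (?q x)"])
    show "trigp (\<lambda>x. complex_of_real (g (?q x)))" by (rule trigp_polynomial[OF g(1)])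
    show "\<bar>\<psi> x - g (?q x)\<bar> < \<epsilon>" if "x \<in> {0..L}" for x
      using g(2)[of "?q x"] Fq[OF that] by simp
  qed
qed

lemma fcoeff_eq_set_integral:
  "fcoeff L f k = (LBINT x:{0..L}. complex_of_real (f x) * cis (kap * real_of_int (- k) * x)) / L"
proof -
  have e: "cis (- 2 * pi * real_of_int k * x / L) = cis (kap * real_of_int (- k) * x)" for x
    by (simp add: kap_def)
  show ?thesis unfolding fcoeff_def e
    using interval_integral_Icc[of 0 L] L_pos by (simp add: zero_ereal_def)
qed

lemma symm_fcoeff: "symm (fcoeff L f)"
  unfolding symm_def
proof
  fix k
  have "cnj (LBINT x:{0..L}. complex_of_real (f x) * cis (kap * real_of_int (- k) * x))
     = (LBINT x:{0..L}. cnj (complex_of_real (f x) * cis (kap * real_of_int (- k) * x)))"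
    unfolding set_lebesgue_integral_def
    by (subst Bochner_Integration.integral_cnj[symmetric]) (auto intro!: Bochner_Integration.integral_cong)
  then show "fcoeff L f (- k) = cnj (fcoeff L f k)"
    by (simp add: fcoeff_eq_set_integral cis_cnj)
qed

text \<open>Orthogonality to single modes extends linearly to trigonometric polynomials. These
  approximate \<open>\<psi>\<close> uniformly, and h is integrable.\<close>

lemma fourier_unique_test:
  assumes h: "set_integrable lborel {0..L} h" and z: "\<And>k. fcoeff L h k = 0"
    and c: "continuous_on {0..L} \<psi>" and e: "\<psi> L = \<psi> 0"
  shows "(LBINT x:{0..L}. h x * \<psi> x) = 0"
proof -
  have tr: "(LBINT x:{0..L}. h x *\<^sub>R f x) = 0" if "trigp f" for f
    using that
  proof (induction rule: trigp.induct)
    case (mono c k)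
    have "(LBINT x:{0..L}. h x *\<^sub>R (c * cis (kap * real_of_int k * x)))
       = c * (LBINT x:{0..L}. complex_of_real (h x) * cis (kap * real_of_int (- (- k)) * x))"
      by (subst set_integral_mult_right[symmetric]) (simp add: scaleR_conv_of_real mult_ac)
    also have "\<dots> = 0" using z[of "- k"] L_pos by (simp add: fcoeff_eq_set_integral)
    finally show ?case .
  next
    case (add f g)
    have "(LBINT x:{0..L}. h x *\<^sub>R (f x + g x)) = (LBINT x:{0..L}. h x *\<^sub>R f x) + (LBINT x:{0..L}. h x *\<^sub>R g x)"
      unfolding scaleR_add_right
      by (rule set_integral_add) (intro continuous_mult_set_integrable h trigp_cont add.hyps)+
    then show ?case using add.IH by simp
  qed
  define I where "I = (LBINT x:{0..L}. \<bar>h x\<bar>)"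
  have I: "I \<ge> 0" unfolding I_def set_lebesgue_integral_def by (rule Bochner_Integration.integral_nonneg) auto
  have small: "\<bar>LBINT x:{0..L}. h x * \<psi> x\<bar> \<le> \<epsilon> * I" if "\<epsilon> > 0" for \<epsilon>
  proof -
    obtain p where p: "trigp (\<lambda>x. complex_of_real (p x))" "\<And>x. x \<in> {0..L} \<Longrightarrow> \<bar>\<psi> x - p x\<bar> < \<epsilon>"
      using approx_trig[OF c e \<open>\<epsilon> > 0\<close>] by blast
    have pc: "continuous_on {0..L} p"
      using continuous_on_Re[OF trigp_cont[OF p(1)], of "{0..L}"] by simp
    have i1: "set_integrable lborel {0..L} (\<lambda>x. h x * p x)" "set_integrable lborel {0..L} (\<lambda>x. h x * \<psi> x)"
      using continuous_mult_set_integrable[OF h pc] continuous_mult_set_integrable[OF h c] by auto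
    have "complex_of_real (LBINT x:{0..L}. h x * p x) = (LBINT x:{0..L}. complex_of_real (h x * p x))"
      by (rule set_integral_complex_of_real[symmetric])
    also have "\<dots> = 0" using tr[OF p(1)] by (simp add: scaleR_conv_of_real)
    finally have p0: "(LBINT x:{0..L}. h x * p x) = 0" by simp
    have "(LBINT x:{0..L}. h x * \<psi> x) = (LBINT x:{0..L}. h x * \<psi> x - h x * p x)"
      using i1 p0 by (simp add: set_integral_diff)
    also have "norm \<dots> \<le> (LBINT x:{0..L}. \<epsilon> * \<bar>h x\<bar>)"
    proof -
      have d: "set_integrable lborel {0..L} (\<lambda>x. h x * \<psi> x - h x * p x)" using i1 by (intro set_integral_diff)
      have "norm (LBINT x:{0..L}. h x * \<psi> x - h x * p x) \<le> (LBINT x:{0..L}. norm (h x * \<psi> x - h x * p x))"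
        by (rule set_integral_norm_bound[OF d])
      also have "\<dots> \<le> (LBINT x:{0..L}. \<epsilon> * \<bar>h x\<bar>)"
      proof (rule set_integral_mono)
        show "set_integrable lborel {0..L} (\<lambda>x. norm (h x * \<psi> x - h x * p x))" by (rule set_integrable_norm[OF d])
        show "set_integrable lborel {0..L} (\<lambda>x. \<epsilon> * \<bar>h x\<bar>)"
          using set_integrable_abs[OF h] by simp
        fix x assume "x \<in> {0..L}"
        then have "\<bar>h x\<bar> * \<bar>\<psi> x - p x\<bar> \<le> \<bar>h x\<bar> * \<epsilon>" using p(2) by (intro mult_left_mono) (auto simp: less_imp_le)
        then show "norm (h x * \<psi> x - h x * p x) \<le> \<epsilon> * \<bar>h x\<bar>"
          by (metis abs_mult mult.commute real_norm_def right_diff_distrib)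
      qed
      finally show ?thesis .
    qed
    also have "(LBINT x:{0..L}. \<epsilon> * \<bar>h x\<bar>) = \<epsilon> * I" unfolding I_def by simp
    finally show ?thesis by simp
  qed
  show ?thesis
  proof (rule ccontr)
    define A where "A = \<bar>LBINT x:{0..L}. h x * \<psi> x\<bar>"
    assume "(LBINT x:{0..L}. h x * \<psi> x) \<noteq> 0"
    then have A: "A > 0" by (simp add: A_def)
    \<comment> \<open>The tolerance \<open>A / (2 * (I + 1))\<close> would make A at most half of
      itself; the summand 1 covers I = 0.\<close>
    have "A \<le> A / (2 * (I + 1)) * I" unfolding A_def by (rule small) (use A I in \<open>simp add: A_def\<close>)
    then have "A * (2 * (I + 1)) \<le> A * I" using I by (simp add: pos_le_divide_eq)
    then have "2 * (I + 1) \<le> I" using A by (simp only: mult_le_cancel_left_pos)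
    then show False using I by simp
  qed
qed

text \<open>Continuous test functions tending almost everywhere to \<open>sgn h\<close> have zero
  integral against h; by dominated convergence the integral of |h| is then zero.\<close>

lemma fourier_unique_AE:
  assumes h: "set_integrable lborel {0..L} h" and m: "h \<in> borel_measurable lborel" and z: "\<And>k. fcoeff L h k = 0"
  shows "AE x in lborel. x \<in> {0..L} \<longrightarrow> h x = 0"
proof -
  have "(\<lambda>x. sgn (h x)) \<in> borel_measurable lborel" using m by measurable
  then have "(\<lambda>x. sgn (h x)) \<in> borel_measurable lebesgue" by (rule measurable_completion)
  then have "(\<lambda>x. sgn (h x)) measurable_on UNIV"
    using measurable_on_iff_borel_measurable[of UNIV "\<lambda>x. sgn (h x)"] by simp
  then obtain N g where N: "negligible N" and gc: "\<And>n. continuous_on UNIV (g n :: real \<Rightarrow> real)"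
    and gl: "\<And>x. x \<notin> N \<Longrightarrow> (\<lambda>n. g n x) \<longlonglongrightarrow> sgn (h x)"
    unfolding measurable_on_def by auto
  \<comment> \<open>The first factor vanishes at 0 and L, which gives equal endpoint values, and is
    eventually 1 at each interior point. Clipping the second factor to [-1, 1] makes |h| a
    dominating function.\<close>
  define \<psi> where "\<psi> n x = min 1 (real n * max 0 (min x (L - x))) * max (- 1) (min 1 (g n x))" for n x
  have pc: "continuous_on S (\<psi> n)" for S n
    unfolding \<psi>_def by (intro continuous_intros continuous_on_subset[OF gc[of n]]) auto
  have p0: "(LBINT x:{0..L}. h x * \<psi> n x) = 0" for n
    by (rule fourier_unique_test[OF h z pc]) (use L_pos in \<open>simp add: \<psi>_def\<close>)
  have pb: "\<bar>\<psi> n x\<bar> \<le> 1" for n x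
    unfolding \<psi>_def abs_mult by (rule mult_le_one) (auto simp: abs_le_iff min_def max_def)
  have pl: "(\<lambda>n. \<psi> n x) \<longlonglongrightarrow> sgn (h x)" if x: "x \<notin> N" "0 < x" "x < L" for x
  proof -
    let ?m = "min x (L - x)"
    have m0: "?m > 0" using x by simp
    obtain M where M: "real M > 1 / ?m" using reals_Archimedean2 by blast
    have "\<forall>\<^sub>F n in sequentially. min 1 (real n * max 0 ?m) = 1"
      using eventually_ge_at_top[of M]
    proof eventually_elim
      case (elim n)
      have "1 / ?m \<le> real n" using M elim by (smt (verit) of_nat_mono)
      then have "1 \<le> real n * ?m" using m0 by (simp add: pos_divide_le_eq)
      then show ?case using m0 by (simp add: max_def)
    qed
    then have "(\<lambda>n. min 1 (real n * max 0 ?m)) \<longlonglongrightarrow> 1" by (rule tendsto_eventually)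
    moreover have "(\<lambda>n. max (- 1) (min 1 (g n x))) \<longlonglongrightarrow> max (- 1) (min 1 (sgn (h x)))"
      by (intro tendsto_intros gl x)
    moreover have "max (- 1) (min 1 (sgn (h x))) = sgn (h x)" by (simp add: sgn_real_def)
    ultimately have "(\<lambda>n. min 1 (real n * max 0 ?m) * max (- 1) (min 1 (g n x))) \<longlonglongrightarrow> 1 * sgn (h x)"
      using tendsto_mult by fastforce
    then show ?thesis by (simp add: \<psi>_def)
  qed
  have ih: "integrable lborel (\<lambda>x. indicator {0..L} x *\<^sub>R h x)" using h by (simp add: set_integrable_def)
  have aeN: "AE x in lborel. x \<notin> N \<and> x \<noteq> 0 \<and> x \<noteq> L"
  proof -
    have "AE x in completion lborel. x \<notin> N" using N by (simp add: negligible_iff_null_sets AE_not_in)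
    then have "AE x in lborel. x \<notin> N" by (simp only: AE_completion_iff)
    then show ?thesis using AE_lborel_singleton[of 0] AE_lborel_singleton[of L] by eventually_elim auto
  qed
  have "(\<lambda>n. integral\<^sup>L lborel (\<lambda>x. indicator {0..L} x *\<^sub>R (h x * \<psi> n x)))
     \<longlonglongrightarrow> integral\<^sup>L lborel (\<lambda>x. indicator {0..L} x *\<^sub>R \<bar>h x\<bar>)"
  proof (rule integral_dominated_convergence[where w="\<lambda>x. norm (indicator {0..L} x *\<^sub>R h x)"])
    show "(\<lambda>x. indicator {0..L} x *\<^sub>R (h x * \<psi> n x)) \<in> borel_measurable lborel" for n
      using m borel_measurable_continuous_onI[OF pc[of UNIV n]] by measurable
    show "integrable lborel (\<lambda>x. norm (indicator {0..L} x *\<^sub>R h x))" using ih by (rule integrable_norm)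
    show "AE x in lborel. (\<lambda>i. indicator {0..L} x *\<^sub>R (h x * \<psi> i x)) \<longlonglongrightarrow> indicator {0..L} x *\<^sub>R \<bar>h x\<bar>"
      using aeN
    proof eventually_elim
      case (elim x)
      show ?case
      proof (cases "x \<in> {0..L}")
        case True
        then have "(\<lambda>n. h x * \<psi> n x) \<longlonglongrightarrow> h x * sgn (h x)" using elim by (intro tendsto_intros pl) auto
        then show ?thesis using True by (simp add: abs_sgn)
      qed simp
    qed
    show "AE x in lborel. norm (indicator {0..L} x *\<^sub>R (h x * \<psi> n x)) \<le> norm (indicator {0..L} x *\<^sub>R h x)" for n
      using pb[of n] by (intro AE_I2) (auto simp: abs_mult indicator_def mult_left_le)
  qed (use m in measurable)
  then have "integral\<^sup>L lborel (\<lambda>x. indicator {0..L} x *\<^sub>R \<bar>h x\<bar>) = 0"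
    using p0 by (simp add: set_lebesgue_integral_def LIMSEQ_const_iff)
  moreover have "integrable lborel (\<lambda>x. indicator {0..L} x *\<^sub>R \<bar>h x\<bar>)"
    using set_integrable_abs[OF h] by (simp add: set_integrable_def)
  ultimately have "AE x in lborel. indicator {0..L} x *\<^sub>R \<bar>h x\<bar> = 0"
    by (subst (asm) integral_nonneg_eq_0_iff_AE) auto
  then show ?thesis by eventually_elim auto
qed

text \<open>The exceptional set is covered by countably many translates of a null set, because every
  point is moved into \<open>{0..L}\<close> by a multiple of L.\<close>

lemma AE_periodic:
  assumes p: "\<And>x. h (x + L) = (h x :: real)" and ae: "AE x in lborel. x \<in> {0..L} \<longrightarrow> h x = 0"
  shows "AE x in lborel. h x = 0"
proof -
  have pn: "h (x + real n * L) = h x" for n x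
    by (induction n) (use p in \<open>auto simp: algebra_simps\<close>, metis add.assoc add.commute p)
  have pz: "h (x + real_of_int j * L) = h x" for j x
  proof (cases "j \<ge> 0")
    case True then show ?thesis using pn[of x "nat j"] by simp
  next
    case False then show ?thesis using pn[of "x + real_of_int j * L" "nat (- j)"] by simp
  qed
  have "AE x in lborel. \<forall>j::int. x + real_of_int j * L \<in> {0..L} \<longrightarrow> h (x + real_of_int j * L) = 0"
  proof (subst AE_all_countable, intro allI)
    fix j :: int
    have e: "lborel = distr lborel borel (\<lambda>x. real_of_int j * L + x)" using lborel_distr_plus by metis
    have "AE x in distr lborel borel (\<lambda>x. real_of_int j * L + x). x \<in> {0..L} \<longrightarrow> h x = 0"
      by (simp only: e[symmetric] ae)
    then have "AE x in lborel. (real_of_int j * L + x) \<in> {0..L} \<longrightarrow> h (real_of_int j * L + x) = 0"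
      by (rule AE_distrD[rotated]) simp
    then show "AE x in lborel. x + real_of_int j * L \<in> {0..L} \<longrightarrow> h (x + real_of_int j * L) = 0"
      by (simp add: add.commute)
  qed
  then show ?thesis
  proof eventually_elim
    case (elim x)
    let ?j = "- \<lfloor>x / L\<rfloor>"
    have "real_of_int \<lfloor>x / L\<rfloor> \<le> x / L" "x / L \<le> real_of_int \<lfloor>x / L\<rfloor> + 1" by linarith+
    then have "real_of_int \<lfloor>x / L\<rfloor> * L \<le> x / L * L" "x / L * L \<le> (real_of_int \<lfloor>x / L\<rfloor> + 1) * L"
      using L_pos by (metis less_imp_le mult_right_mono)+
    moreover have "x / L * L = x" using L_pos by simp
    ultimately have "real_of_int \<lfloor>x / L\<rfloor> * L \<le> x" "x \<le> (real_of_int \<lfloor>x / L\<rfloor> + 1) * L"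
      by simp_all
    then have "x + real_of_int ?j * L \<in> {0..L}" by (simp add: algebra_simps)
    then show ?case using elim pz by metis
  qed
qed

end

section \<open>Sobolev sequences\<close>

text \<open>\<open>hn\<close> is the square of the Sobolev norm, so it only satisfies a triangle inequality with a factor 2.\<close>

definition hw :: "nat \<Rightarrow> int \<Rightarrow> real" where "hw n k = (1 + (real_of_int k)\<^sup>2) ^ n"

definition hs :: "nat \<Rightarrow> (int \<Rightarrow> complex) \<Rightarrow> bool" where
  "hs n a \<longleftrightarrow> (\<lambda>k. hw n k * (cmod (a k))\<^sup>2) summable_on UNIV"

definition hn :: "nat \<Rightarrow> (int \<Rightarrow> complex) \<Rightarrow> real" where
  "hn n a = (\<Sum>\<^sub>\<infinity>k. hw n k * (cmod (a k))\<^sup>2)"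

lemma hw_pos: "hw n k > 0" unfolding hw_def by (intro zero_less_power) (simp add: add_pos_nonneg)
lemma hw_ge1: "hw n k \<ge> 1" unfolding hw_def by (intro one_le_power) simp
lemma hn_nonneg: "hn n a \<ge> 0" unfolding hn_def by (intro infsum_nonneg) (simp add: hw_pos less_imp_le)

lemma wt_le_hw: "wt k ^ (2 * n) \<le> 2 ^ n * hw n k"
proof -
  have "wt k ^ 2 \<le> 2 * (1 + (real_of_int k)\<^sup>2)"
    using zero_le_power2[of "1 - \<bar>real_of_int k\<bar>"] by (simp add: wt_def power2_eq_square algebra_simps)
  then have "(wt k ^ 2) ^ n \<le> (2 * (1 + (real_of_int k)\<^sup>2)) ^ n" by (intro power_mono) auto
  then show ?thesis by (simp only: hw_def power_mult power_mult_distrib)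
qed

lemma hw_le: "hw n k \<le> 2 ^ n * (1 + real_of_int k ^ (2 * n))"
proof -
  let ?q = "(real_of_int k)\<^sup>2"
  have "(1 + ?q) ^ n \<le> (2 * max 1 ?q) ^ n" by (intro power_mono) auto
  also have "\<dots> = 2 ^ n * max 1 ?q ^ n" by (simp add: power_mult_distrib)
  also have "\<dots> \<le> 2 ^ n * (1 + ?q ^ n)" by (intro mult_left_mono) (auto simp: max_def)
  finally show ?thesis by (simp add: hw_def power_mult)
qed

text \<open>Norm bounds are verified on finite sets of frequencies throughout; this yields
  membership and the bound at once.\<close>

lemma hs_I:
  assumes "\<And>F. finite F \<Longrightarrow> (\<Sum>k\<in>F. hw n k * (cmod (a k))\<^sup>2) \<le> C"
  shows "hs n a" "hn n a \<le> C"
proof -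
  show "hs n a" unfolding hs_def
    by (rule nonneg_bdd_above_summable_on)
       (use assms in \<open>auto intro!: bdd_aboveI2 simp: hw_pos less_imp_le\<close>)
  then show "hn n a \<le> C" unfolding hs_def hn_def by (rule infsum_le_finite_sums) (use assms in auto)
qed

lemma hn_finite_le: "hs n a \<Longrightarrow> finite F \<Longrightarrow> (\<Sum>k\<in>F. hw n k * (cmod (a k))\<^sup>2) \<le> hn n a"
  unfolding hs_def hn_def by (rule finite_sum_le_infsum) (auto simp: hw_pos less_imp_le)

lemma hn_term_le: "hs n a \<Longrightarrow> hw n k * (cmod (a k))\<^sup>2 \<le> hn n a"
  using hn_finite_le[of n a "{k}"] by simp

lemma sq_diff_le: "(cmod (x - z))\<^sup>2 \<le> 2 * (cmod (x - y))\<^sup>2 + 2 * (cmod (y - z))\<^sup>2"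
proof -
  have "cmod (x - z) \<le> cmod (x - y) + cmod (y - z)" by (metis diff_add_cancel norm_triangle_ineq add_diff_eq)
  then have "(cmod (x - z))\<^sup>2 \<le> (cmod (x - y) + cmod (y - z))\<^sup>2" by (intro power_mono) auto
  also have "\<dots> \<le> 2 * (cmod (x - y))\<^sup>2 + 2 * (cmod (y - z))\<^sup>2"
    using zero_le_power2[of "cmod (x - y) - cmod (y - z)"] by (simp add: power2_eq_square algebra_simps)
  finally show ?thesis .
qed

lemma hn_triangle:
  assumes "hs n (\<lambda>k. a k - b k)" "hs n (\<lambda>k. b k - c k)"
  shows "hs n (\<lambda>k. a k - c k)" "hn n (\<lambda>k. a k - c k) \<le> 2 * hn n (\<lambda>k. a k - b k) + 2 * hn n (\<lambda>k. b k - c k)"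
proof -
  have *: "(\<Sum>k\<in>F. hw n k * (cmod (a k - c k))\<^sup>2) \<le> 2 * hn n (\<lambda>k. a k - b k) + 2 * hn n (\<lambda>k. b k - c k)" if "finite F" for F
  proof -
    have "(\<Sum>k\<in>F. hw n k * (cmod (a k - c k))\<^sup>2) \<le> (\<Sum>k\<in>F. hw n k * (2 * (cmod (a k - b k))\<^sup>2 + 2 * (cmod (b k - c k))\<^sup>2))"
      by (intro sum_mono mult_left_mono sq_diff_le) (simp add: hw_pos less_imp_le)
    also have "\<dots> = 2 * (\<Sum>k\<in>F. hw n k * (cmod (a k - b k))\<^sup>2) + 2 * (\<Sum>k\<in>F. hw n k * (cmod (b k - c k))\<^sup>2)"
      by (simp add: distrib_left sum.distrib sum_distrib_left mult_ac)
    also have "\<dots> \<le> 2 * hn n (\<lambda>k. a k - b k) + 2 * hn n (\<lambda>k. b k - c k)"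
      using hn_finite_le[OF assms(1) that] hn_finite_le[OF assms(2) that] by simp
    finally show ?thesis .
  qed
  show "hs n (\<lambda>k. a k - c k)" "hn n (\<lambda>k. a k - c k) \<le> 2 * hn n (\<lambda>k. a k - b k) + 2 * hn n (\<lambda>k. b k - c k)"
    using hs_I[OF *] by auto
qed

lemma hs_diff: assumes "hs n a" "hs n b"
  shows "hs n (\<lambda>k. a k - b k)" "hn n (\<lambda>k. a k - b k) \<le> 2 * hn n a + 2 * hn n b"
  using hn_triangle[of n a "\<lambda>_. 0" b] assms by (simp_all add: hs_def hn_def)

lemma hn_commute: "hn n (\<lambda>k. a k - b k) = hn n (\<lambda>k. b k - a k)" by (simp add: hn_def norm_minus_commute)

text \<open>Sobolev embedding by Cauchy-Schwarz against \<open>1 / wt k\<close>, at the price of one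
  derivative. For \<open>n \<ge> 4\<close> it makes the series of three derivatives absolutely
  convergent.\<close>

lemma hs_asum:
  assumes h: "hs n a" and s: "s + 1 \<le> n"
  shows "asum s a" "(\<Sum>\<^sub>\<infinity>k. wt k ^ s * cmod (a k)) \<le> sqrt (2 ^ n * Zw * hn n a)"
proof -
  have *: "(\<Sum>k\<in>F. wt k ^ s * cmod (a k)) \<le> sqrt (2 ^ n * Zw * hn n a)" if F: "finite F" for F
  proof -
    have "(\<Sum>k\<in>F. wt k ^ s * cmod (a k))\<^sup>2 = (\<Sum>k\<in>F. (1 / wt k) * (wt k ^ (s + 1) * cmod (a k)))\<^sup>2"
      using wt_pos by (intro arg_cong[of _ _ "\<lambda>x. x\<^sup>2"] sum.cong) (auto simp: less_imp_neq[THEN not_sym])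
    also have "\<dots> \<le> (\<Sum>k\<in>F. (1 / wt k)\<^sup>2) * (\<Sum>k\<in>F. (wt k ^ (s + 1) * cmod (a k))\<^sup>2)"
      by (rule Cauchy_Schwarz_ineq_sum)
    also have "\<dots> \<le> Zw * (2 ^ n * hn n a)"
    proof (rule mult_mono)
      show "(\<Sum>k\<in>F. (1 / wt k)\<^sup>2) \<le> Zw" unfolding Zw_def
        using finite_sum_le_infsum[OF summable_wt2 F] by (simp add: power_divide)
      have "(\<Sum>k\<in>F. (wt k ^ (s + 1) * cmod (a k))\<^sup>2) \<le> (\<Sum>k\<in>F. 2 ^ n * (hw n k * (cmod (a k))\<^sup>2))"
      proof (rule sum_mono)
        fix k
        have "(wt k ^ (s + 1))\<^sup>2 \<le> wt k ^ (2 * n)"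
          unfolding power_mult[symmetric] using s by (intro wt_power_mono) simp
        also have "\<dots> \<le> 2 ^ n * hw n k" by (rule wt_le_hw)
        finally show "(wt k ^ (s + 1) * cmod (a k))\<^sup>2 \<le> 2 ^ n * (hw n k * (cmod (a k))\<^sup>2)"
          unfolding power_mult_distrib mult.assoc[symmetric] by (rule mult_right_mono) simp
      qed
      also have "\<dots> \<le> 2 ^ n * hn n a"
        unfolding sum_distrib_left[symmetric] using hn_finite_le[OF h F] by simp
      finally show "(\<Sum>k\<in>F. (wt k ^ (s + 1) * cmod (a k))\<^sup>2) \<le> 2 ^ n * hn n a" .
    qed (auto intro!: sum_nonneg simp: Zw_nonneg)
    finally show ?thesis by (intro real_le_rsqrt) (simp add: mult_ac)
  qed
  show "asum s a" unfolding asum_def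
    by (rule nonneg_bdd_above_summable_on)
       (use * wt_pos in \<open>auto intro!: bdd_aboveI2 simp: less_imp_le\<close>)
  then show "(\<Sum>\<^sub>\<infinity>k. wt k ^ s * cmod (a k)) \<le> sqrt (2 ^ n * Zw * hn n a)"
    unfolding asum_def by (rule infsum_le_finite_sums) (use * in auto)
qed

lemma hs_mono: assumes "hs n a" "m \<le> n" shows "hs m a" "hn m a \<le> hn n a"
proof -
  have *: "(\<Sum>k\<in>F. hw m k * (cmod (a k))\<^sup>2) \<le> hn n a" if "finite F" for F
  proof -
    have "(\<Sum>k\<in>F. hw m k * (cmod (a k))\<^sup>2) \<le> (\<Sum>k\<in>F. hw n k * (cmod (a k))\<^sup>2)"
      unfolding hw_def by (intro sum_mono mult_right_mono power_increasing assms) auto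
    also have "\<dots> \<le> hn n a" by (rule hn_finite_le[OF assms(1) that])
    finally show ?thesis .
  qed
  show "hs m a" "hn m a \<le> hn n a" using hs_I[OF *] by auto
qed

lemma bd_hs: assumes "bd (n + 1) C a" shows "hs n a"
proof -
  have C: "C \<ge> 0" using bd_nonneg[OF assms] .
  show ?thesis unfolding hs_def
  proof (rule summable_on_real_le(1)[of "\<lambda>k. C\<^sup>2 * (1 / wt k ^ 2)"])
    show "(\<lambda>k. C\<^sup>2 * (1 / wt k ^ 2)) summable_on UNIV" by (intro summable_on_cmult_right summable_wt2)
    fix k
    have "1 + (real_of_int k)\<^sup>2 \<le> wt k ^ 2"
      by (simp add: wt_def power2_eq_square algebra_simps)
    then have h: "hw n k \<le> (wt k ^ 2) ^ n" unfolding hw_def by (intro power_mono) auto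
    have "(cmod (a k))\<^sup>2 \<le> (C / wt k ^ (n + 1))\<^sup>2" by (intro power_mono bd_le[OF assms]) auto
    then have "hw n k * (cmod (a k))\<^sup>2 \<le> (wt k ^ 2) ^ n * (C / wt k ^ (n + 1))\<^sup>2"
      using h by (intro mult_mono) auto
    also have "(wt k ^ 2) ^ n * (C / wt k ^ (n + 1))\<^sup>2 = C\<^sup>2 * (1 / wt k ^ 2)"
    proof -
      have "(wt k ^ (n + 1))\<^sup>2 = (wt k ^ 2) ^ n * wt k ^ 2" by (simp add: power2_eq_square power_mult_distrib mult_ac)
      then show ?thesis using wt_pos[of k] by (simp add: power_divide)
    qed
    finally show "norm (hw n k * (cmod (a k))\<^sup>2) \<le> C\<^sup>2 * (1 / wt k ^ 2)" by (simp add: hw_pos less_imp_le abs_mult)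
  qed
qed

text \<open>Feeds a Sobolev bound into the decay norm that determines the Picard time.\<close>

lemma hs_bd: assumes "hs n a" "hn n a \<le> R" shows "bd n (sqrt (2 ^ n * R)) a"
  unfolding bd_def
proof
  fix k
  have "(cmod (a k) * wt k ^ n)\<^sup>2 = wt k ^ (2 * n) * (cmod (a k))\<^sup>2"
    by (simp add: power_mult_distrib power_mult[symmetric] mult.commute)
  also have "\<dots> \<le> 2 ^ n * hw n k * (cmod (a k))\<^sup>2" by (intro mult_right_mono wt_le_hw) simp
  also have "\<dots> \<le> 2 ^ n * R" using hn_term_le[OF assms(1), of k] assms(2) by (simp add: mult.assoc)
  finally show "cmod (a k) * wt k ^ n \<le> sqrt (2 ^ n * R)" by (rule real_le_rsqrt)
qed

text \<open>A violation at one point would persist on a nonempty open set, which is not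
  negligible.\<close>

lemma continuous_AE_ge:
  fixes f :: "real \<Rightarrow> real"
  assumes "continuous_on UNIV f" "AE x in lborel. f x \<ge> a"
  shows "f x \<ge> a"
proof (rule ccontr)
  assume "\<not> f x \<ge> a"
  let ?S = "{x. f x < a}"
  have o: "open ?S" using assms(1) by (intro open_Collect_less continuous_on_const)
  have "AE x in lborel. x \<notin> ?S" using assms(2) by eventually_elim auto
  then have "?S \<in> null_sets lborel" using o by (subst AE_iff_null_sets) auto
  then have "negligible ?S" by (simp add: negligible_iff_null_sets null_sets_completionI)
  moreover have "x \<in> ?S" using \<open>\<not> f x \<ge> a\<close> by simp
  ultimately show False using open_not_negligible[OF o] by blast
qed

lemma continuous_AE_eq:
  fixes f g :: "real \<Rightarrow> real"
  assumes "continuous_on UNIV f" "continuous_on UNIV g" "AE x in lborel. f x = g x"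
  shows "f = g"
proof
  fix x
  have "AE x in lborel. f x - g x \<ge> 0" "AE x in lborel. g x - f x \<ge> 0"
    using assms(3) by (eventually_elim, simp)+
  then show "f x = g x"
    using continuous_AE_ge[OF continuous_on_diff[OF assms(1,2)], of 0 x]
      continuous_AE_ge[OF continuous_on_diff[OF assms(2,1)], of 0 x] by simp
qed

section \<open>Sobolev functions and their Fourier series\<close>

context circle begin

lemma hnorm_eq: "hnorm L (real n) f = sqrt (hn n (fcoeff L f))"
  unfolding hnorm_def hn_def hw_def by (simp add: powr_realpow add_pos_nonneg)

lemma sobolev_eq: "sobolev L (real n) f \<longleftrightarrow> periodic_fun L f \<and> f \<in> borel_measurable lborel
     \<and> set_integrable lborel {0..L} (\<lambda>x. (f x)\<^sup>2) \<and> hs n (fcoeff L f)"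
  unfolding sobolev_def hs_def hw_def by (simp add: powr_realpow add_pos_nonneg)

lemma sobolev_integrable: assumes "sobolev L s f" shows "set_integrable lborel {0..L} f"
proof -
  have i: "integrable lborel (\<lambda>x. indicator {0..L} x *\<^sub>R (1 + (f x)\<^sup>2))"
  proof -
    have "set_integrable lborel {0..L} (\<lambda>x. 1 :: real)"
      by (rule borel_integrable_atLeastAtMost') (rule continuous_on_const)
    from set_integral_add(1)[OF this, of "\<lambda>x. (f x)\<^sup>2"] show ?thesis using assms by (simp add: sobolev_def set_integrable_def)
  qed
  have [measurable]: "f \<in> borel_measurable lborel" using assms by (simp add: sobolev_def)
  show ?thesis unfolding set_integrable_def
  proof (rule Bochner_Integration.integrable_bound[OF i])
    have "\<bar>y\<bar> \<le> 1 + y\<^sup>2" for y :: real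
      using zero_le_power2[of "\<bar>y\<bar> - 1"] by (simp add: power2_eq_square algebra_simps)
    then show "AE x in lborel. norm (indicator {0..L} x *\<^sub>R f x) \<le> norm (indicator {0..L} x *\<^sub>R (1 + (f x)\<^sup>2))"
      by (intro AE_I2) (auto simp: abs_mult indicator_def)
  qed measurable
qed

lemma fcoeff_diff:
  assumes "set_integrable lborel {0..L} f" "set_integrable lborel {0..L} g"
  shows "fcoeff L (\<lambda>x. f x - g x) k = fcoeff L f k - fcoeff L g k"
proof -
  have c: "continuous_on {0..L} (\<lambda>x. cis (kap * real_of_int (- k) * x))" by (intro continuous_intros)
  have "set_integrable lborel {0..L} (\<lambda>x. complex_of_real (h x) * cis (kap * real_of_int (- k) * x))"
    if "set_integrable lborel {0..L} h" for h
    using continuous_mult_set_integrable[OF that c] by (simp add: scaleR_conv_of_real)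
  from set_integral_diff(2)[OF this[OF assms(1)] this[OF assms(2)]] show ?thesis
    by (simp add: fcoeff_eq_set_integral left_diff_distrib diff_divide_distrib)
qed

lemma sobolev_fcoeff_diff:
  assumes "sobolev L s f" "sobolev L r g"
  shows "fcoeff L (\<lambda>x. f x - g x) = (\<lambda>k. fcoeff L f k - fcoeff L g k)"
  using fcoeff_diff[OF sobolev_integrable[OF assms(1)] sobolev_integrable[OF assms(2)]] by auto

lemma fser_sobolev: assumes "hs n a" "n \<ge> 1" "symm a" shows "sobolev L (real n) (fser a)"
proof -
  have s: "asum 0 a" using hs_asum(1)[OF assms(1), of 0] assms(2) by simp
  have "fcoeff L (fser a) = a" using fcoeff_fser[OF s assms(3)] by auto
  moreover have "set_integrable lborel {0..L} (\<lambda>x. (fser a x)\<^sup>2)"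
    by (rule borel_integrable_atLeastAtMost') (intro continuous_intros fser_cont[OF s])
  moreover have "fser a \<in> borel_measurable lborel"
    using borel_measurable_continuous_onI[OF fser_cont[OF s]] by simp
  ultimately show ?thesis using assms by (auto simp: sobolev_eq periodic_fun_def fser_periodic)
qed

text \<open>The difference between f and its Fourier series is integrable and periodic and has zero
  coefficients.\<close>

lemma sobolev_rep:
  assumes f: "sobolev L (real n) f" and n: "n \<ge> 1"
  shows "AE x in lborel. f x = fser (fcoeff L f) x"
proof -
  let ?a = "fcoeff L f" and ?h = "\<lambda>x. f x - fser (fcoeff L f) x"
  have hs: "hs n ?a" using f by (simp add: sobolev_eq)
  have s: "asum 0 ?a" using hs_asum(1)[OF hs, of 0] n by simp
  note g = fser_sobolev[OF hs n symm_fcoeff]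
  have "AE x in lborel. x \<in> {0..L} \<longrightarrow> ?h x = 0"
  proof (rule fourier_unique_AE)
    show "set_integrable lborel {0..L} ?h"
      by (intro set_integral_diff sobolev_integrable[OF f] sobolev_integrable[OF g])
    show "?h \<in> borel_measurable lborel" using f g unfolding sobolev_def by (intro borel_measurable_diff) auto
    show "fcoeff L ?h k = 0" for k
      using sobolev_fcoeff_diff[OF f g] fcoeff_fser[OF s symm_fcoeff] by simp
  qed
  then have "AE x in lborel. ?h x = 0"
    by (rule AE_periodic[rotated]) (use f in \<open>simp add: sobolev_def periodic_fun_def fser_periodic\<close>)
  then show ?thesis by eventually_elim simp
qed

lemma sobolev_cont_rep:
  assumes f: "sobolev L (real n) f" and n: "n \<ge> 1" and c: "continuous_on UNIV f"
  shows "f = fser (fcoeff L f)"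
proof (rule continuous_AE_eq[OF c _ sobolev_rep[OF f n]])
  have hs: "hs n (fcoeff L f)" using f by (simp add: sobolev_eq)
  show "continuous_on UNIV (fser (fcoeff L f))" using hs_asum(1)[OF hs, of 0] n by (intro fser_cont[of 0]) simp
qed

lemma continuous_fcoeff_eq_iff:
  assumes c: "continuous_on UNIV f" "continuous_on UNIV g" and p: "\<And>x. f (x + L) = f x" "\<And>x. g (x + L) = g x"
    and e: "\<And>k. fcoeff L f k = fcoeff L g k"
  shows "f = g"
proof -
  have i: "set_integrable lborel {0..L} h" if "continuous_on UNIV h" for h :: "real \<Rightarrow> real"
    by (rule borel_integrable_atLeastAtMost') (rule continuous_on_subset[OF that], simp)
  have "AE x in lborel. x \<in> {0..L} \<longrightarrow> f x - g x = 0"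
    by (rule fourier_unique_AE)
       (use continuous_on_diff[OF c] e i c in \<open>auto simp: fcoeff_diff intro!: borel_measurable_continuous_onI\<close>)
  then have "AE x in lborel. f x - g x = 0" by (rule AE_periodic[rotated]) (simp add: p)
  then have "AE x in lborel. f x = g x" by eventually_elim simp
  then show ?thesis by (rule continuous_AE_eq[OF c])
qed

lemma fser_dd_le:
  assumes "hs n a" "j + 1 \<le> n"
  shows "\<bar>fser (dd j a) x\<bar> \<le> kap ^ j * sqrt (2 ^ n * Zw * hn n a)"
proof -
  have s: "asum j a" using hs_asum(1)[OF assms] .
  have "\<bar>fser (dd j a) x\<bar> \<le> (\<Sum>\<^sub>\<infinity>k. cmod (dd j a k))" by (rule fser_le[OF asum_dd[of 0]]) (use s in simp)
  also have "\<dots> \<le> (\<Sum>\<^sub>\<infinity>k. kap ^ j * (wt k ^ j * cmod (a k)))"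
    by (rule infsum_mono) (use s asum0[OF asum_dd[of 0 j a]] cmod_dd_le in \<open>auto simp: asum_def intro: summable_on_cmult_right\<close>)
  also have "\<dots> = kap ^ j * (\<Sum>\<^sub>\<infinity>k. wt k ^ j * cmod (a k))"
    by (rule infsum_cmult_right) (use s in \<open>simp add: asum_def\<close>)
  also have "\<dots> \<le> kap ^ j * sqrt (2 ^ n * Zw * hn n a)"
    using hs_asum(2)[OF assms] kap_pos by (intro mult_left_mono) auto
  finally show ?thesis .
qed

end

section \<open>The regularised equation\<close>

lemma geometric_limit:
  fixes X :: "nat \<Rightarrow> 'a::banach"
  assumes "\<And>m. norm (X (Suc m) - X m) \<le> C * (1/2) ^ m"
  shows "\<exists>l. X \<longlonglongrightarrow> l \<and> (\<forall>m. norm (l - X m) \<le> 2 * C * (1/2) ^ m)"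
proof -
  have s: "summable (\<lambda>m. C * (1/2::real) ^ m)" by (intro summable_mult summable_geometric) simp
  have sx: "summable (\<lambda>m. X (Suc m) - X m)"
    by (rule summable_comparison_test'[OF s, of 0]) (use assms in simp)
  define l where "l = X 0 + (\<Sum>m. X (Suc m) - X m)"
  have lim: "X \<longlonglongrightarrow> l"
  proof -
    have "(\<lambda>n. X 0 + (\<Sum>m<n. X (Suc m) - X m)) \<longlonglongrightarrow> l"
      unfolding l_def by (intro tendsto_add tendsto_const summable_LIMSEQ sx)
    moreover have "X 0 + (\<Sum>m<n. X (Suc m) - X m) = X n" for n
      using sum_lessThan_telescope[of X n] by simp
    ultimately show ?thesis by simp
  qed
  have "norm (l - X m) \<le> 2 * C * (1/2) ^ m" for m
  proof (rule LIMSEQ_le_const2)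
    show "(\<lambda>n. norm (X n - X m)) \<longlonglongrightarrow> norm (l - X m)" by (intro tendsto_intros lim)
    \<comment> \<open>The subtracted term makes the induction telescope; the bound
      \<open>2 * C * (1/2) ^ m\<close> alone would not reproduce itself.\<close>
    have "norm (X (m + n) - X m) \<le> 2 * C * (1/2) ^ m - 2 * C * (1/2) ^ (m + n)" for n
    proof (induction n)
      case (Suc n)
      have "norm (X (m + Suc n) - X m) \<le> norm (X (Suc (m + n)) - X (m + n)) + norm (X (m + n) - X m)"
        using norm_triangle_ineq[of "X (Suc (m + n)) - X (m + n)" "X (m + n) - X m"] by simp
      also have "\<dots> \<le> C * (1/2) ^ (m + n) + (2 * C * (1/2) ^ m - 2 * C * (1/2) ^ (m + n))"
        using Suc assms[of "m + n"] by linarith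
      finally show ?case by simp
    qed simp
    moreover have "C \<ge> 0" using assms[of 0] by (simp add: order_trans[OF norm_ge_zero])
    ultimately have "norm (X n - X m) \<le> 2 * C * (1/2) ^ m" if "n \<ge> m" for n
      using that le_Suc_ex[OF that] by (smt (verit) mult_nonneg_nonneg zero_le_power divide_nonneg_nonneg)
    then show "\<exists>N. \<forall>n\<ge>N. norm (X n - X m) \<le> 2 * C * (1/2) ^ m" by blast
  qed
  with lim show ?thesis by blast
qed

lemma bd_add: "bd s A a \<Longrightarrow> bd s B b \<Longrightarrow> bd s (A + B) (\<lambda>k. a k + b k)"
proof (unfold bd_def, intro allI)
  fix k assume h: "\<forall>k. cmod (a k) * wt k ^ s \<le> A" "\<forall>k. cmod (b k) * wt k ^ s \<le> B"
  have "cmod (a k + b k) * wt k ^ s \<le> (cmod (a k) + cmod (b k)) * wt k ^ s"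
    by (intro mult_right_mono norm_triangle_ineq) (simp add: wt_pos less_imp_le)
  also have "\<dots> \<le> A + B" using h by (auto simp: distrib_right intro: add_mono)
  finally show "cmod (a k + b k) * wt k ^ s \<le> A + B" .
qed

lemma bd_sub: "bd s A a \<Longrightarrow> bd s B b \<Longrightarrow> bd s (A + B) (\<lambda>k. a k - b k)"
  using bd_add[of s A a B "\<lambda>k. - b k"] by (simp add: bd_def)

lemma bd_conv_diff:
  assumes "bd (s + 2) A a" "bd s B b" "bd (s + 2) A a'" "bd s B b'"
    and "bd (s + 2) d (\<lambda>k. a k - a' k)" "bd s e (\<lambda>k. b k - b' k)"
  shows "bd s ((d * B + A * e) * Zw) (\<lambda>k. conv a b k - conv a' b' k)"
proof -
  have "bd s (d * B * Zw + A * e * Zw) (\<lambda>k. conv (\<lambda>k. a k - a' k) b k + conv a' (\<lambda>k. b k - b' k) k)"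
    by (intro bd_add bd_conv assms)
  then show ?thesis using conv_diff[OF assms(1-4)] by (simp add: distrib_right)
qed

section \<open>The nonlinearity and the fourth-order semigroup on coefficients\<close>

context circle begin

text \<open>The coefficients of \<open>u^3 u_xxx\<close>. The differentiated factor stands
  innermost, so the two surplus powers demanded by \<open>bd_conv\<close> always fall on
  undifferentiated copies of \<open>a\<close>, and the total cost is three powers.\<close>

definition nl :: "(int \<Rightarrow> complex) \<Rightarrow> int \<Rightarrow> complex" where
  "nl a = conv a (conv a (conv a (dd 3 a)))"

lemma symm_nl: "symm a \<Longrightarrow> symm (nl a)"
  unfolding nl_def by (intro symm_conv symm_dd)

lemma bd_nl: assumes "bd (s + 3) R a" shows "bd s (kap ^ 3 * Zw ^ 3 * R ^ 4) (nl a)"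
proof -
  have a: "bd (s + 2) R a" by (rule bd_mono[OF assms]) auto
  have "bd s (R * (R * (R * (kap ^ 3 * R) * Zw) * Zw) * Zw) (nl a)"
    unfolding nl_def by (intro bd_conv a bd_dd assms)
  then show ?thesis by (simp add: algebra_simps eval_nat_numeral)
qed

text \<open>The product is changed one factor at a time; the four factors account for the 4.\<close>

lemma bd_nl_diff:
  assumes "bd 4 R a" "bd 4 R b" "bd 4 d (\<lambda>k. a k - b k)"
  shows "bd 1 (4 * kap ^ 3 * Zw ^ 3 * R ^ 3 * d) (\<lambda>k. nl a k - nl b k)"
proof -
  have a: "bd (1 + 2) R a" "bd (1 + 2) R b" "bd (1 + 2) d (\<lambda>k. a k - b k)" using assms bd_mono by (auto intro: bd_mono)
  have a3: "bd 1 (kap ^ 3 * R) (dd 3 a)" "bd 1 (kap ^ 3 * R) (dd 3 b)"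
    "bd 1 (kap ^ 3 * d) (\<lambda>k. dd 3 a k - dd 3 b k)"
    using assms by (auto intro!: bd_dd simp flip: dd_diff)
  note c1 = bd_conv[OF a(1) a3(1)] bd_conv[OF a(2) a3(2)] bd_conv_diff[OF a(1) a3(1) a(2) a3(2) a(3) a3(3)]
  note c2 = bd_conv[OF a(1) c1(1)] bd_conv[OF a(2) c1(2)] bd_conv_diff[OF a(1) c1(1) a(2) c1(2) a(3) c1(3)]
  have "bd 1 ((d * (R * (R * (kap ^ 3 * R) * Zw) * Zw) +
       R * ((d * (R * (kap ^ 3 * R) * Zw) + R * ((d * (kap ^ 3 * R) + R * (kap ^ 3 * d)) * Zw)) * Zw)) * Zw)
       (\<lambda>k. nl a k - nl b k)"
    unfolding nl_def by (rule bd_conv_diff[OF a(1) c2(1) a(2) c2(2) a(3) c2(3)])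
  then show ?thesis by (simp add: algebra_simps eval_nat_numeral)
qed

lemma continuous_on_nl:
  assumes "\<And>k. continuous_on S (\<lambda>t. a t k)" "\<And>t. t \<in> S \<Longrightarrow> bd 4 R (a t)"
  shows "continuous_on S (\<lambda>t. nl (a t) k)"
proof -
  have a: "bd (1 + 2) R (a t)" if "t \<in> S" for t by (rule bd_mono[OF assms(2)[OF that]]) auto
  have c0: "continuous_on S (\<lambda>t. dd 3 (a t) k)" for k unfolding dd_def by (intro continuous_intros assms)
  have a3: "bd 1 (kap ^ 3 * R) (dd 3 (a t))" if "t \<in> S" for t using assms(2)[OF that] by (auto intro!: bd_dd)
  note c1 = continuous_on_conv[OF assms(1) c0 a a3] and b1 = bd_conv[OF a a3]
  note c2 = continuous_on_conv[OF assms(1) c1 a b1] and b2 = bd_conv[OF a b1]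
  show ?thesis unfolding nl_def by (rule continuous_on_conv[OF assms(1) c2 a b2])
qed

text \<open>The symbol of the regularising term: \<open>(\<i> * kap * k) ^ 4\<close> is real and
  nonnegative, hence the term damps every mode.\<close>

definition lam :: "real \<Rightarrow> int \<Rightarrow> real" where "lam \<epsilon> k = \<epsilon> * (kap * real_of_int k) ^ 4"

lemma lam_nonneg: "\<epsilon> \<ge> 0 \<Longrightarrow> lam \<epsilon> k \<ge> 0" by (simp add: lam_def)

text \<open>Variation of constants for the system \<open>a' = f - lam a\<close> with value
  \<open>\<alpha>\<close> at time 0. The decaying exponential stands outside the integral, so
  differentiation in t is a product rule.\<close>

definition duhamel :: "real \<Rightarrow> (int \<Rightarrow> complex) \<Rightarrow> (real \<Rightarrow> int \<Rightarrow> complex) \<Rightarrow> real \<Rightarrow> int \<Rightarrow> complex" where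
  "duhamel \<epsilon> \<alpha> f t k = exp (- lam \<epsilon> k * t) *\<^sub>R (\<alpha> k + integral {0..t} (\<lambda>s. exp (lam \<epsilon> k * s) *\<^sub>R f s k))"

text \<open>The time integral of the kernel, \<open>(1 - exp (- l * t)) / l\<close> for l > 0. It is
  the factor by which Duhamel's formula multiplies a bound on the source.\<close>

definition emem :: "real \<Rightarrow> real \<Rightarrow> real" where
  "emem l t = exp (- l * t) * integral {0..t} (\<lambda>s. exp (l * s))"

lemma emem_nonneg: "emem l t \<ge> 0"
  unfolding emem_def by (intro mult_nonneg_nonneg integral_nonneg integrable_continuous_real continuous_intros) auto

lemma emem_le_t: assumes "l \<ge> 0" "t \<ge> 0" shows "emem l t \<le> t"
proof -
  have "integral {0..t} (\<lambda>s. exp (l * s)) \<le> integral {0..t} (\<lambda>s. exp (l * t))"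
    by (rule integral_le) (use assms in \<open>auto intro!: integrable_continuous_real continuous_intros mult_left_mono\<close>)
  also have "\<dots> = t * exp (l * t)" using assms by simp
  finally have "emem l t \<le> exp (- l * t) * (t * exp (l * t))" unfolding emem_def by (intro mult_left_mono) auto
  also have "\<dots> = t" by (simp add: mult.left_commute flip: exp_add)
  finally show ?thesis .
qed

lemma emem_le_inv: assumes "l \<ge> 0" "t \<ge> 0" shows "l * emem l t \<le> 1"
proof -
  have "((\<lambda>s. l * exp (l * s)) has_integral (exp (l * t) - exp (l * 0))) {0..t}"
    by (rule fundamental_theorem_of_calculus)
       (use assms in \<open>auto intro!: derivative_eq_intros simp flip: has_real_derivative_iff_has_vector_derivative\<close>)
  then have "l * integral {0..t} (\<lambda>s. exp (l * s)) = exp (l * t) - 1" by (simp add: integral_unique flip: integral_mult_right)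
  then have "l * emem l t = exp (- l * t) * (exp (l * t) - 1)" unfolding emem_def by (simp add: mult.left_commute)
  also have "\<dots> = 1 - exp (- l * t)" by (simp add: right_diff_distrib flip: exp_add)
  finally show ?thesis by simp
qed

text \<open>Low frequencies are small because the time is short (\<open>emem_le_t\<close>), high
  frequencies because of the damping (\<open>emem_le_inv\<close>): three powers of the weight
  against four in \<open>lam\<close> leave a factor 1 / |k|.\<close>

lemma emem_small:
  assumes "\<epsilon> > 0" "\<theta> > 0"
  obtains \<tau> where "\<tau> > 0" "\<And>k t. t \<in> {0..\<tau>} \<Longrightarrow> wt k ^ 3 * emem (lam \<epsilon> k) t \<le> \<theta>"
proof -
  define c where "c = \<epsilon> * kap ^ 4"
  have c: "c > 0" using assms kap_pos by (simp add: c_def)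
  \<comment> \<open>For |k| = m beyond K the quantity is at most \<open>8 / (c * m)\<close>, which
    is below \<open>\<theta>\<close>; the 8 comes from \<open>wt k \<le> 2 * m\<close>.\<close>
  obtain K :: nat where K: "8 / (c * \<theta>) < real K" using reals_Archimedean2 by blast
  have Kp: "real K > 0" using K c assms by (smt (verit) divide_pos_pos mult_pos_pos)
  show thesis
  proof (rule that[of "\<theta> / (1 + real K) ^ 3"])
    show "\<theta> / (1 + real K) ^ 3 > 0" using assms by (simp add: add_pos_nonneg)
    fix k t assume t: "t \<in> {0..\<theta> / (1 + real K) ^ 3}"
    have l: "lam \<epsilon> k \<ge> 0" using assms by (simp add: lam_nonneg)
    show "wt k ^ 3 * emem (lam \<epsilon> k) t \<le> \<theta>"
    proof (cases "\<bar>real_of_int k\<bar> \<le> real K")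
      case True
      have "wt k ^ 3 * emem (lam \<epsilon> k) t \<le> (1 + real K) ^ 3 * (\<theta> / (1 + real K) ^ 3)"
      proof (rule mult_mono)
        show "wt k ^ 3 \<le> (1 + real K) ^ 3" using True by (intro power_mono) (auto simp: wt_def)
        show "emem (lam \<epsilon> k) t \<le> \<theta> / (1 + real K) ^ 3" using emem_le_t[OF l, of t] t by simp
      qed (auto simp: emem_nonneg)
      then show ?thesis by (simp add: add_pos_nonneg less_imp_neq[THEN not_sym])
    next
      case False
      define m where "m = \<bar>real_of_int k\<bar>"
      have m: "m > real K" using False by (simp add: m_def)
      have m1: "m \<ge> 1" using m Kp by (auto simp: m_def)
      have "wt k ^ 3 \<le> (2 * m) ^ 3" using m1 by (intro power_mono) (auto simp: wt_def m_def)
      then have "c * m * (wt k ^ 3 * emem (lam \<epsilon> k) t) \<le> c * m * ((2 * m) ^ 3 * emem (lam \<epsilon> k) t)"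
        using c m1 by (intro mult_left_mono mult_right_mono emem_nonneg) auto
      also have "\<dots> = 8 * (lam \<epsilon> k * emem (lam \<epsilon> k) t)"
      proof -
        have "lam \<epsilon> k = c * m ^ 4" by (simp add: lam_def c_def m_def power_mult_distrib)
        then show ?thesis by (simp add: eval_nat_numeral)
      qed
      also have "\<dots> \<le> 8" using emem_le_inv[OF l, of t] t by simp
      also have "8 \<le> c * m * \<theta>"
      proof -
        have "8 < real K * (c * \<theta>)" using K c assms by (simp add: pos_divide_less_eq)
        also have "\<dots> \<le> m * (c * \<theta>)" using m c assms by (intro mult_right_mono) auto
        finally show ?thesis by (simp add: mult_ac)
      qed
      finally show ?thesis using c m1 by (simp add: mult_le_cancel_left_pos)
    qed
  qed
qed

text \<open>Four powers of the frequency are gained; the nonlinearity costs only three.\<close>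

lemma emem_gain4:
  assumes "\<epsilon> > 0"
  shows "\<exists>C. \<forall>k. \<forall>t\<in>{0..\<tau>}. wt k ^ 4 * emem (lam \<epsilon> k) t \<le> C"
proof -
  define c where "c = \<epsilon> * kap ^ 4"
  have c: "c > 0" using assms kap_pos by (simp add: c_def)
  have "wt k ^ 4 * emem (lam \<epsilon> k) t \<le> max \<tau> (16 / c)" if t: "t \<in> {0..\<tau>}" for k t
  proof (cases "k = 0")
    case True
    have "emem (lam \<epsilon> k) t \<le> \<tau>" using emem_le_t[OF lam_nonneg, of \<epsilon> t k] assms t by simp
    then show ?thesis using True by (simp add: wt_def)
  next
    case False
    define m where "m = \<bar>real_of_int k\<bar>"
    have m1: "m \<ge> 1" using False by (auto simp: m_def)
    have "wt k ^ 4 \<le> (2 * m) ^ 4" using m1 by (intro power_mono) (auto simp: wt_def m_def)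
    then have "c * (wt k ^ 4 * emem (lam \<epsilon> k) t) \<le> c * ((2 * m) ^ 4 * emem (lam \<epsilon> k) t)"
      using c by (intro mult_left_mono mult_right_mono emem_nonneg) auto
    also have "\<dots> = 16 * (lam \<epsilon> k * emem (lam \<epsilon> k) t)"
      by (simp add: lam_def c_def m_def power_mult_distrib)
    also have "\<dots> \<le> 16" using emem_le_inv[OF lam_nonneg, of \<epsilon> t k] assms t by simp
    finally have "wt k ^ 4 * emem (lam \<epsilon> k) t \<le> 16 / c" using c by (simp add: pos_le_divide_eq mult.commute)
    then show ?thesis by simp
  qed
  then show ?thesis by blast
qed

lemma duhamel_term:
  assumes f: "continuous_on {0..t} (\<lambda>s. f s k)" and b: "\<And>s. s \<in> {0..t} \<Longrightarrow> cmod (f s k) \<le> B"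
  shows "cmod (exp (- lam \<epsilon> k * t) *\<^sub>R integral {0..t} (\<lambda>s. exp (lam \<epsilon> k * s) *\<^sub>R f s k)) \<le> B * emem (lam \<epsilon> k) t"
proof -
  let ?l = "lam \<epsilon> k"
  have "cmod (integral {0..t} (\<lambda>s. exp (?l * s) *\<^sub>R f s k)) \<le> integral {0..t} (\<lambda>s. exp (?l * s) * B)"
    by (rule integral_norm_bound_integral)
       (use b in \<open>auto intro!: integrable_continuous_real continuous_intros f mult_left_mono\<close>)
  also have "\<dots> = B * integral {0..t} (\<lambda>s. exp (?l * s))" by simp
  finally show ?thesis unfolding emem_def norm_scaleR
    by (simp add: mult_left_mono mult.left_commute)
qed

lemma duhamel_diff:
  assumes "continuous_on {0..t} (\<lambda>s. f s k)" "continuous_on {0..t} (\<lambda>s. g s k)"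
  shows "duhamel \<epsilon> \<alpha> f t k - duhamel \<epsilon> \<alpha> g t k
    = exp (- lam \<epsilon> k * t) *\<^sub>R integral {0..t} (\<lambda>s. exp (lam \<epsilon> k * s) *\<^sub>R (f s k - g s k))"
proof -
  have "integral {0..t} (\<lambda>s. exp (lam \<epsilon> k * s) *\<^sub>R f s k - exp (lam \<epsilon> k * s) *\<^sub>R g s k)
    = integral {0..t} (\<lambda>s. exp (lam \<epsilon> k * s) *\<^sub>R f s k) - integral {0..t} (\<lambda>s. exp (lam \<epsilon> k * s) *\<^sub>R g s k)"
    by (rule integral_diff) (intro integrable_continuous_real continuous_intros assms)+
  then show ?thesis unfolding duhamel_def by (simp add: scaleR_diff_right scaleR_add_right)
qed

lemma duhamel_diff_le:
  assumes "continuous_on {0..t} (\<lambda>s. f s k)" "continuous_on {0..t} (\<lambda>s. g s k)"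
    and "\<And>s. s \<in> {0..t} \<Longrightarrow> cmod (f s k - g s k) \<le> B"
  shows "cmod (duhamel \<epsilon> \<alpha> f t k - duhamel \<epsilon> \<alpha> g t k) \<le> B * emem (lam \<epsilon> k) t"
  unfolding duhamel_diff[where f=f and g=g and k=k and t=t, OF assms(1,2)]
  by (rule duhamel_term[of t "\<lambda>s k. f s k - g s k"]) (use assms in \<open>auto intro!: continuous_intros\<close>)

lemma duhamel_le:
  assumes "continuous_on {0..t} (\<lambda>s. f s k)" "\<And>s. s \<in> {0..t} \<Longrightarrow> cmod (f s k) \<le> B" "\<epsilon> \<ge> 0" "t \<ge> 0"
  shows "cmod (duhamel \<epsilon> \<alpha> f t k) \<le> cmod (\<alpha> k) + B * emem (lam \<epsilon> k) t"
proof -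
  have "exp (- lam \<epsilon> k * t) \<le> 1" using lam_nonneg[OF assms(3), of k] assms(4) by simp
  then have "cmod (exp (- lam \<epsilon> k * t) *\<^sub>R \<alpha> k) \<le> cmod (\<alpha> k)" by (simp add: mult_left_le_one_le)
  then show ?thesis unfolding duhamel_def scaleR_add_right
    using duhamel_term[where f=f and k=k and t=t and \<epsilon>=\<epsilon>, OF assms(1,2)] by (intro norm_triangle_le add_mono) auto
qed

lemma duhamel_deriv:
  assumes f: "continuous_on {0..\<tau>} (\<lambda>s. f s k)" and t: "t \<in> {0..\<tau>}"
  shows "((\<lambda>t. duhamel \<epsilon> \<alpha> f t k) has_vector_derivative (f t k - lam \<epsilon> k *\<^sub>R duhamel \<epsilon> \<alpha> f t k)) (at t within {0..\<tau>})"
proof -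
  let ?l = "lam \<epsilon> k"
  let ?I = "\<lambda>t. integral {0..t} (\<lambda>s. exp (?l * s) *\<^sub>R f s k)"
  have I: "(?I has_vector_derivative (exp (?l * t) *\<^sub>R f t k)) (at t within {0..\<tau>})"
    by (rule integral_has_vector_derivative) (use t in \<open>auto intro!: continuous_intros f\<close>)
  have E: "((\<lambda>t. exp (- ?l * t)) has_vector_derivative (- ?l * exp (- ?l * t))) (at t within {0..\<tau>})"
    by (auto intro!: derivative_eq_intros simp flip: has_real_derivative_iff_has_vector_derivative)
  have "((\<lambda>t. exp (- ?l * t) *\<^sub>R (\<alpha> k + ?I t)) has_vector_derivative
     (exp (- ?l * t) *\<^sub>R (0 + exp (?l * t) *\<^sub>R f t k) + (- ?l * exp (- ?l * t)) *\<^sub>R (\<alpha> k + ?I t))) (at t within {0..\<tau>})"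
    using has_vector_derivative_scaleR[OF E[folded has_real_derivative_iff_has_vector_derivative]
       has_vector_derivative_add[OF has_vector_derivative_const[of "\<alpha> k"] I]] .
  then show ?thesis unfolding duhamel_def by (simp flip: exp_add)
qed

lemma symm_duh:
  assumes "symm \<alpha>" "\<And>s. s \<in> {0..t} \<Longrightarrow> symm (f s)" "\<And>k. continuous_on {0..t} (\<lambda>s. f s k)"
  shows "symm (duhamel \<epsilon> \<alpha> f t)"
  unfolding symm_def
proof
  fix k
  have "integral {0..t} (\<lambda>s. exp (lam \<epsilon> k * s) *\<^sub>R f s (- k)) = integral {0..t} (\<lambda>s. cnj (exp (lam \<epsilon> k * s) *\<^sub>R f s k))"
    by (rule integral_cong) (use assms(2) in \<open>auto simp: symm_def\<close>)
  also have "\<dots> = cnj (integral {0..t} (\<lambda>s. exp (lam \<epsilon> k * s) *\<^sub>R f s k))"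
    using integral_linear[OF _ bounded_linear_cnj, of "\<lambda>s. exp (lam \<epsilon> k * s) *\<^sub>R f s k" "{0..t}"]
    by (simp add: o_def integrable_continuous_real continuous_intros assms)
  finally show "duhamel \<epsilon> \<alpha> f t (- k) = cnj (duhamel \<epsilon> \<alpha> f t k)"
    using assms(1) by (simp add: duhamel_def lam_def symm_def)
qed

end

lemma has_vector_derivative_within_Un:
  assumes "(f has_vector_derivative D) (at x within S)" "(f has_vector_derivative D) (at x within T)"
  shows "(f has_vector_derivative D) (at x within S \<union> T)"
  using assms unfolding has_vector_derivative_def has_derivative_iff_norm
  by (simp add: at_within_union filterlim_sup)

section \<open>Local solutions of the regularised system\<close>

context circle begin

text \<open>The regularised equation as an infinite system for the coefficients. Decay of every
  order, uniform in time, is built in, so that energy computations concern smooth functions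
  only.\<close>

definition esol :: "real \<Rightarrow> real \<Rightarrow> (real \<Rightarrow> int \<Rightarrow> complex) \<Rightarrow> bool" where
  "esol \<epsilon> \<tau> a \<longleftrightarrow> (\<forall>t\<in>{0..\<tau>}. symm (a t)) \<and> (\<forall>s. \<exists>C. \<forall>t\<in>{0..\<tau>}. bd s C (a t)) \<and>
     (\<forall>k. \<forall>t\<in>{0..\<tau>}. ((\<lambda>t. a t k) has_vector_derivative (nl (a t) k - lam \<epsilon> k *\<^sub>R a t k)) (at t within {0..\<tau>}))"

lemma duhamel_bd_diff:
  assumes f: "\<And>k. continuous_on {0..\<tau>} (\<lambda>s. f s k)" and g: "\<And>k. continuous_on {0..\<tau>} (\<lambda>s. g s k)"
    and b: "\<And>s. s \<in> {0..\<tau>} \<Longrightarrow> bd 1 B (\<lambda>k. f s k - g s k)"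
    and \<theta>: "\<And>k t. t \<in> {0..\<tau>} \<Longrightarrow> wt k ^ 3 * emem (lam \<epsilon> k) t \<le> \<theta>" and t: "t \<in> {0..\<tau>}"
  shows "bd 4 (B * \<theta>) (\<lambda>k. duhamel \<epsilon> \<alpha> f t k - duhamel \<epsilon> \<alpha> g t k)"
  unfolding bd_def
proof
  fix k
  have sub: "{0..t} \<subseteq> {0..\<tau>}" using t by auto
  have B: "B \<ge> 0" using bd_nonneg[OF b[OF t]] .
  have "cmod (duhamel \<epsilon> \<alpha> f t k - duhamel \<epsilon> \<alpha> g t k) \<le> (B / wt k ^ 1) * emem (lam \<epsilon> k) t"
    by (rule duhamel_diff_le)
       (use continuous_on_subset[OF f sub] continuous_on_subset[OF g sub] bd_le[OF b] sub in auto)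
  then have "cmod (duhamel \<epsilon> \<alpha> f t k - duhamel \<epsilon> \<alpha> g t k) * wt k ^ 4 \<le> (B / wt k ^ 1) * emem (lam \<epsilon> k) t * wt k ^ 4"
    by (intro mult_right_mono) (auto simp: wt_pos less_imp_le)
  also have "\<dots> = B * (wt k ^ 3 * emem (lam \<epsilon> k) t)"
    using wt_pos[of k] by (simp add: eval_nat_numeral)
  also have "\<dots> \<le> B * \<theta>" using \<theta>[OF t] B by (intro mult_left_mono)
  finally show "cmod (duhamel \<epsilon> \<alpha> f t k - duhamel \<epsilon> \<alpha> g t k) * wt k ^ 4 \<le> B * \<theta>" .
qed

text \<open>The number j counts the powers gained. The fixed point argument takes j = 3 with a small
  \<open>\<theta>\<close>; the gain of regularity takes j = 4 with whatever constant
  results.\<close>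

lemma duhamel_bd:
  assumes f: "\<And>k. continuous_on {0..\<tau>} (\<lambda>s. f s k)"
    and b: "\<And>s. s \<in> {0..\<tau>} \<Longrightarrow> bd r B (f s)" and \<alpha>: "bd (r + j) A \<alpha>" and "\<epsilon> \<ge> 0"
    and \<theta>: "\<And>k t. t \<in> {0..\<tau>} \<Longrightarrow> wt k ^ j * emem (lam \<epsilon> k) t \<le> \<theta>" and t: "t \<in> {0..\<tau>}"
  shows "bd (r + j) (A + B * \<theta>) (duhamel \<epsilon> \<alpha> f t)"
  unfolding bd_def
proof
  fix k
  have sub: "{0..t} \<subseteq> {0..\<tau>}" using t by auto
  have B: "B \<ge> 0" using bd_nonneg[OF b[OF t]] .
  have "cmod (duhamel \<epsilon> \<alpha> f t k) \<le> cmod (\<alpha> k) + (B / wt k ^ r) * emem (lam \<epsilon> k) t"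
    by (rule duhamel_le) (use continuous_on_subset[OF f sub] bd_le[OF b] sub t assms(4) in auto)
  then have "cmod (duhamel \<epsilon> \<alpha> f t k) * wt k ^ (r + j) \<le> (cmod (\<alpha> k) + (B / wt k ^ r) * emem (lam \<epsilon> k) t) * wt k ^ (r + j)"
    by (intro mult_right_mono) (auto simp: wt_pos less_imp_le)
  also have "\<dots> = cmod (\<alpha> k) * wt k ^ (r + j) + B * (wt k ^ j * emem (lam \<epsilon> k) t)"
    using wt_pos[of k] by (simp add: power_add distrib_right)
  also have "\<dots> \<le> A + B * \<theta>" using \<theta>[OF t] B \<alpha> by (intro add_mono mult_left_mono) (auto simp: bd_def)
  finally show "cmod (duhamel \<epsilon> \<alpha> f t k) * wt k ^ (r + j) \<le> A + B * \<theta>" .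
qed

lemma duhamel_cont: "continuous_on {0..\<tau>} (\<lambda>s. f s k) \<Longrightarrow> continuous_on {0..\<tau>} (\<lambda>t. duhamel \<epsilon> \<alpha> f t k)"
  unfolding continuous_on_eq_continuous_within[of _ "\<lambda>t. duhamel \<epsilon> \<alpha> f t k"]
  by (intro ballI has_vector_derivative_continuous[OF duhamel_deriv])

lemma duhamel_0: "duhamel \<epsilon> \<alpha> f 0 = \<alpha>" by (auto simp: duhamel_def)

text \<open>Decay of order s + 4 puts the nonlinearity in order s + 1, and Duhamel's formula then
  returns order s + 5: each round wins one power, as the data decay to every order.\<close>

lemma mild_bootstrap:
  assumes \<epsilon>: "\<epsilon> > 0" and c: "\<And>k. continuous_on {0..\<tau>} (\<lambda>t. a t k)"
    and R: "\<And>t. t \<in> {0..\<tau>} \<Longrightarrow> bd 4 R (a t)"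
    and fp: "\<And>t. t \<in> {0..\<tau>} \<Longrightarrow> a t = duhamel \<epsilon> \<alpha> (\<lambda>s. nl (a s)) t"
    and \<alpha>: "\<And>s. \<exists>C. bd s C \<alpha>"
  shows "\<exists>C. \<forall>t\<in>{0..\<tau>}. bd s C (a t)"
proof -
  obtain C4 where C4: "\<And>k t. t \<in> {0..\<tau>} \<Longrightarrow> wt k ^ 4 * emem (lam \<epsilon> k) t \<le> C4"
    using emem_gain4[OF \<epsilon>, of \<tau>] by blast
  have nc: "continuous_on {0..\<tau>} (\<lambda>t. nl (a t) k)" for k by (rule continuous_on_nl[OF c R])
  have "\<exists>C. \<forall>t\<in>{0..\<tau>}. bd (s + 4) C (a t)"
  proof (induction s)
    case 0 then show ?case using R by (intro exI[of _ R]) simp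
  next
    case (Suc s)
    have e: "Suc s + 3 = s + 4" by simp
    obtain C where C: "\<And>t. t \<in> {0..\<tau>} \<Longrightarrow> bd (Suc s + 3) C (a t)" using Suc unfolding e by blast
    obtain A where A: "bd (Suc s + 4) A \<alpha>" using \<alpha> by blast
    have "bd (Suc s + 4) (A + (kap ^ 3 * Zw ^ 3 * C ^ 4) * C4) (a t)" if "t \<in> {0..\<tau>}" for t
      unfolding fp[OF that] by (rule duhamel_bd[OF nc bd_nl[OF C] A _ C4 that]) (use \<epsilon> in auto)
    then show ?case by blast
  qed
  then obtain C where "\<forall>t\<in>{0..\<tau>}. bd (s + 4) C (a t)" by blast
  then show ?thesis by (intro exI[of _ C] ballI) (rule bd_mono[of "s + 4" C], auto)
qed

text \<open>The time depends on the data only through their bound \<open>\<rho>\<close> in the norm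
  \<open>bd 4\<close>. Restarts under a uniform bound can therefore use one and the same step
  length.\<close>

lemma picard:
  assumes "\<epsilon> > 0" "\<rho> > 0"
  obtains \<tau> where "\<tau> > 0"
    "\<And>\<alpha>. symm \<alpha> \<Longrightarrow> bd 4 \<rho> \<alpha> \<Longrightarrow> (\<And>s. \<exists>C. bd s C \<alpha>) \<Longrightarrow> \<exists>a. esol \<epsilon> \<tau> a \<and> a 0 = \<alpha>"
proof -
  define M where "M = kap ^ 3 * Zw ^ 3"
  define R where "R = 2 * \<rho>"
  have M: "M \<ge> 0" using kap_pos Zw_nonneg by (simp add: M_def)
  have R: "R > 0" using assms by (simp add: R_def)
  \<comment> \<open>With \<open>M * R ^ 3 * \<theta> \<le> 1 / 8\<close> the Lipschitz constant of
    the iteration, four times this number, is at most 1 / 2, and the nonlinear part contributes at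
    most R / 8; so the iterates stay in the ball of radius \<open>R = 2 * \<rho>\<close>.\<close>
  define \<theta> where "\<theta> = 1 / (8 * (M * R ^ 3 + 1))"
  have den: "M * R ^ 3 + 1 > 0" using M R by (simp add: add_nonneg_pos)
  have \<theta>: "\<theta> > 0" using den by (simp add: \<theta>_def)
  have \<theta>1: "M * R ^ 3 * \<theta> \<le> 1 / 8"
    using den by (simp add: \<theta>_def pos_divide_le_eq)
  obtain \<tau> where \<tau>: "\<tau> > 0" "\<And>k t. t \<in> {0..\<tau>} \<Longrightarrow> wt k ^ 3 * emem (lam \<epsilon> k) t \<le> \<theta>"
    using emem_small[OF assms(1) \<theta>] by blast
  show thesis
  proof (rule that[OF \<tau>(1)])
    fix \<alpha> assume \<alpha>: "symm \<alpha>" "bd 4 \<rho> \<alpha>" "\<And>s. \<exists>C. bd s C \<alpha>"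
    define X where "X m = ((\<lambda>a. duhamel \<epsilon> \<alpha> (\<lambda>s. nl (a s))) ^^ m) (\<lambda>_. \<alpha>)" for m
    have X0: "X 0 = (\<lambda>_. \<alpha>)" and XS: "X (Suc m) = duhamel \<epsilon> \<alpha> (\<lambda>s. nl (X m s))" for m by (auto simp: X_def)
    have inv: "(\<forall>k. continuous_on {0..\<tau>} (\<lambda>t. X m t k)) \<and> (\<forall>t\<in>{0..\<tau>}. symm (X m t) \<and> bd 4 R (X m t))" for m
    proof (induction m)
      case 0
      have "bd 4 R \<alpha>" by (rule bd_mono[OF \<alpha>(2)]) (use assms(2) in \<open>auto simp: R_def\<close>)
      then show ?case using \<alpha>(1) by (simp add: X0)
    next
      case (Suc m)
      then have c: "\<And>k. continuous_on {0..\<tau>} (\<lambda>t. X m t k)" and b: "\<And>t. t \<in> {0..\<tau>} \<Longrightarrow> bd 4 R (X m t)"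
        and s: "\<And>t. t \<in> {0..\<tau>} \<Longrightarrow> symm (X m t)" by auto
      have nc: "continuous_on {0..\<tau>} (\<lambda>t. nl (X m t) k)" for k by (rule continuous_on_nl[OF c b])
      have nb: "bd 1 (M * R ^ 4) (nl (X m t))" if "t \<in> {0..\<tau>}" for t
        unfolding M_def using b[OF that] by (intro bd_nl) simp
      have "bd 4 R (X (Suc m) t)" if t: "t \<in> {0..\<tau>}" for t
      proof -
        have "bd (1 + 3) (\<rho> + (M * R ^ 4) * \<theta>) (X (Suc m) t)"
          unfolding XS by (rule duhamel_bd[OF nc nb _ _ \<tau>(2) t]) (use \<alpha> assms in auto)
        moreover have "\<rho> + (M * R ^ 4) * \<theta> \<le> R"
        proof -
          have "(M * R ^ 4) * \<theta> = R * (M * R ^ 3 * \<theta>)" by (simp add: eval_nat_numeral)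
          also have "\<dots> \<le> R * (1 / 8)" using \<theta>1 R by (intro mult_left_mono) auto
          finally show ?thesis using assms(2) by (simp add: R_def)
        qed
        ultimately show ?thesis by (rule_tac bd_mono) auto
      qed
      moreover have "symm (X (Suc m) t)" if t: "t \<in> {0..\<tau>}" for t
        unfolding XS by (rule symm_duh[OF \<alpha>(1)])
          (use t s symm_nl in \<open>auto intro: continuous_on_subset[OF nc]\<close>)
      ultimately show ?case unfolding XS using duhamel_cont[OF nc] by auto
    qed
    have c: "continuous_on {0..\<tau>} (\<lambda>t. X m t k)" and b: "t \<in> {0..\<tau>} \<Longrightarrow> bd 4 R (X m t)"
      and s: "t \<in> {0..\<tau>} \<Longrightarrow> symm (X m t)" for m k t using inv[of m] by auto
    have nc: "continuous_on {0..\<tau>} (\<lambda>t. nl (X m t) k)" for m k by (rule continuous_on_nl[OF c b])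
    have contr: "bd 4 (d / 2) (\<lambda>k. duhamel \<epsilon> \<alpha> (\<lambda>s. nl (a s)) t k - duhamel \<epsilon> \<alpha> (\<lambda>s. nl (a' s)) t k)"
      if "\<And>k. continuous_on {0..\<tau>} (\<lambda>t. a t k)" "\<And>k. continuous_on {0..\<tau>} (\<lambda>t. a' t k)"
        "\<And>t. t \<in> {0..\<tau>} \<Longrightarrow> bd 4 R (a t)" "\<And>t. t \<in> {0..\<tau>} \<Longrightarrow> bd 4 R (a' t)"
        "\<And>t. t \<in> {0..\<tau>} \<Longrightarrow> bd 4 d (\<lambda>k. a t k - a' t k)" and t: "t \<in> {0..\<tau>}" for a a' t d
    proof -
      have "bd 4 (4 * kap ^ 3 * Zw ^ 3 * R ^ 3 * d * \<theta>) (\<lambda>k. duhamel \<epsilon> \<alpha> (\<lambda>s. nl (a s)) t k - duhamel \<epsilon> \<alpha> (\<lambda>s. nl (a' s)) t k)"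
        by (rule duhamel_bd_diff[OF continuous_on_nl[OF that(1,3)] continuous_on_nl[OF that(2,4)] bd_nl_diff[OF that(3,4,5)] \<tau>(2) t])
      moreover have "4 * kap ^ 3 * Zw ^ 3 * R ^ 3 * d * \<theta> \<le> d / 2"
      proof -
        have "4 * kap ^ 3 * Zw ^ 3 * R ^ 3 * d * \<theta> = 4 * d * (M * R ^ 3 * \<theta>)" by (simp add: M_def)
        also have "\<dots> \<le> 4 * d * (1 / 8)" using \<theta>1 bd_nonneg[OF that(5)[OF t]] by (intro mult_left_mono) auto
        finally show ?thesis by simp
      qed
      ultimately show ?thesis by (rule bd_mono[OF _ order_refl])
    qed
    have step: "bd 4 (2 * R * (1/2) ^ m) (\<lambda>k. X (Suc m) t k - X m t k)" if t: "t \<in> {0..\<tau>}" for m t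
      using t
    proof (induction m arbitrary: t)
      case 0
      have "bd 4 (R + R) (\<lambda>k. X (Suc 0) t k - X 0 t k)" by (rule bd_sub[OF b[OF 0] b[OF 0]])
      then show ?case by simp
    next
      case (Suc m)
      have "bd 4 (2 * R * (1/2) ^ m / 2) (\<lambda>k. duhamel \<epsilon> \<alpha> (\<lambda>s. nl (X (Suc m) s)) t k - duhamel \<epsilon> \<alpha> (\<lambda>s. nl (X m s)) t k)"
        by (rule contr[OF c c b b Suc.IH Suc.prems])
      then show ?case by (simp only: XS[of "Suc m", symmetric] XS[of m, symmetric]) (simp add: mult_ac)
    qed
    define a where "a t k = lim (\<lambda>m. X m t k)" for t k
    have lim: "(\<lambda>m. X m t k) \<longlonglongrightarrow> a t k" and est: "cmod (a t k - X m t k) \<le> 2 * (2 * R / wt k ^ 4) * (1/2) ^ m"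
      if t: "t \<in> {0..\<tau>}" for t k m
    proof -
      have "\<exists>l. (\<lambda>m. X m t k) \<longlonglongrightarrow> l \<and> (\<forall>m. norm (l - X m t k) \<le> 2 * (2 * R / wt k ^ 4) * (1/2) ^ m)"
        by (rule geometric_limit) (use bd_le[OF step[OF t]] in auto)
      then obtain l where l: "(\<lambda>m. X m t k) \<longlonglongrightarrow> l" "\<And>m. norm (l - X m t k) \<le> 2 * (2 * R / wt k ^ 4) * (1/2) ^ m" by blast
      have "a t k = l" unfolding a_def using l(1) by (rule limI)
      then show "(\<lambda>m. X m t k) \<longlonglongrightarrow> a t k" "cmod (a t k - X m t k) \<le> 2 * (2 * R / wt k ^ 4) * (1/2) ^ m" using l by auto
    qed
    have estb: "bd 4 (4 * R * (1/2) ^ m) (\<lambda>k. a t k - X m t k)" if t: "t \<in> {0..\<tau>}" for t m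
      unfolding bd_def
    proof
      fix k
      have "cmod (a t k - X m t k) * wt k ^ 4 \<le> 2 * (2 * R / wt k ^ 4) * (1/2) ^ m * wt k ^ 4"
        by (intro mult_right_mono est[OF t]) (simp add: wt_pos less_imp_le)
      then show "cmod (a t k - X m t k) * wt k ^ 4 \<le> 4 * R * (1/2) ^ m" using wt_pos[of k] by simp
    qed
    have ac: "continuous_on {0..\<tau>} (\<lambda>t. a t k)" for k
    proof (rule uniform_limit_theorem)
      show "uniform_limit {0..\<tau>} (\<lambda>m t. X m t k) (\<lambda>t. a t k) sequentially"
      proof (rule uniform_limitI)
        fix e :: real assume e: "e > 0"
        have "(\<lambda>m. 2 * (2 * R / wt k ^ 4) * (1/2::real) ^ m) \<longlonglongrightarrow> 2 * (2 * R / wt k ^ 4) * 0"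
          by (intro tendsto_intros LIMSEQ_realpow_zero) auto
        then have "\<forall>\<^sub>F m in sequentially. 2 * (2 * R / wt k ^ 4) * (1/2::real) ^ m < e"
          using e by (intro order_tendstoD(2)) auto
        then show "\<forall>\<^sub>F m in sequentially. \<forall>t\<in>{0..\<tau>}. dist (X m t k) (a t k) < e"
        proof eventually_elim
          case (elim m)
          show ?case
          proof
            fix t assume "t \<in> {0..\<tau>}"
            from est[OF this, of k m] elim show "dist (X m t k) (a t k) < e"
              by (simp add: dist_norm norm_minus_commute)
          qed
        qed
      qed
    qed (use c in auto)
    have ab: "bd 4 R (a t)" if t: "t \<in> {0..\<tau>}" for t
      unfolding bd_def
    proof
      fix k
      have "(\<lambda>m. cmod (X m t k) * wt k ^ 4) \<longlonglongrightarrow> cmod (a t k) * wt k ^ 4" by (intro tendsto_intros lim t)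
      then show "cmod (a t k) * wt k ^ 4 \<le> R" by (rule LIMSEQ_le_const2) (use b[OF t] in \<open>auto simp: bd_def\<close>)
    qed
    have as: "symm (a t)" if t: "t \<in> {0..\<tau>}" for t
      unfolding symm_def
    proof
      fix k
      have "(\<lambda>m. cnj (X m t k)) \<longlonglongrightarrow> cnj (a t k)" by (intro tendsto_intros lim t)
      moreover have "cnj (X m t k) = X m t (- k)" for m using s[OF t, of m] by (simp add: symm_def)
      ultimately show "a t (- k) = cnj (a t k)" using lim[OF t, of "- k"] LIMSEQ_unique by auto
    qed
    have fp: "a t = duhamel \<epsilon> \<alpha> (\<lambda>s. nl (a s)) t" if t: "t \<in> {0..\<tau>}" for t
    proof
      fix k
      \<comment> \<open>The image of the limit is compared with \<open>X (Suc m)\<close>, the image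
        of \<open>X m\<close>; this error and the distance of \<open>X (Suc m)\<close> to the limit
        both decay like \<open>(1/2) ^ m\<close>.\<close>
      have "bd 4 (4 * R * (1/2) ^ m / 2) (\<lambda>k. duhamel \<epsilon> \<alpha> (\<lambda>s. nl (a s)) t k - X (Suc m) t k)" for m
        unfolding XS by (rule contr[OF ac c ab b estb t])
      then have *: "bd 4 (4 * R * (1/2) ^ m / 2 + 4 * R * (1/2) ^ Suc m) (\<lambda>k. (duhamel \<epsilon> \<alpha> (\<lambda>s. nl (a s)) t k - X (Suc m) t k) - (a t k - X (Suc m) t k))" for m
        by (rule bd_sub[OF _ estb[OF t]])
      have "cmod (duhamel \<epsilon> \<alpha> (\<lambda>s. nl (a s)) t k - a t k) * wt k ^ 4 \<le> 4 * R * (1/2) ^ m" for m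
        using *[of m, unfolded bd_def, rule_format, of k] by simp
      moreover have "(\<lambda>m. 4 * R * (1/2::real) ^ m) \<longlonglongrightarrow> 4 * R * 0"
        by (intro tendsto_intros LIMSEQ_realpow_zero) auto
      ultimately have "cmod (duhamel \<epsilon> \<alpha> (\<lambda>s. nl (a s)) t k - a t k) * wt k ^ 4 \<le> 4 * R * 0"
        by (intro LIMSEQ_le_const) auto
      then show "a t k = duhamel \<epsilon> \<alpha> (\<lambda>s. nl (a s)) t k" using wt_pos[of k] by (simp add: mult_le_0_iff)
    qed
    have "((\<lambda>t. a t k) has_vector_derivative (nl (a t) k - lam \<epsilon> k *\<^sub>R a t k)) (at t within {0..\<tau>})"
      if t: "t \<in> {0..\<tau>}" for t k
    proof -
      have "((\<lambda>t. duhamel \<epsilon> \<alpha> (\<lambda>s. nl (a s)) t k) has_vector_derivative (nl (a t) k - lam \<epsilon> k *\<^sub>R a t k)) (at t within {0..\<tau>})"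
        using duhamel_deriv[OF continuous_on_nl[OF ac ab] t] fp[OF t] by simp
      then show ?thesis by (rule has_vector_derivative_transform[OF t, rotated]) (simp add: fp)
    qed
    moreover have "a 0 = \<alpha>" using fp[of 0] \<tau>(1) by (simp add: duhamel_0)
    ultimately have "esol \<epsilon> \<tau> a \<and> a 0 = \<alpha>"
      unfolding esol_def using as mild_bootstrap[OF assms(1) ac ab fp \<alpha>(3)] by blast
    then show "\<exists>a. esol \<epsilon> \<tau> a \<and> a 0 = \<alpha>" by blast
  qed
qed

lemma esol_mono: assumes "esol \<epsilon> \<tau> a" "\<sigma> \<le> \<tau>" shows "esol \<epsilon> \<sigma> a"
proof -
  have sub: "{0..\<sigma>} \<subseteq> {0..\<tau>}" using assms(2) by auto
  have "\<forall>s. \<exists>C. \<forall>t\<in>{0..\<sigma>}. bd s C (a t)" using assms(1) sub unfolding esol_def by (meson subsetD)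
  moreover have "((\<lambda>t. a t k) has_vector_derivative (nl (a t) k - lam \<epsilon> k *\<^sub>R a t k)) (at t within {0..\<sigma>})"
    if "t \<in> {0..\<sigma>}" for k t
    using assms(1) sub that unfolding esol_def by (meson has_vector_derivative_within_subset subsetD)
  ultimately show ?thesis using assms(1) sub unfolding esol_def by (meson subsetD)
qed

lemma esol_glue:
  assumes a: "esol \<epsilon> \<tau> a" and b: "esol \<epsilon> \<sigma> b" and e: "b 0 = a \<tau>" and p: "\<tau> \<ge> 0" "\<sigma> \<ge> 0"
  shows "esol \<epsilon> (\<tau> + \<sigma>) (\<lambda>t. if t \<le> \<tau> then a t else b (t - \<tau>))"
proof -
  let ?c = "\<lambda>t. if t \<le> \<tau> then a t else b (t - \<tau>)"
  have cb: "?c t = b (t - \<tau>)" if "t \<ge> \<tau>" for t using that e by (cases "t = \<tau>") auto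
  have "((\<lambda>t. ?c t k) has_vector_derivative (nl (?c t) k - lam \<epsilon> k *\<^sub>R ?c t k)) (at t within {0..\<tau> + \<sigma>})"
    if t: "t \<in> {0..\<tau> + \<sigma>}" for t k
  proof -
    let ?D = "nl (?c t) k - lam \<epsilon> k *\<^sub>R ?c t k"
    have l: "((\<lambda>t. ?c t k) has_vector_derivative ?D) (at t within {0..\<tau>})" if "t \<le> \<tau>"
    proof -
      have "((\<lambda>t. a t k) has_vector_derivative ?D) (at t within {0..\<tau>})" using a t that by (auto simp: esol_def)
      moreover have "t \<in> {0..\<tau>}" using t that by simp
      ultimately show ?thesis by (rule_tac has_vector_derivative_transform[where f="\<lambda>t. a t k"]) simp_all
    qed
    have r: "((\<lambda>t. ?c t k) has_vector_derivative ?D) (at t within {\<tau>..\<tau> + \<sigma>})" if "t \<ge> \<tau>"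
    proof -
      have "((\<lambda>t. b t k) has_vector_derivative ?D) (at (t - \<tau>) within {0..\<sigma>})"
        using b t that cb[OF that] by (auto simp: esol_def)
      then have "((\<lambda>t. b t k) has_vector_derivative ?D) (at (t - \<tau>) within (\<lambda>t. t - \<tau>) ` {\<tau>..\<tau> + \<sigma>})"
        by (rule has_vector_derivative_within_subset) auto
      then have "(((\<lambda>t. b t k) \<circ> (\<lambda>t. t - \<tau>)) has_vector_derivative (1 *\<^sub>R ?D)) (at t within {\<tau>..\<tau> + \<sigma>})"
        by (intro vector_diff_chain_within) (auto intro!: derivative_eq_intros)
      then have "((\<lambda>t. b (t - \<tau>) k) has_vector_derivative ?D) (at t within {\<tau>..\<tau> + \<sigma>})" by (simp add: o_def)
      moreover have "?c s k = b (s - \<tau>) k" if "s \<in> {\<tau>..\<tau> + \<sigma>}" for s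
        by (rule fun_cong[OF cb]) (use that in simp)
      moreover have "t \<in> {\<tau>..\<tau> + \<sigma>}" using t that by simp
      ultimately show ?thesis by (rule_tac has_vector_derivative_transform[where f="\<lambda>t. b (t - \<tau>) k"])
    qed
    have u: "{0..\<tau> + \<sigma>} = {0..\<tau>} \<union> {\<tau>..\<tau> + \<sigma>}" using p by auto
    consider "t < \<tau>" | "t = \<tau>" | "t > \<tau>" by linarith
    then show ?thesis
    proof cases
      case 1
      have "at t within {0..\<tau> + \<sigma>} = at t within {0..\<tau>}"
        by (rule at_within_nhd[of t "{..<\<tau>}"]) (use 1 p in auto)
      then show ?thesis using l 1 by simp
    next
      case 3
      have "at t within {0..\<tau> + \<sigma>} = at t within {\<tau>..\<tau> + \<sigma>}"
        by (rule at_within_nhd[of t "{\<tau><..}"]) (use 3 p in auto)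
      then show ?thesis using r 3 by simp
    next
      case 2
      then show ?thesis unfolding u using l r by (intro has_vector_derivative_within_Un) auto
    qed
  qed
  moreover have "\<exists>C. \<forall>t\<in>{0..\<tau> + \<sigma>}. bd s C (?c t)" for s
  proof -
    obtain C D where C: "\<And>t. t \<in> {0..\<tau>} \<Longrightarrow> bd s C (a t)" and D: "\<And>t. t \<in> {0..\<sigma>} \<Longrightarrow> bd s D (b t)"
      using a b unfolding esol_def by meson
    have "bd s (max C D) (?c t)" if "t \<in> {0..\<tau> + \<sigma>}" for t
      using bd_mono[OF C[of t] order_refl, of "max C D"] bd_mono[OF D[of "t - \<tau>"] order_refl, of "max C D"] that by auto
    then show ?thesis by blast
  qed
  moreover have "symm (?c t)" if "t \<in> {0..\<tau> + \<sigma>}" for t using a b that by (auto simp: esol_def)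
  ultimately show ?thesis unfolding esol_def by blast
qed

end

section \<open>Weighted energy estimate\<close>

lemma jetD: "jet f \<Longrightarrow> (f j has_real_derivative f (Suc j) x) (at x)" by (simp add: jet_def)

lemma jet_cont: "jet f \<Longrightarrow> continuous_on S (f j)"
  by (rule DERIV_continuous_on) (rule has_field_derivative_at_within[OF jetD])

lemma jet_eqI:
  assumes "jet f" "jet g" "f 0 = g 0" shows "f = g"
proof
  fix j show "f j = g j"
  proof (induction j)
    case (Suc j)
    show ?case
    proof
      fix x
      show "f (Suc j) x = g (Suc j) x" using jetD[OF assms(1), of j x] jetD[OF assms(2), of j x] Suc DERIV_unique by metis
    qed
  qed (rule assms)
qed

lemma jet_shift: "jet f \<Longrightarrow> jet (\<lambda>j. f (j + i))" by (simp add: jet_def)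

lemma jet_diff: "jet f \<Longrightarrow> jet g \<Longrightarrow> jet (\<lambda>j x. f j x - g j x)"
  by (auto simp: jet_def intro!: derivative_eq_intros)

text \<open>The product jet is defined by iterating the product rule, so that being a jet is a
  direct induction; the binomial form follows in \<open>jmul_leibniz\<close>.\<close>

fun jmul :: "(nat \<Rightarrow> real \<Rightarrow> real) \<Rightarrow> (nat \<Rightarrow> real \<Rightarrow> real) \<Rightarrow> nat \<Rightarrow> real \<Rightarrow> real" where
  "jmul f g 0 x = f 0 x * g 0 x"
| "jmul f g (Suc n) x = jmul (\<lambda>j. f (Suc j)) g n x + jmul f (\<lambda>j. g (Suc j)) n x"

lemma jet_Suc: "jet f \<Longrightarrow> jet (\<lambda>j. f (Suc j))" by (simp add: jet_def)

lemma jet_jmul: assumes "jet f" "jet g" shows "jet (jmul f g)"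
  unfolding jet_def
proof (intro allI)
  fix n x
  show "(jmul f g n has_real_derivative jmul f g (Suc n) x) (at x)"
    using assms
  proof (induction n arbitrary: f g)
    case 0
    have "((\<lambda>x. f 0 x * g 0 x) has_real_derivative (f (Suc 0) x * g 0 x + f 0 x * g (Suc 0) x)) (at x)"
      using jetD[OF 0(1), of 0 x] jetD[OF 0(2), of 0 x] by (auto intro!: derivative_eq_intros)
    moreover have "jmul f g 0 = (\<lambda>x. f 0 x * g 0 x)" by auto
    ultimately show ?case by simp
  next
    case (Suc n)
    have "((\<lambda>x. jmul (\<lambda>j. f (Suc j)) g n x + jmul f (\<lambda>j. g (Suc j)) n x) has_real_derivative
       (jmul (\<lambda>j. f (Suc j)) g (Suc n) x + jmul f (\<lambda>j. g (Suc j)) (Suc n) x)) (at x)"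
      by (intro DERIV_add Suc jet_Suc)
    moreover have "jmul f g (Suc n) = (\<lambda>x. jmul (\<lambda>j. f (Suc j)) g n x + jmul f (\<lambda>j. g (Suc j)) n x)" by auto
    ultimately show ?case by (simp only: jmul.simps(2)[of f g "Suc n"])
  qed
qed

lemma jmul_leibniz: "jmul f g n x = (\<Sum>i\<le>n. real (n choose i) * f i x * g (n - i) x)"
proof (induction n arbitrary: f g)
  case (Suc n)
  have "(\<Sum>i\<le>Suc n. real (Suc n choose i) * f i x * g (Suc n - i) x)
     = f 0 x * g (Suc n) x + (\<Sum>i\<le>n. real (Suc n choose Suc i) * f (Suc i) x * g (n - i) x)"
    by (subst sum.atMost_Suc_shift) simp
  also have "(\<Sum>i\<le>n. real (Suc n choose Suc i) * f (Suc i) x * g (n - i) x)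
     = (\<Sum>i\<le>n. real (n choose i) * f (Suc i) x * g (n - i) x) + (\<Sum>i\<le>n. real (n choose Suc i) * f (Suc i) x * g (n - i) x)"
    by (simp add: distrib_right sum.distrib)
  also have "f 0 x * g (Suc n) x + (\<dots>) = (\<Sum>i\<le>n. real (n choose i) * f (Suc i) x * g (n - i) x)
     + (f 0 x * g (Suc n) x + (\<Sum>i\<le>n. real (n choose Suc i) * f (Suc i) x * g (Suc n - Suc i) x))" by simp
  also have "f 0 x * g (Suc n) x + (\<Sum>i\<le>n. real (n choose Suc i) * f (Suc i) x * g (Suc n - Suc i) x)
    = (\<Sum>i\<le>Suc n. real (n choose i) * f i x * g (Suc n - i) x)"
    by (subst sum.atMost_Suc_shift) simp
  also have "\<dots> = (\<Sum>i\<le>n. real (n choose i) * f i x * g (Suc (n - i)) x)"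
    by (simp add: Suc_diff_le)
  finally show ?case using Suc by simp
qed simp

text \<open>Orders strictly below k: in the estimates with k = n the derivative of order n itself is
  controlled only in mean square.\<close>

definition supb :: "nat \<Rightarrow> real \<Rightarrow> (nat \<Rightarrow> real \<Rightarrow> real) \<Rightarrow> bool" where
  "supb k B f \<longleftrightarrow> (\<forall>j<k. \<forall>x. \<bar>f j x\<bar> \<le> B)"

lemma supb_mono: "supb k B f \<Longrightarrow> l \<le> k \<Longrightarrow> B \<le> D \<Longrightarrow> supb l D f"
  unfolding supb_def by (meson less_le_trans order_trans)

lemma supb_jmul: assumes "supb k A f" "supb k B g" "A \<ge> 0" "B \<ge> 0" shows "supb k (2 ^ k * (A * B)) (jmul f g)"
proof -
  have *: "\<bar>jmul f g n x\<bar> \<le> 2 ^ n * (A * B)"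
    if "\<And>j x. j \<le> n \<Longrightarrow> \<bar>f j x\<bar> \<le> A" "\<And>j x. j \<le> n \<Longrightarrow> \<bar>g j x\<bar> \<le> B" for f g :: "nat \<Rightarrow> real \<Rightarrow> real" and n x
    using that
  proof (induction n arbitrary: f g)
    case 0 then show ?case using assms by (auto simp: abs_mult intro!: mult_mono)
  next
    case (Suc n)
    have "\<bar>jmul (\<lambda>j. f (Suc j)) g n x\<bar> \<le> 2 ^ n * (A * B)" by (rule Suc.IH) (use Suc.prems in auto)
    moreover have "\<bar>jmul f (\<lambda>j. g (Suc j)) n x\<bar> \<le> 2 ^ n * (A * B)" by (rule Suc.IH) (use Suc.prems in auto)
    ultimately show ?case by simp
  qed
  show ?thesis unfolding supb_def
  proof (intro allI impI)
    fix j x assume "j < k"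
    then have "\<bar>jmul f g j x\<bar> \<le> 2 ^ j * (A * B)" using assms(1,2) by (intro *) (auto simp: supb_def)
    also have "\<dots> \<le> 2 ^ k * (A * B)" using \<open>j < k\<close> assms by (intro mult_right_mono power_increasing) auto
    finally show "\<bar>jmul f g j x\<bar> \<le> 2 ^ k * (A * B)" .
  qed
qed

primrec jpow :: "(nat \<Rightarrow> real \<Rightarrow> real) \<Rightarrow> nat \<Rightarrow> nat \<Rightarrow> real \<Rightarrow> real" where
  "jpow f 0 = (\<lambda>j x. if j = 0 then 1 else 0)"
| "jpow f (Suc m) = jmul f (jpow f m)"

lemma jet_jpow: "jet f \<Longrightarrow> jet (jpow f m)"
proof (induction m)
  case 0 then show ?case by (auto simp: jet_def)
qed (simp add: jet_jmul)

lemma jpow_0: "jpow f m 0 x = f 0 x ^ m" by (induction m) auto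

lemma jpow_1: "jpow f (Suc m) 1 x = real (Suc m) * f 0 x ^ m * f 1 x"
proof (induction m)
  case 0 then show ?case by simp
next
  case (Suc m)
  have "jpow f (Suc (Suc m)) 1 x = f 1 x * jpow f (Suc m) 0 x + f 0 x * jpow f (Suc m) 1 x" by simp
  also have "\<dots> = real (Suc (Suc m)) * f 0 x ^ Suc m * f 1 x"
    unfolding Suc jpow_0 by (simp add: algebra_simps)
  finally show ?case .
qed

lemma supb_jpow: assumes "B \<ge> 0" shows "\<exists>C\<ge>0. \<forall>f. supb k B f \<longrightarrow> supb k C (jpow f m)"
proof (induction m)
  case 0 then show ?case by (intro exI[of _ 1]) (auto simp: supb_def)
next
  case (Suc m)
  then obtain C where C: "C \<ge> 0" "\<And>f. supb k B f \<Longrightarrow> supb k C (jpow f m)" by blast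
  show ?case
    by (intro exI[of _ "2 ^ k * (B * C)"]) (use C assms in \<open>auto intro!: supb_jmul\<close>)
qed

section \<open>Periodic jets and their bounds\<close>

context circle begin

definition per :: "(nat \<Rightarrow> real \<Rightarrow> real) \<Rightarrow> bool" where "per f \<longleftrightarrow> (\<forall>j x. f j (x + L) = f j x)"

lemma per_jmul: "per f \<Longrightarrow> per g \<Longrightarrow> per (jmul f g)"
proof -
  have "jmul f g n (x + L) = jmul f g n x" if "per f" "per g" for f g n x
    using that
  proof (induction n arbitrary: f g)
    case (Suc n)
    have "per (\<lambda>j. f (Suc j))" "per (\<lambda>j. g (Suc j))" using Suc.prems by (auto simp: per_def)
    then show ?case using Suc by simp
  qed (simp add: per_def)
  then show "per f \<Longrightarrow> per g \<Longrightarrow> per (jmul f g)" by (simp add: per_def)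
qed

lemma per_jpow: "per f \<Longrightarrow> per (jpow f m)"
proof (induction m)
  case 0 then show ?case by (simp add: per_def)
qed (simp add: per_jmul)

lemma integral_deriv_periodic:
  assumes "\<And>x. (P has_real_derivative p x) (at x)" "P L = P 0"
  shows "(p has_integral 0) {0..L}"
proof -
  have "(p has_integral (P L - P 0)) {0..L}"
    by (rule fundamental_theorem_of_calculus)
       (use L_pos assms in \<open>auto simp flip: has_real_derivative_iff_has_vector_derivative intro: has_field_derivative_at_within\<close>)
  then show ?thesis using assms by simp
qed

lemma per_0L: "per f \<Longrightarrow> f j L = f j 0"
  unfolding per_def by (metis add_0)

text \<open>At a minimum point \<open>w^2\<close> is at most its mean. From there to x it changes by
  an integral of \<open>2 w w'\<close>, whose modulus is at most the integral of
  \<open>w^2 + w'^2\<close>.\<close>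

lemma sup_sq_le:
  assumes w: "\<And>x. (w has_real_derivative w1 x) (at x)" and c: "continuous_on {0..L} w1" and x: "x \<in> {0..L}"
  shows "(w x)\<^sup>2 \<le> (1 / L + 1) * integral {0..L} (\<lambda>x. (w x)\<^sup>2) + integral {0..L} (\<lambda>x. (w1 x)\<^sup>2)"
proof -
  have wc: "continuous_on S w" for S by (rule DERIV_continuous_on) (rule has_field_derivative_at_within[OF w])
  let ?Q = "integral {0..L} (\<lambda>x. (w x)\<^sup>2)" and ?q = "integral {0..L} (\<lambda>x. (w1 x)\<^sup>2)"
  have i: "(\<lambda>x. (w x)\<^sup>2) integrable_on {0..L}" "(\<lambda>x. (w1 x)\<^sup>2) integrable_on {0..L}"
    by (intro integrable_continuous_real continuous_intros wc c)+
  obtain y where y: "y \<in> {0..L}" "\<And>z. z \<in> {0..L} \<Longrightarrow> (w y)\<^sup>2 \<le> (w z)\<^sup>2"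
  proof -
    have "\<exists>y\<in>{0..L}. \<forall>z\<in>{0..L}. (w y)\<^sup>2 \<le> (w z)\<^sup>2"
      by (rule continuous_attains_inf) (use L_pos in \<open>auto intro!: continuous_intros wc\<close>)
    then show ?thesis using that by blast
  qed
  have "integral {0..L} (\<lambda>_. (w y)\<^sup>2) \<le> ?Q" by (rule integral_le) (use y i in auto)
  then have wy: "(w y)\<^sup>2 \<le> 1 / L * ?Q" using L_pos by (simp add: field_simps)
  have "(w x)\<^sup>2 - (w y)\<^sup>2 \<le> integral {0..L} (\<lambda>x. (w x)\<^sup>2 + (w1 x)\<^sup>2)"
  proof -
    have pw: "\<bar>2 * w z * w1 z\<bar> \<le> (w z)\<^sup>2 + (w1 z)\<^sup>2" for z
      using sum_squares_bound[of "\<bar>w z\<bar>" "\<bar>w1 z\<bar>"] by (simp add: abs_mult)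
    have d: "((\<lambda>z. (w z)\<^sup>2) has_vector_derivative 2 * w z * w1 z) (at z within S)" for z S
      unfolding has_real_derivative_iff_has_vector_derivative[symmetric]
      by (auto intro!: derivative_eq_intros has_field_derivative_at_within[OF w] simp: power2_eq_square)
    have bnd: "\<bar>integral {u..v} (\<lambda>z. 2 * w z * w1 z)\<bar> \<le> integral {0..L} (\<lambda>x. (w x)\<^sup>2 + (w1 x)\<^sup>2)"
      if "u \<in> {0..L}" "v \<in> {0..L}" for u v
    proof -
      have sub: "{u..v} \<subseteq> {0..L}" using that by auto
      have "\<bar>integral {u..v} (\<lambda>z. 2 * w z * w1 z)\<bar> \<le> integral {u..v} (\<lambda>x. (w x)\<^sup>2 + (w1 x)\<^sup>2)"
        unfolding real_norm_def[symmetric]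
        by (rule integral_norm_bound_integral)
           (use pw in \<open>auto intro!: integrable_continuous_real continuous_intros wc continuous_on_subset[OF c sub]\<close>)
      also have "\<dots> \<le> integral {0..L} (\<lambda>x. (w x)\<^sup>2 + (w1 x)\<^sup>2)"
        by (rule integral_subset_le[OF sub])
           (auto intro!: integrable_continuous_real continuous_intros wc c continuous_on_subset[OF c sub])
      finally show ?thesis .
    qed
    show ?thesis
    proof (cases "y \<le> x")
      case True
      have "((\<lambda>z. 2 * w z * w1 z) has_integral ((w x)\<^sup>2 - (w y)\<^sup>2)) {y..x}"
        by (rule fundamental_theorem_of_calculus[OF True]) (rule d)
      then show ?thesis using bnd[of y x] y x by (simp add: integral_unique)
    next
      case False
      have "((\<lambda>z. 2 * w z * w1 z) has_integral ((w y)\<^sup>2 - (w x)\<^sup>2)) {x..y}"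
        by (rule fundamental_theorem_of_calculus) (use False in \<open>auto intro: d\<close>)
      then show ?thesis using bnd[of x y] y x by (simp add: integral_unique)
    qed
  qed
  also have "integral {0..L} (\<lambda>x. (w x)\<^sup>2 + (w1 x)\<^sup>2) = ?Q + ?q" by (rule integral_add[OF i])
  finally show ?thesis using wy by (simp add: distrib_right)
qed

text \<open>The physical-side counterpart of an \<open>H^n\<close> bound: orders below n uniformly,
  order n in mean square.\<close>

definition bnd :: "nat \<Rightarrow> real \<Rightarrow> (nat \<Rightarrow> real \<Rightarrow> real) \<Rightarrow> bool" where
  "bnd n B f \<longleftrightarrow> jet f \<and> per f \<and> supb n B f \<and> integral {0..L} (\<lambda>x. (f n x)\<^sup>2) \<le> B"

text \<open>In Leibniz' formula of order n only the two extreme terms contain a derivative of order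
  n, each multiplied by a bounded function; all other terms together are bounded by D.\<close>

lemma bnd_jmul:
  assumes n: "n \<ge> 1" and B: "B \<ge> 0"
  shows "\<exists>C\<ge>B. \<forall>f g. bnd n B f \<longrightarrow> bnd n B g \<longrightarrow> bnd n C (jmul f g)"
proof -
  define D where "D = 2 ^ n * (B * B)"
  define C where "C = B + D + 3 * (B\<^sup>2 * B + B\<^sup>2 * B + D\<^sup>2 * L)"
  have D: "D \<ge> 0" using B by (simp add: D_def)
  have r: "3 * (B\<^sup>2 * B + B\<^sup>2 * B + D\<^sup>2 * L) \<ge> 0" using B D L_pos by simp
  have "bnd n C (jmul f g)" if f: "bnd n B f" and g: "bnd n B g" for f g
  proof -
    have jf: "jet f" "jet g" "per f" "per g" and sb: "supb n B f" "supb n B g"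
      and i2: "integral {0..L} (\<lambda>x. (f n x)\<^sup>2) \<le> B" "integral {0..L} (\<lambda>x. (g n x)\<^sup>2) \<le> B"
      using f g by (auto simp: bnd_def)
    have "supb n D (jmul f g)" unfolding D_def by (rule supb_jmul[OF sb B B])
    then have s: "supb n C (jmul f g)" by (rule supb_mono) (use r B in \<open>auto simp: C_def\<close>)
    have pw: "(jmul f g n x)\<^sup>2 \<le> 3 * (B\<^sup>2 * (f n x)\<^sup>2 + B\<^sup>2 * (g n x)\<^sup>2 + D\<^sup>2)" for x
    proof -
      have fb: "\<bar>f j x\<bar> \<le> B" "\<bar>g j x\<bar> \<le> B" if "j < n" for j using sb that by (auto simp: supb_def)
      define t where "t i = real (n choose i) * f i x * g (n - i) x" for i
      have split: "{..n} = insert 0 (insert n {1..<n})" using n by auto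
      have "jmul f g n x = t 0 + (t n + (\<Sum>i\<in>{1..<n}. t i))"
        unfolding jmul_leibniz t_def[symmetric] split using n by (subst sum.insert; simp)+
      moreover have "\<bar>\<Sum>i\<in>{1..<n}. t i\<bar> \<le> D"
      proof -
        have "\<bar>\<Sum>i\<in>{1..<n}. t i\<bar> \<le> (\<Sum>i\<in>{1..<n}. real (n choose i) * (B * B))"
        proof (rule order_trans[OF sum_abs sum_mono])
          fix i assume i: "i \<in> {1..<n}"
          have "\<bar>f i x\<bar> * \<bar>g (n - i) x\<bar> \<le> B * B" using i fb B by (intro mult_mono) auto
          then have "real (n choose i) * (\<bar>f i x\<bar> * \<bar>g (n - i) x\<bar>) \<le> real (n choose i) * (B * B)" by (rule mult_left_mono) simp
          then show "\<bar>t i\<bar> \<le> real (n choose i) * (B * B)" by (simp add: t_def abs_mult mult.assoc)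
        qed
        also have "\<dots> \<le> (\<Sum>i\<le>n. real (n choose i) * (B * B))" by (rule sum_mono2) (use B in auto)
        also have "\<dots> = D" unfolding D_def sum_distrib_right[symmetric] of_nat_sum[symmetric] choose_row_sum by simp
        finally show ?thesis .
      qed
      moreover have "\<bar>t 0\<bar> \<le> B * \<bar>g n x\<bar>" using fb(1)[of 0] n by (simp add: t_def abs_mult mult_right_mono)
      moreover have "\<bar>t n\<bar> \<le> B * \<bar>f n x\<bar>" using mult_left_mono[OF fb(2)[of 0], of "\<bar>f n x\<bar>"] n by (simp add: t_def abs_mult mult.commute)
      ultimately have "\<bar>jmul f g n x\<bar> \<le> B * \<bar>f n x\<bar> + B * \<bar>g n x\<bar> + D" by linarith
      then have "(jmul f g n x)\<^sup>2 \<le> (B * \<bar>f n x\<bar> + B * \<bar>g n x\<bar> + D)\<^sup>2" by (subst power2_abs[symmetric]) (rule power_mono, auto)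
      also have "\<dots> \<le> 3 * ((B * \<bar>f n x\<bar>)\<^sup>2 + (B * \<bar>g n x\<bar>)\<^sup>2 + D\<^sup>2)"
      proof -
        have "(a + b + c)\<^sup>2 \<le> 3 * (a\<^sup>2 + b\<^sup>2 + c\<^sup>2)" for a b c :: real
          using zero_le_power2[of "a - b"] zero_le_power2[of "b - c"] zero_le_power2[of "a - c"]
          by (simp add: power2_eq_square algebra_simps)
        then show ?thesis .
      qed
      finally show ?thesis by (simp add: power_mult_distrib)
    qed
    have jj: "jet (jmul f g)" by (rule jet_jmul[OF jf(1,2)])
    have "integral {0..L} (\<lambda>x. (jmul f g n x)\<^sup>2) \<le> integral {0..L} (\<lambda>x. 3 * (B\<^sup>2 * (f n x)\<^sup>2 + B\<^sup>2 * (g n x)\<^sup>2 + D\<^sup>2))"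
      by (rule integral_le) (use pw in \<open>auto intro!: integrable_continuous_real continuous_intros jet_cont[OF jj] jet_cont[OF jf(1)] jet_cont[OF jf(2)]\<close>)
    also have "\<dots> = 3 * (B\<^sup>2 * integral {0..L} (\<lambda>x. (f n x)\<^sup>2) + B\<^sup>2 * integral {0..L} (\<lambda>x. (g n x)\<^sup>2) + D\<^sup>2 * L)"
      using L_pos by (simp add: integral_add integrable_continuous_real continuous_intros jet_cont[OF jf(1)] jet_cont[OF jf(2)] del: distrib_left_numeral)
    also have "\<dots> \<le> 3 * (B\<^sup>2 * B + B\<^sup>2 * B + D\<^sup>2 * L)" using i2 by (intro mult_left_mono add_mono) auto
    also have "\<dots> \<le> C" using B D by (simp add: C_def)
    finally show ?thesis using jj s per_jmul[OF jf(3,4)] by (simp add: bnd_def)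
  qed
  moreover have "C \<ge> B" using B D r by (simp add: C_def)
  ultimately show ?thesis by blast
qed

lemma bnd_mono: "bnd n B f \<Longrightarrow> B \<le> C \<Longrightarrow> bnd n C f"
  unfolding bnd_def using supb_mono by (meson order_refl order_trans)

lemma bnd_cube:
  assumes n: "n \<ge> 1" and B: "B \<ge> 0"
  shows "\<exists>C\<ge>B. \<forall>f. bnd n B f \<longrightarrow> bnd n C (jpow f 3)"
proof -
  obtain C1 where C1: "C1 \<ge> B" "\<And>f g. bnd n B f \<Longrightarrow> bnd n B g \<Longrightarrow> bnd n C1 (jmul f g)" using bnd_jmul[OF n B] by blast
  obtain C2 where C2: "C2 \<ge> C1" "\<And>f g. bnd n C1 f \<Longrightarrow> bnd n C1 g \<Longrightarrow> bnd n C2 (jmul f g)" using bnd_jmul[OF n, of C1] C1 B by auto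
  have "bnd n C2 (jpow f 3)" if f: "bnd n B f" for f
  proof -
    have jf: "jet f" using f by (simp add: bnd_def)
    \<comment> \<open>Jets with the same order-0 entry coincide, so the cube can be treated as two
      products, without the constant jet that ends the recursion of \<open>jpow\<close>.\<close>
    have "jmul f (jmul f f) = jpow f 3"
    proof (rule jet_eqI)
      show "jmul f (jmul f f) 0 = jpow f 3 0" by (auto simp: jpow_0 eval_nat_numeral)
    qed (intro jet_jmul jet_jpow jf)+
    then show ?thesis using C2(2)[OF bnd_mono[OF f C1(1)] C1(2)[OF f f]] by simp
  qed
  then show ?thesis using C1 C2 by (intro exI[of _ C2]) auto
qed

end

lemma sq_sum3_le: "(a + b + c)\<^sup>2 \<le> 3 * (a\<^sup>2 + b\<^sup>2 + c\<^sup>2)" for a b c :: real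
  using zero_le_power2[of "a - b"] zero_le_power2[of "b - c"] zero_le_power2[of "a - c"]
  by (simp add: power2_eq_square algebra_simps)

lemma le_ge1_mult: "1 \<le> k \<Longrightarrow> 0 \<le> y \<Longrightarrow> y \<le> k * y" for k y :: real
  using mult_right_mono[of 1 k y] by simp

lemma le_mult_ge1: "1 \<le> k \<Longrightarrow> 0 \<le> y \<Longrightarrow> y \<le> y * k" for k y :: real
  using mult_left_mono[of 1 k y] by simp

lemma abs_mult_le: "\<bar>x\<bar> \<le> A \<Longrightarrow> \<bar>y\<bar> \<le> B \<Longrightarrow> \<bar>x * y\<bar> \<le> A * B" for x y A B :: real
  unfolding abs_mult by (rule mult_mono) auto

lemma abs_power_le: "\<bar>x\<bar> \<le> A \<Longrightarrow> \<bar>x ^ n\<bar> \<le> A ^ n" for x A :: real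
  unfolding power_abs by (rule power_mono) auto

context circle begin

text \<open>For \<open>i \<ge> 3\<close> at most one factor has order n: \<open>c n\<close> for i =
  n, or \<open>f n\<close> for i = 3. The other factors have order below n since
  \<open>n \<ge> 4\<close>, so the sum is linear in the top derivatives.\<close>

lemma transport_rest_le:
  assumes n: "n \<ge> 4" and K: "K \<ge> 1" and c: "supb n K c" and f: "supb n K f"
  shows "\<bar>\<Sum>i\<in>{3..n}. real (n choose i) * c i x * f (n - i + 3) x\<bar> \<le> 2 ^ n * (K\<^sup>2 * (1 + \<bar>f n x\<bar> + \<bar>c n x\<bar>))"
proof -
  let ?s = "1 + \<bar>f n x\<bar> + \<bar>c n x\<bar>"
  have t: "\<bar>c i x\<bar> * \<bar>f (n - i + 3) x\<bar> \<le> K\<^sup>2 * ?s" if i: "i \<in> {3..n}" for i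
  proof -
    have s1: "1 \<le> ?s" "\<bar>f n x\<bar> \<le> ?s" "\<bar>c n x\<bar> \<le> ?s" by auto
    consider "i = n" | "i < n" "n - i + 3 = n" | "i < n" "n - i + 3 < n" using i by fastforce
    then show ?thesis
    proof cases
      case 1
      have "\<bar>f 3 x\<bar> \<le> K" using f n by (auto simp: supb_def)
      then have "\<bar>c n x\<bar> * \<bar>f 3 x\<bar> \<le> ?s * K" using s1 by (intro mult_mono) auto
      also have "\<dots> \<le> K\<^sup>2 * ?s" using K s1 by (simp add: power2_eq_square mult_right_mono mult.commute)
      finally show ?thesis using 1 by simp
    next
      case 2
      have "\<bar>c i x\<bar> \<le> K" using c 2 by (auto simp: supb_def)
      then have "\<bar>c i x\<bar> * \<bar>f (n - i + 3) x\<bar> \<le> K * ?s" using 2 s1 K by (intro mult_mono) auto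
      also have "\<dots> \<le> K\<^sup>2 * ?s" using K s1 by (simp add: power2_eq_square mult_right_mono)
      finally show ?thesis .
    next
      case 3
      have "\<bar>c i x\<bar> \<le> K" "\<bar>f (n - i + 3) x\<bar> \<le> K" using c f 3 by (auto simp: supb_def)
      then have "\<bar>c i x\<bar> * \<bar>f (n - i + 3) x\<bar> \<le> K * K" using K by (intro mult_mono) auto
      also have "\<dots> \<le> K\<^sup>2 * ?s" using K s1 by (simp add: power2_eq_square mult_left_le)
      finally show ?thesis .
    qed
  qed
  have "\<bar>\<Sum>i\<in>{3..n}. real (n choose i) * c i x * f (n - i + 3) x\<bar> \<le> (\<Sum>i\<in>{3..n}. real (n choose i) * (K\<^sup>2 * ?s))"
  proof (rule order_trans[OF sum_abs sum_mono])
    fix i assume "i \<in> {3..n}"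
    from mult_left_mono[OF t[OF this], of "real (n choose i)"]
    show "\<bar>real (n choose i) * c i x * f (n - i + 3) x\<bar> \<le> real (n choose i) * (K\<^sup>2 * ?s)"
      by (simp add: abs_mult mult.assoc)
  qed
  also have "\<dots> \<le> (\<Sum>i\<le>n. real (n choose i) * (K\<^sup>2 * ?s))" by (rule sum_mono2) auto
  also have "\<dots> = 2 ^ n * (K\<^sup>2 * ?s)" unfolding sum_distrib_right[symmetric] of_nat_sum[symmetric] choose_row_sum by simp
  finally show ?thesis .
qed

text \<open>The three terms singled out carry derivatives of f above order n and have to be
  integrated by parts.\<close>

lemma transport_expand:
  assumes "n \<ge> 4"
  shows "jmul c (\<lambda>j. f (j + 3)) n x = c 0 x * f (n + 3) x + real n * c 1 x * f (n + 2) x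
    + real (n * (n - 1)) / 2 * c 2 x * f (n + 1) x + (\<Sum>i\<in>{3..n}. real (n choose i) * c i x * f (n - i + 3) x)"
proof -
  have s: "{..n} = insert 0 (insert 1 (insert 2 {3..n}))" using assms by auto
  have c2: "real (n choose 2) = real (n * (n - 1)) / 2"
  proof -
    have "2 dvd n * (n - 1)" by (cases n) auto
    then show ?thesis unfolding choose_two by (simp add: real_of_nat_div)
  qed
  have e: "n - 1 + 3 = n + 2" "n - 2 + 3 = n + 1" using assms by auto
  have "jmul c (\<lambda>j. f (j + 3)) n x = (\<Sum>i\<in>insert 0 (insert 1 (insert 2 {3..n})). real (n choose i) * c i x * f (n - i + 3) x)"
    unfolding jmul_leibniz s by simp
  also have "\<dots> = real (n choose 0) * c 0 x * f (n - 0 + 3) x + (real (n choose 1) * c 1 x * f (n - 1 + 3) x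
     + (real (n choose 2) * c 2 x * f (n - 2 + 3) x + (\<Sum>i\<in>{3..n}. real (n choose i) * c i x * f (n - i + 3) x)))"
    by simp
  finally show ?thesis unfolding c2 e by simp
qed

text \<open>With \<open>w = f n - G n\<close> and \<open>\<Phi> = f^(2n)\<close>, the two leading terms are \<open>2 \<Phi> w w\<^sub>x\<^sub>x\<^sub>x + 3 \<Phi>\<^sub>x w w\<^sub>x\<^sub>x\<close>, which equals
  \<open>\<Phi>\<^sub>x\<^sub>x\<^sub>x w\<^sup>2 / 2\<close> plus the derivative of \<open>2 \<Phi> w w\<^sub>x\<^sub>x - \<Phi> w\<^sub>x\<^sup>2 + \<Phi>\<^sub>x w w\<^sub>x - \<Phi>\<^sub>x\<^sub>x w\<^sup>2 / 2\<close>. The \<open>\<epsilon>\<close>-terms are absorbed by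
  the dissipation \<open>- 2 \<epsilon> f^(2n-3) w\<^sub>x\<^sub>x\<^sup>2\<close>.\<close>

lemma weighted_energy_bound:
  assumes n: "n \<ge> 4" and a: "a > 0" and B: "B \<ge> 1"
  shows "\<exists>C. \<forall>f G \<epsilon>. bnd n B f \<longrightarrow> (\<forall>x. a \<le> f 0 x) \<longrightarrow> jet G \<longrightarrow> per G \<longrightarrow> supb (n + 5) B G \<longrightarrow> 0 \<le> \<epsilon> \<longrightarrow> \<epsilon> \<le> 1 \<longrightarrow>
    integral {0..L} (\<lambda>x. real (2 * n - 3) * f 0 x ^ (2 * n - 4) * (f 0 x ^ 3 * f 3 x - \<epsilon> * f 4 x) * (f n x - G n x)\<^sup>2
      + 2 * f 0 x ^ (2 * n - 3) * (f n x - G n x) * (jmul (jpow f 3) (\<lambda>j. f (j + 3)) n x - \<epsilon> * f (n + 4) x)) \<le> C"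
proof -
  define r where "r = 2 * n - 4"
  have p: "2 * n - 3 = Suc r" and rr: "real (Suc r) = 2 * real n - 3" using n by (auto simp: r_def)
  obtain Cc where Cc: "Cc \<ge> B" "\<And>f. bnd n B f \<Longrightarrow> bnd n Cc (jpow f 3)" using bnd_cube[of n B] n B by auto
  obtain Cf where Cf: "Cf \<ge> 0" "\<And>f. supb 4 B f \<Longrightarrow> supb 4 Cf (jpow f (Suc r))" using supb_jpow[of B 4 "Suc r"] B by auto
  define CP where "CP = 2 ^ 4 * (Cf * Cc)"
  have Cc0: "Cc \<ge> 1" using Cc B by simp
  have CP0: "CP \<ge> 0" using Cc0 Cf by (simp add: CP_def)
  \<comment> \<open>One constant dominating all others, so that every error term is bounded by a
    power of K.\<close>
  define K where "K = Cc + Cf + CP + B ^ r + real (Suc r) + real n + real (n * (n - 1)) + 2 ^ n"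
  have Br: "B ^ r \<ge> 0" using B by simp
  have K: "K \<ge> 1" "Cc \<le> K" "B \<le> K" "Cf \<le> K" "CP \<le> K" "B ^ r \<le> K" "real (Suc r) \<le> K" "real n \<le> K" "real (n * (n - 1)) \<le> K" "(2::real) ^ n \<le> K"
  proof -
    have "0 \<le> real (n * (n - 1))" "0 \<le> real n" "(0::real) \<le> 2 ^ n" "0 \<le> real (Suc r)" by simp_all
    then show "K \<ge> 1" "Cc \<le> K" "B \<le> K" "Cf \<le> K" "CP \<le> K" "B ^ r \<le> K" "real (Suc r) \<le> K" "real n \<le> K" "real (n * (n - 1)) \<le> K" "(2::real) ^ n \<le> K"
      using Cc0 Cc(1) Cf(1) CP0 Br B unfolding K_def by linarith+
  qed
  define m where "m = a ^ Suc r"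
  have m: "m > 0" using a by (simp add: m_def)
  define S0 where "S0 = L + B + Cc"
  have S0: "S0 \<ge> 0" using L_pos B Cc0 by (simp add: S0_def)
  define A where "A = 3 * (K ^ 8 * 12)"
  define Q0 where "Q0 = 3 * K\<^sup>2 * S0"
  have Q0: "Q0 \<ge> 0" using S0 by (simp add: Q0_def)
  define A1 where "A1 = 4 * K ^ 3 + 4 * K\<^sup>2 / m + 2 * K\<^sup>2"
  have A1: "A1 > 0" using K m by (simp add: A1_def add_nonneg_pos add_pos_nonneg)
  \<comment> \<open>Chosen such that \<open>A1 * Q0 * \<eta> \<le> m\<close>: the part of the sup
    bound W that is linear in q then disappears in the dissipation \<open>- m * q\<close>.\<close>
  define \<eta> where "\<eta> = m / (A1 * (Q0 + 1))"
  have \<eta>: "\<eta> > 0" using m A1 Q0 by (simp add: \<eta>_def)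
  define C' where "C' = A1 * Q0 * (1 + \<eta> * (1 / L + 2) * Q0 + 1 / (4 * \<eta>)) + A1 * L"
  have C': "C' \<ge> 0" using A1 Q0 \<eta> L_pos by (simp add: C'_def)
  show ?thesis
  proof (intro exI[of _ "A * S0 + C'"] allI impI)
    fix f G :: "nat \<Rightarrow> real \<Rightarrow> real" and \<epsilon> :: real
    assume f: "bnd n B f" and fa: "\<forall>x. a \<le> f 0 x" and jG: "jet G" and pG: "per G" and sG: "supb (n + 5) B G"
      and \<epsilon>: "0 \<le> \<epsilon>" "\<epsilon> \<le> 1"
    have jf: "jet f" and pf: "per f" and sf: "supb n B f" and if2: "integral {0..L} (\<lambda>x. (f n x)\<^sup>2) \<le> B"
      using f by (auto simp: bnd_def)
    define c where "c = jpow f 3"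
    define \<phi> where "\<phi> = jpow f (Suc r)"
    define \<Phi> where "\<Phi> = jmul \<phi> c"
    have cb: "bnd n Cc c" unfolding c_def by (rule Cc(2)[OF f])
    have jc: "jet c" and pc: "per c" and sc: "supb n Cc c" and ic2: "integral {0..L} (\<lambda>x. (c n x)\<^sup>2) \<le> Cc"
      using cb by (auto simp: bnd_def)
    have jp: "jet \<phi>" and pp: "per \<phi>" unfolding \<phi>_def by (rule jet_jpow[OF jf], rule per_jpow[OF pf])
    have sp: "supb 4 Cf \<phi>" unfolding \<phi>_def by (rule Cf(2)) (rule supb_mono[OF sf], use n in auto)
    have jP: "jet \<Phi>" and pP: "per \<Phi>" unfolding \<Phi>_def by (auto intro: jet_jmul jp jc per_jmul pp pc)
    have sP: "supb 4 CP \<Phi>" unfolding \<Phi>_def CP_def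
      by (rule supb_jmul) (use sp Cf Cc0 n in \<open>auto intro: supb_mono[OF sc]\<close>)
    have bf: "\<bar>f j x\<bar> \<le> K" if "j < n" for j x using sf K(3) that by (auto simp: supb_def intro: order_trans)
    have bc: "\<bar>c j x\<bar> \<le> K" if "j < n" for j x using sc K(2) that by (auto simp: supb_def intro: order_trans)
    have bp: "\<bar>\<phi> j x\<bar> \<le> K" if "j < 4" for j x using sp K(4) that by (auto simp: supb_def intro: order_trans)
    have bP: "\<bar>\<Phi> j x\<bar> \<le> K" if "j < 4" for j x using sP K(5) that by (auto simp: supb_def intro: order_trans)
    have bG: "\<bar>G j x\<bar> \<le> K" if "j < n + 5" for j x using sG K(3) that by (auto simp: supb_def intro: order_trans)
    define w where "w j x = f (n + j) x - G (n + j) x" for j x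
    have jw: "jet w" unfolding w_def using jet_diff[OF jet_shift[OF jf] jet_shift[OF jG], of n n] by (simp add: add.commute)
    have pw: "per w" using pf pG by (simp add: per_def w_def)
    have p0: "\<phi> 0 x = f 0 x ^ Suc r" and c0: "c 0 x = f 0 x ^ 3" and P0: "\<Phi> 0 x = \<phi> 0 x * c 0 x" for x
      by (simp_all only: \<phi>_def c_def \<Phi>_def jpow_0 jmul.simps)
    \<comment> \<open>Here the exponent is used: with \<open>\<phi> = f^(2n-3)\<close> and
      \<open>c = f^3\<close> both sides equal \<open>6 n f^(2n-1) f'\<close>. The second transport
      term thereby becomes \<open>3 \<Phi>_x w w_xx\<close>.\<close>
    have P1: "3 * \<Phi> 1 x = 2 * real n * \<phi> 0 x * c 1 x" for x
    proof -
      have c1: "c 1 x = 3 * f 0 x ^ 2 * f 1 x" using jpow_1[of f 2 x] by (simp add: c_def eval_nat_numeral)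
      have p1: "\<phi> 1 x = real (Suc r) * f 0 x ^ r * f 1 x" unfolding \<phi>_def by (rule jpow_1)
      have "\<Phi> 1 x = \<phi> 1 x * c 0 x + \<phi> 0 x * c 1 x" by (simp add: \<Phi>_def)
      then show ?thesis unfolding p1 c1 p0 c0 rr by (simp add: algebra_simps eval_nat_numeral)
    qed
    define rest where "rest x = (\<Sum>i\<in>{3..n}. real (n choose i) * c i x * f (n - i + 3) x)" for x
    define s where "s x = 1 + \<bar>f n x\<bar> + \<bar>c n x\<bar>" for x
    have s1: "s x \<ge> 1" for x by (simp add: s_def)
    have rest: "\<bar>rest x\<bar> \<le> K ^ 3 * s x" for x
    proof -
      have "\<bar>rest x\<bar> \<le> 2 ^ n * (K\<^sup>2 * s x)" unfolding rest_def s_def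
        by (rule transport_rest_le[OF n K(1)]) (use supb_mono[OF sf] supb_mono[OF sc] K in auto)
      also have "\<dots> \<le> K * (K\<^sup>2 * s x)" using K s1[of x] by (intro mult_right_mono) auto
      finally show ?thesis by (simp add: eval_nat_numeral)
    qed
    define N where "N = real (n * (n - 1))"
    have N: "0 \<le> N" "N \<le> K" using K by (auto simp: N_def)
    \<comment> \<open>What the dispersive part leaves after integration by parts: no derivative of w
      remains, and the derivatives above order n fall on the smooth jet G.\<close>
    define E1 where "E1 x = real (Suc r) * f 0 x ^ r * (f 0 x ^ 3 * f 3 x) * (w 0 x)\<^sup>2 + \<Phi> 3 x / 2 * (w 0 x)\<^sup>2
       - N / 2 * (\<phi> 1 x * c 2 x + \<phi> 0 x * c 3 x) * (w 0 x)\<^sup>2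
       + 2 * \<phi> 0 x * w 0 x * (c 0 x * G (n + 3) x + real n * c 1 x * G (n + 2) x + N / 2 * c 2 x * G (n + 1) x + rest x)" for x
    \<comment> \<open>The last term is \<open>2 K\<close> times the derivative of
      \<open>w w_x\<close>, inserted because \<open>2 \<phi>_xx (w_x)^2\<close> has no sign: it
      cancels that term up to a multiple of \<open>w w_xx\<close>.\<close>
    define E2 where "E2 x = - (real (Suc r) * f 0 x ^ r * f 4 x * (w 0 x)\<^sup>2) - 2 * \<phi> 0 x * (w 2 x)\<^sup>2
       - 2 * \<phi> 2 x * w 0 x * w 2 x + 2 * \<phi> 2 x * (w 1 x)\<^sup>2 - 2 * \<phi> 0 x * w 0 x * G (n + 4) x
       - 2 * K * ((w 1 x)\<^sup>2 + w 0 x * w 2 x)" for x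
    define P where "P x = 2 * \<Phi> 0 x * w 0 x * w 2 x - \<Phi> 0 x * (w 1 x)\<^sup>2 + \<Phi> 1 x * w 0 x * w 1 x - \<Phi> 2 x / 2 * (w 0 x)\<^sup>2
       + N / 2 * (\<phi> 0 x * c 2 x * (w 0 x)\<^sup>2)
       + \<epsilon> * (- 2 * \<phi> 0 x * w 0 x * w 3 x + 2 * (\<phi> 1 x * w 0 x + \<phi> 0 x * w 1 x) * w 2 x - 2 * \<phi> 1 x * (w 1 x)\<^sup>2
          + 2 * K * (w 0 x * w 1 x))" for x
    define P' where "P' x = 2 * \<Phi> 0 x * w 0 x * w 3 x + 3 * \<Phi> 1 x * w 0 x * w 2 x - \<Phi> 3 x / 2 * (w 0 x)\<^sup>2
       + N / 2 * ((\<phi> 1 x * c 2 x + \<phi> 0 x * c 3 x) * (w 0 x)\<^sup>2 + 2 * \<phi> 0 x * c 2 x * w 0 x * w 1 x)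
       + \<epsilon> * (- 2 * \<phi> 0 x * w 0 x * w 4 x + 2 * \<phi> 2 x * w 0 x * w 2 x + 2 * \<phi> 0 x * (w 2 x)\<^sup>2 - 2 * \<phi> 2 x * (w 1 x)\<^sup>2
          + 2 * K * ((w 1 x)\<^sup>2 + w 0 x * w 2 x))" for x
    have dw: "(w 0 has_real_derivative w 1 x) (at x)" "(w 1 has_real_derivative w 2 x) (at x)" "(w 2 has_real_derivative w 3 x) (at x)" "(w 3 has_real_derivative w 4 x) (at x)" for x
      using jetD[OF jw, of 0 x] jetD[OF jw, of 1 x] jetD[OF jw, of 2 x] jetD[OF jw, of 3 x] by (simp_all add: eval_nat_numeral)
    have dP: "(\<Phi> 0 has_real_derivative \<Phi> 1 x) (at x)" "(\<Phi> 1 has_real_derivative \<Phi> 2 x) (at x)" "(\<Phi> 2 has_real_derivative \<Phi> 3 x) (at x)" for x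
      using jetD[OF jP, of 0 x] jetD[OF jP, of 1 x] jetD[OF jP, of 2 x] by (simp_all add: eval_nat_numeral)
    have dp: "(\<phi> 0 has_real_derivative \<phi> 1 x) (at x)" "(\<phi> 1 has_real_derivative \<phi> 2 x) (at x)" for x
      using jetD[OF jp, of 0 x] jetD[OF jp, of 1 x] by (simp_all add: eval_nat_numeral)
    have dc: "(c 2 has_real_derivative c 3 x) (at x)" for x using jetD[OF jc, of 2 x] by (simp add: eval_nat_numeral)
    have dPP: "(P has_real_derivative P' x) (at x)" for x
    proof -
      \<comment> \<open>Variables in place of the fractions 1 / 2 and N / 2 keep the verification
        polynomial; at h = 1 / 2 the term with \<open>1 - 2 * h\<close> disappears.\<close>
      have gen: "((\<lambda>x. 2 * \<Phi> 0 x * w 0 x * w 2 x - \<Phi> 0 x * (w 1 x)\<^sup>2 + \<Phi> 1 x * w 0 x * w 1 x - h * \<Phi> 2 x * (w 0 x)\<^sup>2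
       + N2 * (\<phi> 0 x * c 2 x * (w 0 x)\<^sup>2)
       + \<epsilon> * (- 2 * \<phi> 0 x * w 0 x * w 3 x + 2 * (\<phi> 1 x * w 0 x + \<phi> 0 x * w 1 x) * w 2 x - 2 * \<phi> 1 x * (w 1 x)\<^sup>2
          + 2 * K * (w 0 x * w 1 x))) has_real_derivative
        (2 * \<Phi> 0 x * w 0 x * w 3 x + 3 * \<Phi> 1 x * w 0 x * w 2 x + (1 - 2 * h) * \<Phi> 2 x * w 0 x * w 1 x - h * \<Phi> 3 x * (w 0 x)\<^sup>2
       + N2 * ((\<phi> 1 x * c 2 x + \<phi> 0 x * c 3 x) * (w 0 x)\<^sup>2 + 2 * \<phi> 0 x * c 2 x * w 0 x * w 1 x)
       + \<epsilon> * (- 2 * \<phi> 0 x * w 0 x * w 4 x + 2 * \<phi> 2 x * w 0 x * w 2 x + 2 * \<phi> 0 x * (w 2 x)\<^sup>2 - 2 * \<phi> 2 x * (w 1 x)\<^sup>2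
          + 2 * K * ((w 1 x)\<^sup>2 + w 0 x * w 2 x)))) (at x)" for h N2
        by (rule derivative_eq_intros dw dP dp dc refl)+ (simp add: algebra_simps power2_eq_square)
      show ?thesis using gen[of "1 / 2" "N / 2"] unfolding P_def[abs_def] P'_def by simp
    qed
    have per0: "P L = P 0" unfolding P_def by (simp only: per_0L[OF pw] per_0L[OF pP] per_0L[OF pp] per_0L[OF pc])
    let ?I = "\<lambda>x. real (2 * n - 3) * f 0 x ^ (2 * n - 4) * (f 0 x ^ 3 * f 3 x - \<epsilon> * f 4 x) * (f n x - G n x)\<^sup>2
      + 2 * f 0 x ^ (2 * n - 3) * (f n x - G n x) * (jmul (jpow f 3) (\<lambda>j. f (j + 3)) n x - \<epsilon> * f (n + 4) x)"
    have Ieq: "?I x = P' x + E1 x + \<epsilon> * E2 x" for x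
    proof -
      have fw: "f (n + j) x = w j x + G (n + j) x" for j by (simp add: w_def)
      have w0: "f n x - G n x = w 0 x" by (simp add: w_def)
      have "?I x = real (Suc r) * f 0 x ^ r * (f 0 x ^ 3 * f 3 x - \<epsilon> * f 4 x) * (w 0 x)\<^sup>2
        + 2 * \<phi> 0 x * w 0 x * (c 0 x * (w 3 x + G (n + 3) x) + real n * c 1 x * (w 2 x + G (n + 2) x)
          + N / 2 * c 2 x * (w 1 x + G (n + 1) x) + rest x - \<epsilon> * (w 4 x + G (n + 4) x))"
        unfolding w0 p c_def[symmetric] transport_expand[OF n] fw N_def rest_def p0 r_def ..
      also have "\<dots> = P' x + E1 x + \<epsilon> * E2 x"
        unfolding P'_def E1_def E2_def P1 P0 by (simp add: algebra_simps)
      finally show ?thesis .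
    qed
    have wK: "\<bar>w 0 x\<bar> \<le> K * s x" for x
    proof -
      have "\<bar>w 0 x\<bar> \<le> \<bar>f n x\<bar> + K" using bG[of n x] by (simp add: w_def)
      also have "\<dots> \<le> K * \<bar>f n x\<bar> + K" using K(1) by (simp add: le_ge1_mult)
      also have "\<dots> \<le> K * s x" using K(1) by (simp add: s_def distrib_left)
      finally show ?thesis .
    qed
    have s2: "(s x)\<^sup>2 \<le> 3 * (1 + (f n x)\<^sup>2 + (c n x)\<^sup>2)" for x
      unfolding s_def using sq_sum3_le[of 1 "\<bar>f n x\<bar>" "\<bar>c n x\<bar>"] by simp
    have w2s: "(w 0 x)\<^sup>2 \<le> K\<^sup>2 * (s x)\<^sup>2" for x
      using power_mono[OF wK[of x], of 2] by (simp add: power_mult_distrib)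
    have b0: "\<bar>f 0 x ^ r\<bar> \<le> K" for x
    proof -
      have "\<bar>f 0 x\<bar> ^ r \<le> B ^ r" using sf n by (intro power_mono) (auto simp: supb_def)
      then show ?thesis using K(6) by (simp add: power_abs)
    qed
    have E1b: "E1 x \<le> A * (1 + (f n x)\<^sup>2 + (c n x)\<^sup>2)" for x
    proof -
      have Kp: "K ^ i \<le> K ^ j" if "i \<le> j" for i j using that K(1) by (intro power_increasing) auto
      have ww: "\<bar>(w 0 x)\<^sup>2\<bar> \<le> K\<^sup>2 * (s x)\<^sup>2" using w2s by simp
      have ss: "(s x)\<^sup>2 \<ge> 0" by simp
      have "\<bar>real (Suc r) * f 0 x ^ r * (f 0 x ^ 3 * f 3 x) * (w 0 x)\<^sup>2\<bar> \<le> K * K * (K ^ 3 * K) * (K\<^sup>2 * (s x)\<^sup>2)"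
        using K(7) bf[of 0 x] bf[of 3 x] n
        by (intro abs_mult_le abs_power_le b0 ww) auto
      then have t1: "\<bar>real (Suc r) * f 0 x ^ r * (f 0 x ^ 3 * f 3 x) * (w 0 x)\<^sup>2\<bar> \<le> K ^ 8 * (s x)\<^sup>2"
        by (simp add: eval_nat_numeral mult_ac)
      have "\<bar>\<Phi> 3 x / 2\<bar> \<le> K" using bP[of 3 x] by auto
      then have "\<bar>\<Phi> 3 x / 2 * (w 0 x)\<^sup>2\<bar> \<le> K * (K\<^sup>2 * (s x)\<^sup>2)" by (rule abs_mult_le[OF _ ww])
      also have "\<dots> \<le> K ^ 8 * (s x)\<^sup>2" using mult_right_mono[OF Kp[of 3 8] ss] by (simp add: eval_nat_numeral mult_ac)
      finally have t2: "\<bar>\<Phi> 3 x / 2 * (w 0 x)\<^sup>2\<bar> \<le> K ^ 8 * (s x)\<^sup>2" .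
      have "\<bar>\<phi> 1 x * c 2 x\<bar> \<le> K * K" "\<bar>\<phi> 0 x * c 3 x\<bar> \<le> K * K" using n by (intro abs_mult_le bp bc; simp)+
      then have "\<bar>\<phi> 1 x * c 2 x + \<phi> 0 x * c 3 x\<bar> \<le> 2 * (K * K)" by linarith
      then have "\<bar>N / 2 * (\<phi> 1 x * c 2 x + \<phi> 0 x * c 3 x) * (w 0 x)\<^sup>2\<bar> \<le> (K / 2) * (2 * (K * K)) * (K\<^sup>2 * (s x)\<^sup>2)"
        using N by (intro abs_mult_le ww) auto
      also have "\<dots> \<le> K ^ 8 * (s x)\<^sup>2" using mult_right_mono[OF Kp[of 5 8] ss] by (simp add: eval_nat_numeral mult_ac)
      finally have t3: "\<bar>N / 2 * (\<phi> 1 x * c 2 x + \<phi> 0 x * c 3 x) * (w 0 x)\<^sup>2\<bar> \<le> K ^ 8 * (s x)\<^sup>2" .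
      have K3: "K ^ 2 \<le> K ^ 3 * s x" "K ^ 3 \<le> K ^ 3 * s x"
        using Kp[of 2 3] s1[of x] K(1) by (auto intro: order_trans[of _ "K ^ 3"])
      have g1: "\<bar>c 0 x * G (n + 3) x\<bar> \<le> K * K" using n by (intro abs_mult_le bc bG) auto
      have g2: "\<bar>real n * c 1 x * G (n + 2) x\<bar> \<le> K * K * K" using n K(8) by (intro abs_mult_le bc bG) auto
      have g3: "\<bar>N / 2 * c 2 x * G (n + 1) x\<bar> \<le> K * K * K" using n N by (intro abs_mult_le bc bG) auto
      have "\<bar>c 0 x * G (n + 3) x + real n * c 1 x * G (n + 2) x + N / 2 * c 2 x * G (n + 1) x + rest x\<bar> \<le> 4 * (K ^ 3 * s x)"
        using g1 g2 g3 rest[of x] K3 by (simp add: power2_eq_square power3_eq_cube)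
      then have "\<bar>2 * \<phi> 0 x * w 0 x * (c 0 x * G (n + 3) x + real n * c 1 x * G (n + 2) x + N / 2 * c 2 x * G (n + 1) x + rest x)\<bar>
          \<le> 2 * K * (K * s x) * (4 * (K ^ 3 * s x))"
        by (intro abs_mult_le bp wK) auto
      also have "\<dots> \<le> 8 * (K ^ 8 * (s x)\<^sup>2)" using mult_right_mono[OF Kp[of 5 8] ss] by (simp add: eval_nat_numeral mult_ac)
      finally have t4: "\<bar>2 * \<phi> 0 x * w 0 x * (c 0 x * G (n + 3) x + real n * c 1 x * G (n + 2) x + N / 2 * c 2 x * G (n + 1) x + rest x)\<bar> \<le> 8 * (K ^ 8 * (s x)\<^sup>2)" .
      have "E1 x \<le> 12 * (K ^ 8 * (s x)\<^sup>2)" unfolding E1_def using t1 t2 t3 t4 K(1) by (smt (verit) zero_le_mult_iff zero_le_power ss)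
      also have "\<dots> \<le> 12 * (K ^ 8 * (3 * (1 + (f n x)\<^sup>2 + (c n x)\<^sup>2)))" using K(1) s2[of x] by (intro mult_left_mono) auto
      finally show ?thesis by (simp add: A_def algebra_simps)
    qed
    have E2b: "E2 x \<le> - m * (w 2 x)\<^sup>2 + A1 * (1 + W) * (w 0 x)\<^sup>2 + A1" if W: "\<bar>w 0 x\<bar> \<le> W" for x W
    proof -
      have W0: "W \<ge> 0" using W by simp
      \<comment> \<open>For n = 4 the function \<open>f 4\<close> is the top derivative and has no
        bound known in advance; it is estimated through \<open>w\<close> and the sup bound W, to be
        absorbed later.\<close>
      have f4: "\<bar>f 4 x\<bar> \<le> K * (1 + W)"
      proof (cases "n = 4")
        case True
        have "\<bar>f 4 x\<bar> \<le> W + K" using W bG[of 4 x] True by (simp add: w_def)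
        also have "W \<le> K * W" using K(1) W0 by (simp add: le_ge1_mult)
        finally show ?thesis by (simp add: distrib_left)
      next
        case False
        then have "\<bar>f 4 x\<bar> \<le> K * 1" using bf[of 4 x] n by simp
        also have "\<dots> \<le> K * (1 + W)" using K(1) W0 by (intro mult_left_mono) auto
        finally show ?thesis .
      qed
      have "\<bar>real (Suc r) * f 0 x ^ r * f 4 x\<bar> \<le> K * K * (K * (1 + W))"
        using K(7) by (intro abs_mult_le b0 f4) auto
      then have "- (real (Suc r) * f 0 x ^ r * f 4 x) \<le> K ^ 3 * (1 + W)" by (simp add: power3_eq_cube mult_ac)
      then have u1: "- (real (Suc r) * f 0 x ^ r * f 4 x * (w 0 x)\<^sup>2) \<le> K ^ 3 * (1 + W) * (w 0 x)\<^sup>2"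
        using mult_right_mono[of "- (real (Suc r) * f 0 x ^ r * f 4 x)" _ "(w 0 x)\<^sup>2"] by simp
      have "m \<le> \<phi> 0 x" unfolding m_def p0 using fa a by (intro power_mono) auto
      then have u2: "m * (w 2 x)\<^sup>2 \<le> \<phi> 0 x * (w 2 x)\<^sup>2" by (rule mult_right_mono) simp
      have u3: "\<phi> 2 x * (w 1 x)\<^sup>2 \<le> K * (w 1 x)\<^sup>2" using bp[of 2 x] by (intro mult_right_mono) auto
      have "\<bar>- (\<phi> 2 x + K) * (w 0 x * w 2 x)\<bar> \<le> 2 * K * (\<bar>w 0 x\<bar> * \<bar>w 2 x\<bar>)"
        by (rule abs_mult_le) (use bp[of 2 x] in \<open>auto simp: abs_mult\<close>)
      then have u4: "- 2 * \<phi> 2 x * w 0 x * w 2 x - 2 * K * (w 0 x * w 2 x) \<le> 4 * K * (\<bar>w 0 x\<bar> * \<bar>w 2 x\<bar>)"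
        by (simp add: algebra_simps)
      \<comment> \<open>Young's inequality spends one of the two copies of \<open>m (w_xx)^2\<close>
        provided by the dissipation; the other is kept against W.\<close>
      have u5: "4 * K * (\<bar>w 0 x\<bar> * \<bar>w 2 x\<bar>) \<le> m * (w 2 x)\<^sup>2 + 4 * K\<^sup>2 / m * (w 0 x)\<^sup>2"
      proof -
        have "m * (4 * K * (\<bar>w 0 x\<bar> * \<bar>w 2 x\<bar>)) \<le> m * (m * (w 2 x)\<^sup>2 + 4 * K\<^sup>2 / m * (w 0 x)\<^sup>2)"
          using zero_le_power2[of "m * \<bar>w 2 x\<bar> - 2 * K * \<bar>w 0 x\<bar>"] m
          by (simp add: power2_diff power_mult_distrib algebra_simps power2_eq_square)
        then show ?thesis using m by simp
      qed
      have "\<bar>\<phi> 0 x * w 0 x * G (n + 4) x\<bar> \<le> K * \<bar>w 0 x\<bar> * K" by (intro abs_mult_le bp bG) auto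
      moreover have "2 * (K * \<bar>w 0 x\<bar> * K) \<le> K\<^sup>2 * (1 + (w 0 x)\<^sup>2)"
      proof -
        have "2 * \<bar>w 0 x\<bar> \<le> 1 + (w 0 x)\<^sup>2" using zero_le_power2[of "\<bar>w 0 x\<bar> - 1"] by (simp add: power2_diff)
        then have "K\<^sup>2 * (2 * \<bar>w 0 x\<bar>) \<le> K\<^sup>2 * (1 + (w 0 x)\<^sup>2)" by (intro mult_left_mono) auto
        then show ?thesis by (simp add: power2_eq_square mult_ac)
      qed
      ultimately have u6: "- 2 * \<phi> 0 x * w 0 x * G (n + 4) x \<le> K\<^sup>2 + K\<^sup>2 * (w 0 x)\<^sup>2" by (simp add: distrib_left abs_le_iff)
      have "E2 x \<le> K ^ 3 * (1 + W) * (w 0 x)\<^sup>2 - m * (w 2 x)\<^sup>2 + 4 * K\<^sup>2 / m * (w 0 x)\<^sup>2 + K\<^sup>2 + K\<^sup>2 * (w 0 x)\<^sup>2"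
        unfolding E2_def using u1 u2 u3 u4 u5 u6 by (simp add: distrib_left)
      also have "\<dots> = - m * (w 2 x)\<^sup>2 + (K ^ 3 * (1 + W) + 4 * K\<^sup>2 / m + K\<^sup>2) * (w 0 x)\<^sup>2 + K\<^sup>2"
        by (simp add: algebra_simps)
      also have "\<dots> \<le> - m * (w 2 x)\<^sup>2 + A1 * (1 + W) * (w 0 x)\<^sup>2 + A1"
      proof -
        have nn: "4 * K\<^sup>2 / m \<ge> 0" "K\<^sup>2 \<ge> 0" "K ^ 3 \<ge> 0" using m K(1) by auto
        have "K ^ 3 * (1 + W) + 4 * K\<^sup>2 / m + K\<^sup>2 \<le> K ^ 3 * (1 + W) + 4 * K\<^sup>2 / m * (1 + W) + K\<^sup>2 * (1 + W)"
          using nn W0 by (intro add_mono order_refl le_mult_ge1) auto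
        also have "\<dots> = (K ^ 3 + 4 * K\<^sup>2 / m + K\<^sup>2) * (1 + W)" by (simp add: distrib_right)
        also have "\<dots> \<le> A1 * (1 + W)" using nn W0 by (intro mult_right_mono) (auto simp: A1_def)
        finally have "(K ^ 3 * (1 + W) + 4 * K\<^sup>2 / m + K\<^sup>2) * (w 0 x)\<^sup>2 \<le> A1 * (1 + W) * (w 0 x)\<^sup>2" by (rule mult_right_mono) simp
        moreover have "K\<^sup>2 \<le> A1" using nn by (simp add: A1_def)
        ultimately show ?thesis by simp
      qed
      finally show ?thesis .
    qed
    note cont = jet_cont[OF jf] jet_cont[OF jc] jet_cont[OF jw] jet_cont[OF jp] jet_cont[OF jP] jet_cont[OF jG]
    define Q q1 q where "Q = integral {0..L} (\<lambda>x. (w 0 x)\<^sup>2)" and "q1 = integral {0..L} (\<lambda>x. (w 1 x)\<^sup>2)"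
      and "q = integral {0..L} (\<lambda>x. (w 2 x)\<^sup>2)"
    have nn: "Q \<ge> 0" "q1 \<ge> 0" "q \<ge> 0" unfolding Q_def q1_def q_def
      by (auto intro!: integral_nonneg integrable_continuous_real continuous_intros cont)
    have Si: "integral {0..L} (\<lambda>x. 1 + (f n x)\<^sup>2 + (c n x)\<^sup>2) \<le> S0"
    proof -
      have "integral {0..L} (\<lambda>x. 1 + (f n x)\<^sup>2 + (c n x)\<^sup>2) = L + integral {0..L} (\<lambda>x. (f n x)\<^sup>2) + integral {0..L} (\<lambda>x. (c n x)\<^sup>2)"
        using L_pos by (simp add: integral_add integrable_continuous_real continuous_intros cont)
      then show ?thesis using if2 ic2 by (simp add: S0_def)
    qed
    have QQ: "Q \<le> Q0"
    proof -
      have "Q \<le> integral {0..L} (\<lambda>x. 3 * K\<^sup>2 * (1 + (f n x)\<^sup>2 + (c n x)\<^sup>2))"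
        unfolding Q_def
      proof (rule integral_le)
        fix x
        have "(w 0 x)\<^sup>2 \<le> K\<^sup>2 * (s x)\<^sup>2" by (rule w2s)
        also have "\<dots> \<le> K\<^sup>2 * (3 * (1 + (f n x)\<^sup>2 + (c n x)\<^sup>2))" by (intro mult_left_mono s2) auto
        finally show "(w 0 x)\<^sup>2 \<le> 3 * K\<^sup>2 * (1 + (f n x)\<^sup>2 + (c n x)\<^sup>2)" by (simp add: algebra_simps)
      qed (intro integrable_continuous_real continuous_intros cont)+
      also have "\<dots> = 3 * K\<^sup>2 * integral {0..L} (\<lambda>x. 1 + (f n x)\<^sup>2 + (c n x)\<^sup>2)" by (rule integral_mult_right)
      also have "\<dots> \<le> Q0" unfolding Q0_def using Si K(1) by (intro mult_left_mono) auto
      finally show ?thesis .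
    qed
    have qq: "q1 \<le> Q + q"
    proof -
      have "((\<lambda>x. (w 1 x)\<^sup>2 + w 0 x * w 2 x) has_integral 0) {0..L}"
      proof (rule integral_deriv_periodic[of "\<lambda>x. w 0 x * w 1 x"])
        show "((\<lambda>x. w 0 x * w 1 x) has_real_derivative (w 1 x)\<^sup>2 + w 0 x * w 2 x) (at x)" for x
          by (rule derivative_eq_intros dw refl)+ (simp add: power2_eq_square)
      qed (simp only: per_0L[OF pw])
      then have "0 = integral {0..L} (\<lambda>x. (w 1 x)\<^sup>2 + w 0 x * w 2 x)" by (simp add: integral_unique)
      also have "\<dots> = q1 + integral {0..L} (\<lambda>x. w 0 x * w 2 x)" unfolding q1_def
        by (rule integral_add) (intro integrable_continuous_real continuous_intros cont)+
      finally have "q1 = - integral {0..L} (\<lambda>x. w 0 x * w 2 x)" by simp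
      also have "\<dots> = integral {0..L} (\<lambda>x. - (w 0 x * w 2 x))" by simp
      also have "\<dots> \<le> integral {0..L} (\<lambda>x. (w 0 x)\<^sup>2 + (w 2 x)\<^sup>2)"
      proof (rule integral_le)
        show "- (w 0 x * w 2 x) \<le> (w 0 x)\<^sup>2 + (w 2 x)\<^sup>2" for x
          using zero_le_power2[of "w 0 x + w 2 x", unfolded power2_sum] zero_le_power2[of "w 0 x"] zero_le_power2[of "w 2 x"]
          by linarith
      qed (intro integrable_continuous_real continuous_intros cont)+
      also have "\<dots> = Q + q" unfolding Q_def q_def
        by (rule integral_add) (intro integrable_continuous_real continuous_intros cont)+
      finally show ?thesis .
    qed
    \<comment> \<open>A sup bound for w by \<open>sup_sq_le\<close>. Since
      \<open>q1 \<le> Q + q\<close>, it grows only like the square root of q, whereas the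
      dissipation is linear in q.\<close>
    define W where "W = sqrt ((1 / L + 1) * Q + q1)"
    have Wsq: "W\<^sup>2 = (1 / L + 1) * Q + q1" and W0: "W \<ge> 0" unfolding W_def using nn L_pos by auto
    have Wb: "\<bar>w 0 x\<bar> \<le> W" if "x \<in> {0..L}" for x
      unfolding W_def Q_def q1_def by (rule real_le_rsqrt) (use sup_sq_le[OF dw(1) cont(3) that] in simp)
    have "integral {0..L} ?I \<le> integral {0..L} (\<lambda>x. P' x + A * (1 + (f n x)\<^sup>2 + (c n x)\<^sup>2) + \<epsilon> * (- m * (w 2 x)\<^sup>2 + A1 * (1 + W) * (w 0 x)\<^sup>2 + A1))"
      unfolding Ieq
    proof (rule integral_le)
      show "(\<lambda>x. P' x + E1 x + \<epsilon> * E2 x) integrable_on {0..L}"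
        unfolding P'_def E1_def E2_def rest_def by (intro integrable_continuous_real continuous_intros cont) auto
      show "(\<lambda>x. P' x + A * (1 + (f n x)\<^sup>2 + (c n x)\<^sup>2) + \<epsilon> * (- m * (w 2 x)\<^sup>2 + A1 * (1 + W) * (w 0 x)\<^sup>2 + A1)) integrable_on {0..L}"
        unfolding P'_def by (intro integrable_continuous_real continuous_intros cont) auto
      show "P' x + E1 x + \<epsilon> * E2 x \<le> P' x + A * (1 + (f n x)\<^sup>2 + (c n x)\<^sup>2) + \<epsilon> * (- m * (w 2 x)\<^sup>2 + A1 * (1 + W) * (w 0 x)\<^sup>2 + A1)"
        if "x \<in> {0..L}" for x
        using E1b[of x] mult_left_mono[OF E2b[OF Wb[OF that]] \<epsilon>(1)] by linarith
    qed
    also have "\<dots> = 0 + A * integral {0..L} (\<lambda>x. 1 + (f n x)\<^sup>2 + (c n x)\<^sup>2) + \<epsilon> * (- m * q + A1 * (1 + W) * Q + A1 * L)"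
    proof (rule integral_unique, intro has_integral_add has_integral_mult_right)
      show "(P' has_integral 0) {0..L}" by (rule integral_deriv_periodic[OF dPP per0])
      show "((\<lambda>x. 1 + (f n x)\<^sup>2 + (c n x)\<^sup>2) has_integral integral {0..L} (\<lambda>x. 1 + (f n x)\<^sup>2 + (c n x)\<^sup>2)) {0..L}"
        by (intro integrable_integral integrable_continuous_real continuous_intros cont)
      show "((\<lambda>x. (w 2 x)\<^sup>2) has_integral q) {0..L}" "((\<lambda>x. (w 0 x)\<^sup>2) has_integral Q) {0..L}"
        unfolding q_def Q_def by (intro integrable_integral integrable_continuous_real continuous_intros cont)+
      show "((\<lambda>x. A1) has_integral A1 * L) {0..L}" using has_integral_const_real[of A1 0 L] L_pos by (simp add: mult.commute)
    qed
    also have "\<dots> \<le> 0 + A * S0 + C'"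
    proof (intro add_mono order_refl mult_left_mono Si)
      show "A \<ge> 0" using K(1) by (simp add: A_def)
      have "W \<le> \<eta> * W\<^sup>2 + 1 / (4 * \<eta>)"
      proof -
        have "0 \<le> (2 * \<eta> * W - 1)\<^sup>2" by simp
        also have "\<dots> = 4 * \<eta> * (\<eta> * W\<^sup>2) - 4 * \<eta> * W + 1" by (simp add: power2_eq_square algebra_simps)
        finally have "4 * \<eta> * W \<le> 4 * \<eta> * (\<eta> * W\<^sup>2) + 1" by linarith
        also have "\<dots> = 4 * \<eta> * (\<eta> * W\<^sup>2 + 1 / (4 * \<eta>))" using \<eta> by (simp add: distrib_left)
        finally show ?thesis by (rule mult_left_le_imp_le) (use \<eta> in simp)
      qed
      also have "\<eta> * W\<^sup>2 \<le> \<eta> * ((1 / L + 2) * Q0 + q)"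
      proof (rule mult_left_mono)
        have "(1 / L + 2) * Q \<le> (1 / L + 2) * Q0" using QQ L_pos by (intro mult_left_mono) auto
        then show "W\<^sup>2 \<le> (1 / L + 2) * Q0 + q" unfolding Wsq using qq by (simp add: distrib_right)
      qed (use \<eta> in simp)
      finally have Wl: "W \<le> \<eta> * (1 / L + 2) * Q0 + \<eta> * q + 1 / (4 * \<eta>)" by (simp only: distrib_left[of \<eta> "(1 / L + 2) * Q0" q] mult.assoc)
      have "A1 * (1 + W) * Q \<le> A1 * (1 + W) * Q0" using QQ A1 W0 by (intro mult_left_mono) auto
      also have "\<dots> = A1 * Q0 * (1 + W)" by simp
      also have "\<dots> \<le> A1 * Q0 * (1 + (\<eta> * (1 / L + 2) * Q0 + \<eta> * q + 1 / (4 * \<eta>)))"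
        using Wl A1 Q0 by (intro mult_left_mono add_left_mono) auto
      also have "\<dots> = A1 * Q0 * (1 + \<eta> * (1 / L + 2) * Q0 + 1 / (4 * \<eta>)) + A1 * Q0 * \<eta> * q" by (simp add: algebra_simps)
      also have "A1 * Q0 * \<eta> * q \<le> m * q"
      proof (rule mult_right_mono)
        have "A1 * Q0 * \<eta> = m * (Q0 / (Q0 + 1))" using A1 by (simp add: \<eta>_def)
        also have "\<dots> \<le> m * 1" using m Q0 by (intro mult_left_mono) auto
        finally show "A1 * Q0 * \<eta> \<le> m" by simp
      qed (rule nn)
      finally have "- m * q + A1 * (1 + W) * Q + A1 * L \<le> C'" by (simp add: C'_def)
      then have "\<epsilon> * (- m * q + A1 * (1 + W) * Q + A1 * L) \<le> \<epsilon> * C'" using \<epsilon> by (intro mult_left_mono) auto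
      also have "\<dots> \<le> 1 * C'" using \<epsilon> C' by (intro mult_right_mono) auto
      finally show "\<epsilon> * (- m * q + A1 * (1 + W) * Q + A1 * L) \<le> C'" by simp
    qed
    finally show "integral {0..L} ?I \<le> A * S0 + C'" by simp
  qed
qed

end

section \<open>Stability in the mean square\<close>

lemma within_derivative_mvt:
  fixes h :: "real \<Rightarrow> real"
  assumes "\<And>t. t \<in> {0..T} \<Longrightarrow> (h has_real_derivative h' t) (at t within {0..T})"
    and "\<And>t. t \<in> {0..T} \<Longrightarrow> h' t \<le> C" and t: "t \<in> {0..T}"
  shows "h t \<le> h 0 + C * t"
proof -
  have "\<exists>x\<in>{0..t}. h t - h 0 = (\<lambda>y. h' x * y) (t - 0)"
  proof (rule mvt_very_simple)
    show "0 \<le> t" using t by simp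
    show "(h has_derivative (\<lambda>y. h' x * y)) (at x within {0..t})" if "0 \<le> x" "x \<le> t" for x
      using has_field_derivative_subset[OF assms(1), of x "{0..t}"] that t by (auto simp: has_field_derivative_def)
  qed
  then obtain x where x: "x \<in> {0..t}" "h t - h 0 = h' x * t" by auto
  have "h' x * t \<le> C * t" using assms(2)[of x] x t by (intro mult_right_mono) auto
  then show ?thesis using x by simp
qed

text \<open>Adding the constant source to the unknown makes the differential inequality
  homogeneous.\<close>

lemma gronwall_within:
  fixes e :: "real \<Rightarrow> real"
  assumes d: "\<And>t. t \<in> {0..T} \<Longrightarrow> (e has_real_derivative e' t) (at t within {0..T})"
    and le: "\<And>t. t \<in> {0..T} \<Longrightarrow> e' t \<le> C * (e t + \<rho>)" and t: "t \<in> {0..T}"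
  shows "e t + \<rho> \<le> (e 0 + \<rho>) * exp (C * t)"
proof -
  have "exp (- C * t) * (e t + \<rho>) \<le> exp (- C * 0) * (e 0 + \<rho>) + 0 * t"
  proof (rule within_derivative_mvt[OF _ _ t])
    fix s assume s: "s \<in> {0..T}"
    show "((\<lambda>t. exp (- C * t) * (e t + \<rho>)) has_real_derivative exp (- C * s) * (e' s - C * (e s + \<rho>))) (at s within {0..T})"
      by (auto intro!: derivative_eq_intros d[OF s] simp: algebra_simps)
    show "exp (- C * s) * (e' s - C * (e s + \<rho>)) \<le> 0" using le[OF s] by (simp add: mult_le_0_iff)
  qed
  then have le': "exp (C * t) * (exp (- C * t) * (e t + \<rho>)) \<le> exp (C * t) * (e 0 + \<rho>)" by (intro mult_left_mono) auto
  have eq: "exp (C * t) * (exp (- C * t) * (e t + \<rho>)) = e t + \<rho>"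
    unfolding mult.assoc[symmetric] exp_add[symmetric] by simp
  show ?thesis using le' unfolding eq by (simp only: mult.commute)
qed

lemma abs_two_sum3_le: "\<bar>p\<bar> \<le> M \<Longrightarrow> \<bar>q\<bar> \<le> M \<Longrightarrow> \<bar>r\<bar> \<le> M \<Longrightarrow> \<bar>2 * (p + q + r)\<bar> \<le> 6 * M" for p q r M :: real
  by (auto simp: abs_le_iff)

lemma two_mult_diff_le: "\<bar>2 * w * (r - r')\<bar> \<le> 2 * (w\<^sup>2 + r\<^sup>2 + r'\<^sup>2)" for w r r' :: real
proof -
  have "\<bar>2 * w * (r - r')\<bar> = 2 * \<bar>w\<bar> * \<bar>r - r'\<bar>" by (simp add: abs_mult)
  also have "\<dots> \<le> 2 * \<bar>w\<bar> * (\<bar>r\<bar> + \<bar>r'\<bar>)" by (intro mult_left_mono) auto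
  also have "\<dots> = 2 * \<bar>w\<bar> * \<bar>r\<bar> + 2 * \<bar>w\<bar> * \<bar>r'\<bar>" by (simp add: distrib_left)
  also have "\<dots> \<le> (w\<^sup>2 + r\<^sup>2) + (w\<^sup>2 + r'\<^sup>2)"
    using sum_squares_bound[of "\<bar>w\<bar>" "\<bar>r\<bar>"] sum_squares_bound[of "\<bar>w\<bar>" "\<bar>r'\<bar>"] by (intro add_mono) simp_all
  also have "\<dots> \<le> 2 * (w\<^sup>2 + r\<^sup>2 + r'\<^sup>2)" by simp
  finally show ?thesis .
qed

context circle begin

lemma integral_param_deriv:
  fixes F :: "real \<Rightarrow> real \<Rightarrow> real"
  assumes "\<And>t x. t \<in> {0..T} \<Longrightarrow> x \<in> {0..L} \<Longrightarrow> ((\<lambda>t. F t x) has_real_derivative F' t x) (at t within {0..T})"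
    and "continuous_on ({0..T} \<times> {0..L}) (\<lambda>(t, x). F' t x)"
    and "\<And>t. t \<in> {0..T} \<Longrightarrow> continuous_on {0..L} (F t)" and "t \<in> {0..T}"
  shows "((\<lambda>t. integral {0..L} (F t)) has_real_derivative integral {0..L} (F' t)) (at t within {0..T})"
  using leibniz_rule_field_derivative[of "{0..T}" 0 L F F' t] assms
  by (simp add: integrable_continuous_real)

text \<open>The residual r lets one notion serve both equations: it is
  \<open>- \<epsilon> u_xxxx\<close> for the regularised one and 0 for the Harry Dym equation
  itself.\<close>

definition classical_sol ::
  "real \<Rightarrow> (real \<Rightarrow> real \<Rightarrow> real) \<Rightarrow> (real \<Rightarrow> real \<Rightarrow> real) \<Rightarrow> (real \<Rightarrow> real \<Rightarrow> real) \<Rightarrow> (real \<Rightarrow> real \<Rightarrow> real) \<Rightarrow> (real \<Rightarrow> real \<Rightarrow> real) \<Rightarrow> bool"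
where
  "classical_sol T u u1 u2 u3 r \<longleftrightarrow>
     (\<forall>t\<in>{0..T}. \<forall>x. (u t has_real_derivative u1 t x) (at x) \<and> (u1 t has_real_derivative u2 t x) (at x)
         \<and> (u2 t has_real_derivative u3 t x) (at x) \<and> u t (x + L) = u t x \<and> u1 t (x + L) = u1 t x \<and> u2 t (x + L) = u2 t x) \<and>
     continuous_on ({0..T} \<times> UNIV) (\<lambda>(t, x). u t x) \<and> continuous_on ({0..T} \<times> UNIV) (\<lambda>(t, x). u3 t x) \<and>
     continuous_on ({0..T} \<times> UNIV) (\<lambda>(t, x). r t x) \<and>
     (\<forall>t\<in>{0..T}. \<forall>x. ((\<lambda>t. u t x) has_real_derivative (u t x ^ 3 * u3 t x + r t x)) (at t within {0..T}))"

lemma slice_cont: "continuous_on ({0..T} \<times> UNIV) (\<lambda>(t, x). f t x) \<Longrightarrow> t \<in> {0..T} \<Longrightarrow> continuous_on S (f t)"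
  by (rule continuous_on_compose2[of "{0..T} \<times> UNIV" "\<lambda>(t, x). f t x" S "\<lambda>x. (t, x)", simplified])
     (auto intro!: continuous_intros)

text \<open>In the order of the summands: the weight differentiated along \<open>u^3 u_xxx\<close>,
  the difference of the cubes multiplied by \<open>v_xxx\<close>, the weight differentiated along
  the residual, and the difference of the residuals.\<close>

definition stabA :: "real \<Rightarrow> real \<Rightarrow> real" where
  "stabA a B = 3 * B / a + 6 * B ^ 3 / a ^ 3 + 3 * B / a ^ 4 + 2 / a ^ 3"

definition stabD :: "real \<Rightarrow> real \<Rightarrow> real" where
  "stabD a B = 3 * B / a ^ 4 + 2 / a ^ 3"

definition stabC :: "real \<Rightarrow> real \<Rightarrow> real" where
  "stabC a B = stabA a B * B ^ 3 + 2 * stabD a B"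

lemma stab_nonneg:
  assumes "a > 0" "B \<ge> 1"
  shows "stabA a B \<ge> 0" "stabD a B \<ge> 0" "stabC a B \<ge> 0"
  using assms by (auto simp: stabA_def stabD_def stabC_def)

text \<open>Division by \<open>f^3\<close> reduces the leading term to \<open>2 w w_xxx\<close>, the
  derivative of \<open>2 w w_xx - (w_x)^2\<close>, which integrates to zero. The rest is quadratic
  in w and the residuals. The weight is built from f alone, so g enters through upper
  bounds.\<close>

lemma stability_space:
  fixes f f1 f2 f3 g g1 g2 g3 r r' :: "real \<Rightarrow> real" and \<rho> :: real
  assumes a: "a > 0" and B: "B \<ge> 1"
    and f: "\<forall>x. (f has_real_derivative f1 x) (at x) \<and> (f1 has_real_derivative f2 x) (at x) \<and> (f2 has_real_derivative f3 x) (at x)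
        \<and> f (x + L) = f x \<and> f1 (x + L) = f1 x \<and> f2 (x + L) = f2 x"
      and g: "\<forall>x. (g has_real_derivative g1 x) (at x) \<and> (g1 has_real_derivative g2 x) (at x) \<and> (g2 has_real_derivative g3 x) (at x)
        \<and> g (x + L) = g x \<and> g1 (x + L) = g1 x \<and> g2 (x + L) = g2 x"
      and b: "\<forall>x. a \<le> f x \<and> \<bar>f x\<bar> \<le> B \<and> \<bar>g x\<bar> \<le> B \<and> \<bar>f3 x\<bar> \<le> B \<and> \<bar>g3 x\<bar> \<le> B"
      and c3: "continuous_on {0..L} f3" "continuous_on {0..L} g3" "continuous_on {0..L} r" "continuous_on {0..L} r'"
      and ir: "integral {0..L} (\<lambda>x. (r x)\<^sup>2) \<le> \<rho>" "integral {0..L} (\<lambda>x. (r' x)\<^sup>2) \<le> \<rho>"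
  shows "integral {0..L} (\<lambda>x. - 3 * (f x ^ 3 * f3 x + r x) * (f x - g x)\<^sup>2 / f x ^ 4
        + 2 * (f x - g x) * (f x ^ 3 * f3 x + r x - (g x ^ 3 * g3 x + r' x)) / f x ^ 3)
     \<le> stabC a B * (integral {0..L} (\<lambda>x. (f x - g x)\<^sup>2 / f x ^ 3) + \<rho>)"
proof -
    let ?A = "stabA a B" and ?D = "stabD a B"
    note AD = stab_nonneg[OF a B]
    have df: "(f has_real_derivative f1 x) (at x)" "(f1 has_real_derivative f2 x) (at x)" "(f2 has_real_derivative f3 x) (at x)"
      "(g has_real_derivative g1 x) (at x)" "(g1 has_real_derivative g2 x) (at x)" "(g2 has_real_derivative g3 x) (at x)" for x
      using f g by blast+
    have fc: "continuous_on {0..L} f" "continuous_on {0..L} g"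
      by (rule DERIV_continuous_on, rule has_field_derivative_at_within, rule df)+
    have f0: "f x > 0" "f x \<noteq> 0" for x
    proof -
      have "a \<le> f x" using b by blast
      then show "f x > 0" "f x \<noteq> 0" using a by auto
    qed
    let ?w = "\<lambda>x. f x - g x"
    let ?P = "\<lambda>x. 2 * ?w x * (f2 x - g2 x) - (f1 x - g1 x)\<^sup>2"
    have P: "(?P has_real_derivative 2 * ?w x * (f3 x - g3 x)) (at x)" for x
      by (rule derivative_eq_intros df refl)+ (simp add: power2_eq_square algebra_simps)
    have fL: "f L = f 0" "f1 L = f1 0" "f2 L = f2 0" "g L = g 0" "g1 L = g1 0" "g2 L = g2 0"
      using f[rule_format, of 0] g[rule_format, of 0] by auto
    have per: "?P L = ?P 0" by (simp only: fL)
    have pw: "- 3 * (f x ^ 3 * f3 x + r x) * (?w x)\<^sup>2 / f x ^ 4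
        + 2 * ?w x * (f x ^ 3 * f3 x + r x - (g x ^ 3 * g3 x + r' x)) / f x ^ 3
      \<le> 2 * ?w x * (f3 x - g3 x) + (?A * (?w x)\<^sup>2 + ?D * ((r x)\<^sup>2 + (r' x)\<^sup>2))" for x
    proof -
      let ?W = "(?w x)\<^sup>2"
      have inv: "1 / f x \<le> 1 / a" "1 / f x ^ 3 \<le> 1 / a ^ 3" "1 / f x ^ 4 \<le> 1 / a ^ 4"
      proof -
        have ax: "a \<le> f x" using b by blast
        show "1 / f x \<le> 1 / a" using ax a f0(1)[of x] by (intro divide_left_mono) auto
        show "1 / f x ^ 3 \<le> 1 / a ^ 3" "1 / f x ^ 4 \<le> 1 / a ^ 4"
          using power_mono[OF ax, of 3] power_mono[OF ax, of 4] a f0(1)[of x] by (intro divide_left_mono; simp)+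
      qed
      have inv0: "0 \<le> 1 / f x" "0 \<le> 1 / f x ^ 3" "0 \<le> 1 / f x ^ 4" using f0(1)[of x] by auto
      have bb: "\<bar>f x\<bar> \<le> B" "\<bar>g x\<bar> \<le> B" "\<bar>f3 x\<bar> \<le> B" "\<bar>g3 x\<bar> \<le> B" using b by auto
      have t1: "- 3 * f3 x * (1 / f x) * ?W \<le> 3 * B / a * ?W"
      proof -
        have "\<bar>- 3 * f3 x * (1 / f x)\<bar> \<le> 3 * B * (1 / a)"
          by (rule abs_mult_le) (use bb inv inv0 in \<open>auto simp: abs_mult\<close>)
        then have "- 3 * f3 x * (1 / f x) \<le> 3 * B * (1 / a)" by (rule abs_le_D1)
        also have "\<dots> = 3 * B / a" by simp
        finally show ?thesis by (rule mult_right_mono) simp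
      qed
      have t2: "2 * ((f x)\<^sup>2 + f x * g x + (g x)\<^sup>2) * g3 x * (1 / f x ^ 3) * ?W \<le> 6 * B ^ 3 / a ^ 3 * ?W"
      proof -
        have "\<bar>f x * f x\<bar> \<le> B * B" "\<bar>f x * g x\<bar> \<le> B * B" "\<bar>g x * g x\<bar> \<le> B * B" by (intro abs_mult_le bb)+
        then have "\<bar>2 * ((f x)\<^sup>2 + f x * g x + (g x)\<^sup>2)\<bar> \<le> 6 * (B * B)"
          unfolding power2_eq_square by (rule abs_two_sum3_le)
        note abs_mult_le[OF this bb(4)]
        then have "\<bar>2 * ((f x)\<^sup>2 + f x * g x + (g x)\<^sup>2) * g3 x * (1 / f x ^ 3)\<bar> \<le> 6 * (B * B) * B * (1 / a ^ 3)"
          by (rule abs_mult_le) (use inv inv0 in auto)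
        then have "2 * ((f x)\<^sup>2 + f x * g x + (g x)\<^sup>2) * g3 x * (1 / f x ^ 3) \<le> 6 * (B * B) * B * (1 / a ^ 3)" by (rule abs_le_D1)
        also have "\<dots> = 6 * B ^ 3 / a ^ 3" by (simp add: power3_eq_cube)
        finally show ?thesis by (rule mult_right_mono) simp
      qed
      have t3: "- 3 * r x * (1 / f x ^ 4) * ?W \<le> 3 * B / a ^ 4 * ((r x)\<^sup>2 + ?W)"
      proof -
        \<comment> \<open>The term \<open>r w^2\<close> is cubic; bounding one factor w by 2 B
          leaves \<open>r w\<close>, to which Young's inequality applies.\<close>
        have "\<bar>?w x\<bar> \<le> 2 * B" using bb by auto
        then have "\<bar>(1 / f x ^ 4) * (?w x)\<bar> \<le> 1 / a ^ 4 * (2 * B)" by (rule abs_mult_le[rotated]) (use inv inv0 in auto)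
        then have "\<bar>(1 / f x ^ 4) * (?w x) * (r x * ?w x)\<bar> \<le> 1 / a ^ 4 * (2 * B) * \<bar>r x * ?w x\<bar>" by (rule abs_mult_le) simp
        also have "\<bar>r x * ?w x\<bar> \<le> ((r x)\<^sup>2 + ?W) / 2"
          using sum_squares_bound[of "\<bar>r x\<bar>" "\<bar>?w x\<bar>"] by (simp add: abs_mult)
        then have "1 / a ^ 4 * (2 * B) * \<bar>r x * ?w x\<bar> \<le> 1 / a ^ 4 * (2 * B) * (((r x)\<^sup>2 + ?W) / 2)"
          using a B by (intro mult_left_mono) auto
        finally have "\<bar>(1 / f x ^ 4) * (?w x) * (r x * ?w x)\<bar> \<le> B / a ^ 4 * ((r x)\<^sup>2 + ?W)" by simp
        then have "- ((1 / f x ^ 4) * (?w x) * (r x * ?w x)) \<le> B / a ^ 4 * ((r x)\<^sup>2 + ?W)" by (rule abs_le_D2)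
        then have "- 3 * ((1 / f x ^ 4) * (?w x) * (r x * ?w x)) \<le> 3 * (B / a ^ 4 * ((r x)\<^sup>2 + ?W))" by linarith
        also have "\<dots> = 3 * B / a ^ 4 * ((r x)\<^sup>2 + ?W)" by simp
        finally have "- 3 * ((1 / f x ^ 4) * (?w x) * (r x * ?w x)) \<le> 3 * B / a ^ 4 * ((r x)\<^sup>2 + ?W)" .
        moreover have "- 3 * r x * (1 / f x ^ 4) * ?W = - 3 * ((1 / f x ^ 4) * (?w x) * (r x * ?w x))"
          by (simp add: power2_eq_square)
        ultimately show ?thesis by (simp only:)
      qed
      have t4: "2 * ?w x * (r x - r' x) * (1 / f x ^ 3) \<le> 2 / a ^ 3 * (?W + (r x)\<^sup>2 + (r' x)\<^sup>2)"
      proof -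
        have "\<bar>2 * ?w x * (r x - r' x)\<bar> \<le> 2 * (?W + (r x)\<^sup>2 + (r' x)\<^sup>2)"
          by (rule two_mult_diff_le)
        then have "\<bar>2 * ?w x * (r x - r' x) * (1 / f x ^ 3)\<bar> \<le> 2 * (?W + (r x)\<^sup>2 + (r' x)\<^sup>2) * (1 / a ^ 3)"
          by (rule abs_mult_le) (use inv inv0 in auto)
        then have "2 * ?w x * (r x - r' x) * (1 / f x ^ 3) \<le> 2 * (?W + (r x)\<^sup>2 + (r' x)\<^sup>2) * (1 / a ^ 3)" by (rule abs_le_D1)
        also have "\<dots> = 2 / a ^ 3 * (?W + (r x)\<^sup>2 + (r' x)\<^sup>2)" by simp
        finally show ?thesis .
      qed
      have "- 3 * (f x ^ 3 * f3 x + r x) * ?W / f x ^ 4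
        + 2 * ?w x * (f x ^ 3 * f3 x + r x - (g x ^ 3 * g3 x + r' x)) / f x ^ 3
       = 2 * ?w x * (f3 x - g3 x) + (- 3 * f3 x * (1 / f x) * ?W + 2 * ((f x)\<^sup>2 + f x * g x + (g x)\<^sup>2) * g3 x * (1 / f x ^ 3) * ?W
        + - 3 * r x * (1 / f x ^ 4) * ?W + 2 * ?w x * (r x - r' x) * (1 / f x ^ 3))"
        using f0(2)[of x] by (simp add: field_simps eval_nat_numeral)
      also have "\<dots> \<le> 2 * ?w x * (f3 x - g3 x) + (3 * B / a * ?W + 6 * B ^ 3 / a ^ 3 * ?W + 3 * B / a ^ 4 * ((r x)\<^sup>2 + ?W) + 2 / a ^ 3 * (?W + (r x)\<^sup>2 + (r' x)\<^sup>2))"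
        using t1 t2 t3 t4 by linarith
      also have "\<dots> \<le> 2 * ?w x * (f3 x - g3 x) + (?A * ?W + ?D * ((r x)\<^sup>2 + (r' x)\<^sup>2))"
      proof -
        have "3 * B / a ^ 4 * (r' x)\<^sup>2 \<ge> 0" using a B by simp
        then show ?thesis unfolding stabA_def stabD_def by (simp add: distrib_left distrib_right)
      qed
      finally show ?thesis .
    qed
    have "integral {0..L} (\<lambda>x. - 3 * (f x ^ 3 * f3 x + r x) * (?w x)\<^sup>2 / f x ^ 4
        + 2 * ?w x * (f x ^ 3 * f3 x + r x - (g x ^ 3 * g3 x + r' x)) / f x ^ 3)
      \<le> integral {0..L} (\<lambda>x. 2 * ?w x * (f3 x - g3 x) + (?A * (?w x)\<^sup>2 + ?D * ((r x)\<^sup>2 + (r' x)\<^sup>2)))"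
      by (rule integral_le) (use pw f0 in \<open>auto intro!: integrable_continuous_real continuous_intros fc c3\<close>)
    also have "\<dots> = 0 + (?A * integral {0..L} (\<lambda>x. (?w x)\<^sup>2) + ?D * (integral {0..L} (\<lambda>x. (r x)\<^sup>2) + integral {0..L} (\<lambda>x. (r' x)\<^sup>2)))"
      by (rule integral_unique, intro has_integral_add has_integral_mult_right integral_deriv_periodic[OF P per])
         (auto intro!: integrable_integral integrable_continuous_real continuous_intros fc c3)
    also have "\<dots> \<le> ?A * (B ^ 3 * integral {0..L} (\<lambda>x. (?w x)\<^sup>2 / f x ^ 3)) + ?D * (\<rho> + \<rho>)"
    proof -
      have "integral {0..L} (\<lambda>x. (?w x)\<^sup>2) \<le> integral {0..L} (\<lambda>x. B ^ 3 * ((?w x)\<^sup>2 / f x ^ 3))"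
      proof (rule integral_le)
        show "(?w x)\<^sup>2 \<le> B ^ 3 * ((?w x)\<^sup>2 / f x ^ 3)" for x
        proof -
          have "f x ^ 3 \<le> B ^ 3" using b f0(1)[of x] by (intro power_mono) (auto simp: abs_le_iff)
          then have "1 \<le> B ^ 3 / f x ^ 3" using f0(1)[of x] by simp
          from mult_right_mono[OF this, of "(?w x)\<^sup>2"] show ?thesis by simp
        qed
      qed (use f0 in \<open>auto intro!: integrable_continuous_real continuous_intros fc\<close>)
      also have "\<dots> = B ^ 3 * integral {0..L} (\<lambda>x. (?w x)\<^sup>2 / f x ^ 3)" by (rule integral_mult_right)
      finally show ?thesis using AD ir by (simp add: add_mono mult_left_mono)
    qed
    also have "\<dots> \<le> stabC a B * (integral {0..L} (\<lambda>x. (?w x)\<^sup>2 / f x ^ 3) + \<rho>)"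
    proof -
      have "integral {0..L} (\<lambda>x. (?w x)\<^sup>2 / f x ^ 3) \<ge> 0"
        by (rule integral_nonneg) (use f0 in \<open>auto intro!: integrable_continuous_real continuous_intros fc simp: less_imp_le\<close>)
      moreover have "\<rho> \<ge> 0"
        by (rule order_trans[OF _ ir(1)]) (auto intro!: integral_nonneg integrable_continuous_real continuous_intros c3)
      ultimately have "0 \<le> ?A * B ^ 3 * \<rho>" "0 \<le> 2 * ?D * integral {0..L} (\<lambda>x. (?w x)\<^sup>2 / f x ^ 3)" using AD B by auto
      then show ?thesis by (simp add: stabC_def algebra_simps)
    qed
    finally show "integral {0..L} (\<lambda>x. - 3 * (f x ^ 3 * f3 x + r x) * (?w x)\<^sup>2 / f x ^ 4
        + 2 * ?w x * (f x ^ 3 * f3 x + r x - (g x ^ 3 * g3 x + r' x)) / f x ^ 3)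
      \<le> stabC a B * (integral {0..L} (\<lambda>x. (?w x)\<^sup>2 / f x ^ 3) + \<rho>)" .
qed

text \<open>The weighted estimate integrated in time. The constant is chosen before the solutions
  and residuals, since it is applied to whole families of approximations.\<close>

lemma stability:
  assumes a: "a > 0" and B: "B \<ge> 1" and T0: "T0 \<ge> 0"
  shows "\<exists>C\<ge>0. \<forall>T u u1 u2 u3 v v1 v2 v3 r r' \<rho>. classical_sol T u u1 u2 u3 r \<longrightarrow> classical_sol T v v1 v2 v3 r' \<longrightarrow> T \<le> T0 \<longrightarrow>
     (\<forall>t\<in>{0..T}. \<forall>x. a \<le> u t x \<and> \<bar>u t x\<bar> \<le> B \<and> \<bar>v t x\<bar> \<le> B \<and> \<bar>u3 t x\<bar> \<le> B \<and> \<bar>v3 t x\<bar> \<le> B) \<longrightarrow>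
     (\<forall>t\<in>{0..T}. integral {0..L} (\<lambda>x. (r t x)\<^sup>2) \<le> \<rho> \<and> integral {0..L} (\<lambda>x. (r' t x)\<^sup>2) \<le> \<rho>) \<longrightarrow>
     (\<forall>t\<in>{0..T}. integral {0..L} (\<lambda>x. (u t x - v t x)\<^sup>2) \<le> C * (integral {0..L} (\<lambda>x. (u 0 x - v 0 x)\<^sup>2) + \<rho>))"
proof -
  define C where "C = stabC a B"
  have C: "C \<ge> 0" using stab_nonneg[OF a B] by (simp add: C_def)
  \<comment> \<open>\<open>B ^ 3\<close> and \<open>1 / a ^ 3\<close> convert between the weighted
    and the plain mean square; the exponential is Gronwall's.\<close>
  define M where "M = B ^ 3 * (1 / a ^ 3 + 1) * exp (C * T0)"
  have M: "M \<ge> 0" using a B by (simp add: M_def)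
  show ?thesis
  proof (intro exI[of _ M] conjI allI impI ballI M)
    fix T u u1 u2 u3 v v1 v2 v3 r r' \<rho> t
    assume u: "classical_sol T u u1 u2 u3 r" and v: "classical_sol T v v1 v2 v3 r'" and T: "T \<le> T0"
      and b: "\<forall>t\<in>{0..T}. \<forall>x. a \<le> u t x \<and> \<bar>u t x\<bar> \<le> B \<and> \<bar>v t x\<bar> \<le> B \<and> \<bar>u3 t x\<bar> \<le> B \<and> \<bar>v3 t x\<bar> \<le> B"
      and ir: "\<forall>t\<in>{0..T}. integral {0..L} (\<lambda>x. (r t x)\<^sup>2) \<le> \<rho> \<and> integral {0..L} (\<lambda>x. (r' t x)\<^sup>2) \<le> \<rho>"
      and t: "t \<in> {0..T}"
    have u0: "u s x > 0" "u s x \<noteq> 0" if "s \<in> {0..T}" for s x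
    proof -
      have "a \<le> u s x" using b that by blast
      then show "u s x > 0" "u s x \<noteq> 0" using a by auto
    qed
    note cu = u[unfolded classical_sol_def] and cv = v[unfolded classical_sol_def]
    have jc: "continuous_on ({0..T} \<times> {0..L}) (\<lambda>p. u (fst p) (snd p))" "continuous_on ({0..T} \<times> {0..L}) (\<lambda>p. u3 (fst p) (snd p))"
       "continuous_on ({0..T} \<times> {0..L}) (\<lambda>p. r (fst p) (snd p))" "continuous_on ({0..T} \<times> {0..L}) (\<lambda>p. v (fst p) (snd p))"
       "continuous_on ({0..T} \<times> {0..L}) (\<lambda>p. v3 (fst p) (snd p))" "continuous_on ({0..T} \<times> {0..L}) (\<lambda>p. r' (fst p) (snd p))"
      using cu cv by (auto simp: case_prod_unfold intro: continuous_on_subset)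
    define e where "e t = integral {0..L} (\<lambda>x. (u t x - v t x)\<^sup>2 / u t x ^ 3)" for t
    define e' where "e' t = integral {0..L} (\<lambda>x. - 3 * (u t x ^ 3 * u3 t x + r t x) * (u t x - v t x)\<^sup>2 / u t x ^ 4
        + 2 * (u t x - v t x) * (u t x ^ 3 * u3 t x + r t x - (v t x ^ 3 * v3 t x + r' t x)) / u t x ^ 3)" for t
    have sc: "continuous_on {0..L} (u s)" "continuous_on {0..L} (u3 s)" "continuous_on {0..L} (r s)"
      "continuous_on {0..L} (v s)" "continuous_on {0..L} (v3 s)" "continuous_on {0..L} (r' s)" if "s \<in> {0..T}" for s
      using cu cv that slice_cont by blast+
    have d: "(e has_real_derivative e' s) (at s within {0..T})" if s: "s \<in> {0..T}" for s
      unfolding e_def[abs_def] e'_def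
    proof (rule integral_param_deriv[OF _ _ _ s])
      fix s x assume s: "s \<in> {0..T}"
      have du: "((\<lambda>t. u t x) has_real_derivative (u s x ^ 3 * u3 s x + r s x)) (at s within {0..T})" using cu s by blast
      have dv: "((\<lambda>t. v t x) has_real_derivative (v s x ^ 3 * v3 s x + r' s x)) (at s within {0..T})" using cv s by blast
      let ?U = "u s x ^ 3 * u3 s x + r s x" and ?V = "v s x ^ 3 * v3 s x + r' s x"
      have d3: "((\<lambda>t. u t x ^ 3) has_real_derivative 3 * (?U * u s x ^ 2)) (at s within {0..T})"
        using DERIV_power[OF du, of 3] by simp
      have d2: "((\<lambda>t. (u t x - v t x)\<^sup>2) has_real_derivative 2 * ((?U - ?V) * (u s x - v s x))) (at s within {0..T})"
        using DERIV_power[OF DERIV_diff[OF du dv], of 2] by simp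
      have ne: "u s x ^ 3 \<noteq> 0" using u0[OF s, of x] by simp
      have q: "(2 * ((U - V) * w) * y ^ 3 - w\<^sup>2 * (3 * (U * y ^ 2))) / (y ^ 3 * y ^ 3) = - 3 * U * w\<^sup>2 / y ^ 4 + 2 * w * (U - V) / y ^ 3"
        if "y \<noteq> 0" for U V w y :: real
        using that by (simp add: field_simps eval_nat_numeral)
      from DERIV_divide[OF d2 d3 ne, unfolded q[OF u0(2)[OF s, of x]]]
      have "((\<lambda>t. (u t x - v t x)\<^sup>2 / u t x ^ 3) has_real_derivative
        - 3 * ?U * (u s x - v s x)\<^sup>2 / u s x ^ 4 + 2 * (u s x - v s x) * (?U - ?V) / u s x ^ 3) (at s within {0..T})" .
      then show "((\<lambda>t. (u t x - v t x)\<^sup>2 / u t x ^ 3) has_real_derivative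
        - 3 * (u s x ^ 3 * u3 s x + r s x) * (u s x - v s x)\<^sup>2 / u s x ^ 4
        + 2 * (u s x - v s x) * (u s x ^ 3 * u3 s x + r s x - (v s x ^ 3 * v3 s x + r' s x)) / u s x ^ 3) (at s within {0..T})" .
    next
      show "continuous_on ({0..T} \<times> {0..L}) (\<lambda>(s, x). - 3 * (u s x ^ 3 * u3 s x + r s x) * (u s x - v s x)\<^sup>2 / u s x ^ 4
        + 2 * (u s x - v s x) * (u s x ^ 3 * u3 s x + r s x - (v s x ^ 3 * v3 s x + r' s x)) / u s x ^ 3)"
        unfolding case_prod_unfold by (intro continuous_intros jc) (use u0 in auto)
      show "continuous_on {0..L} (\<lambda>x. (u s x - v s x)\<^sup>2 / u s x ^ 3)" if "s \<in> {0..T}" for s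
        by (intro continuous_intros sc that) (use u0 that in auto)
    qed
    have le: "e' s \<le> C * (e s + \<rho>)" if s: "s \<in> {0..T}" for s
      unfolding e_def e'_def C_def
      by (rule stability_space[OF a B, where ?f1.0="u1 s" and ?f2.0="u2 s" and ?g1.0="v1 s" and ?g2.0="v2 s"])
        (use cu cv b ir s sc[OF s] in \<open>blast+\<close>)
    have rho: "\<rho> \<ge> 0"
    proof -
      have "0 \<le> integral {0..L} (\<lambda>x. (r t x)\<^sup>2)" by (auto intro!: integral_nonneg integrable_continuous_real continuous_intros sc t)
      then show ?thesis using ir t by fastforce
    qed
    have ui: "(\<lambda>x. (u s x - v s x)\<^sup>2) integrable_on {0..L}" "(\<lambda>x. (u s x - v s x)\<^sup>2 / u s x ^ 3) integrable_on {0..L}" if "s \<in> {0..T}" for s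
      using u0[OF that] by (auto intro!: integrable_continuous_real continuous_intros sc that)
    have "integral {0..L} (\<lambda>x. (u t x - v t x)\<^sup>2) \<le> integral {0..L} (\<lambda>x. B ^ 3 * ((u t x - v t x)\<^sup>2 / u t x ^ 3))"
    proof (rule integral_le)
      show "(u t x - v t x)\<^sup>2 \<le> B ^ 3 * ((u t x - v t x)\<^sup>2 / u t x ^ 3)" for x
      proof -
        have "u t x \<le> B" using b t by (meson abs_le_D1)
        then have "u t x ^ 3 \<le> B ^ 3" using u0[OF t, of x] by (intro power_mono) auto
        then have "1 \<le> B ^ 3 / u t x ^ 3" using u0[OF t, of x] by simp
        from mult_right_mono[OF this, of "(u t x - v t x)\<^sup>2"] show ?thesis by simp
      qed
    qed (use ui[OF t] integrable_on_cmult_left[OF ui(2)[OF t], of "B ^ 3"] in auto)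
    also have "\<dots> = B ^ 3 * e t" unfolding e_def by (rule integral_mult_right)
    also have "\<dots> \<le> B ^ 3 * ((e 0 + \<rho>) * exp (C * t))"
      using gronwall_within[OF d le t] rho B by (intro mult_left_mono) auto
    also have "\<dots> \<le> B ^ 3 * (((1 / a ^ 3 + 1) * (integral {0..L} (\<lambda>x. (u 0 x - v 0 x)\<^sup>2) + \<rho>)) * exp (C * T0))"
    proof -
      have z: "0 \<in> {0..T}" using t by simp
      have I0: "0 \<le> integral {0..L} (\<lambda>x. (u 0 x - v 0 x)\<^sup>2)" by (rule integral_nonneg[OF ui(1)[OF z]]) simp
      have "e 0 \<le> integral {0..L} (\<lambda>x. 1 / a ^ 3 * (u 0 x - v 0 x)\<^sup>2)"
        unfolding e_def
      proof (rule integral_le)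
        show "(u 0 x - v 0 x)\<^sup>2 / u 0 x ^ 3 \<le> 1 / a ^ 3 * (u 0 x - v 0 x)\<^sup>2" for x
        proof -
          have "a ^ 3 \<le> u 0 x ^ 3" using b z a by (intro power_mono) auto
          then have "1 / u 0 x ^ 3 \<le> 1 / a ^ 3" using a u0(1)[OF z, of x] by (intro divide_left_mono) auto
          from mult_right_mono[OF this, of "(u 0 x - v 0 x)\<^sup>2"] show ?thesis by simp
        qed
      qed (use ui[OF z] integrable_on_cmult_left[OF ui(1)[OF z], of "1 / a ^ 3"] in auto)
      also have "\<dots> = 1 / a ^ 3 * integral {0..L} (\<lambda>x. (u 0 x - v 0 x)\<^sup>2)" by (rule integral_mult_right)
      finally have e0: "e 0 + \<rho> \<le> (1 / a ^ 3 + 1) * (integral {0..L} (\<lambda>x. (u 0 x - v 0 x)\<^sup>2) + \<rho>)"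
        using I0 divide_nonneg_pos[OF rho zero_less_power[OF a, of 3]] by (simp add: distrib_left distrib_right)
      have "e 0 \<ge> 0" unfolding e_def by (rule integral_nonneg[OF ui(2)[OF z]]) (use u0[OF z] in \<open>simp add: less_imp_le\<close>)
      then have "(e 0 + \<rho>) * exp (C * t) \<le> ((1 / a ^ 3 + 1) * (integral {0..L} (\<lambda>x. (u 0 x - v 0 x)\<^sup>2) + \<rho>)) * exp (C * T0)"
        using e0 t T C rho by (intro mult_mono) (auto intro: mult_left_mono)
      then show ?thesis using B by (intro mult_left_mono) auto
    qed
    finally show "integral {0..L} (\<lambda>x. (u t x - v t x)\<^sup>2) \<le> M * (integral {0..L} (\<lambda>x. (u 0 x - v 0 x)\<^sup>2) + \<rho>)"
      by (simp add: M_def mult_ac)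
  qed
qed

end

section \<open>A priori bounds and existence for the regularised equation\<close>

definition rapid :: "(int \<Rightarrow> complex) \<Rightarrow> bool" where
  "rapid a \<longleftrightarrow> (\<forall>s. \<exists>C. bd s C a)"

lemma rapid_asum: "rapid a \<Longrightarrow> asum s a" unfolding rapid_def using bd_asum by blast

lemma rapid_hs: "rapid a \<Longrightarrow> hs n a" unfolding rapid_def using bd_hs by blast

lemma rapid_diff: "rapid a \<Longrightarrow> rapid b \<Longrightarrow> rapid (\<lambda>k. a k - b k)"
  unfolding rapid_def using bd_sub by blast

lemma hw_0 [simp]: "hw 0 k = 1" by (simp add: hw_def)

lemma summable_tail:
  fixes f :: "'a \<Rightarrow> real"
  assumes s: "f summable_on UNIV" and nn: "\<And>k. f k \<ge> 0" and "e > 0"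
  obtains F0 where "finite F0" "\<And>F. finite F \<Longrightarrow> F \<inter> F0 = {} \<Longrightarrow> (\<Sum>k\<in>F. f k) \<le> e"
proof -
  have "(f has_sum infsum f UNIV) UNIV" using s by simp
  then have "((\<lambda>F. \<Sum>k\<in>F. f k) \<longlongrightarrow> infsum f UNIV) (finite_subsets_at_top UNIV)" by (simp add: has_sum_def)
  then have "\<forall>\<^sub>F F in finite_subsets_at_top UNIV. (\<Sum>k\<in>F. f k) > infsum f UNIV - e"
    by (rule order_tendstoD(1)) (use assms in simp)
  then obtain F0 where F0: "finite F0" "(\<Sum>k\<in>F0. f k) > infsum f UNIV - e"
    unfolding eventually_finite_subsets_at_top by blast
  show thesis
  proof (rule that[OF F0(1)])
    fix F assume F: "finite F" "F \<inter> F0 = {}"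
    have "(\<Sum>k\<in>F. f k) + (\<Sum>k\<in>F0. f k) = (\<Sum>k\<in>F \<union> F0. f k)"
      by (rule sum.union_disjoint[symmetric]) (use F F0 in auto)
    also have "\<dots> \<le> infsum f UNIV" by (rule finite_sum_le_infsum[OF s]) (use F F0 nn in auto)
    finally show "(\<Sum>k\<in>F. f k) \<le> e" using F0(2) by simp
  qed
qed

text \<open>Interpolation without exponents: outside a finite set of frequencies Cauchy-Schwarz uses
  the small tail of the sum of \<open>1 / wt k ^ 2\<close> against the \<open>H^n\<close> bound, and
  on the finite set smallness of each coefficient suffices.\<close>

lemma asum_small:
  assumes s: "s + 1 \<le> n" and R: "R \<ge> 0" and \<eta>: "\<eta> > 0"
  obtains \<delta> where "\<delta> > 0" "\<And>d. hs n d \<Longrightarrow> hn n d \<le> R \<Longrightarrow> hn 0 d \<le> \<delta> \<Longrightarrow> (\<Sum>\<^sub>\<infinity>k. wt k ^ s * cmod (d k)) \<le> \<eta>"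
proof -
  \<comment> \<open>Tail size for which the Cauchy-Schwarz product
    \<open>e * (2 ^ n * (R + 1))\<close> is exactly \<open>(\<eta> / 2)\<^sup>2\<close>.\<close>
  define e where "e = (\<eta> / 2)\<^sup>2 / (2 ^ n * (R + 1))"
  have e: "e > 0" using R \<eta> by (simp add: e_def)
  obtain F0 where F0: "finite F0" "\<And>F. finite F \<Longrightarrow> F \<inter> F0 = {} \<Longrightarrow> (\<Sum>k\<in>F. 1 / wt k ^ 2) \<le> e"
    using summable_tail[OF summable_wt2 _ e] by auto
  define S0 where "S0 = (\<Sum>k\<in>F0. wt k ^ s) + 1"
  have S0: "S0 > 0" unfolding S0_def by (intro add_nonneg_pos sum_nonneg) (auto simp: wt_pos less_imp_le)
  define \<delta> where "\<delta> = (\<eta> / (2 * S0))\<^sup>2"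
  have \<delta>: "\<delta> > 0" using S0 \<eta> by (simp add: \<delta>_def)
  show thesis
  proof (rule that[OF \<delta>])
    fix d assume d: "hs n d" "hn n d \<le> R" "hn 0 d \<le> \<delta>"
    have h0: "hs 0 d" using hs_mono[OF d(1), of 0] by simp
    have "(\<Sum>k\<in>F. wt k ^ s * cmod (d k)) \<le> \<eta>" if F: "finite F" for F
    proof -
      have dk: "cmod (d k) \<le> \<eta> / (2 * S0)" for k
      proof (rule power2_le_imp_le)
        show "(cmod (d k))\<^sup>2 \<le> (\<eta> / (2 * S0))\<^sup>2" using hn_term_le[OF h0, of k] d(3) by (simp add: \<delta>_def)
      qed (use \<eta> S0 in simp)
      have "(\<Sum>k\<in>F \<inter> F0. wt k ^ s * cmod (d k)) \<le> (\<Sum>k\<in>F \<inter> F0. wt k ^ s * (\<eta> / (2 * S0)))"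
        by (intro sum_mono mult_left_mono dk) (simp add: wt_pos less_imp_le)
      also have "\<dots> = (\<Sum>k\<in>F \<inter> F0. wt k ^ s) * (\<eta> / (2 * S0))" by (rule sum_distrib_right[symmetric])
      also have "\<dots> \<le> S0 * (\<eta> / (2 * S0))"
      proof (rule mult_right_mono)
        have "(\<Sum>k\<in>F \<inter> F0. wt k ^ s) \<le> (\<Sum>k\<in>F0. wt k ^ s)" by (rule sum_mono2) (use F0 in \<open>auto simp: wt_pos less_imp_le\<close>)
        then show "(\<Sum>k\<in>F \<inter> F0. wt k ^ s) \<le> S0" by (simp add: S0_def)
      qed (use \<eta> S0 in simp)
      also have "\<dots> = \<eta> / 2" using S0 by simp
      finally have p1: "(\<Sum>k\<in>F \<inter> F0. wt k ^ s * cmod (d k)) \<le> \<eta> / 2" .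
      have "(\<Sum>k\<in>F - F0. wt k ^ s * cmod (d k))\<^sup>2 = (\<Sum>k\<in>F - F0. (1 / wt k) * (wt k ^ (s + 1) * cmod (d k)))\<^sup>2"
        using wt_pos by (intro arg_cong[of _ _ "\<lambda>x. x\<^sup>2"] sum.cong) (auto simp: less_imp_neq[THEN not_sym])
      also have "\<dots> \<le> (\<Sum>k\<in>F - F0. (1 / wt k)\<^sup>2) * (\<Sum>k\<in>F - F0. (wt k ^ (s + 1) * cmod (d k))\<^sup>2)"
        by (rule Cauchy_Schwarz_ineq_sum)
      also have "\<dots> \<le> e * (2 ^ n * (R + 1))"
      proof (rule mult_mono)
        show "(\<Sum>k\<in>F - F0. (1 / wt k)\<^sup>2) \<le> e" using F0(2)[of "F - F0"] F by (auto simp: power_divide)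
        have "(\<Sum>k\<in>F - F0. (wt k ^ (s + 1) * cmod (d k))\<^sup>2) \<le> (\<Sum>k\<in>F - F0. 2 ^ n * (hw n k * (cmod (d k))\<^sup>2))"
        proof (rule sum_mono)
          fix k
          have "(wt k ^ (s + 1))\<^sup>2 \<le> wt k ^ (2 * n)"
            unfolding power_mult[symmetric] using s by (intro wt_power_mono) simp
          also have "\<dots> \<le> 2 ^ n * hw n k" by (rule wt_le_hw)
          finally show "(wt k ^ (s + 1) * cmod (d k))\<^sup>2 \<le> 2 ^ n * (hw n k * (cmod (d k))\<^sup>2)"
            unfolding power_mult_distrib mult.assoc[symmetric] by (rule mult_right_mono) simp
        qed
        also have "\<dots> \<le> 2 ^ n * (R + 1)"
          unfolding sum_distrib_left[symmetric] using hn_finite_le[OF d(1), of "F - F0"] F d(2) by simp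
        finally show "(\<Sum>k\<in>F - F0. (wt k ^ (s + 1) * cmod (d k))\<^sup>2) \<le> 2 ^ n * (R + 1)" .
      qed (use e in \<open>auto intro!: sum_nonneg\<close>)
      also have "\<dots> = (\<eta> / 2)\<^sup>2" using R by (simp add: e_def)
      finally have "(\<Sum>k\<in>F - F0. wt k ^ s * cmod (d k)) \<le> \<eta> / 2" by (rule power2_le_imp_le) (use \<eta> in simp)
      moreover have "(\<Sum>k\<in>F. wt k ^ s * cmod (d k)) = (\<Sum>k\<in>F \<inter> F0. wt k ^ s * cmod (d k)) + (\<Sum>k\<in>F - F0. wt k ^ s * cmod (d k))"
        by (rule sum.Int_Diff[OF F])
      ultimately show ?thesis using p1 by simp
    qed
    moreover have "asum s d" by (rule hs_asum(1)[OF d(1) s])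
    ultimately show "(\<Sum>\<^sub>\<infinity>k. wt k ^ s * cmod (d k)) \<le> \<eta>" unfolding asum_def by (intro infsum_le_finite_sums) auto
  qed
qed

section \<open>Regularised solutions in physical space\<close>

context circle begin

lemma rapid_dd: "rapid a \<Longrightarrow> rapid (dd j a)" unfolding rapid_def using bd_dd by blast

lemma rapid_nl: "rapid a \<Longrightarrow> rapid (nl a)" unfolding rapid_def using bd_nl by blast

abbreviation fjet :: "(int \<Rightarrow> complex) \<Rightarrow> nat \<Rightarrow> real \<Rightarrow> real" where
  "fjet a \<equiv> (\<lambda>j. fser (dd j a))"

lemma jet_fjet: "rapid a \<Longrightarrow> jet (fjet a)"
  unfolding jet_def by (auto intro!: fser_deriv_dd rapid_asum)

lemma per_fjet: "per (fjet a)" by (simp add: per_def fser_periodic)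

lemma fser_nl:
  assumes "rapid a" "symm a"
  shows "fser (nl a) x = fser a x ^ 3 * fser (dd 3 a) x"
proof -
  have r: "rapid (conv p q)" if "rapid p" "rapid q" for p q using that unfolding rapid_def using bd_conv by blast
  have c: "fser (conv p q) x = fser p x * fser q x" if "rapid p" "rapid q" "symm p" "symm q" for p q
    by (rule fser_conv[where s=0 and r=0 and q=0]) (use that r rapid_asum in auto)
  note d = rapid_dd[OF assms(1), of 3] symm_dd[OF assms(2), of 3]
  have "fser (nl a) x = fser a x * (fser a x * (fser a x * fser (dd 3 a) x))"
    unfolding nl_def by (simp add: c r assms d symm_conv)
  then show ?thesis by (simp add: power3_eq_cube mult.assoc)
qed

lemma fjet_nl:
  assumes "rapid a" "symm a"
  shows "fser (dd j (nl a)) x = jmul (jpow (fjet a) 3) (\<lambda>i. fjet a (i + 3)) j x"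
proof -
  have "fjet (nl a) = jmul (jpow (fjet a) 3) (\<lambda>i. fjet a (i + 3))"
  proof (rule jet_eqI)
    show "fjet (nl a) 0 = jmul (jpow (fjet a) 3) (\<lambda>i. fjet a (i + 3)) 0"
      by (rule ext) (simp del: jpow.simps add: jpow_0 fser_nl[OF assms])
  qed (intro jet_fjet rapid_nl assms jet_jmul jet_jpow jet_shift[of "fjet a" 3])+
  then show ?thesis by metis
qed

lemma fser_scale: "fser (\<lambda>k. c *\<^sub>R a k) x = c * fser a x"
proof -
  have "fser (\<lambda>k. c *\<^sub>R a k) x = (\<Sum>\<^sub>\<infinity>k. c * Re (a k * cis (kap * real_of_int k * x)))"
    unfolding fser_def by (rule infsum_cong) (simp add: algebra_simps)
  also have "\<dots> = c * fser a x" unfolding fser_def by (rule infsum_cmult_right')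
  finally show ?thesis .
qed

text \<open>As the fourth power of the imaginary unit is 1, the damping multiplier is
  \<open>\<epsilon>\<close> times four derivatives.\<close>

lemma dd_lam: "dd j (\<lambda>k. lam \<epsilon> k *\<^sub>R a k) = (\<lambda>k. \<epsilon> *\<^sub>R dd (j + 4) a k)"
proof
  fix k
  have "(\<i> * complex_of_real (kap * real_of_int k)) ^ 4 = complex_of_real ((kap * real_of_int k) ^ 4)"
    by (simp add: power_mult_distrib)
  then show "dd j (\<lambda>k. lam \<epsilon> k *\<^sub>R a k) k = \<epsilon> *\<^sub>R dd (j + 4) a k"
    by (simp add: dd_def lam_def scaleR_conv_of_real power_add mult_ac)
qed

lemma fser_rhs:
  assumes "rapid a" "symm a"
  shows "fser (dd j (\<lambda>k. nl a k - lam \<epsilon> k *\<^sub>R a k)) x = jmul (jpow (fjet a) 3) (\<lambda>i. fjet a (i + 3)) j x - \<epsilon> * fjet a (j + 4) x"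
proof -
  have "fser (dd j (\<lambda>k. nl a k - lam \<epsilon> k *\<^sub>R a k)) x = fser (\<lambda>k. dd j (nl a) k - \<epsilon> *\<^sub>R dd (j + 4) a k) x"
    by (simp add: dd_diff dd_lam)
  also have "\<dots> = fser (dd j (nl a)) x - fser (\<lambda>k. \<epsilon> *\<^sub>R dd (j + 4) a k) x"
  proof (rule fser_diff[where s=0 and r=0])
    show "asum 0 (dd j (nl a))" by (intro rapid_asum rapid_dd rapid_nl assms)
    have "asum 0 (dd (j + 4) a)" by (intro rapid_asum rapid_dd assms)
    then show "asum 0 (\<lambda>k. \<epsilon> *\<^sub>R dd (j + 4) a k)"
      unfolding asum_def using summable_on_cmult_right[of "\<lambda>k. cmod (dd (j + 4) a k)" UNIV "\<bar>\<epsilon>\<bar>"] by simp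
  qed
  finally show ?thesis by (simp add: fjet_nl[OF assms] fser_scale)
qed

lemma bd_rhs:
  assumes "bd (s + 4) C a" and "\<epsilon> \<ge> 0"
  shows "bd s (kap ^ 3 * Zw ^ 3 * C ^ 4 + \<epsilon> * kap ^ 4 * C) (\<lambda>k. nl a k - lam \<epsilon> k *\<^sub>R a k)"
proof (rule bd_sub)
  show "bd s (kap ^ 3 * Zw ^ 3 * C ^ 4) (nl a)" by (rule bd_nl[OF bd_mono[OF assms(1)]]) auto
  have "bd s (kap ^ 4 * C) (dd 4 a)" by (rule bd_dd[OF assms(1)])
  then have "cmod (dd 4 a k) * wt k ^ s \<le> kap ^ 4 * C" for k by (simp add: bd_def)
  from mult_left_mono[OF this assms(2)] show "bd s (\<epsilon> * kap ^ 4 * C) (\<lambda>k. lam \<epsilon> k *\<^sub>R a k)"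
    using dd_lam[of 0 \<epsilon> a] assms(2) unfolding bd_def by (simp add: fun_eq_iff mult.assoc)
qed

lemma esol_rapid: "esol \<epsilon> \<tau> a \<Longrightarrow> t \<in> {0..\<tau>} \<Longrightarrow> rapid (a t)" unfolding esol_def rapid_def by blast
lemma esol_symm: "esol \<epsilon> \<tau> a \<Longrightarrow> t \<in> {0..\<tau>} \<Longrightarrow> symm (a t)" unfolding esol_def by blast

lemma esol_cont: "esol \<epsilon> \<tau> a \<Longrightarrow> continuous_on {0..\<tau>} (\<lambda>t. a t k)"
  unfolding esol_def continuous_on_eq_continuous_within by (blast intro: has_vector_derivative_continuous)

lemma esol_joint:
  assumes "esol \<epsilon> \<tau> a"
  shows "continuous_on ({0..\<tau>} \<times> U) (\<lambda>(t, x). fjet (a t) j x)"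
proof -
  obtain C where C: "\<And>t. t \<in> {0..\<tau>} \<Longrightarrow> bd (2 + j) C (a t)" using assms unfolding esol_def by blast
  show ?thesis
  proof (rule fser_cont_joint[where M="\<lambda>k. kap ^ j * C * (1 / wt k ^ 2)"])
    show "continuous_on {0..\<tau>} (\<lambda>t. dd j (a t) k)" for k
      unfolding dd_def by (intro continuous_intros esol_cont[OF assms])
    show "cmod (dd j (a t) k) \<le> kap ^ j * C * (1 / wt k ^ 2)" if "t \<in> {0..\<tau>}" for t k
      using bd_le[OF bd_dd[OF C[OF that]], of k] by simp
  qed (intro summable_on_cmult_right summable_wt2)
qed

lemma esol_deriv:
  assumes e: "esol \<epsilon> \<tau> a" and "\<epsilon> \<ge> 0" and t: "t \<in> {0..\<tau>}"
  shows "((\<lambda>t. fjet (a t) j x) has_real_derivative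
     (jmul (jpow (fjet (a t)) 3) (\<lambda>i. fjet (a t) (i + 3)) j x - \<epsilon> * fjet (a t) (j + 4) x)) (at t within {0..\<tau>})"
proof -
  obtain C where C: "\<And>t. t \<in> {0..\<tau>} \<Longrightarrow> bd (2 + j + 4) C (a t)" using e unfolding esol_def by blast
  define D where "D = kap ^ 3 * Zw ^ 3 * C ^ 4 + \<epsilon> * kap ^ 4 * C"
  let ?g = "\<lambda>t k. nl (a t) k - lam \<epsilon> k *\<^sub>R a t k"
  have D: "bd (2 + j) D (?g t)" if "t \<in> {0..\<tau>}" for t
    unfolding D_def by (rule bd_rhs[OF C[OF that] assms(2)])
  have "((\<lambda>t. \<Sum>\<^sub>\<infinity>k. Re (dd j (a t) k * cis (kap * real_of_int k * x))) has_real_derivative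
      (\<Sum>\<^sub>\<infinity>k. Re (dd j (?g t) k * cis (kap * real_of_int k * x)))) (at t within {0..\<tau>})"
  proof (rule has_real_derivative_infsum[where M="\<lambda>k. kap ^ j * D * (1 / wt k ^ 2)"])
    fix k s assume s: "s \<in> {0..\<tau>}"
    have "((\<lambda>t. a t k) has_vector_derivative ?g s k) (at s within {0..\<tau>})" using e s unfolding esol_def by blast
    then have "((\<lambda>t. (\<i> * complex_of_real (kap * real_of_int k)) ^ j * cis (kap * real_of_int k * x) * a t k) has_vector_derivative
        ((\<i> * complex_of_real (kap * real_of_int k)) ^ j * cis (kap * real_of_int k * x) * ?g s k)) (at s within {0..\<tau>})"
      by (rule has_vector_derivative_mult_right)
    then have "((\<lambda>t. Re ((\<i> * complex_of_real (kap * real_of_int k)) ^ j * cis (kap * real_of_int k * x) * a t k)) has_real_derivative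
        Re ((\<i> * complex_of_real (kap * real_of_int k)) ^ j * cis (kap * real_of_int k * x) * ?g s k)) (at s within {0..\<tau>})"
      unfolding has_vector_derivative_complex_iff by blast
    then show "((\<lambda>t. Re (dd j (a t) k * cis (kap * real_of_int k * x))) has_real_derivative
        Re (dd j (?g s) k * cis (kap * real_of_int k * x))) (at s within {0..\<tau>})"
      by (simp only: dd_def mult_ac)
    have "\<bar>Re (dd j (?g s) k * cis (kap * real_of_int k * x))\<bar> \<le> cmod (dd j (?g s) k)" by (rule fser_term_le)
    also have "\<dots> \<le> kap ^ j * D * (1 / wt k ^ 2)" using bd_le[OF bd_dd[OF D[OF s]], of k] by simp
    finally show "\<bar>Re (dd j (?g s) k * cis (kap * real_of_int k * x))\<bar> \<le> kap ^ j * D * (1 / wt k ^ 2)" .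
  next
    fix s assume "s \<in> {0..\<tau>}"
    then show "(\<lambda>k. Re (dd j (a s) k * cis (kap * real_of_int k * x))) summable_on UNIV"
      by (intro fser_summable[of 0] rapid_asum rapid_dd esol_rapid[OF e])
  next
    show "(\<lambda>k. kap ^ j * D * (1 / wt k ^ 2)) summable_on UNIV" by (intro summable_on_cmult_right summable_wt2)
  qed (use t in auto)
  then have "((\<lambda>t. fjet (a t) j x) has_real_derivative fser (dd j (?g t)) x) (at t within {0..\<tau>})"
    unfolding fser_def .
  then show ?thesis unfolding fser_rhs[OF esol_rapid[OF e t] esol_symm[OF e t]] .
qed

definition cN :: "nat \<Rightarrow> real" where "cN n = 2 ^ n * (1 + 1 / kap ^ (2 * n)) / L"

lemma cN_pos: "cN n > 0" unfolding cN_def using kap_pos L_pos by (simp add: add_pos_pos)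

lemma int_sq_eq: "rapid a \<Longrightarrow> symm a \<Longrightarrow> integral {0..L} (\<lambda>x. (fser a x)\<^sup>2) = L * hn 0 a"
proof -
  assume r: "rapid a" and s: "symm a"
  have "((\<lambda>k. L * (cmod (a k))\<^sup>2) has_sum integral {0..L} (\<lambda>x. (fser a x)\<^sup>2)) UNIV"
    by (rule parseval[OF rapid_asum[OF r, of 0] s])
  then have "integral {0..L} (\<lambda>x. (fser a x)\<^sup>2) = (\<Sum>\<^sub>\<infinity>k. L * (cmod (a k))\<^sup>2)" by (simp add: infsumI)
  then show ?thesis by (simp add: hn_def infsum_cmult_right')
qed

text \<open>By \<open>hw_le\<close> the weight of order n is at most
  \<open>2 ^ n * (1 + k ^ (2 * n))\<close>; Parseval for a and for its n-th derivative does the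
  rest. \<open>cN\<close> collects the factors.\<close>

lemma hn_le_int:
  assumes r: "rapid a" and s: "symm a"
  shows "hn n a \<le> cN n * (integral {0..L} (\<lambda>x. (fser a x)\<^sup>2) + integral {0..L} (\<lambda>x. (fser (dd n a) x)\<^sup>2))"
proof -
  have k: "kap ^ (2 * n) > 0" using kap_pos by simp
  have h0: "hs 0 a" "hs 0 (dd n a)" by (intro rapid_hs r rapid_dd)+
  have "(\<Sum>k\<in>F. hw n k * (cmod (a k))\<^sup>2) \<le> 2 ^ n * (hn 0 a + 1 / kap ^ (2 * n) * hn 0 (dd n a))" if F: "finite F" for F
  proof -
    have "(\<Sum>k\<in>F. hw n k * (cmod (a k))\<^sup>2) \<le> (\<Sum>k\<in>F. 2 ^ n * (hw 0 k * (cmod (a k))\<^sup>2 + 1 / kap ^ (2 * n) * (hw 0 k * (cmod (dd n a k))\<^sup>2)))"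
    proof (rule sum_mono)
      fix j
      have "(cmod (dd n a j))\<^sup>2 = kap ^ (2 * n) * (real_of_int j ^ (2 * n) * (cmod (a j))\<^sup>2)"
        by (simp add: cmod_dd power_mult_distrib power_mult[symmetric] mult.commute[of n 2] power_even_abs)
      then have "real_of_int j ^ (2 * n) * (cmod (a j))\<^sup>2 = 1 / kap ^ (2 * n) * (cmod (dd n a j))\<^sup>2" using kap_pos by simp
      moreover have "hw n j * (cmod (a j))\<^sup>2 \<le> 2 ^ n * (1 + real_of_int j ^ (2 * n)) * (cmod (a j))\<^sup>2"
        by (intro mult_right_mono hw_le) simp
      ultimately show "hw n j * (cmod (a j))\<^sup>2 \<le> 2 ^ n * (hw 0 j * (cmod (a j))\<^sup>2 + 1 / kap ^ (2 * n) * (hw 0 j * (cmod (dd n a j))\<^sup>2))"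
        by (simp add: distrib_left distrib_right mult.assoc)
    qed
    also have "\<dots> = 2 ^ n * ((\<Sum>k\<in>F. hw 0 k * (cmod (a k))\<^sup>2) + 1 / kap ^ (2 * n) * (\<Sum>k\<in>F. hw 0 k * (cmod (dd n a k))\<^sup>2))"
      by (simp only: sum_distrib_left[symmetric] sum.distrib)
    also have "\<dots> \<le> 2 ^ n * (hn 0 a + 1 / kap ^ (2 * n) * hn 0 (dd n a))"
      using hn_finite_le[OF h0(1) F] hn_finite_le[OF h0(2) F] k by (intro mult_left_mono add_mono) auto
    finally show ?thesis .
  qed
  then have "hn n a \<le> 2 ^ n * (hn 0 a + 1 / kap ^ (2 * n) * hn 0 (dd n a))" by (rule hs_I(2))
  also have "\<dots> \<le> 2 ^ n * ((1 + 1 / kap ^ (2 * n)) * (hn 0 a + hn 0 (dd n a)))"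
  proof (rule mult_left_mono)
    have "0 \<le> 1 / kap ^ (2 * n) * hn 0 a" using k hn_nonneg[of 0 a] by (intro mult_nonneg_nonneg) auto
    then show "hn 0 a + 1 / kap ^ (2 * n) * hn 0 (dd n a) \<le> (1 + 1 / kap ^ (2 * n)) * (hn 0 a + hn 0 (dd n a))"
      using hn_nonneg[of 0 "dd n a"] by (simp only: distrib_left distrib_right)
  qed simp
  also have "\<dots> = cN n * (L * hn 0 a + L * hn 0 (dd n a))" using L_pos unfolding cN_def by (simp add: field_simps)
  finally show ?thesis by (simp only: int_sq_eq r s rapid_dd symm_dd)
qed

lemma int_le_hn:
  assumes r: "rapid a" and s: "symm a"
  shows "integral {0..L} (\<lambda>x. (fser a x)\<^sup>2) \<le> L * hn n a"
    "integral {0..L} (\<lambda>x. (fser (dd n a) x)\<^sup>2) \<le> L * kap ^ (2 * n) * hn n a"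
proof -
  have hsn: "hs n a" by (rule rapid_hs[OF r])
  have "hn 0 a \<le> hn n a" using hs_mono(2)[OF hsn, of 0] by simp
  then show "integral {0..L} (\<lambda>x. (fser a x)\<^sup>2) \<le> L * hn n a" using L_pos by (simp add: int_sq_eq r s)
  have "hn 0 (dd n a) \<le> kap ^ (2 * n) * hn n a"
  proof (rule hs_I(2))
    fix F :: "int set" assume F: "finite F"
    have "(\<Sum>k\<in>F. hw 0 k * (cmod (dd n a k))\<^sup>2) \<le> (\<Sum>k\<in>F. kap ^ (2 * n) * (hw n k * (cmod (a k))\<^sup>2))"
    proof (rule sum_mono)
      fix j
      have "(cmod (dd n a j))\<^sup>2 = kap ^ (2 * n) * (((real_of_int j)\<^sup>2) ^ n * (cmod (a j))\<^sup>2)"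
        by (simp add: cmod_dd power_mult_distrib power_mult[symmetric] mult.commute[of n 2] power_even_abs)
      moreover have "((real_of_int j)\<^sup>2) ^ n \<le> hw n j" unfolding hw_def by (intro power_mono) auto
      ultimately show "hw 0 j * (cmod (dd n a j))\<^sup>2 \<le> kap ^ (2 * n) * (hw n j * (cmod (a j))\<^sup>2)"
        using kap_pos by (simp add: mult_left_mono mult_right_mono)
    qed
    also have "\<dots> \<le> kap ^ (2 * n) * hn n a"
      unfolding sum_distrib_left[symmetric] using hn_finite_le[OF hsn F] kap_pos by (intro mult_left_mono) auto
    finally show "(\<Sum>k\<in>F. hw 0 k * (cmod (dd n a k))\<^sup>2) \<le> kap ^ (2 * n) * hn n a" .
  qed
  from mult_left_mono[OF this less_imp_le[OF L_pos]]
  show "integral {0..L} (\<lambda>x. (fser (dd n a) x)\<^sup>2) \<le> L * kap ^ (2 * n) * hn n a"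
    by (simp add: int_sq_eq[OF rapid_dd[OF r] symm_dd[OF s]] mult.assoc)
qed

text \<open>A single number for everything that \<open>hn n a \<le> R\<close> controls: all
  derivatives below order n uniformly, and the mean squares of orders 0 and n. The base 1 + kap
  makes the power monotone in the order.\<close>

definition Bc :: "nat \<Rightarrow> real \<Rightarrow> real" where
  "Bc n R = 1 + (1 + kap) ^ n * sqrt (2 ^ n * Zw * R) + L * kap ^ (2 * n) * R + L * R"

lemma Bc_ge1: "R \<ge> 0 \<Longrightarrow> Bc n R \<ge> 1"
  unfolding Bc_def using kap_pos L_pos Zw_nonneg by simp

lemma fjet_le_Bc:
  assumes h: "hs n a" and R: "hn n a \<le> R" and j: "j < n"
  shows "\<bar>fjet a j x\<bar> \<le> Bc n R"
proof -
  have R0: "R \<ge> 0" using hn_nonneg[of n a] R by linarith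
  have "\<bar>fjet a j x\<bar> \<le> kap ^ j * sqrt (2 ^ n * Zw * hn n a)" by (rule fser_dd_le[OF h]) (use j in simp)
  also have "\<dots> \<le> (1 + kap) ^ n * sqrt (2 ^ n * Zw * R)"
  proof (rule mult_mono)
    have "kap ^ j \<le> (1 + kap) ^ j" using kap_pos by (intro power_mono) auto
    also have "\<dots> \<le> (1 + kap) ^ n" using kap_pos j by (intro power_increasing) auto
    finally show "kap ^ j \<le> (1 + kap) ^ n" .
    show "sqrt (2 ^ n * Zw * hn n a) \<le> sqrt (2 ^ n * Zw * R)"
      using R Zw_nonneg by (intro real_sqrt_le_mono mult_left_mono) auto
  qed (use kap_pos Zw_nonneg hn_nonneg[of n a] in auto)
  also have "\<dots> \<le> Bc n R" unfolding Bc_def using R0 L_pos kap_pos by simp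
  finally show ?thesis .
qed

lemma bnd_fjet:
  assumes r: "rapid a" and s: "symm a" and R: "hn n a \<le> R"
  shows "bnd n (Bc n R) (fjet a)"
proof -
  have R0: "R \<ge> 0" using hn_nonneg[of n a] R by linarith
  have "integral {0..L} (\<lambda>x. (fser (dd n a) x)\<^sup>2) \<le> L * kap ^ (2 * n) * hn n a" by (rule int_le_hn(2)[OF r s])
  also have "\<dots> \<le> L * kap ^ (2 * n) * R" using R L_pos kap_pos by (intro mult_left_mono) auto
  also have "\<dots> \<le> Bc n R" unfolding Bc_def using R0 L_pos kap_pos Zw_nonneg by simp
  finally show ?thesis unfolding bnd_def supb_def
    using jet_fjet[OF r] per_fjet fjet_le_Bc[OF rapid_hs[OF r] R] by blast
qed

end

text \<open>If h reached 1, there would be a first such time m; before it h stays at most 1, and the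
  assumption applied at m gives h m < 1.\<close>

lemma continuity_method:
  fixes h :: "real \<Rightarrow> real"
  assumes c: "continuous_on {0..\<tau>} h" and h0: "h 0 < 1"
    and step: "\<And>t. t \<in> {0..\<tau>} \<Longrightarrow> (\<And>s. s \<in> {0..t} \<Longrightarrow> h s \<le> 1) \<Longrightarrow> h t < 1" and t: "t \<in> {0..\<tau>}"
  shows "h t < 1"
proof (rule ccontr)
  assume nt: "\<not> h t < 1"
  define S where "S = {s \<in> {0..t}. h s = 1}"
  have ct: "continuous_on {0..t} h" by (rule continuous_on_subset[OF c]) (use t in auto)
  have ne: "S \<noteq> {}"
    using IVT'[of h 0 1 t] h0 nt t ct by (auto simp: S_def)
  have "closed S" unfolding S_def
    using continuous_closed_preimage_constant[OF ct, of 1] by simp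
  then have "compact S" unfolding S_def by (intro compact_Int_closed[of "{0..t}" S, unfolded S_def, simplified] | auto simp: compact_eq_bounded_closed intro: bounded_subset[of "{0..t}"])
  then obtain m where m: "m \<in> S" "\<And>s. s \<in> S \<Longrightarrow> m \<le> s" using compact_attains_inf[of S] ne by blast
  have mt: "m \<in> {0..t}" "h m = 1" using m(1) by (auto simp: S_def)
  have "h s \<le> 1" if s: "s \<in> {0..m}" for s
  proof (rule ccontr)
    assume "\<not> h s \<le> 1"
    moreover have "continuous_on {0..s} h" by (rule continuous_on_subset[OF ct]) (use s mt in auto)
    ultimately obtain x where x: "0 \<le> x" "x \<le> s" "h x = 1" using IVT'[of h 0 1 s] h0 s by auto
    then have "x \<in> S" using s mt by (auto simp: S_def)
    then have "x = s" using m(2)[of x] x s by auto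
    then show False using x \<open>\<not> h s \<le> 1\<close> by simp
  qed
  then have "h m < 1" using mt t by (intro step) auto
  then show False using mt by simp
qed

lemma continuous_on_jmul_joint:
  assumes "\<And>j. continuous_on S (\<lambda>p. f p j (X p))" "\<And>j. continuous_on S (\<lambda>p. g p j (X p))"
  shows "continuous_on S (\<lambda>p. jmul (f p) (g p) n (X p))"
  unfolding jmul_leibniz by (intro continuous_intros assms)

lemma continuous_on_jpow_joint:
  assumes "\<And>j. continuous_on S (\<lambda>p. f p j (X p))"
  shows "continuous_on S (\<lambda>p. jpow (f p) m j (X p))"
proof (induction m arbitrary: j)
  case (Suc m)
  then show ?case unfolding jpow.simps by (intro continuous_on_jmul_joint assms)
qed auto

context circle begin

abbreviation erhs :: "real \<Rightarrow> (int \<Rightarrow> complex) \<Rightarrow> nat \<Rightarrow> real \<Rightarrow> real" where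
  "erhs \<epsilon> a j x \<equiv> jmul (jpow (fjet a) 3) (\<lambda>i. fjet a (i + 3)) j x - \<epsilon> * fjet a (j + 4) x"

lemma esol_joint': "esol \<epsilon> \<tau> a \<Longrightarrow> continuous_on ({0..\<tau>} \<times> U) (\<lambda>p. fjet (a (fst p)) j (snd p))"
  using esol_joint[of \<epsilon> \<tau> a U j] by (simp add: case_prod_unfold)

lemma erhs_0: "erhs \<epsilon> a 0 x = fjet a 0 x ^ 3 * fjet a 3 x - \<epsilon> * fjet a 4 x"
  by (simp add: jpow_0 del: jpow.simps)

text \<open>The time derivative of this energy is the integrand of
  \<open>weighted_energy_bound\<close> with the jets of the solution and of \<open>\<gamma>\<close>.
  The choice \<open>\<gamma> = 0\<close> gives the a priori bound, a truncation of the data gives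
  continuity at time 0.\<close>

lemma shifted_energy:
  assumes n: "n \<ge> 4" and b: "b > 0" and R: "R \<ge> 0" and \<Gamma>: "\<Gamma> \<ge> 0"
  shows "\<exists>C\<ge>0. \<forall>\<epsilon> \<tau> a \<gamma>. 0 \<le> \<epsilon> \<longrightarrow> \<epsilon> \<le> 1 \<longrightarrow> esol \<epsilon> \<tau> a \<longrightarrow>
     (\<forall>t\<in>{0..\<tau>}. hn n (a t) \<le> R \<and> (\<forall>x. b \<le> fser (a t) x)) \<longrightarrow> rapid \<gamma> \<longrightarrow> supb (n + 5) \<Gamma> (fjet \<gamma>) \<longrightarrow>
     (\<forall>t\<in>{0..\<tau>}. integral {0..L} (\<lambda>x. fser (a t) x ^ (2 * n - 3) * (fjet (a t) n x - fjet \<gamma> n x)\<^sup>2)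
        \<le> integral {0..L} (\<lambda>x. fser (a 0) x ^ (2 * n - 3) * (fjet (a 0) n x - fjet \<gamma> n x)\<^sup>2) + C * t)"
proof -
  define B where "B = Bc n R + \<Gamma>"
  have B: "B \<ge> 1" "Bc n R \<le> B" "\<Gamma> \<le> B" using Bc_ge1[OF R, of n] \<Gamma> by (auto simp: B_def)
  from weighted_energy_bound[OF n b B(1)] obtain C0 where C0: "\<forall>f G \<epsilon>. bnd n B f \<longrightarrow> (\<forall>x. b \<le> f 0 x) \<longrightarrow> jet G \<longrightarrow> per G \<longrightarrow> supb (n + 5) B G \<longrightarrow> 0 \<le> \<epsilon> \<longrightarrow> \<epsilon> \<le> 1 \<longrightarrow>
    integral {0..L} (\<lambda>x. real (2 * n - 3) * f 0 x ^ (2 * n - 4) * (f 0 x ^ 3 * f 3 x - \<epsilon> * f 4 x) * (f n x - G n x)\<^sup>2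
      + 2 * f 0 x ^ (2 * n - 3) * (f n x - G n x) * (jmul (jpow f 3) (\<lambda>j. f (j + 3)) n x - \<epsilon> * f (n + 4) x)) \<le> C0"
    by (elim exE)
  show ?thesis
  proof (intro exI[of _ "max 0 C0"] conjI allI impI ballI)
    fix \<epsilon> \<tau> a \<gamma> t
    assume \<epsilon>: "0 \<le> \<epsilon>" "\<epsilon> \<le> 1" and e: "esol \<epsilon> \<tau> a"
      and h: "\<forall>t\<in>{0..\<tau>}. hn n (a t) \<le> R \<and> (\<forall>x. b \<le> fser (a t) x)"
      and \<gamma>: "rapid \<gamma>" "supb (n + 5) \<Gamma> (fjet \<gamma>)" and t: "t \<in> {0..\<tau>}"
    let ?F = "\<lambda>t x. fser (a t) x ^ (2 * n - 3) * (fjet (a t) n x - fjet \<gamma> n x)\<^sup>2"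
    let ?F' = "\<lambda>t x. real (2 * n - 3) * fjet (a t) 0 x ^ (2 * n - 4) * (fjet (a t) 0 x ^ 3 * fjet (a t) 3 x - \<epsilon> * fjet (a t) 4 x) * (fjet (a t) n x - fjet \<gamma> n x)\<^sup>2
      + 2 * fjet (a t) 0 x ^ (2 * n - 3) * (fjet (a t) n x - fjet \<gamma> n x) * (jmul (jpow (fjet (a t)) 3) (\<lambda>j. fjet (a t) (j + 3)) n x - \<epsilon> * fjet (a t) (n + 4) x)"
    have jg: "jet (fjet \<gamma>)" by (rule jet_fjet[OF \<gamma>(1)])
    have cg: "continuous_on ({0..\<tau>} \<times> {0..L}) (\<lambda>p. fjet \<gamma> n (snd p))"
      by (rule continuous_on_compose2[OF jet_cont[OF jg, of UNIV] continuous_on_snd[OF continuous_on_id]]) auto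
    have "integral {0..L} (?F t) \<le> integral {0..L} (?F 0) + max 0 C0 * t"
    proof (rule within_derivative_mvt[OF _ _ t])
      fix s assume s: "s \<in> {0..\<tau>}"
      show "((\<lambda>t. integral {0..L} (?F t)) has_real_derivative integral {0..L} (?F' s)) (at s within {0..\<tau>})"
      proof (rule integral_param_deriv[OF _ _ _ s])
        fix s x assume s: "s \<in> {0..\<tau>}"
        have d0: "((\<lambda>t. fser (a t) x) has_real_derivative (fjet (a s) 0 x ^ 3 * fjet (a s) 3 x - \<epsilon> * fjet (a s) 4 x)) (at s within {0..\<tau>})"
          using esol_deriv[OF e \<epsilon>(1) s, of 0 x] unfolding erhs_0 by simp
        note dn = esol_deriv[OF e \<epsilon>(1) s, of n x]
        have e1: "2 * n - 3 - Suc 0 = 2 * n - 4" by simp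
        have "((\<lambda>t. fser (a t) x ^ (2 * n - 3) * (fjet (a t) n x - fjet \<gamma> n x)\<^sup>2) has_real_derivative
           real (2 * n - 3) * ((fjet (a s) 0 x ^ 3 * fjet (a s) 3 x - \<epsilon> * fjet (a s) 4 x) * fser (a s) x ^ (2 * n - 3 - Suc 0)) * (fjet (a s) n x - fjet \<gamma> n x)\<^sup>2
           + real 2 * ((erhs \<epsilon> (a s) n x - 0) * (fjet (a s) n x - fjet \<gamma> n x) ^ (2 - Suc 0)) * fser (a s) x ^ (2 * n - 3)) (at s within {0..\<tau>})"
          by (intro DERIV_mult DERIV_power DERIV_diff DERIV_const d0 dn)
        moreover have "real (2 * n - 3) * ((fjet (a s) 0 x ^ 3 * fjet (a s) 3 x - \<epsilon> * fjet (a s) 4 x) * fser (a s) x ^ (2 * n - 3 - Suc 0)) * (fjet (a s) n x - fjet \<gamma> n x)\<^sup>2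
           + real 2 * ((erhs \<epsilon> (a s) n x - 0) * (fjet (a s) n x - fjet \<gamma> n x) ^ (2 - Suc 0)) * fser (a s) x ^ (2 * n - 3) = ?F' s x"
          unfolding e1 by (simp add: mult_ac)
        ultimately show "((\<lambda>t. ?F t x) has_real_derivative ?F' s x) (at s within {0..\<tau>})" by (simp only:)
      next
        show "continuous_on ({0..\<tau>} \<times> {0..L}) (\<lambda>(t, x). ?F' t x)"
          unfolding case_prod_unfold
          by (intro continuous_intros esol_joint'[OF e] cg continuous_on_jmul_joint[where X=snd] continuous_on_jpow_joint[where X=snd])
        show "continuous_on {0..L} (?F s)" if "s \<in> {0..\<tau>}" for s
        proof -
          have js: "jet (fjet (a s))" by (rule jet_fjet[OF esol_rapid[OF e that]])
          show ?thesis using jet_cont[OF js, of "{0..L}" 0] jet_cont[OF js, of "{0..L}" n] jet_cont[OF jg, of "{0..L}" n]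
            by (intro continuous_intros) simp_all
        qed
      qed
      have bs: "bnd n B (fjet (a s))"
        by (rule bnd_mono[OF bnd_fjet[OF esol_rapid[OF e s] esol_symm[OF e s]] B(2)]) (use h s in blast)
      have "integral {0..L} (?F' s) \<le> C0"
        by (rule C0[rule_format, OF bs _ jg per_fjet supb_mono[OF \<gamma>(2) order_refl B(3)] \<epsilon>]) (use h s in simp)
      then show "integral {0..L} (?F' s) \<le> max 0 C0" by simp
    qed
    then show "integral {0..L} (?F t) \<le> integral {0..L} (?F 0) + max 0 C0 * t" .
  qed simp
qed

text \<open>Under the \<open>H^n\<close> bound the right-hand side of the equation is bounded in
  mean square, so the squared distance from the initial value grows at most linearly. With
  \<open>fser_small\<close> this keeps the solution away from zero.\<close>

lemma L2_growth:
  assumes n: "n \<ge> 4" and R: "R \<ge> 0"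
  shows "\<exists>C\<ge>0. \<forall>\<epsilon> \<tau> a. 0 \<le> \<epsilon> \<longrightarrow> \<epsilon> \<le> 1 \<longrightarrow> esol \<epsilon> \<tau> a \<longrightarrow> (\<forall>t\<in>{0..\<tau>}. hn n (a t) \<le> R) \<longrightarrow>
     (\<forall>t\<in>{0..\<tau>}. integral {0..L} (\<lambda>x. (fser (a t) x - fser (a 0) x)\<^sup>2) \<le> C * t)"
proof -
  define B where "B = Bc n R"
  have B: "B \<ge> 1" using Bc_ge1[OF R] by (simp add: B_def)
  define C where "C = L * (4 * B\<^sup>2 + 2 * (B ^ 3 * B)\<^sup>2) + 2 * (L * B\<^sup>2 + B)"
  have C: "C \<ge> 0" using L_pos B by (simp add: C_def)
  show ?thesis
  proof (intro exI[of _ C] conjI allI impI ballI C)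
    fix \<epsilon> \<tau> a t
    assume \<epsilon>: "0 \<le> \<epsilon>" "\<epsilon> \<le> 1" and e: "esol \<epsilon> \<tau> a" and h: "\<forall>t\<in>{0..\<tau>}. hn n (a t) \<le> R" and t: "t \<in> {0..\<tau>}"
    let ?F = "\<lambda>t x. (fser (a t) x - fser (a 0) x)\<^sup>2"
    let ?g = "\<lambda>t x. fjet (a t) 0 x ^ 3 * fjet (a t) 3 x - \<epsilon> * fjet (a t) 4 x"
    let ?F' = "\<lambda>t x. 2 * (?g t x * (fser (a t) x - fser (a 0) x))"
    have z: "0 \<in> {0..\<tau>}" using t by simp
    have js: "jet (fjet (a s))" if "s \<in> {0..\<tau>}" for s by (rule jet_fjet[OF esol_rapid[OF e that]])
    have cj: "continuous_on S (fjet (a s) j)" if "s \<in> {0..\<tau>}" for s j S by (rule jet_cont[OF js[OF that]])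
    have c0: "continuous_on S (fser (a s))" if "s \<in> {0..\<tau>}" for s S using cj[OF that, of S 0] by simp
    have "integral {0..L} (?F t) \<le> integral {0..L} (?F 0) + C * t"
    proof (rule within_derivative_mvt[OF _ _ t])
      fix s assume s: "s \<in> {0..\<tau>}"
      show "((\<lambda>t. integral {0..L} (?F t)) has_real_derivative integral {0..L} (?F' s)) (at s within {0..\<tau>})"
      proof (rule integral_param_deriv[OF _ _ _ s])
        fix s x assume s: "s \<in> {0..\<tau>}"
        have d0: "((\<lambda>t. fser (a t) x) has_real_derivative ?g s x) (at s within {0..\<tau>})"
          using esol_deriv[OF e \<epsilon>(1) s, of 0 x] unfolding erhs_0 by simp
        show "((\<lambda>t. ?F t x) has_real_derivative ?F' s x) (at s within {0..\<tau>})"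
          using DERIV_power[OF DERIV_diff[OF d0 DERIV_const[of "fser (a 0) x"]], of 2] by simp
      next
        have cg: "continuous_on ({0..\<tau>} \<times> {0..L}) (\<lambda>p. fser (a 0) (snd p))"
          by (rule continuous_on_compose2[OF c0[OF z, of UNIV] continuous_on_snd[OF continuous_on_id]]) auto
        have cf: "continuous_on ({0..\<tau>} \<times> {0..L}) (\<lambda>p. fser (a (fst p)) (snd p))" using esol_joint'[OF e, of _ 0] by simp
        show "continuous_on ({0..\<tau>} \<times> {0..L}) (\<lambda>(t, x). ?F' t x)"
          unfolding case_prod_unfold by (intro continuous_intros esol_joint'[OF e] cg cf)
        show "continuous_on {0..L} (?F s)" if "s \<in> {0..\<tau>}" for s
          by (intro continuous_intros c0 that z)
      qed
      have bs: "\<bar>fjet (a s) j x\<bar> \<le> B" if "s \<in> {0..\<tau>}" "j < n" for s j x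
        unfolding B_def by (rule fjet_le_Bc[OF rapid_hs[OF esol_rapid[OF e that(1)]]]) (use h that in auto)
      have i4: "integral {0..L} (\<lambda>x. (fjet (a s) 4 x)\<^sup>2) \<le> L * B\<^sup>2 + B"
      proof (cases "n = 4")
        case True
        have "integral {0..L} (\<lambda>x. (fjet (a s) 4 x)\<^sup>2) \<le> B"
          using bnd_fjet[OF esol_rapid[OF e s] esol_symm[OF e s], of n R] h s True by (auto simp: bnd_def B_def)
        then show ?thesis using L_pos zero_le_power2[of B] by (simp add: add_increasing)
      next
        case False
        have "integral {0..L} (\<lambda>x. (fjet (a s) 4 x)\<^sup>2) \<le> integral {0..L} (\<lambda>x. B\<^sup>2)"
        proof (rule integral_le)
          show "(fjet (a s) 4 x)\<^sup>2 \<le> B\<^sup>2" for x using power_mono[OF bs[OF s, of 4 x], of 2] n False by simp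
        qed (intro integrable_continuous_real continuous_intros cj s)+
        then show ?thesis using B L_pos by simp
      qed
      have "integral {0..L} (?F' s) \<le> integral {0..L} (\<lambda>x. (4 * B\<^sup>2 + 2 * (B ^ 3 * B)\<^sup>2) + 2 * (fjet (a s) 4 x)\<^sup>2)"
      proof (rule integral_le)
        fix x
        let ?w = "fser (a s) x - fser (a 0) x"
        have young: "2 * (p * q) \<le> q\<^sup>2 + p\<^sup>2" for p q :: real using sum_squares_bound[of p q] by simp
        have "?F' s x \<le> ?w\<^sup>2 + (?g s x)\<^sup>2" by (rule young)
        also have "?w\<^sup>2 \<le> (2 * B)\<^sup>2"
        proof -
          have "\<bar>?w\<bar> \<le> 2 * B" using bs[OF s, of 0 x] bs[OF z, of 0 x] n by (simp add: abs_le_iff)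
          from power_mono[OF this, of 2] show ?thesis by simp
        qed
        also have "(?g s x)\<^sup>2 \<le> 2 * (fjet (a s) 0 x ^ 3 * fjet (a s) 3 x)\<^sup>2 + 2 * (\<epsilon> * fjet (a s) 4 x)\<^sup>2"
          using zero_le_power2[of "fjet (a s) 0 x ^ 3 * fjet (a s) 3 x + \<epsilon> * fjet (a s) 4 x"] by (simp add: power2_eq_square algebra_simps)
        also have "(fjet (a s) 0 x ^ 3 * fjet (a s) 3 x)\<^sup>2 \<le> (B ^ 3 * B)\<^sup>2"
        proof -
          have "\<bar>fjet (a s) 0 x ^ 3 * fjet (a s) 3 x\<bar> \<le> B ^ 3 * B" using n by (intro abs_mult_le abs_power_le bs s) auto
          from power_mono[OF this, of 2] show ?thesis by simp
        qed
        also have "(\<epsilon> * fjet (a s) 4 x)\<^sup>2 \<le> (fjet (a s) 4 x)\<^sup>2"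
          unfolding power_mult_distrib using \<epsilon> by (intro mult_left_le_one_le) (auto simp: power_le_one)
        finally show "?F' s x \<le> (4 * B\<^sup>2 + 2 * (B ^ 3 * B)\<^sup>2) + 2 * (fjet (a s) 4 x)\<^sup>2" by (simp add: power_mult_distrib)
      qed (intro integrable_continuous_real continuous_intros cj c0 s z)+
      also have "\<dots> = L * (4 * B\<^sup>2 + 2 * (B ^ 3 * B)\<^sup>2) + 2 * integral {0..L} (\<lambda>x. (fjet (a s) 4 x)\<^sup>2)"
      proof (rule integral_unique, intro has_integral_add has_integral_mult_right)
        show "((\<lambda>x. (fjet (a s) 4 x)\<^sup>2) has_integral integral {0..L} (\<lambda>x. (fjet (a s) 4 x)\<^sup>2)) {0..L}"
          by (intro integrable_integral integrable_continuous_real continuous_intros cj s)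
        show "((\<lambda>x. 4 * B\<^sup>2 + 2 * (B ^ 3 * B)\<^sup>2) has_integral L * (4 * B\<^sup>2 + 2 * (B ^ 3 * B)\<^sup>2)) {0..L}"
          using has_integral_const_real[of "4 * B\<^sup>2 + 2 * (B ^ 3 * B)\<^sup>2" 0 L] L_pos by simp
      qed
      also have "\<dots> \<le> C" using i4 by (simp add: C_def)
      finally show "integral {0..L} (?F' s) \<le> C" .
    qed
    then show "integral {0..L} (?F t) \<le> C * t" by simp
  qed
qed

lemma fser_small:
  assumes n: "n \<ge> 1" and R: "R \<ge> 0" and \<eta>: "\<eta> > 0"
  obtains \<delta> where "\<delta> > 0" "\<And>d x. hs n d \<Longrightarrow> hn n d \<le> R \<Longrightarrow> hn 0 d \<le> \<delta> \<Longrightarrow> \<bar>fser d x\<bar> \<le> \<eta>"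
proof -
  obtain \<delta> where \<delta>: "\<delta> > 0" "\<And>d. hs n d \<Longrightarrow> hn n d \<le> R \<Longrightarrow> hn 0 d \<le> \<delta> \<Longrightarrow> (\<Sum>\<^sub>\<infinity>k. wt k ^ 0 * cmod (d k)) \<le> \<eta>"
    using asum_small[of 0 n R \<eta>] n R \<eta> by auto
  have "\<bar>fser d x\<bar> \<le> \<eta>" if "hs n d" "hn n d \<le> R" "hn 0 d \<le> \<delta>" for d x
    using fser_le[OF hs_asum(1)[OF that(1), of 0], of x] \<delta>(2)[OF that] n by simp
  then show thesis using that \<delta>(1) by blast
qed

text \<open>The energy estimate presupposes both an \<open>H^n\<close> bound and a lower bound on
  the solution, so the two are improved together by \<open>continuity_method\<close>. No constant
  depends on \<open>\<epsilon>\<close>, which makes T uniform.\<close>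

lemma a_priori:
  assumes n: "n \<ge> 4" and b0: "b0 > 0" and R0: "R0 \<ge> 0"
  obtains T R where "T > 0" "R \<ge> 0"
    "\<And>\<epsilon> \<tau> a t x. 0 \<le> \<epsilon> \<Longrightarrow> \<epsilon> \<le> 1 \<Longrightarrow> \<tau> \<le> T \<Longrightarrow> esol \<epsilon> \<tau> a \<Longrightarrow> hn n (a 0) \<le> R0 \<Longrightarrow> (\<forall>x. b0 \<le> fser (a 0) x) \<Longrightarrow>
       t \<in> {0..\<tau>} \<Longrightarrow> hn n (a t) \<le> R \<and> 3 / 4 * b0 \<le> fser (a t) x"
proof -
  define Bd where "Bd = Bc n R0"
  have Bd: "Bd \<ge> 1" using Bc_ge1[OF R0] by (simp add: Bd_def)
  define p where "p = 2 * n - 3"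
  \<comment> \<open>Bounds the weighted energy of the data: \<open>Bd ^ p\<close> for the weight, Bd
    for the mean square of order n.\<close>
  define E0 where "E0 = Bd ^ p * Bd"
  define m where "m = (3 / 4 * b0) ^ p"
  have m: "m > 0" using b0 by (simp add: m_def)
  have E0: "E0 \<ge> 0" using Bd by (simp add: E0_def)
  \<comment> \<open>The estimates return at most \<open>2 * Bd + 1 + (E0 + 1) / m\<close> for P. P1
    exceeds this, so the assumption \<open>P \<le> P1\<close> improves strictly; it also exceeds the
    initial value, at most \<open>2 * Bd\<close>.\<close>
  define P1 where "P1 = 2 * (2 * Bd + 2 + (E0 + 1) / m)"
  have P1: "P1 > 0" using Bd E0 m by (simp add: P1_def add_pos_nonneg)
  define R where "R = cN n * P1"
  have R: "R \<ge> 0" using cN_pos P1 by (simp add: R_def less_imp_le)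
  obtain \<delta>0 where \<delta>0: "\<delta>0 > 0" "\<And>d x. hs n d \<Longrightarrow> hn n d \<le> 2 * R + 2 * R0 \<Longrightarrow> hn 0 d \<le> \<delta>0 \<Longrightarrow> \<bar>fser d x\<bar> \<le> b0 / 4"
    using fser_small[of n "2 * R + 2 * R0" "b0 / 4"] n R R0 b0 by auto
  \<comment> \<open>Below \<open>L * \<delta>0\<close> the distance to the data costs at most b0 / 4
    of the lower bound; below 1 it adds at most 1 to P.\<close>
  define \<delta> where "\<delta> = min 1 (L * \<delta>0)"
  have \<delta>: "\<delta> > 0" "\<delta> \<le> 1" "\<delta> \<le> L * \<delta>0" using \<delta>0 L_pos by (auto simp: \<delta>_def)
  have b34: "3 / 4 * b0 > 0" using b0 by simp
  obtain C1 where C1: "C1 \<ge> 0" "\<forall>\<epsilon> \<tau> a \<gamma>. 0 \<le> \<epsilon> \<longrightarrow> \<epsilon> \<le> 1 \<longrightarrow> esol \<epsilon> \<tau> a \<longrightarrow>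
     (\<forall>t\<in>{0..\<tau>}. hn n (a t) \<le> R \<and> (\<forall>x. 3 / 4 * b0 \<le> fser (a t) x)) \<longrightarrow> rapid \<gamma> \<longrightarrow> supb (n + 5) 0 (fjet \<gamma>) \<longrightarrow>
     (\<forall>t\<in>{0..\<tau>}. integral {0..L} (\<lambda>x. fser (a t) x ^ (2 * n - 3) * (fjet (a t) n x - fjet \<gamma> n x)\<^sup>2)
        \<le> integral {0..L} (\<lambda>x. fser (a 0) x ^ (2 * n - 3) * (fjet (a 0) n x - fjet \<gamma> n x)\<^sup>2) + C1 * t)"
    using shifted_energy[OF n b34 R order_refl] by (elim exE conjE)
  obtain C2 where C2: "C2 \<ge> 0" "\<forall>\<epsilon> \<tau> a. 0 \<le> \<epsilon> \<longrightarrow> \<epsilon> \<le> 1 \<longrightarrow> esol \<epsilon> \<tau> a \<longrightarrow> (\<forall>t\<in>{0..\<tau>}. hn n (a t) \<le> R) \<longrightarrow>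
     (\<forall>t\<in>{0..\<tau>}. integral {0..L} (\<lambda>x. (fser (a t) x - fser (a 0) x)\<^sup>2) \<le> C2 * t)"
    using L2_growth[OF n R] by (elim exE conjE)
  \<comment> \<open>Up to time T the energy grows by at most 1 and the squared distance to at most
    half of \<open>\<delta>\<close>.\<close>
  define T where "T = min (1 / (C1 + 1)) (\<delta> / (2 * (C2 + 1)))"
  have T: "T > 0" using C1(1) C2(1) \<delta> by (simp add: T_def)
  have TC1: "C1 * t \<le> 1" and TC2: "C2 * t \<le> \<delta> / 2" if "0 \<le> t" "t \<le> T" for t
  proof -
    have "C1 * t \<le> C1 * (1 / (C1 + 1))" using that C1(1) by (intro mult_left_mono) (auto simp: T_def)
    also have "\<dots> \<le> 1" using C1(1) by simp
    finally show "C1 * t \<le> 1" .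
    have "C2 * t \<le> C2 * (\<delta> / (2 * (C2 + 1)))" using that C2(1) by (intro mult_left_mono) (auto simp: T_def)
    also have "\<dots> = \<delta> / 2 * (C2 / (C2 + 1))" by simp
    also have "\<dots> \<le> \<delta> / 2 * 1" using C2(1) \<delta> by (intro mult_left_mono) auto
    finally show "C2 * t \<le> \<delta> / 2" by simp
  qed
  show thesis
  proof (rule that[OF T R])
    fix \<epsilon> \<tau> a t x
    assume \<epsilon>: "0 \<le> \<epsilon>" "\<epsilon> \<le> 1" and \<tau>: "\<tau> \<le> T" and e: "esol \<epsilon> \<tau> a" and R0a: "hn n (a 0) \<le> R0"
      and b0a: "\<forall>x. b0 \<le> fser (a 0) x" and t: "t \<in> {0..\<tau>}"
    have z: "0 \<in> {0..\<tau>}" using t by simp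
    have ra: "rapid (a s)" and sa: "symm (a s)" if "s \<in> {0..\<tau>}" for s using esol_rapid[OF e that] esol_symm[OF e that] by auto
    define P where "P s = integral {0..L} (\<lambda>x. (fser (a s) x)\<^sup>2) + integral {0..L} (\<lambda>x. (fjet (a s) n x)\<^sup>2)" for s
    define V where "V s = integral {0..L} (\<lambda>x. (fser (a s) x - fser (a 0) x)\<^sup>2)" for s
    have cj: "continuous_on S (fjet (a s) j)" if "s \<in> {0..\<tau>}" for s j S by (rule jet_cont[OF jet_fjet[OF ra[OF that]]])
    have c0: "continuous_on S (fser (a s))" if "s \<in> {0..\<tau>}" for s S using cj[OF that, of S 0] by simp
    have cf: "continuous_on ({0..\<tau>} \<times> {0..L}) (\<lambda>p. fser (a (fst p)) (snd p))" using esol_joint'[OF e, of _ 0] by simp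
    have cg: "continuous_on ({0..\<tau>} \<times> {0..L}) (\<lambda>p. fser (a 0) (snd p))"
      by (rule continuous_on_compose2[OF c0[OF z, of UNIV] continuous_on_snd[OF continuous_on_id]]) auto
    have par: "continuous_on {0..\<tau>} (\<lambda>s. integral {0..L} (F s))" if "continuous_on ({0..\<tau>} \<times> {0..L}) (\<lambda>p. F (fst p) (snd p))" for F :: "real \<Rightarrow> real \<Rightarrow> real"
      using integral_continuous_on_param[of "{0..\<tau>}" 0 L F] that by (simp add: case_prod_unfold)
    have Pc: "continuous_on {0..\<tau>} P" unfolding P_def[abs_def]
      by (intro continuous_on_add par continuous_intros cf esol_joint'[OF e])
    have Vc: "continuous_on {0..\<tau>} V" unfolding V_def[abs_def] by (intro par continuous_intros cf cg)
    \<comment> \<open>\<open>h s \<le> 1\<close> expresses both bootstrap assumptions at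
      once.\<close>
    define h where "h s = max (P s / P1) (V s / \<delta>)" for s
    have hc: "continuous_on {0..\<tau>} h" unfolding h_def[abs_def] using P1 \<delta> by (intro continuous_intros Pc Vc) auto
    have u0b: "\<bar>fjet (a 0) j x\<bar> \<le> Bd" if "j < n" for j x
      unfolding Bd_def by (rule fjet_le_Bc[OF rapid_hs[OF ra[OF z]] R0a that])
    have LR: "L * R0 \<le> Bd" unfolding Bd_def Bc_def using L_pos kap_pos Zw_nonneg R0 by simp
    have i0: "integral {0..L} (\<lambda>x. (fser (a 0) x)\<^sup>2) \<le> Bd"
    proof -
      have "integral {0..L} (\<lambda>x. (fser (a 0) x)\<^sup>2) \<le> L * hn n (a 0)" by (rule int_le_hn(1)[OF ra[OF z] sa[OF z]])
      also have "\<dots> \<le> L * R0" using R0a L_pos by simp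
      finally show ?thesis using LR by simp
    qed
    have in0: "integral {0..L} (\<lambda>x. (fjet (a 0) n x)\<^sup>2) \<le> Bd"
      using bnd_fjet[OF ra[OF z] sa[OF z] R0a] by (simp add: bnd_def Bd_def)
    have good: "hn n (a s) \<le> R \<and> (\<forall>x. 3 / 4 * b0 \<le> fser (a s) x)" if s: "s \<in> {0..\<tau>}" and hs1: "h s \<le> 1" for s
    proof -
      have "P s \<le> P1" "V s \<le> \<delta>" using hs1 P1 \<delta> by (auto simp: h_def)
      have hR: "hn n (a s) \<le> R"
      proof -
        have "hn n (a s) \<le> cN n * P s" unfolding P_def by (rule hn_le_int[OF ra[OF s] sa[OF s]])
        also have "\<dots> \<le> R" unfolding R_def using \<open>P s \<le> P1\<close> cN_pos by (intro mult_left_mono) (auto simp: less_imp_le)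
        finally show ?thesis .
      qed
      let ?d = "\<lambda>k. a s k - a 0 k"
      have fd: "fser ?d x = fser (a s) x - fser (a 0) x" for x
        by (rule fser_diff[OF rapid_asum[OF ra[OF s], of 0] rapid_asum[OF ra[OF z], of 0]])
      have rd: "rapid ?d" "symm ?d" by (rule rapid_diff[OF ra[OF s] ra[OF z]], rule symm_diff[OF sa[OF s] sa[OF z]])
      have "L * hn 0 ?d = V s" unfolding V_def using int_sq_eq[OF rd] by (simp only: fd)
      then have "hn 0 ?d \<le> \<delta>0" using \<open>V s \<le> \<delta>\<close> \<delta>(3) L_pos by (metis mult_le_cancel_left_pos order_trans)
      moreover have "hn n ?d \<le> 2 * R + 2 * R0"
        using hs_diff(2)[OF rapid_hs[OF ra[OF s], of n] rapid_hs[OF ra[OF z], of n]] hR R0a by linarith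
      ultimately have "\<bar>fser ?d x\<bar> \<le> b0 / 4" for x by (intro \<delta>0(2) rapid_hs rd)
      then have "3 / 4 * b0 \<le> fser (a s) x" for x
      proof -
        have "\<bar>fser (a s) x - fser (a 0) x\<bar> \<le> b0 / 4" using \<open>\<And>x. \<bar>fser ?d x\<bar> \<le> b0 / 4\<close>[of x] by (simp only: fd)
        moreover have "b0 \<le> fser (a 0) x" using b0a by blast
        ultimately show ?thesis by linarith
      qed
      then show ?thesis using hR by blast
    qed
    have "h t < 1"
    proof (rule continuity_method[OF hc _ _ t])
      have "P 0 \<le> Bd + Bd" unfolding P_def using i0 in0 by (intro add_mono) auto
      also have "\<dots> < P1" using Bd E0 m by (simp add: P1_def add_nonneg_pos)
      finally show "h 0 < 1" using P1 \<delta> by (simp add: h_def V_def)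
    next
      fix t assume t: "t \<in> {0..\<tau>}" and hs1: "\<And>s. s \<in> {0..t} \<Longrightarrow> h s \<le> 1"
      have et: "esol \<epsilon> t a" by (rule esol_mono[OF e]) (use t in simp)
      have gd: "\<forall>s\<in>{0..t}. hn n (a s) \<le> R \<and> (\<forall>x. 3 / 4 * b0 \<le> fser (a s) x)"
        using good hs1 t by (meson atLeastAtMost_iff order_trans)
      have tt: "t \<in> {0..t}" "0 \<le> t" "t \<le> T" using t \<tau> by auto
      \<comment> \<open>The shift zero turns the shifted energy into the plain weighted
        energy.\<close>
      have z0: "rapid (\<lambda>_. 0)" by (auto simp: rapid_def bd_def)
      have fz: "fjet (\<lambda>_. 0) j x = 0" for j x by (simp add: dd_def fser_def)
      have "integral {0..L} (\<lambda>x. fser (a t) x ^ p * (fjet (a t) n x)\<^sup>2) \<le> integral {0..L} (\<lambda>x. fser (a 0) x ^ p * (fjet (a 0) n x)\<^sup>2) + C1 * t"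
      proof -
        have "supb (n + 5) 0 (fjet (\<lambda>_. 0))" by (simp add: supb_def fz)
        from C1(2)[rule_format, OF \<epsilon> et bspec[OF gd] z0 this tt(1)] show ?thesis
          unfolding p_def fz by simp
      qed
      also have "integral {0..L} (\<lambda>x. fser (a 0) x ^ p * (fjet (a 0) n x)\<^sup>2) \<le> integral {0..L} (\<lambda>x. Bd ^ p * (fjet (a 0) n x)\<^sup>2)"
      proof (rule integral_le)
        show "fser (a 0) x ^ p * (fjet (a 0) n x)\<^sup>2 \<le> Bd ^ p * (fjet (a 0) n x)\<^sup>2" for x
          using abs_power_le[OF u0b[of 0 x], of p] n by (intro mult_right_mono) (auto simp: abs_le_iff)
      qed (intro integrable_continuous_real continuous_intros cj c0 z)+
      also have "\<dots> = Bd ^ p * integral {0..L} (\<lambda>x. (fjet (a 0) n x)\<^sup>2)" by (rule integral_mult_right)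
      also have "\<dots> \<le> E0" unfolding E0_def using in0 Bd by (intro mult_left_mono) auto
      finally have D1: "integral {0..L} (\<lambda>x. fser (a t) x ^ p * (fjet (a t) n x)\<^sup>2) \<le> E0 + 1" using TC1[OF tt(2,3)] by linarith
      have "m * integral {0..L} (\<lambda>x. (fjet (a t) n x)\<^sup>2) = integral {0..L} (\<lambda>x. m * (fjet (a t) n x)\<^sup>2)" by (rule integral_mult_right[symmetric])
      also have "\<dots> \<le> integral {0..L} (\<lambda>x. fser (a t) x ^ p * (fjet (a t) n x)\<^sup>2)"
      proof (rule integral_le)
        show "m * (fjet (a t) n x)\<^sup>2 \<le> fser (a t) x ^ p * (fjet (a t) n x)\<^sup>2" for x
          unfolding m_def using gd tt b0 by (intro mult_right_mono power_mono) auto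
      qed (intro integrable_continuous_real continuous_intros cj c0 t)+
      finally have "m * integral {0..L} (\<lambda>x. (fjet (a t) n x)\<^sup>2) \<le> E0 + 1" using D1 by linarith
      then have iN: "integral {0..L} (\<lambda>x. (fjet (a t) n x)\<^sup>2) \<le> (E0 + 1) / m" using m by (simp add: pos_le_divide_eq mult.commute)
      have "\<forall>s\<in>{0..t}. hn n (a s) \<le> R" using gd by blast
      then have V2: "V t \<le> \<delta> / 2" using C2(2)[rule_format, OF \<epsilon> et _ tt(1)] TC2[OF tt(2,3)] unfolding V_def by force
      have "integral {0..L} (\<lambda>x. (fser (a t) x)\<^sup>2) \<le> integral {0..L} (\<lambda>x. 2 * (fser (a 0) x)\<^sup>2 + 2 * (fser (a t) x - fser (a 0) x)\<^sup>2)"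
      proof (rule integral_le)
        show "(fser (a t) x)\<^sup>2 \<le> 2 * (fser (a 0) x)\<^sup>2 + 2 * (fser (a t) x - fser (a 0) x)\<^sup>2" for x
          using zero_le_power2[of "fser (a t) x - 2 * fser (a 0) x"] by (simp add: power2_eq_square algebra_simps)
      qed (intro integrable_continuous_real continuous_intros c0 t z)+
      also have "\<dots> = 2 * integral {0..L} (\<lambda>x. (fser (a 0) x)\<^sup>2) + 2 * V t"
        unfolding V_def by (rule integral_unique, intro has_integral_add has_integral_mult_right)
          (intro integrable_integral integrable_continuous_real continuous_intros c0 t z)+
      also have "\<dots> \<le> 2 * Bd + 2 * (\<delta> / 2)" using i0 V2 by linarith
      also have "\<dots> \<le> 2 * Bd + 1" using \<delta> by simp
      finally have "P t \<le> 2 * Bd + 1 + (E0 + 1) / m" using iN by (simp add: P_def)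
      also have "\<dots> < P1"
      proof -
        have "(E0 + 1) / m \<ge> 0" using E0 m by simp
        moreover have "2 * Bd + 1 + y < 2 * (2 * Bd + 2 + y)" if "0 \<le> y" for y using that Bd by simp
        ultimately show ?thesis unfolding P1_def by blast
      qed
      finally have "P t < P1" .
      moreover have "V t < \<delta>" using V2 \<delta> by simp
      ultimately show "h t < 1" using P1 \<delta> by (simp add: h_def)
    qed
    then show "hn n (a t) \<le> R \<and> 3 / 4 * b0 \<le> fser (a t) x" using good[OF t] by simp
  qed
qed

text \<open>The Picard step may shrink with \<open>\<epsilon>\<close>, but it is the same at every
  restart, because \<open>a_priori\<close> bounds each restart value by the same R; finitely many
  steps reach T.\<close>

lemma esol_exists:
  assumes n: "n \<ge> 4" and b0: "b0 > 0" and R0: "R0 \<ge> 0"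
  obtains T R where "T > 0" "R \<ge> 0"
    "\<And>\<epsilon> \<alpha>. 0 < \<epsilon> \<Longrightarrow> \<epsilon> \<le> 1 \<Longrightarrow> rapid \<alpha> \<Longrightarrow> symm \<alpha> \<Longrightarrow> hn n \<alpha> \<le> R0 \<Longrightarrow> (\<forall>x. b0 \<le> fser \<alpha> x) \<Longrightarrow>
       \<exists>a. esol \<epsilon> T a \<and> a 0 = \<alpha> \<and> (\<forall>t\<in>{0..T}. hn n (a t) \<le> R \<and> (\<forall>x. 3 / 4 * b0 \<le> fser (a t) x))"
proof -
  obtain T R where T: "T > 0" and R: "R \<ge> 0" and ap: "\<And>\<epsilon> \<tau> a t x. 0 \<le> \<epsilon> \<Longrightarrow> \<epsilon> \<le> 1 \<Longrightarrow> \<tau> \<le> T \<Longrightarrow> esol \<epsilon> \<tau> a \<Longrightarrow> hn n (a 0) \<le> R0 \<Longrightarrow> (\<forall>x. b0 \<le> fser (a 0) x) \<Longrightarrow>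
       t \<in> {0..\<tau>} \<Longrightarrow> hn n (a t) \<le> R \<and> 3 / 4 * b0 \<le> fser (a t) x"
    using a_priori[OF n b0 R0] by blast
  show thesis
  proof (rule that[OF T R])
    fix \<epsilon> :: real and \<alpha> assume \<epsilon>: "0 < \<epsilon>" "\<epsilon> \<le> 1" and \<alpha>: "rapid \<alpha>" "symm \<alpha>" "hn n \<alpha> \<le> R0" "\<forall>x. b0 \<le> fser \<alpha> x"
    define \<rho> where "\<rho> = sqrt (2 ^ n * R) + 1"
    have \<rho>: "\<rho> > 0" using R unfolding \<rho>_def by (intro add_nonneg_pos) auto
    obtain \<tau> where \<tau>: "\<tau> > 0" and pic: "\<And>\<alpha>. symm \<alpha> \<Longrightarrow> bd 4 \<rho> \<alpha> \<Longrightarrow> (\<And>s. \<exists>C. bd s C \<alpha>) \<Longrightarrow> \<exists>a. esol \<epsilon> \<tau> a \<and> a 0 = \<alpha>"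
      using picard[OF \<epsilon>(1) \<rho>] by blast
    have "\<exists>a. esol \<epsilon> (min T (real m * \<tau>)) a \<and> a 0 = \<alpha>" for m
    proof (induction m)
      case 0
      obtain C where "bd 4 C \<alpha>" using \<alpha>(1) by (auto simp: rapid_def)
      then have "bd 4 (max C 1) \<alpha>" by (rule bd_mono) auto
      moreover have mx: "max C 1 > 0" by simp
      \<comment> \<open>The bound by R is known only for values of a solution, so the start uses a
        time \<open>\<sigma>\<close> adapted to the data and then restricts to the single time
        0.\<close>
      obtain \<sigma> where "\<sigma> > 0" "\<And>\<alpha>. symm \<alpha> \<Longrightarrow> bd 4 (max C 1) \<alpha> \<Longrightarrow> (\<And>s. \<exists>C. bd s C \<alpha>) \<Longrightarrow> \<exists>a. esol \<epsilon> \<sigma> a \<and> a 0 = \<alpha>"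
        using picard[OF \<epsilon>(1) mx] by blast
      ultimately obtain a where "esol \<epsilon> \<sigma> a" "a 0 = \<alpha>" "\<sigma> > 0" using \<alpha> unfolding rapid_def by blast
      moreover from this have "min T (real 0 * \<tau>) \<le> \<sigma>" by simp
      ultimately show ?case using esol_mono by blast
    next
      case (Suc m)
      then obtain a where a: "esol \<epsilon> (min T (real m * \<tau>)) a" "a 0 = \<alpha>" by blast
      let ?s = "min T (real m * \<tau>)"
      have s0: "?s \<ge> 0" using T \<tau> by simp
      then have ss: "?s \<in> {0..?s}" by simp
      have h: "hn n (a ?s) \<le> R" using ap[OF _ \<epsilon>(2) _ a(1) _ _ ss] \<epsilon> \<alpha> a(2) by auto
      have "bd n (sqrt (2 ^ n * R)) (a ?s)" by (rule hs_bd[OF rapid_hs[OF esol_rapid[OF a(1) ss]] h])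
      then have "bd 4 \<rho> (a ?s)" by (rule bd_mono) (use n in \<open>auto simp: \<rho>_def\<close>)
      then obtain b where b: "esol \<epsilon> \<tau> b" "b 0 = a ?s"
        using pic[OF esol_symm[OF a(1) ss]] esol_rapid[OF a(1) ss] unfolding rapid_def by blast
      have "esol \<epsilon> (?s + \<tau>) (\<lambda>t. if t \<le> ?s then a t else b (t - ?s))"
        by (rule esol_glue[OF a(1) b s0]) (use \<tau> in simp)
      then have "esol \<epsilon> (min T (real (Suc m) * \<tau>)) (\<lambda>t. if t \<le> ?s then a t else b (t - ?s))"
        by (rule esol_mono) (use \<tau> T in \<open>auto simp: min_def algebra_simps\<close>)
      moreover have "(\<lambda>t. if t \<le> ?s then a t else b (t - ?s)) 0 = \<alpha>" using a(2) s0 by simp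
      ultimately show ?case by blast
    qed
    moreover obtain m where "real m > T / \<tau>" using reals_Archimedean2 by blast
    then have "min T (real m * \<tau>) = T" using \<tau> by (simp add: pos_divide_less_eq)
    ultimately obtain a where a: "esol \<epsilon> T a" "a 0 = \<alpha>" by metis
    have "\<forall>t\<in>{0..T}. hn n (a t) \<le> R \<and> (\<forall>x. 3 / 4 * b0 \<le> fser (a t) x)"
      using ap[OF _ \<epsilon>(2) order_refl a(1)] \<epsilon> \<alpha> a(2) by auto
    then show "\<exists>a. esol \<epsilon> T a \<and> a 0 = \<alpha> \<and> (\<forall>t\<in>{0..T}. hn n (a t) \<le> R \<and> (\<forall>x. 3 / 4 * b0 \<le> fser (a t) x))"
      using a by blast
  qed
qed

end

section \<open>Vanishing regularisation\<close>

definition trunc :: "nat \<Rightarrow> (int \<Rightarrow> complex) \<Rightarrow> int \<Rightarrow> complex" where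
  "trunc N a k = (if \<bar>k\<bar> \<le> int N then a k else 0)"

lemma trunc_rapid: "rapid (trunc N a)"
  unfolding rapid_def
proof
  fix s
  have "cmod (trunc N a k) * wt k ^ s \<le> (\<Sum>k\<in>{-int N..int N}. cmod (a k) * wt k ^ s)" for k
  proof (cases "\<bar>k\<bar> \<le> int N")
    case True
    have "cmod (a k) * wt k ^ s \<le> (\<Sum>k\<in>{-int N..int N}. cmod (a k) * wt k ^ s)"
      by (rule member_le_sum) (use True in \<open>auto simp: wt_pos less_imp_le\<close>)
    then show ?thesis using True by (simp add: trunc_def)
  next
    case False
    then show ?thesis by (simp add: trunc_def sum_nonneg wt_pos less_imp_le)
  qed
  then show "\<exists>C. bd s C (trunc N a)" unfolding bd_def by blast
qed

lemma trunc_symm: "symm a \<Longrightarrow> symm (trunc N a)" by (simp add: symm_def trunc_def)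

lemma hn_termwise:
  assumes "hs n a" "\<And>k. cmod (b k) \<le> cmod (a k)" shows "hs n b" "hn n b \<le> hn n a"
proof -
  have "(\<Sum>k\<in>F. hw n k * (cmod (b k))\<^sup>2) \<le> hn n a" if F: "finite F" for F
  proof -
    have "(\<Sum>k\<in>F. hw n k * (cmod (b k))\<^sup>2) \<le> (\<Sum>k\<in>F. hw n k * (cmod (a k))\<^sup>2)"
      using assms(2) by (intro sum_mono mult_left_mono power_mono) (auto simp: hw_pos less_imp_le)
    then show ?thesis using hn_finite_le[OF assms(1) F] by linarith
  qed
  then show "hs n b" "hn n b \<le> hn n a" using hs_I by auto
qed

lemma hn_trunc_le: "hs n a \<Longrightarrow> hn n (trunc N a) \<le> hn n a"
  by (rule hn_termwise(2)) (auto simp: trunc_def)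

lemma trunc_tail:
  assumes h: "hs n a" and e: "e > 0"
  shows "\<exists>K0. \<forall>K\<ge>K0. hn n (\<lambda>k. a k - trunc K a k) \<le> e"
proof -
  obtain F0 where F0: "finite F0" "\<And>F. finite F \<Longrightarrow> F \<inter> F0 = {} \<Longrightarrow> (\<Sum>k\<in>F. hw n k * (cmod (a k))\<^sup>2) \<le> e"
    using summable_tail[OF h[unfolded hs_def] _ e] by (auto simp: hw_pos less_imp_le)
  obtain K0 :: nat where K0: "\<And>k. k \<in> F0 \<Longrightarrow> \<bar>k\<bar> \<le> int K0"
  proof -
    have "finite ((\<lambda>k. nat \<bar>k\<bar>) ` F0)" using F0 by simp
    then obtain K0 where "\<forall>m\<in>(\<lambda>k. nat \<bar>k\<bar>) ` F0. m \<le> K0" using finite_nat_set_iff_bounded_le by blast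
    then show thesis using that by (metis image_eqI int_nat_eq abs_ge_zero nat_le_iff)
  qed
  have "hn n (\<lambda>k. a k - trunc K a k) \<le> e" if K: "K \<ge> K0" for K
  proof (rule hs_I(2))
    fix F :: "int set" assume F: "finite F"
    have "(\<Sum>k\<in>F. hw n k * (cmod (a k - trunc K a k))\<^sup>2) = (\<Sum>k\<in>F - F0. hw n k * (cmod (a k - trunc K a k))\<^sup>2)"
      using F K0 K by (intro sum.mono_neutral_right) (fastforce simp: trunc_def)+
    also have "\<dots> \<le> (\<Sum>k\<in>F - F0. hw n k * (cmod (a k))\<^sup>2)"
      by (intro sum_mono mult_left_mono) (auto simp: trunc_def hw_pos less_imp_le)
    also have "\<dots> \<le> e" by (rule F0(2)) (use F in auto)
    finally show "(\<Sum>k\<in>F. hw n k * (cmod (a k - trunc K a k))\<^sup>2) \<le> e" .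
  qed
  then show ?thesis by blast
qed

text \<open>Lower semicontinuity: finite partial sums converge, and bounding all of them bounds the
  norm.\<close>

lemma hn_limit:
  assumes l: "\<And>k. (\<lambda>N. b N k) \<longlonglongrightarrow> c k" and ev: "\<forall>\<^sub>F N in sequentially. hs n (b N) \<and> hn n (b N) \<le> C"
  shows "hs n c" "hn n c \<le> C"
proof -
  have "(\<Sum>k\<in>F. hw n k * (cmod (c k))\<^sup>2) \<le> C" if F: "finite F" for F
  proof (rule tendsto_upperbound)
    show "(\<lambda>N. \<Sum>k\<in>F. hw n k * (cmod (b N k))\<^sup>2) \<longlonglongrightarrow> (\<Sum>k\<in>F. hw n k * (cmod (c k))\<^sup>2)"
      by (intro tendsto_intros l)
    show "\<forall>\<^sub>F N in sequentially. (\<Sum>k\<in>F. hw n k * (cmod (b N k))\<^sup>2) \<le> C"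
      using ev by eventually_elim (use hn_finite_le[OF _ F] in force)
  qed simp
  then show "hs n c" "hn n c \<le> C" using hs_I by auto
qed

context circle begin

text \<open>Classical solutions with a uniform \<open>H^n\<close> bound, which is all that the limit
  yields directly. Continuity into \<open>H^n\<close> is the separate result
  \<open>hsol_hcont\<close>.\<close>

definition hsol :: "nat \<Rightarrow> real \<Rightarrow> real \<Rightarrow> (real \<Rightarrow> int \<Rightarrow> complex) \<Rightarrow> bool" where
  "hsol n R T c \<longleftrightarrow> (\<forall>t\<in>{0..T}. hs n (c t) \<and> symm (c t) \<and> hn n (c t) \<le> R) \<and>
     classical_sol T (\<lambda>t. fser (c t)) (\<lambda>t. fser (dd 1 (c t))) (\<lambda>t. fser (dd 2 (c t))) (\<lambda>t. fser (dd 3 (c t))) (\<lambda>_ _. 0)"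

lemma fcoeff_le:
  assumes c: "continuous_on {0..L} f" and M: "\<And>x. x \<in> {0..L} \<Longrightarrow> \<bar>f x\<bar> \<le> M"
  shows "cmod (fcoeff L f k) \<le> M"
proof -
  have "cmod (integral {0..L} (\<lambda>x. complex_of_real (f x) * cis (kap * real_of_int (- k) * x))) \<le> integral {0..L} (\<lambda>x. M)"
    by (rule integral_norm_bound_integral)
       (use M in \<open>auto intro!: integrable_continuous_real continuous_intros c simp: norm_mult\<close>)
  also have "\<dots> = M * L" using L_pos by simp
  finally show ?thesis unfolding fcoeff_eq_integral[OF c] using L_pos by (simp add: norm_divide pos_divide_le_eq)
qed

lemma fcoeff_time_integral:
  fixes g :: "real \<Rightarrow> real \<Rightarrow> real"
  assumes c: "continuous_on ({0..t} \<times> {0..L}) (\<lambda>(s, x). g s x)"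
  shows "fcoeff L (\<lambda>x. integral {0..t} (\<lambda>s. g s x)) k = integral {0..t} (\<lambda>s. fcoeff L (g s) k)"
proof -
  have cs: "continuous_on {0..L} (g s)" if "s \<in> {0..t}" for s
    by (rule continuous_on_compose2[OF c, of "{0..L}" "\<lambda>x. (s, x)", simplified]) (use that in \<open>auto intro!: continuous_intros\<close>)
  have cx: "continuous_on {0..t} (\<lambda>s. g s x)" if "x \<in> {0..L}" for x
    by (rule continuous_on_compose2[OF c, of "{0..t}" "\<lambda>s. (s, x)", simplified]) (use that in \<open>auto intro!: continuous_intros\<close>)
  have c': "continuous_on ({0..L} \<times> {0..t}) (\<lambda>p. g (snd p) (fst p))"
    by (rule continuous_on_compose2[OF c, of _ "\<lambda>p. (snd p, fst p)", simplified case_prod_conv]) (auto intro!: continuous_intros)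
  have ci: "continuous_on {0..L} (\<lambda>x. integral {0..t} (\<lambda>s. g s x))"
    using integral_continuous_on_param[of "{0..L}" 0 t "\<lambda>x s. g s x"] c' by (simp add: case_prod_unfold)
  let ?e = "\<lambda>x. cis (kap * real_of_int (- k) * x)"
  have "integral {0..L} (\<lambda>x. complex_of_real (integral {0..t} (\<lambda>s. g s x)) * ?e x)
     = integral {0..L} (\<lambda>x. integral {0..t} (\<lambda>s. complex_of_real (g s x) * ?e x))"
  proof (rule integral_cong)
    fix x assume x: "x \<in> {0..L}"
    have "complex_of_real (integral {0..t} (\<lambda>s. g s x)) = integral {0..t} (\<lambda>s. complex_of_real (g s x))"
      using integral_linear[OF integrable_continuous_real[OF cx[OF x]] bounded_linear_of_real[where 'a=complex]] by (simp add: o_def)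
    then show "complex_of_real (integral {0..t} (\<lambda>s. g s x)) * ?e x = integral {0..t} (\<lambda>s. complex_of_real (g s x) * ?e x)"
      by simp
  qed
  also have "\<dots> = integral {0..t} (\<lambda>s. integral {0..L} (\<lambda>x. complex_of_real (g s x) * ?e x))"
  proof -
    have "continuous_on (cbox (0, 0) (L, t)) (\<lambda>(x, s). complex_of_real (g s x) * ?e x)"
      unfolding cbox_Pair_eq case_prod_unfold by (intro continuous_intros) (use c' in simp)
    from integral_swap_continuous[OF this] show ?thesis by simp
  qed
  finally have "fcoeff L (\<lambda>x. integral {0..t} (\<lambda>s. g s x)) k = integral {0..t} (\<lambda>s. integral {0..L} (\<lambda>x. complex_of_real (g s x) * ?e x)) / L"
    unfolding fcoeff_eq_integral[OF ci] by simp
  also have "\<dots> = integral {0..t} (\<lambda>s. integral {0..L} (\<lambda>x. complex_of_real (g s x) * ?e x) / L)" by simp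
  also have "\<dots> = integral {0..t} (\<lambda>s. fcoeff L (g s) k)"
    by (rule integral_cong) (simp add: fcoeff_eq_integral[OF cs])
  finally show ?thesis .
qed

text \<open>For n = 4 this is the top derivative, bounded in mean square by \<open>bnd\<close>; for
  larger n it is bounded uniformly.\<close>

lemma int4_le:
  assumes n: "n \<ge> 4" and r: "rapid a" "symm a" and h: "hn n a \<le> R"
  shows "integral {0..L} (\<lambda>x. (fjet a 4 x)\<^sup>2) \<le> L * (Bc n R)\<^sup>2 + Bc n R"
proof (cases "n = 4")
  case True
  have "integral {0..L} (\<lambda>x. (fjet a 4 x)\<^sup>2) \<le> Bc n R" using bnd_fjet[OF r h] True by (simp add: bnd_def)
  then show ?thesis using L_pos zero_le_power2[of "Bc n R"] by (simp add: add_increasing)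
next
  case False
  have "integral {0..L} (\<lambda>x. (fjet a 4 x)\<^sup>2) \<le> integral {0..L} (\<lambda>x. (Bc n R)\<^sup>2)"
  proof (rule integral_le)
    show "(fjet a 4 x)\<^sup>2 \<le> (Bc n R)\<^sup>2" for x
      using power_mono[OF fjet_le_Bc[OF rapid_hs[OF r(1)] h, of 4 x], of 2] n False by simp
  qed (intro integrable_continuous_real continuous_intros jet_cont[OF jet_fjet[OF r(1)]])+
  then show ?thesis using Bc_ge1[of R n] hn_nonneg[of n a] h L_pos by simp
qed

lemma esol_classical_sol:
  assumes e: "esol \<epsilon> T a" and \<epsilon>: "\<epsilon> \<ge> 0"
  shows "classical_sol T (\<lambda>t. fser (a t)) (\<lambda>t. fser (dd 1 (a t))) (\<lambda>t. fser (dd 2 (a t))) (\<lambda>t. fser (dd 3 (a t))) (\<lambda>t x. - \<epsilon> * fser (dd 4 (a t)) x)"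
proof -
  have j: "(fser (dd j (a t)) has_real_derivative fser (dd (Suc j) (a t)) x) (at x)" if "t \<in> {0..T}" for t j x
    using jetD[OF jet_fjet[OF esol_rapid[OF e that]], of j x] .
  have cj: "continuous_on ({0..T} \<times> UNIV) (\<lambda>(t, x). fser (dd j (a t)) x)" for j by (rule esol_joint[OF e])
  have c4: "continuous_on ({0..T} \<times> UNIV) (\<lambda>(t, x). - \<epsilon> * fser (dd 4 (a t)) x)"
    unfolding case_prod_unfold by (intro continuous_intros esol_joint'[OF e])
  have d: "((\<lambda>t. fser (a t) x) has_real_derivative (fser (a t) x ^ 3 * fser (dd 3 (a t)) x + - \<epsilon> * fser (dd 4 (a t)) x)) (at t within {0..T})"
    if "t \<in> {0..T}" for t x
    using esol_deriv[OF e \<epsilon> that, of 0 x] unfolding erhs_0 by simp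
  show ?thesis unfolding classical_sol_def
    using j[of _ 0] j[of _ 1] j[of _ 2] cj[of 0] cj[of 3] c4 d by (simp add: fser_periodic numeral_2_eq_2 numeral_3_eq_3)
qed

lemma fser_dd_le_asum:
  assumes "asum 3 d" "j \<le> 3"
  shows "\<bar>fser (dd j d) x\<bar> \<le> kap ^ j * (\<Sum>\<^sub>\<infinity>k. wt k ^ 3 * cmod (d k))"
proof -
  have s: "asum j d" by (rule asum_mono[OF assms])
  have "\<bar>fser (dd j d) x\<bar> \<le> (\<Sum>\<^sub>\<infinity>k. cmod (dd j d k))" by (rule fser_le[OF asum_dd[of 0]]) (use s in simp)
  also have "\<dots> \<le> (\<Sum>\<^sub>\<infinity>k. kap ^ j * (wt k ^ 3 * cmod (d k)))"
  proof (rule infsum_mono)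
    show "(\<lambda>k. cmod (dd j d k)) summable_on UNIV" using asum0[OF asum_dd[of 0 j d]] s by simp
    show "(\<lambda>k. kap ^ j * (wt k ^ 3 * cmod (d k))) summable_on UNIV" using assms(1) unfolding asum_def by (rule summable_on_cmult_right)
    show "cmod (dd j d k) \<le> kap ^ j * (wt k ^ 3 * cmod (d k))" for k
      using cmod_dd_le[of j d k] wt_power_mono[OF assms(2), of k] kap_pos
      by (meson mult_left_mono mult_right_mono norm_ge_zero order_trans zero_le_power less_imp_le)
  qed
  also have "\<dots> = kap ^ j * (\<Sum>\<^sub>\<infinity>k. wt k ^ 3 * cmod (d k))"
    by (rule infsum_cmult_right) (use assms in \<open>simp add: asum_def\<close>)
  finally show ?thesis .
qed

end

lemma cube_mult_diff_le:
  fixes u v p q B \<eta> :: real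
  assumes "\<bar>u\<bar> \<le> B" "\<bar>v\<bar> \<le> B" "\<bar>p\<bar> \<le> B" "\<bar>u - v\<bar> \<le> \<eta>" "\<bar>p - q\<bar> \<le> \<eta>"
  shows "\<bar>u ^ 3 * p - v ^ 3 * q\<bar> \<le> 4 * B ^ 3 * \<eta>"
proof -
  have e: "u ^ 3 * p - v ^ 3 * q = (u - v) * ((u * u + u * v + v * v) * p) + v ^ 3 * (p - q)"
    by (simp add: algebra_simps power3_eq_cube)
  have "\<bar>u * u\<bar> \<le> B * B" "\<bar>u * v\<bar> \<le> B * B" "\<bar>v * v\<bar> \<le> B * B" by (intro abs_mult_le assms)+
  then have "\<bar>u * u + u * v + v * v\<bar> \<le> 3 * (B * B)" using abs_triangle_ineq[of "u * u + u * v" "v * v"] abs_triangle_ineq[of "u * u" "u * v"] by argo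
  then have "\<bar>(u - v) * ((u * u + u * v + v * v) * p)\<bar> \<le> \<eta> * (3 * (B * B) * B)"
    by (intro abs_mult_le[OF assms(4)] abs_mult_le[OF _ assms(3)])
  moreover have "\<bar>v ^ 3 * (p - q)\<bar> \<le> B ^ 3 * \<eta>" by (intro abs_mult_le abs_power_le assms)
  moreover have "\<eta> * (3 * (B * B) * B) = 3 * B ^ 3 * \<eta>" by (simp add: power3_eq_cube)
  ultimately show ?thesis unfolding e using abs_triangle_ineq[of "(u - v) * ((u * u + u * v + v * v) * p)" "v ^ 3 * (p - q)"] by linarith
qed

section \<open>Convergence of the regularised solutions\<close>

context circle begin

text \<open>The regularising term need not tend to zero pointwise, as fourth derivatives lack a
  uniform bound for n = 4. The equation is therefore integrated in time and tested on Fourier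
  coefficients; a continuous periodic function whose coefficients all vanish is zero, and
  differentiating the integrated equation gives back the classical one.\<close>

lemma esol_limit:
  assumes n: "n \<ge> 4" and T: "T > 0" and e0: "\<And>N. \<epsilon> N \<ge> 0" "\<epsilon> \<longlonglongrightarrow> 0"
    and es: "\<And>N. esol (\<epsilon> N) T (A N)" and R: "\<And>N t. t \<in> {0..T} \<Longrightarrow> hn n (A N t) \<le> R"
    and lim: "\<And>t k. t \<in> {0..T} \<Longrightarrow> (\<lambda>N. A N t k) \<longlonglongrightarrow> c t k"
    and u3: "\<And>\<eta>. \<eta> > 0 \<Longrightarrow> \<forall>\<^sub>F N in sequentially. \<forall>t\<in>{0..T}. (\<Sum>\<^sub>\<infinity>k. wt k ^ 3 * cmod (A N t k - c t k)) \<le> \<eta>"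
  shows "hsol n R T c"
proof -
  have ra: "rapid (A N t)" and sa: "symm (A N t)" if "t \<in> {0..T}" for N t
    using esol_rapid[OF es that] esol_symm[OF es that] by auto
  have hc: "hs n (c t)" and hR: "hn n (c t) \<le> R" if t: "t \<in> {0..T}" for t
    using hn_limit[of "\<lambda>N. A N t" "c t" n R] lim[OF t] R[OF t] rapid_hs[OF ra[OF t]] by auto
  have sc: "symm (c t)" if t: "t \<in> {0..T}" for t
    unfolding symm_def
  proof
    fix k
    have "(\<lambda>N. cnj (A N t k)) \<longlonglongrightarrow> cnj (c t k)" by (intro tendsto_intros lim t)
    moreover have "cnj (A N t k) = A N t (- k)" for N using sa[OF t, of N] by (simp add: symm_def)
    ultimately show "c t (- k) = cnj (c t k)" using lim[OF t, of "- k"] LIMSEQ_unique by auto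
  qed
  have c3: "asum 3 (c t)" if "t \<in> {0..T}" for t using hs_asum(1)[OF hc[OF that], of 3] n by simp
  have sup: "\<forall>\<^sub>F N in sequentially. \<forall>t\<in>{0..T}. \<forall>x. \<bar>fser (dd j (A N t)) x - fser (dd j (c t)) x\<bar> \<le> \<eta>"
    if \<eta>: "\<eta> > 0" and j: "j \<le> 3" for \<eta> j
  proof -
    have kj: "kap ^ j > 0" using kap_pos by simp
    have "\<eta> / kap ^ j > 0" using \<eta> kj by simp
    from u3[OF this] show ?thesis
    proof eventually_elim
      case (elim N)
      show ?case
      proof (intro ballI allI)
        fix t x assume t: "t \<in> {0..T}"
        have a3: "asum 3 (A N t)" by (rule rapid_asum[OF ra[OF t]])
        have "fser (dd j (A N t)) x - fser (dd j (c t)) x = fser (dd j (\<lambda>k. A N t k - c t k)) x"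
          unfolding dd_diff by (rule fser_diff[where s=0 and r=0, symmetric])
            (use asum_mono[OF a3 j] asum_mono[OF c3[OF t] j] in \<open>auto intro!: asum_dd\<close>)
        also have "\<bar>\<dots>\<bar> \<le> kap ^ j * (\<Sum>\<^sub>\<infinity>k. wt k ^ 3 * cmod (A N t k - c t k))"
          by (rule fser_dd_le_asum[OF asum_diff[OF a3 c3[OF t]] j])
        also have "\<dots> \<le> kap ^ j * (\<eta> / kap ^ j)" using elim t kj by (intro mult_left_mono) auto
        also have "\<dots> = \<eta>" using kap_pos by simp
        finally show "\<bar>fser (dd j (A N t)) x - fser (dd j (c t)) x\<bar> \<le> \<eta>" .
      qed
    qed
  qed
  have cj: "continuous_on ({0..T} \<times> UNIV) (\<lambda>p. fser (dd j (c (fst p))) (snd p))" if j: "j \<le> 3" for j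
  proof (rule uniform_limit_theorem)
    show "uniform_limit ({0..T} \<times> UNIV) (\<lambda>N p. fser (dd j (A N (fst p))) (snd p)) (\<lambda>p. fser (dd j (c (fst p))) (snd p)) sequentially"
    proof (rule uniform_limitI)
      fix e :: real assume "e > 0"
      then have "e / 2 > 0" by simp
      from sup[OF this j] show "\<forall>\<^sub>F N in sequentially. \<forall>p\<in>{0..T} \<times> UNIV. dist (fser (dd j (A N (fst p))) (snd p)) (fser (dd j (c (fst p))) (snd p)) < e"
      proof eventually_elim
        case (elim N)
        show ?case
        proof
          fix p assume "p \<in> {0..T} \<times> (UNIV :: real set)"
          then have "fst p \<in> {0..T}" by auto
          with elim have "\<bar>fser (dd j (A N (fst p))) (snd p) - fser (dd j (c (fst p))) (snd p)\<bar> \<le> e / 2" by blast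
          then show "dist (fser (dd j (A N (fst p))) (snd p)) (fser (dd j (c (fst p))) (snd p)) < e"
            using \<open>e > 0\<close> by (simp add: dist_real_def)
        qed
      qed
    qed
    show "\<forall>\<^sub>F N in sequentially. continuous_on ({0..T} \<times> UNIV) (\<lambda>p. fser (dd j (A N (fst p))) (snd p))"
      by (intro always_eventually allI esol_joint'[OF es])
  qed simp
  have cj0: "continuous_on ({0..T} \<times> UNIV) (\<lambda>p. fser (c (fst p)) (snd p))" using cj[of 0] by simp
  define B where "B = Bc n R"
  have R0: "R \<ge> 0" using R[where t=0 and N=0] T hn_nonneg[of n "A 0 0"] by simp
  have B: "B \<ge> 1" unfolding B_def by (rule Bc_ge1[OF R0])
  have bc: "\<bar>fser (dd j (c t)) x\<bar> \<le> B" if "t \<in> {0..T}" "j \<le> 3" for t j x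
    unfolding B_def by (rule fjet_le_Bc[OF hc hR]) (use that n in auto)
  have ba: "\<bar>fser (dd j (A N t)) x\<bar> \<le> B" if "t \<in> {0..T}" "j \<le> 3" for N t j x
    unfolding B_def by (rule fjet_le_Bc[OF rapid_hs[OF ra[OF that(1)]] R]) (use that n in auto)
  define F where "F t x = fser (c t) x ^ 3 * fser (dd 3 (c t)) x" for t x
  define FN where "FN N t x = fser (A N t) x ^ 3 * fser (dd 3 (A N t)) x" for N t x
  have cF: "continuous_on ({0..T} \<times> UNIV) (\<lambda>p. F (fst p) (snd p))" unfolding F_def by (intro continuous_intros cj cj0) simp
  have cFN: "continuous_on ({0..T} \<times> UNIV) (\<lambda>p. FN N (fst p) (snd p))" for N
    unfolding FN_def using esol_joint'[OF es[of N], of UNIV 0] by (intro continuous_intros esol_joint'[OF es]) simp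
  have cFt: "continuous_on {0..t} (\<lambda>s. G s x)" if "t \<in> {0..T}" "continuous_on ({0..T} \<times> UNIV) (\<lambda>p. G (fst p) (snd p))" for G :: "real \<Rightarrow> real \<Rightarrow> real" and t x
    by (rule continuous_on_compose2[OF that(2), of "{0..t}" "\<lambda>s. (s, x)", simplified fst_conv snd_conv])
       (use that(1) in \<open>auto intro!: continuous_intros\<close>)
  have cFx: "continuous_on UNIV (\<lambda>x. integral {0..t} (\<lambda>s. G s x))" if "t \<in> {0..T}" "continuous_on ({0..T} \<times> UNIV) (\<lambda>p. G (fst p) (snd p))" for G :: "real \<Rightarrow> real \<Rightarrow> real" and t
  proof -
    have "continuous_on (UNIV \<times> {0..t}) (\<lambda>p. G (snd p) (fst p))"
      by (rule continuous_on_compose2[OF that(2), of _ "\<lambda>p. (snd p, fst p)", simplified fst_conv snd_conv]) (use that(1) in \<open>auto intro!: continuous_intros\<close>)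
    then show ?thesis using integral_continuous_on_param[of UNIV 0 t "\<lambda>x s. G s x"] by (simp add: case_prod_unfold)
  qed
  have duhamel: "fser (c t) x = fser (c 0) x + integral {0..t} (\<lambda>s. F s x)" if t: "t \<in> {0..T}" for t x
  proof -
    have z: "0 \<in> {0..T}" using T by simp
    define E where "E x = fser (c t) x - fser (c 0) x - integral {0..t} (\<lambda>s. F s x)" for x
    define EN where "EN N x = fser (A N t) x - fser (A N 0) x - integral {0..t} (\<lambda>s. FN N s x)" for N x
    have cont0: "continuous_on UNIV (fser (c s))" if "s \<in> {0..T}" for s by (rule fser_cont[OF c3[OF that]])
    have contA: "continuous_on UNIV (fser (A N s))" if "s \<in> {0..T}" for s N by (rule fser_cont[OF rapid_asum[OF ra[OF that], of 0]])
    have Ec: "continuous_on UNIV E" unfolding E_def[abs_def] by (intro continuous_intros cont0 t z cFx[OF t cF])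
    have ENc: "continuous_on UNIV (EN N)" for N unfolding EN_def[abs_def] by (intro continuous_intros contA t z cFx[OF t cFN])
    \<comment> \<open>The defect of a regularised solution is the time integral of its regularising
      term. At fixed k four derivatives are just the factor \<open>(kap * |k|) ^ 4\<close>, so the
      coefficient of the defect is O(\<open>\<epsilon> N\<close>).\<close>
    have ENc4: "cmod (fcoeff L (EN N) k) \<le> \<epsilon> N * (kap ^ 4 * \<bar>real_of_int k\<bar> ^ 4 * (R + 1) * T)" for N k
    proof -
      have ENi: "EN N x = integral {0..t} (\<lambda>s. - \<epsilon> N * fser (dd 4 (A N s)) x)" for x
      proof -
        have "((\<lambda>s. fser (A N s) x) has_vector_derivative (FN N s x + - \<epsilon> N * fser (dd 4 (A N s)) x)) (at s within {0..t})" if "s \<in> {0..t}" for s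
        proof -
          have "s \<in> {0..T}" using that t by auto
          then have "((\<lambda>s. fser (A N s) x) has_real_derivative (FN N s x + - \<epsilon> N * fser (dd 4 (A N s)) x)) (at s within {0..T})"
            using esol_classical_sol[OF es e0(1), of N] unfolding classical_sol_def FN_def by blast
          then have "((\<lambda>s. fser (A N s) x) has_real_derivative (FN N s x + - \<epsilon> N * fser (dd 4 (A N s)) x)) (at s within {0..t})"
            by (rule has_field_derivative_subset) (use t in auto)
          then show ?thesis by (simp add: has_real_derivative_iff_has_vector_derivative)
        qed
        then have "((\<lambda>s. FN N s x + - \<epsilon> N * fser (dd 4 (A N s)) x) has_integral (fser (A N t) x - fser (A N 0) x)) {0..t}"
          using t by (intro fundamental_theorem_of_calculus) auto
        moreover have i1: "(\<lambda>s. FN N s x) integrable_on {0..t}" by (intro integrable_continuous_real cFt[OF t cFN])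
        moreover have i2: "(\<lambda>s. - \<epsilon> N * fser (dd 4 (A N s)) x) integrable_on {0..t}"
          by (intro integrable_continuous_real continuous_intros cFt[OF t esol_joint'[OF es]])
        ultimately show ?thesis unfolding EN_def using integral_add[OF i1 i2] by (simp add: integral_unique)
      qed
      have "fcoeff L (EN N) k = fcoeff L (\<lambda>x. integral {0..t} (\<lambda>s. - \<epsilon> N * fser (dd 4 (A N s)) x)) k"
        by (rule arg_cong[of _ _ "\<lambda>f. fcoeff L f k"]) (rule ext, rule ENi)
      also have "\<dots> = integral {0..t} (\<lambda>s. fcoeff L (\<lambda>x. - \<epsilon> N * fser (dd 4 (A N s)) x) k)"
      proof (rule fcoeff_time_integral)
        have "continuous_on ({0..t} \<times> {0..L}) (\<lambda>p. fser (dd 4 (A N (fst p))) (snd p))"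
          by (rule continuous_on_subset[OF esol_joint'[OF es, where U=UNIV]]) (use t in auto)
        then show "continuous_on ({0..t} \<times> {0..L}) (\<lambda>(s, x). - \<epsilon> N * fser (dd 4 (A N s)) x)"
          unfolding case_prod_unfold by (intro continuous_intros)
      qed
      also have "\<dots> = integral {0..t} (\<lambda>s. (- \<epsilon> N) *\<^sub>R dd 4 (A N s) k)"
      proof (rule integral_cong)
        fix s assume "s \<in> {0..t}"
        then have s: "s \<in> {0..T}" using t by auto
        have r: "asum 0 (dd 4 (A N s))" by (intro rapid_asum rapid_dd ra s)
        have "asum 0 (\<lambda>k. (- \<epsilon> N) *\<^sub>R dd 4 (A N s) k)"
          using r summable_on_cmult_right[of "\<lambda>k. cmod (dd 4 (A N s) k)" UNIV "\<bar>\<epsilon> N\<bar>"] by (simp add: asum_def)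
        moreover have "symm (\<lambda>k. (- \<epsilon> N) *\<^sub>R dd 4 (A N s) k)" using symm_dd[OF sa[OF s], of 4] by (simp add: symm_def)
        ultimately have "fcoeff L (fser (\<lambda>k. (- \<epsilon> N) *\<^sub>R dd 4 (A N s) k)) k = (- \<epsilon> N) *\<^sub>R dd 4 (A N s) k" by (rule fcoeff_fser)
        moreover have "fser (\<lambda>k. (- \<epsilon> N) *\<^sub>R dd 4 (A N s) k) = (\<lambda>x. - \<epsilon> N * fser (dd 4 (A N s)) x)" by (rule ext) (rule fser_scale)
        ultimately show "fcoeff L (\<lambda>x. - \<epsilon> N * fser (dd 4 (A N s)) x) k = (- \<epsilon> N) *\<^sub>R dd 4 (A N s) k" by simp
      qed
      also have "cmod \<dots> \<le> integral {0..t} (\<lambda>s. \<epsilon> N * (kap ^ 4 * \<bar>real_of_int k\<bar> ^ 4 * (R + 1)))"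
      proof (rule integral_norm_bound_integral)
        have "continuous_on {0..t} (\<lambda>s. A N s k)" by (rule continuous_on_subset[OF esol_cont[OF es]]) (use t in auto)
        then show "(\<lambda>s. (- \<epsilon> N) *\<^sub>R dd 4 (A N s) k) integrable_on {0..t}"
          unfolding dd_def by (intro integrable_continuous_real continuous_intros)
        fix s assume "s \<in> {0..t}"
        then have s: "s \<in> {0..T}" using t by auto
        have "(cmod (A N s k))\<^sup>2 \<le> hw n k * (cmod (A N s k))\<^sup>2" using mult_right_mono[OF hw_ge1[of n k], of "(cmod (A N s k))\<^sup>2"] by simp
        also have "\<dots> \<le> R" using hn_term_le[OF rapid_hs[OF ra[OF s, of N], of n], of k] R[OF s, of N] by linarith
        also have "\<dots> \<le> (R + 1)\<^sup>2" using R0 by (simp add: power2_eq_square algebra_simps)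
        finally have "cmod (A N s k) \<le> R + 1" by (rule power2_le_imp_le) (use R0 in simp)
        then have "cmod (dd 4 (A N s) k) \<le> kap ^ 4 * \<bar>real_of_int k\<bar> ^ 4 * (R + 1)" unfolding cmod_dd by (intro mult_left_mono) auto
        then show "norm ((- \<epsilon> N) *\<^sub>R dd 4 (A N s) k) \<le> \<epsilon> N * (kap ^ 4 * \<bar>real_of_int k\<bar> ^ 4 * (R + 1))"
          using e0(1)[of N] by (simp add: mult_left_mono)
      qed auto
      also have "\<dots> = \<epsilon> N * (kap ^ 4 * \<bar>real_of_int k\<bar> ^ 4 * (R + 1)) * t" using t by simp
      also have "\<dots> \<le> \<epsilon> N * (kap ^ 4 * \<bar>real_of_int k\<bar> ^ 4 * (R + 1)) * T"
        using t e0(1)[of N] R0 by (intro mult_left_mono mult_nonneg_nonneg) auto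
      finally show ?thesis by (simp add: mult.assoc)
    qed
    have "fcoeff L E k = 0" for k
    proof -
      have "cmod (fcoeff L E k) \<le> e" if e: "e > 0" for e
      proof -
        \<comment> \<open>The defects differ by at most \<open>(2 + 4 * B ^ 3 * T) * \<eta>\<close>:
          2 for the two endpoint values, the rest for the integral by
          \<open>cube_mult_diff_le\<close>.\<close>
        define \<eta> where "\<eta> = e / (2 * (2 + 4 * B ^ 3 * T))"
        have den: "2 + 4 * B ^ 3 * T > 0" using B T by (simp add: add_pos_nonneg)
        have \<eta>: "\<eta> > 0" using e den by (simp add: \<eta>_def)
        have "(\<lambda>N. \<epsilon> N * (kap ^ 4 * \<bar>real_of_int k\<bar> ^ 4 * (R + 1) * T)) \<longlonglongrightarrow> 0 * (kap ^ 4 * \<bar>real_of_int k\<bar> ^ 4 * (R + 1) * T)"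
          by (intro tendsto_intros e0)
        then have "\<forall>\<^sub>F N in sequentially. \<epsilon> N * (kap ^ 4 * \<bar>real_of_int k\<bar> ^ 4 * (R + 1) * T) < e / 2"
          using e by (intro order_tendstoD(2)) auto
        moreover have "\<forall>\<^sub>F N in sequentially. \<forall>t\<in>{0..T}. \<forall>x. \<bar>fser (dd 0 (A N t)) x - fser (dd 0 (c t)) x\<bar> \<le> \<eta>" by (rule sup[OF \<eta>]) simp
        moreover have "\<forall>\<^sub>F N in sequentially. \<forall>t\<in>{0..T}. \<forall>x. \<bar>fser (dd 3 (A N t)) x - fser (dd 3 (c t)) x\<bar> \<le> \<eta>" by (rule sup[OF \<eta>]) simp
        ultimately have "\<forall>\<^sub>F N in sequentially. cmod (fcoeff L E k) \<le> e"
        proof eventually_elim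
          case (elim N)
          have d0: "\<bar>fser (c s) x - fser (A N s) x\<bar> \<le> \<eta>" and d3: "\<bar>fser (dd 3 (c s)) x - fser (dd 3 (A N s)) x\<bar> \<le> \<eta>" if "s \<in> {0..T}" for s x
            using elim that by (auto simp: abs_minus_commute)
          have dF: "\<bar>F s x - FN N s x\<bar> \<le> 4 * B ^ 3 * \<eta>" if s: "s \<in> {0..T}" for s x
            unfolding F_def FN_def
            by (rule cube_mult_diff_le) (use bc[OF s, of 0 x] ba[OF s, of 0 N x] bc[OF s, of 3 x] d0[OF s] d3[OF s] in auto)
          have "\<bar>E x - EN N x\<bar> \<le> (2 + 4 * B ^ 3 * T) * \<eta>" for x
          proof -
            have "integral {0..t} (\<lambda>s. F s x) - integral {0..t} (\<lambda>s. FN N s x) = integral {0..t} (\<lambda>s. F s x - FN N s x)"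
              by (rule integral_diff[symmetric]) (intro integrable_continuous_real cFt[OF t cF] cFt[OF t cFN])+
            also have "norm \<dots> \<le> integral {0..t} (\<lambda>s. 4 * B ^ 3 * \<eta>)"
            proof (rule integral_norm_bound_integral)
              show "(\<lambda>s. F s x - FN N s x) integrable_on {0..t}"
                by (intro integrable_continuous_real continuous_intros cFt[OF t cF] cFt[OF t cFN])
              show "norm (F s x - FN N s x) \<le> 4 * B ^ 3 * \<eta>" if "s \<in> {0..t}" for s using dF[of s x] that t by simp
            qed auto
            also have "\<dots> = 4 * B ^ 3 * \<eta> * t" using t by simp
            also have "\<dots> \<le> 4 * B ^ 3 * \<eta> * T" using t B \<eta> by (intro mult_left_mono) auto
            finally have "\<bar>integral {0..t} (\<lambda>s. F s x) - integral {0..t} (\<lambda>s. FN N s x)\<bar> \<le> 4 * B ^ 3 * T * \<eta>" by (simp add: mult_ac)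
            then show ?thesis using d0[OF t, of x] d0[OF z, of x] unfolding E_def EN_def by (simp add: distrib_right abs_le_iff)
          qed
          then have "cmod (fcoeff L (\<lambda>x. E x - EN N x) k) \<le> (2 + 4 * B ^ 3 * T) * \<eta>"
            by (intro fcoeff_le continuous_on_subset[OF continuous_on_diff[OF Ec ENc]]) auto
          also have "\<dots> = e / 2"
          proof -
            have "D * (e / (2 * D)) = e / 2" if "D > 0" for D using that by simp
            then show ?thesis unfolding \<eta>_def using den by blast
          qed
          also have "fcoeff L (\<lambda>x. E x - EN N x) k = fcoeff L E k - fcoeff L (EN N) k"
            by (intro fcoeff_diff borel_integrable_atLeastAtMost' continuous_on_subset[OF Ec] continuous_on_subset[OF ENc]) auto
          finally have "cmod (fcoeff L E k - fcoeff L (EN N) k) \<le> e / 2" .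
          then show ?case using ENc4[of N k] elim(1) norm_triangle_sub[of "fcoeff L E k" "fcoeff L (EN N) k"] by linarith
        qed
        then show ?thesis by simp
      qed
      then have "cmod (fcoeff L E k) \<le> 0" by (rule field_le_epsilon[of _ 0, simplified])
      then show ?thesis by simp
    qed
    moreover have "fcoeff L (\<lambda>_. 0) k = 0" for k
      using fcoeff_le[of "\<lambda>_. 0" 0 k] by (simp add: continuous_on_const)
    ultimately have "E = (\<lambda>_. 0)"
      by (intro continuous_fcoeff_eq_iff Ec continuous_on_const) (auto simp: E_def F_def fser_periodic)
    then show ?thesis by (simp add: E_def fun_eq_iff algebra_simps)
  qed
  have dt: "((\<lambda>t. fser (c t) x) has_real_derivative (fser (c t) x ^ 3 * fser (dd 3 (c t)) x + 0)) (at t within {0..T})" if t: "t \<in> {0..T}" for t x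
  proof -
    have TT: "T \<in> {0..T}" using T by simp
    have "((\<lambda>t. integral {0..t} (\<lambda>s. F s x)) has_vector_derivative F t x) (at t within {0..T})"
      by (rule integral_has_vector_derivative[OF cFt[OF TT cF] t])
    then have "((\<lambda>t. fser (c 0) x + integral {0..t} (\<lambda>s. F s x)) has_real_derivative (0 + F t x)) (at t within {0..T})"
      by (intro DERIV_add DERIV_const) (simp add: has_real_derivative_iff_has_vector_derivative)
    then have "((\<lambda>t. fser (c t) x) has_real_derivative (0 + F t x)) (at t within {0..T})"
      by (rule has_field_derivative_transform_within[OF _ zero_less_one t]) (rule duhamel[symmetric])
    then show ?thesis by (simp add: F_def)
  qed
  have dx: "(fser (dd j (c t)) has_real_derivative fser (dd (Suc j) (c t)) x) (at x)" if "t \<in> {0..T}" "j \<le> 2" for t j x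
    by (rule fser_deriv_dd[OF asum_mono[OF c3[OF that(1)]]]) (use that in simp)
  have "classical_sol T (\<lambda>t. fser (c t)) (\<lambda>t. fser (dd 1 (c t))) (\<lambda>t. fser (dd 2 (c t))) (\<lambda>t. fser (dd 3 (c t))) (\<lambda>_ _. 0)"
    unfolding classical_sol_def case_prod_unfold
    using dx[of _ 0] dx[of _ 1] dx[of _ 2] cj0 cj[of 3] dt by (simp add: fser_periodic numeral_2_eq_2 numeral_3_eq_3)
  then show ?thesis unfolding hsol_def using hc hR sc by blast
qed

text \<open>\<open>stability\<close> with the regularising terms as residuals: fourth derivatives
  are bounded in mean square, so the residuals are of size \<open>\<epsilon>\<^sup>2\<close>
  there.\<close>

lemma esol_cauchy:
  assumes n: "n \<ge> 4" and b: "b > 0" and T: "T \<ge> 0" and R: "R \<ge> 0"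
  shows "\<exists>C\<ge>0. \<forall>\<epsilon> \<epsilon>' a a'. 0 \<le> \<epsilon> \<longrightarrow> 0 \<le> \<epsilon>' \<longrightarrow> esol \<epsilon> T a \<longrightarrow> esol \<epsilon>' T a' \<longrightarrow>
     (\<forall>t\<in>{0..T}. hn n (a t) \<le> R \<and> hn n (a' t) \<le> R \<and> (\<forall>x. b \<le> fser (a t) x)) \<longrightarrow>
     (\<forall>t\<in>{0..T}. hn 0 (\<lambda>k. a t k - a' t k) \<le> C * (hn 0 (\<lambda>k. a 0 k - a' 0 k) + (\<epsilon>\<^sup>2 + \<epsilon>'\<^sup>2)))"
proof -
  define B where "B = Bc n R"
  have B: "B \<ge> 1" unfolding B_def by (rule Bc_ge1[OF R])
  define Q where "Q = L * B\<^sup>2 + B"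
  have Q: "Q \<ge> 0" using B L_pos by (simp add: Q_def)
  obtain C where C: "C \<ge> 0" and st: "\<forall>T' u u1 u2 u3 v v1 v2 v3 r r' \<rho>. classical_sol T' u u1 u2 u3 r \<longrightarrow> classical_sol T' v v1 v2 v3 r' \<longrightarrow> T' \<le> T \<longrightarrow>
     (\<forall>t\<in>{0..T'}. \<forall>x. b \<le> u t x \<and> \<bar>u t x\<bar> \<le> B \<and> \<bar>v t x\<bar> \<le> B \<and> \<bar>u3 t x\<bar> \<le> B \<and> \<bar>v3 t x\<bar> \<le> B) \<longrightarrow>
     (\<forall>t\<in>{0..T'}. integral {0..L} (\<lambda>x. (r t x)\<^sup>2) \<le> \<rho> \<and> integral {0..L} (\<lambda>x. (r' t x)\<^sup>2) \<le> \<rho>) \<longrightarrow>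
     (\<forall>t\<in>{0..T'}. integral {0..L} (\<lambda>x. (u t x - v t x)\<^sup>2) \<le> C * (integral {0..L} (\<lambda>x. (u 0 x - v 0 x)\<^sup>2) + \<rho>))"
    using stability[OF b B T] by (elim exE conjE)
  have C1: "C * (1 + Q / L) \<ge> 0" using C Q L_pos by simp
  show ?thesis
  proof (intro exI[of _ "C * (1 + Q / L)"] conjI allI impI ballI C1)
    fix \<epsilon> \<epsilon>' :: real and a a' t
    assume e: "0 \<le> \<epsilon>" "0 \<le> \<epsilon>'" and s: "esol \<epsilon> T a" "esol \<epsilon>' T a'"
      and h: "\<forall>t\<in>{0..T}. hn n (a t) \<le> R \<and> hn n (a' t) \<le> R \<and> (\<forall>x. b \<le> fser (a t) x)" and t: "t \<in> {0..T}"
    have r: "rapid (a s)" "rapid (a' s)" "symm (a s)" "symm (a' s)" if "s \<in> {0..T}" for s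
      using esol_rapid[OF s(1) that] esol_rapid[OF s(2) that] esol_symm[OF s(1) that] esol_symm[OF s(2) that] by auto
    have hR: "hn n (a s) \<le> R" "hn n (a' s) \<le> R" if "s \<in> {0..T}" for s using h that by auto
    have bb: "\<bar>fser (dd j (a s)) x\<bar> \<le> B" "\<bar>fser (dd j (a' s)) x\<bar> \<le> B" if "s \<in> {0..T}" "j < n" for s x j
      unfolding B_def by (rule fjet_le_Bc[OF rapid_hs[OF r(1)[OF that(1)]] hR(1)[OF that(1)] that(2)],
        rule fjet_le_Bc[OF rapid_hs[OF r(2)[OF that(1)]] hR(2)[OF that(1)] that(2)])
    have i4: "integral {0..L} (\<lambda>x. (- \<epsilon> * fser (dd 4 (a s)) x)\<^sup>2) \<le> (\<epsilon>\<^sup>2 + \<epsilon>'\<^sup>2) * Q \<and> integral {0..L} (\<lambda>x. (- \<epsilon>' * fser (dd 4 (a' s)) x)\<^sup>2) \<le> (\<epsilon>\<^sup>2 + \<epsilon>'\<^sup>2) * Q"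
      if s: "s \<in> {0..T}" for s
    proof -
      have q: "integral {0..L} (\<lambda>x. (fser (dd 4 (a s)) x)\<^sup>2) \<le> Q" "integral {0..L} (\<lambda>x. (fser (dd 4 (a' s)) x)\<^sup>2) \<le> Q"
        unfolding Q_def B_def using int4_le[OF n] r[OF s] hR[OF s] by blast+
      have "\<epsilon>\<^sup>2 * integral {0..L} (\<lambda>x. (fser (dd 4 (a s)) x)\<^sup>2) \<le> \<epsilon>\<^sup>2 * Q" "\<epsilon>'\<^sup>2 * integral {0..L} (\<lambda>x. (fser (dd 4 (a' s)) x)\<^sup>2) \<le> \<epsilon>'\<^sup>2 * Q"
        using q by (intro mult_left_mono; simp)+
      moreover have "0 \<le> \<epsilon>\<^sup>2 * Q" "0 \<le> \<epsilon>'\<^sup>2 * Q" using Q by auto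
      ultimately show ?thesis by (simp add: power_mult_distrib distrib_right)
    qed
    have "\<forall>t\<in>{0..T}. integral {0..L} (\<lambda>x. (fser (a t) x - fser (a' t) x)\<^sup>2) \<le> C * (integral {0..L} (\<lambda>x. (fser (a 0) x - fser (a' 0) x)\<^sup>2) + (\<epsilon>\<^sup>2 + \<epsilon>'\<^sup>2) * Q)"
    proof (rule st[THEN spec, THEN spec, THEN spec, THEN spec, THEN spec, THEN spec, THEN spec, THEN spec, THEN spec, THEN spec, THEN spec, THEN spec, THEN mp, THEN mp, THEN mp, THEN mp, THEN mp])
      show "classical_sol T (\<lambda>t. fser (a t)) (\<lambda>t. fser (dd 1 (a t))) (\<lambda>t. fser (dd 2 (a t))) (\<lambda>t. fser (dd 3 (a t))) (\<lambda>t x. - \<epsilon> * fser (dd 4 (a t)) x)"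
        "classical_sol T (\<lambda>t. fser (a' t)) (\<lambda>t. fser (dd 1 (a' t))) (\<lambda>t. fser (dd 2 (a' t))) (\<lambda>t. fser (dd 3 (a' t))) (\<lambda>t x. - \<epsilon>' * fser (dd 4 (a' t)) x)"
        by (rule esol_classical_sol[OF s(1) e(1)], rule esol_classical_sol[OF s(2) e(2)])
      show "\<forall>t\<in>{0..T}. \<forall>x. b \<le> fser (a t) x \<and> \<bar>fser (a t) x\<bar> \<le> B \<and> \<bar>fser (a' t) x\<bar> \<le> B \<and> \<bar>fser (dd 3 (a t)) x\<bar> \<le> B \<and> \<bar>fser (dd 3 (a' t)) x\<bar> \<le> B"
        using h bb[of _ 0] bb[of _ 3] n by simp
      show "\<forall>t\<in>{0..T}. integral {0..L} (\<lambda>x. (- \<epsilon> * fser (dd 4 (a t)) x)\<^sup>2) \<le> (\<epsilon>\<^sup>2 + \<epsilon>'\<^sup>2) * Q \<and> integral {0..L} (\<lambda>x. (- \<epsilon>' * fser (dd 4 (a' t)) x)\<^sup>2) \<le> (\<epsilon>\<^sup>2 + \<epsilon>'\<^sup>2) * Q"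
        using i4 by blast
    qed simp
    moreover have "integral {0..L} (\<lambda>x. (fser (a s) x - fser (a' s) x)\<^sup>2) = L * hn 0 (\<lambda>k. a s k - a' s k)" if "s \<in> {0..T}" for s
      using int_sq_eq[OF rapid_diff[OF r(1,2)[OF that]] symm_diff[OF r(3,4)[OF that]]]
      by (simp only: fser_diff[OF rapid_asum[OF r(1)[OF that], of 0] rapid_asum[OF r(2)[OF that], of 0]])
    ultimately have "L * hn 0 (\<lambda>k. a t k - a' t k) \<le> C * (L * hn 0 (\<lambda>k. a 0 k - a' 0 k) + (\<epsilon>\<^sup>2 + \<epsilon>'\<^sup>2) * Q)"
      using t by simp
    then have "hn 0 (\<lambda>k. a t k - a' t k) \<le> C * (hn 0 (\<lambda>k. a 0 k - a' 0 k) + (\<epsilon>\<^sup>2 + \<epsilon>'\<^sup>2) * (Q / L))"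
      using L_pos by (simp add: field_simps)
    also have "\<dots> \<le> C * ((1 + Q / L) * (hn 0 (\<lambda>k. a 0 k - a' 0 k) + (\<epsilon>\<^sup>2 + \<epsilon>'\<^sup>2)))"
    proof (rule mult_left_mono[OF _ C])
      have "0 \<le> Q / L * hn 0 (\<lambda>k. a 0 k - a' 0 k)" "0 \<le> \<epsilon>\<^sup>2 + \<epsilon>'\<^sup>2" using Q L_pos hn_nonneg[of 0 "\<lambda>k. a 0 k - a' 0 k"] by auto
      then show "hn 0 (\<lambda>k. a 0 k - a' 0 k) + (\<epsilon>\<^sup>2 + \<epsilon>'\<^sup>2) * (Q / L) \<le> (1 + Q / L) * (hn 0 (\<lambda>k. a 0 k - a' 0 k) + (\<epsilon>\<^sup>2 + \<epsilon>'\<^sup>2))"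
        by (simp add: algebra_simps)
    qed
    finally show "hn 0 (\<lambda>k. a t k - a' t k) \<le> C * (1 + Q / L) * (hn 0 (\<lambda>k. a 0 k - a' 0 k) + (\<epsilon>\<^sup>2 + \<epsilon>'\<^sup>2))" by (simp add: mult.assoc)
  qed
qed

text \<open>Both the truncation and the regularisation errors vanish in mean square, hence the
  family is Cauchy there uniformly in time. The uniform \<open>H^n\<close> bound lifts this to three
  derivatives, enough for the nonlinearity.\<close>

lemma approx_limit:
  assumes n: "n \<ge> 4" and b: "b > 0" and T: "T > 0" and R: "R \<ge> 0"
    and h: "hs n \<alpha>"
    and es: "\<And>N. esol (1 / (real N + 1)) T (A N)" and A0: "\<And>N. A N 0 = trunc (N + N0) \<alpha>"
    and bA: "\<And>N t. t \<in> {0..T} \<Longrightarrow> hn n (A N t) \<le> R \<and> (\<forall>x. b \<le> fser (A N t) x)"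
  obtains c where "hsol n R T c" "c 0 = \<alpha>" "\<And>t k. t \<in> {0..T} \<Longrightarrow> (\<lambda>N. A N t k) \<longlonglongrightarrow> c t k" "\<forall>t\<in>{0..T}. \<forall>x. b \<le> fser (c t) x"
proof -
  let ?\<epsilon> = "\<lambda>N. 1 / (real N + 1)"
  have e0: "?\<epsilon> \<longlonglongrightarrow> 0" using LIMSEQ_inverse_real_of_nat by (simp add: inverse_eq_divide add.commute)
  have ra: "rapid (A N t)" if "t \<in> {0..T}" for N t using esol_rapid[OF es that] .
  obtain C where C: "C \<ge> 0" and st: "\<forall>\<epsilon> \<epsilon>' a a'. 0 \<le> \<epsilon> \<longrightarrow> 0 \<le> \<epsilon>' \<longrightarrow> esol \<epsilon> T a \<longrightarrow> esol \<epsilon>' T a' \<longrightarrow>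
     (\<forall>t\<in>{0..T}. hn n (a t) \<le> R \<and> hn n (a' t) \<le> R \<and> (\<forall>x. b \<le> fser (a t) x)) \<longrightarrow>
     (\<forall>t\<in>{0..T}. hn 0 (\<lambda>k. a t k - a' t k) \<le> C * (hn 0 (\<lambda>k. a 0 k - a' 0 k) + (\<epsilon>\<^sup>2 + \<epsilon>'\<^sup>2)))"
    using esol_cauchy[OF n b less_imp_le[OF T] R] by (elim exE conjE)
  have cau: "hn 0 (\<lambda>k. A N t k - A M t k) \<le> C * (hn 0 (\<lambda>k. A N 0 k - A M 0 k) + ((?\<epsilon> N)\<^sup>2 + (?\<epsilon> M)\<^sup>2))" if t: "t \<in> {0..T}" for N M t
  proof -
    have hh: "\<forall>t\<in>{0..T}. hn n (A N t) \<le> R \<and> hn n (A M t) \<le> R \<and> (\<forall>x. b \<le> fser (A N t) x)" using bA by blast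
    have nn: "0 \<le> ?\<epsilon> N" "0 \<le> ?\<epsilon> M" by auto
    show ?thesis using st[THEN spec, THEN spec, THEN spec, THEN spec, THEN mp, THEN mp, THEN mp, THEN mp, THEN mp, OF nn es es hh] t by blast
  qed
  have C0: "\<exists>N1. \<forall>N\<ge>N1. \<forall>M\<ge>N1. \<forall>t\<in>{0..T}. hn 0 (\<lambda>k. A N t k - A M t k) \<le> e" if e: "e > 0" for e
  proof -
    \<comment> \<open>The two truncation errors enter with the factor 2 of
      \<open>hn_triangle\<close>, the two squares of \<open>1 / (N + 1)\<close> with factor 1: six
      shares in all.\<close>
    define e' where "e' = e / (6 * (C + 1))"
    have e': "e' > 0" using e C by (simp add: e'_def)
    obtain K0 where K0: "\<And>K. K \<ge> K0 \<Longrightarrow> hn n (\<lambda>k. \<alpha> k - trunc K \<alpha> k) \<le> e'" using trunc_tail[OF h e'] by blast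
    have "(\<lambda>N. (?\<epsilon> N)\<^sup>2) \<longlonglongrightarrow> 0\<^sup>2" by (intro tendsto_intros e0)
    then have "\<forall>\<^sub>F N in sequentially. (?\<epsilon> N)\<^sup>2 < e'" using e' by (intro order_tendstoD(2)) auto
    then obtain K1 where K1: "\<And>N. N \<ge> K1 \<Longrightarrow> (?\<epsilon> N)\<^sup>2 < e'" unfolding eventually_sequentially by blast
    have "hn 0 (\<lambda>k. A N t k - A M t k) \<le> e" if NM: "N \<ge> max K0 K1" "M \<ge> max K0 K1" and t: "t \<in> {0..T}" for N M t
    proof -
      have ht: "hs 0 (\<lambda>k. \<alpha> k - trunc K \<alpha> k)" "hn 0 (\<lambda>k. \<alpha> k - trunc K \<alpha> k) \<le> hn n (\<lambda>k. \<alpha> k - trunc K \<alpha> k)" for K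
        using hs_mono[of n "\<lambda>k. \<alpha> k - trunc K \<alpha> k" 0] hs_diff(1)[OF h rapid_hs[OF trunc_rapid]] by auto
      have ht': "hs 0 (\<lambda>k. trunc K \<alpha> k - \<alpha> k)" for K using ht(1)[of K] by (simp add: hs_def norm_minus_commute)
      have "hn 0 (\<lambda>k. A N 0 k - A M 0 k) \<le> 2 * hn 0 (\<lambda>k. trunc (N + N0) \<alpha> k - \<alpha> k) + 2 * hn 0 (\<lambda>k. \<alpha> k - trunc (M + N0) \<alpha> k)"
        unfolding A0 by (rule hn_triangle(2)[OF ht' ht(1)])
      also have "\<dots> \<le> 2 * e' + 2 * e'"
        using ht(2)[of "N + N0"] ht(2)[of "M + N0"] K0[of "N + N0"] K0[of "M + N0"] NM
        unfolding hn_commute[of 0 "trunc (N + N0) \<alpha>" \<alpha>] by (intro add_mono mult_left_mono) auto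
      finally have "hn 0 (\<lambda>k. A N 0 k - A M 0 k) + ((?\<epsilon> N)\<^sup>2 + (?\<epsilon> M)\<^sup>2) \<le> 6 * e'" using K1[of N] K1[of M] NM by simp
      then have "C * (hn 0 (\<lambda>k. A N 0 k - A M 0 k) + ((?\<epsilon> N)\<^sup>2 + (?\<epsilon> M)\<^sup>2)) \<le> C * (6 * e')" using C by (rule mult_left_mono)
      also have "\<dots> = e * (C / (C + 1))" using C by (simp add: e'_def add_nonneg_eq_0_iff field_simps)
      also have "\<dots> \<le> e * 1" using e C by (intro mult_left_mono) auto
      finally show ?thesis using cau[OF t, of N M] by simp
    qed
    then show ?thesis by (intro exI[of _ "max K0 K1"]) blast
  qed
  define c where "c t k = lim (\<lambda>N. A N t k)" for t k
  have lim: "(\<lambda>N. A N t k) \<longlonglongrightarrow> c t k" if t: "t \<in> {0..T}" for t k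
  proof -
    have "Cauchy (\<lambda>N. A N t k)"
    proof (rule metric_CauchyI)
      fix e :: real assume e: "e > 0"
      then have "(e / 2)\<^sup>2 > 0" by simp
      from C0[OF this] obtain N1 where N1: "\<And>N M. N \<ge> N1 \<Longrightarrow> M \<ge> N1 \<Longrightarrow> hn 0 (\<lambda>k. A N t k - A M t k) \<le> (e / 2)\<^sup>2" using t by blast
      have "dist (A N t k) (A M t k) < e" if "N \<ge> N1" "M \<ge> N1" for N M
      proof -
        have "(cmod (A N t k - A M t k))\<^sup>2 \<le> (e / 2)\<^sup>2"
          using hn_term_le[OF rapid_hs[OF rapid_diff[OF ra[OF t, of N] ra[OF t, of M]], of 0], of k] N1[OF that] by simp
        then have "cmod (A N t k - A M t k) \<le> e / 2" by (rule power2_le_imp_le) (use e in simp)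
        then show ?thesis using e by (simp add: dist_norm)
      qed
      then show "\<exists>M. \<forall>m\<ge>M. \<forall>n\<ge>M. dist (A m t k) (A n t k) < e" by blast
    qed
    then have "convergent (\<lambda>N. A N t k)" by (simp add: Cauchy_convergent_iff)
    then show ?thesis unfolding c_def by (simp add: convergent_LIMSEQ_iff)
  qed
  have u0: "\<exists>N1. \<forall>N\<ge>N1. \<forall>t\<in>{0..T}. hn 0 (\<lambda>k. A N t k - c t k) \<le> e" if e: "e > 0" for e
  proof -
    obtain N1 where N1: "\<And>N M t. N \<ge> N1 \<Longrightarrow> M \<ge> N1 \<Longrightarrow> t \<in> {0..T} \<Longrightarrow> hn 0 (\<lambda>k. A N t k - A M t k) \<le> e" using C0[OF e] by blast
    have "hn 0 (\<lambda>k. A N t k - c t k) \<le> e" if N: "N \<ge> N1" and t: "t \<in> {0..T}" for N t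
    proof (rule hn_limit(2)[of "\<lambda>M k. A N t k - A M t k"])
      show "(\<lambda>M. A N t k - A M t k) \<longlonglongrightarrow> A N t k - c t k" for k by (intro tendsto_intros lim t)
      show "\<forall>\<^sub>F M in sequentially. hs 0 (\<lambda>k. A N t k - A M t k) \<and> hn 0 (\<lambda>k. A N t k - A M t k) \<le> e"
        using eventually_ge_at_top[of N1]
        by eventually_elim (use N1 N t rapid_hs[OF rapid_diff[OF ra[OF t] ra[OF t]]] in blast)
    qed
    then show ?thesis by blast
  qed
  have hc: "hs n (c t)" and hR: "hn n (c t) \<le> R" if t: "t \<in> {0..T}" for t
    using hn_limit[of "\<lambda>N. A N t" "c t" n R] lim[OF t] bA[OF t] rapid_hs[OF ra[OF t]] by auto
  \<comment> \<open>Differences of two functions with norm at most R stay below 4 R, so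
    \<open>asum_small\<close> turns mean-square smallness into smallness of three
    derivatives.\<close>
  have u3: "\<forall>\<^sub>F N in sequentially. \<forall>t\<in>{0..T}. (\<Sum>\<^sub>\<infinity>k. wt k ^ 3 * cmod (A N t k - c t k)) \<le> \<eta>" if \<eta>: "\<eta> > 0" for \<eta>
  proof -
    have s3: "3 + 1 \<le> n" and R4: "4 * R \<ge> 0" using n R by auto
    obtain \<delta> where \<delta>: "\<delta> > 0" "\<And>d. hs n d \<Longrightarrow> hn n d \<le> 4 * R \<Longrightarrow> hn 0 d \<le> \<delta> \<Longrightarrow> (\<Sum>\<^sub>\<infinity>k. wt k ^ 3 * cmod (d k)) \<le> \<eta>"
      using asum_small[OF s3 R4 \<eta>] by blast
    obtain N1 where N1: "\<And>N t. N \<ge> N1 \<Longrightarrow> t \<in> {0..T} \<Longrightarrow> hn 0 (\<lambda>k. A N t k - c t k) \<le> \<delta>" using u0[OF \<delta>(1)] by blast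
    have "(\<Sum>\<^sub>\<infinity>k. wt k ^ 3 * cmod (A N t k - c t k)) \<le> \<eta>" if "N \<ge> N1" and t: "t \<in> {0..T}" for N t
    proof (rule \<delta>(2)[OF _ _ N1[OF that]])
      note d = hs_diff[OF rapid_hs[OF ra[OF t, of N], of n] hc[OF t]]
      show "hs n (\<lambda>k. A N t k - c t k)" by (rule d(1))
      show "hn n (\<lambda>k. A N t k - c t k) \<le> 4 * R" using d(2) hR[OF t] bA[OF t, of N] by linarith
    qed
    then show ?thesis unfolding eventually_sequentially by blast
  qed
  have hs: "hsol n R T c"
    by (rule esol_limit[OF n T _ e0 es _ lim u3]) (use bA in auto)
  have c0: "c 0 = \<alpha>"
  proof
    fix k
    have "\<forall>\<^sub>F N in sequentially. A N 0 k = \<alpha> k"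
      using eventually_ge_at_top[of "nat \<bar>k\<bar>"] by eventually_elim (auto simp: A0 trunc_def)
    then have "(\<lambda>N. A N 0 k) \<longlonglongrightarrow> \<alpha> k" by (rule tendsto_eventually)
    then show "c 0 k = \<alpha> k" using lim[of 0 k] T LIMSEQ_unique by auto
  qed
  have low: "b \<le> fser (c t) x" if t: "t \<in> {0..T}" for t x
  proof (rule field_le_epsilon)
    fix e :: real assume e: "e > 0"
    from u3[OF e] obtain N where N: "(\<Sum>\<^sub>\<infinity>k. wt k ^ 3 * cmod (A N t k - c t k)) \<le> e"
      unfolding eventually_sequentially using t by blast
    have a3: "asum 3 (A N t)" "asum 3 (c t)" using rapid_asum[OF ra[OF t]] hs_asum(1)[OF hc[OF t], of 3] n by auto
    have "\<bar>fser (\<lambda>k. A N t k - c t k) x\<bar> \<le> e" using fser_dd_le_asum[OF asum_diff[OF a3], of 0 x] N by simp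
    moreover have "fser (\<lambda>k. A N t k - c t k) x = fser (A N t) x - fser (c t) x" by (rule fser_diff[OF a3])
    moreover have "b \<le> fser (A N t) x" using bA[OF t] by blast
    ultimately show "b \<le> fser (c t) x + e" by linarith
  qed
  show thesis by (rule that[OF hs c0 lim]) (use low in auto)
qed

text \<open>The order of quantifiers is the point: C is chosen before the bound
  \<open>\<Gamma>\<close> on the jet of \<open>\<gamma>\<close>, D after it. A better approximation
  of the data by \<open>\<gamma>\<close> thus costs only a shorter time.\<close>

lemma approx_close_to_data:
  assumes n: "n \<ge> 4" and b: "b > 0" and R: "R \<ge> 0"
  shows "\<exists>C\<ge>0. \<forall>\<Gamma>\<ge>0. \<exists>D\<ge>0. \<forall>\<epsilon> \<tau> a \<gamma>. 0 \<le> \<epsilon> \<longrightarrow> \<epsilon> \<le> 1 \<longrightarrow> esol \<epsilon> \<tau> a \<longrightarrow>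
     (\<forall>t\<in>{0..\<tau>}. hn n (a t) \<le> R \<and> (\<forall>x. b \<le> fser (a t) x)) \<longrightarrow> rapid \<gamma> \<longrightarrow> symm \<gamma> \<longrightarrow> supb (n + 5) \<Gamma> (fjet \<gamma>) \<longrightarrow>
     (\<forall>t\<in>{0..\<tau>}. hn n (\<lambda>k. a t k - \<gamma> k) \<le> C * hn n (\<lambda>k. a 0 k - \<gamma> k) + D * t)"
proof -
  define p where "p = 2 * n - 3"
  define B where "B = Bc n R"
  have B: "B \<ge> 1" unfolding B_def by (rule Bc_ge1[OF R])
  define m where "m = b ^ p"
  have m: "m > 0" using b by (simp add: m_def)
  \<comment> \<open>\<open>2 * L\<close> comes from the mean square of the difference, the other
    summand from its n-th derivative, with \<open>B ^ p\<close> and m as upper and lower bounds of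
    the weight.\<close>
  define C where "C = cN n * (2 * L + 1 / m * (B ^ p * (L * kap ^ (2 * n))))"
  have C: "C \<ge> 0" using cN_pos[of n] L_pos m B kap_pos by (simp add: C_def)
  obtain C2 where C2: "C2 \<ge> 0" "\<forall>\<epsilon> \<tau> a. 0 \<le> \<epsilon> \<longrightarrow> \<epsilon> \<le> 1 \<longrightarrow> esol \<epsilon> \<tau> a \<longrightarrow> (\<forall>t\<in>{0..\<tau>}. hn n (a t) \<le> R) \<longrightarrow>
     (\<forall>t\<in>{0..\<tau>}. integral {0..L} (\<lambda>x. (fser (a t) x - fser (a 0) x)\<^sup>2) \<le> C2 * t)"
    using L2_growth[OF n R] by (elim exE conjE)
  show ?thesis
  proof (rule exI[of _ C], rule conjI[OF C], intro allI impI)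
    fix \<Gamma> :: real assume \<Gamma>: "\<Gamma> \<ge> 0"
    obtain C1 where C1: "C1 \<ge> 0" "\<forall>\<epsilon> \<tau> a \<gamma>. 0 \<le> \<epsilon> \<longrightarrow> \<epsilon> \<le> 1 \<longrightarrow> esol \<epsilon> \<tau> a \<longrightarrow>
     (\<forall>t\<in>{0..\<tau>}. hn n (a t) \<le> R \<and> (\<forall>x. b \<le> fser (a t) x)) \<longrightarrow> rapid \<gamma> \<longrightarrow> supb (n + 5) \<Gamma> (fjet \<gamma>) \<longrightarrow>
     (\<forall>t\<in>{0..\<tau>}. integral {0..L} (\<lambda>x. fser (a t) x ^ (2 * n - 3) * (fjet (a t) n x - fjet \<gamma> n x)\<^sup>2)
        \<le> integral {0..L} (\<lambda>x. fser (a 0) x ^ (2 * n - 3) * (fjet (a 0) n x - fjet \<gamma> n x)\<^sup>2) + C1 * t)"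
      using shifted_energy[OF n b R \<Gamma>] by (elim exE conjE)
    define D where "D = cN n * (2 * C2 + 1 / m * C1)"
    have D: "D \<ge> 0" using cN_pos[of n] C1(1) C2(1) m by (simp add: D_def)
    show "\<exists>D\<ge>0. \<forall>\<epsilon> \<tau> a \<gamma>. 0 \<le> \<epsilon> \<longrightarrow> \<epsilon> \<le> 1 \<longrightarrow> esol \<epsilon> \<tau> a \<longrightarrow>
     (\<forall>t\<in>{0..\<tau>}. hn n (a t) \<le> R \<and> (\<forall>x. b \<le> fser (a t) x)) \<longrightarrow> rapid \<gamma> \<longrightarrow> symm \<gamma> \<longrightarrow> supb (n + 5) \<Gamma> (fjet \<gamma>) \<longrightarrow>
     (\<forall>t\<in>{0..\<tau>}. hn n (\<lambda>k. a t k - \<gamma> k) \<le> C * hn n (\<lambda>k. a 0 k - \<gamma> k) + D * t)"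
    proof (rule exI[of _ D], rule conjI[OF D], intro allI impI ballI)
      fix \<epsilon> \<tau> a \<gamma> t
      assume \<epsilon>: "0 \<le> \<epsilon>" "\<epsilon> \<le> 1" and e: "esol \<epsilon> \<tau> a"
        and h: "\<forall>t\<in>{0..\<tau>}. hn n (a t) \<le> R \<and> (\<forall>x. b \<le> fser (a t) x)"
        and \<gamma>: "rapid \<gamma>" "symm \<gamma>" "supb (n + 5) \<Gamma> (fjet \<gamma>)" and t: "t \<in> {0..\<tau>}"
      have z: "0 \<in> {0..\<tau>}" using t by simp
      have ra: "rapid (a s)" and sa: "symm (a s)" if "s \<in> {0..\<tau>}" for s using esol_rapid[OF e that] esol_symm[OF e that] by auto
      let ?d = "\<lambda>s k. a s k - \<gamma> k"
      have rd: "rapid (?d s)" "symm (?d s)" if "s \<in> {0..\<tau>}" for s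
        by (rule rapid_diff[OF ra[OF that] \<gamma>(1)], rule symm_diff[OF sa[OF that] \<gamma>(2)])
      have fd: "fser (?d s) x = fser (a s) x - fser \<gamma> x" if "s \<in> {0..\<tau>}" for s x
        by (rule fser_diff[OF rapid_asum[OF ra[OF that], of 0] rapid_asum[OF \<gamma>(1), of 0]])
      have fdn: "fser (dd n (?d s)) x = fjet (a s) n x - fjet \<gamma> n x" if "s \<in> {0..\<tau>}" for s x
        unfolding dd_diff by (rule fser_diff[OF rapid_asum[OF rapid_dd[OF ra[OF that]], of 0] rapid_asum[OF rapid_dd[OF \<gamma>(1)], of 0]])
      have cj: "continuous_on S (fjet (a s) j)" if "s \<in> {0..\<tau>}" for s j S by (rule jet_cont[OF jet_fjet[OF ra[OF that]]])
      have c0: "continuous_on S (fser (a s))" if "s \<in> {0..\<tau>}" for s S using cj[OF that, of S 0] by simp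
      have cg: "continuous_on S (fjet \<gamma> j)" for j S by (rule jet_cont[OF jet_fjet[OF \<gamma>(1)]])
      have cg0: "continuous_on S (fser \<gamma>)" for S using cg[of S 0] by simp
      have u0b: "\<bar>fser (a 0) x\<bar> \<le> B" for x
        using fjet_le_Bc[OF rapid_hs[OF ra[OF z]], of n R 0 x] h z n by (simp add: B_def)
      let ?h0 = "hn n (?d 0)"
      have "\<forall>s\<in>{0..\<tau>}. hn n (a s) \<le> R" using h by blast
      then have V: "integral {0..L} (\<lambda>x. (fser (a t) x - fser (a 0) x)\<^sup>2) \<le> C2 * t" using C2(2)[rule_format, of \<epsilon> \<tau> a t] \<epsilon> e t by simp
      have I1: "integral {0..L} (\<lambda>x. (fser (?d t) x)\<^sup>2) \<le> 2 * (C2 * t) + 2 * (L * ?h0)"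
      proof -
        have "integral {0..L} (\<lambda>x. (fser (?d t) x)\<^sup>2) \<le> integral {0..L} (\<lambda>x. 2 * (fser (a t) x - fser (a 0) x)\<^sup>2 + 2 * (fser (?d 0) x)\<^sup>2)"
          unfolding fd[OF t] fd[OF z]
        proof (rule integral_le)
          show "(fser (a t) x - fser \<gamma> x)\<^sup>2 \<le> 2 * (fser (a t) x - fser (a 0) x)\<^sup>2 + 2 * (fser (a 0) x - fser \<gamma> x)\<^sup>2" for x
            using zero_le_power2[of "(fser (a t) x - fser (a 0) x) - (fser (a 0) x - fser \<gamma> x)"] by (simp add: power2_eq_square algebra_simps)
        qed (intro integrable_continuous_real continuous_intros c0 cg0 t z)+
        also have "\<dots> = 2 * integral {0..L} (\<lambda>x. (fser (a t) x - fser (a 0) x)\<^sup>2) + 2 * integral {0..L} (\<lambda>x. (fser (?d 0) x)\<^sup>2)"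
          unfolding fd[OF z] by (rule integral_unique, intro has_integral_add has_integral_mult_right)
            (intro integrable_integral integrable_continuous_real continuous_intros c0 cg0 t z)+
        also have "\<dots> \<le> 2 * (C2 * t) + 2 * (L * ?h0)" using V int_le_hn(1)[OF rd[OF z], of n] by linarith
        finally show ?thesis .
      qed
      have "integral {0..L} (\<lambda>x. fser (a t) x ^ p * (fjet (a t) n x - fjet \<gamma> n x)\<^sup>2)
          \<le> integral {0..L} (\<lambda>x. fser (a 0) x ^ p * (fjet (a 0) n x - fjet \<gamma> n x)\<^sup>2) + C1 * t"
        unfolding p_def
        using C1(2)[THEN spec, THEN spec, THEN spec, THEN spec, THEN mp, THEN mp, THEN mp, THEN mp, THEN mp, THEN mp, OF \<epsilon> e h \<gamma>(1,3)] t by blast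
      also have "integral {0..L} (\<lambda>x. fser (a 0) x ^ p * (fjet (a 0) n x - fjet \<gamma> n x)\<^sup>2) \<le> integral {0..L} (\<lambda>x. B ^ p * (fser (dd n (?d 0)) x)\<^sup>2)"
        unfolding fdn[OF z]
      proof (rule integral_le)
        show "fser (a 0) x ^ p * (fjet (a 0) n x - fjet \<gamma> n x)\<^sup>2 \<le> B ^ p * (fjet (a 0) n x - fjet \<gamma> n x)\<^sup>2" for x
          using abs_power_le[OF u0b[of x], of p] by (intro mult_right_mono) (auto simp: abs_le_iff)
      qed (intro integrable_continuous_real continuous_intros c0 cj cg z)+
      also have "\<dots> = B ^ p * integral {0..L} (\<lambda>x. (fser (dd n (?d 0)) x)\<^sup>2)" by (rule integral_mult_right)
      also have "\<dots> \<le> B ^ p * (L * kap ^ (2 * n) * ?h0)" using int_le_hn(2)[OF rd[OF z], of n] B by (intro mult_left_mono) auto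
      finally have W: "integral {0..L} (\<lambda>x. fser (a t) x ^ p * (fjet (a t) n x - fjet \<gamma> n x)\<^sup>2) \<le> B ^ p * (L * kap ^ (2 * n) * ?h0) + C1 * t" by simp
      have "m * integral {0..L} (\<lambda>x. (fser (dd n (?d t)) x)\<^sup>2) = integral {0..L} (\<lambda>x. m * (fjet (a t) n x - fjet \<gamma> n x)\<^sup>2)"
        unfolding fdn[OF t] by (rule integral_mult_right[symmetric])
      also have "\<dots> \<le> integral {0..L} (\<lambda>x. fser (a t) x ^ p * (fjet (a t) n x - fjet \<gamma> n x)\<^sup>2)"
      proof (rule integral_le)
        show "m * (fjet (a t) n x - fjet \<gamma> n x)\<^sup>2 \<le> fser (a t) x ^ p * (fjet (a t) n x - fjet \<gamma> n x)\<^sup>2" for x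
          unfolding m_def using h t b by (intro mult_right_mono power_mono) auto
      qed (intro integrable_continuous_real continuous_intros c0 cj cg t)+
      finally have "m * integral {0..L} (\<lambda>x. (fser (dd n (?d t)) x)\<^sup>2) \<le> B ^ p * (L * kap ^ (2 * n) * ?h0) + C1 * t" using W by linarith
      then have I2: "integral {0..L} (\<lambda>x. (fser (dd n (?d t)) x)\<^sup>2) \<le> 1 / m * (B ^ p * (L * kap ^ (2 * n) * ?h0) + C1 * t)"
        using m by (simp add: pos_le_divide_eq mult.commute)
      have "hn n (?d t) \<le> cN n * (integral {0..L} (\<lambda>x. (fser (?d t) x)\<^sup>2) + integral {0..L} (\<lambda>x. (fser (dd n (?d t)) x)\<^sup>2))"
        by (rule hn_le_int[OF rd[OF t]])
      also have "\<dots> \<le> cN n * ((2 * (C2 * t) + 2 * (L * ?h0)) + 1 / m * (B ^ p * (L * kap ^ (2 * n) * ?h0) + C1 * t))"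
        using I1 I2 cN_pos[of n] by (intro mult_left_mono add_mono) auto
      also have "\<dots> = C * ?h0 + D * t" unfolding C_def D_def by (simp add: distrib_left distrib_right mult_ac)
      finally show "hn n (?d t) \<le> C * ?h0 + D * t" .
    qed
  qed
qed

lemma supb_fjet: assumes "rapid \<gamma>" shows "\<exists>\<Gamma>\<ge>0. supb k \<Gamma> (fjet \<gamma>)"
proof -
  let ?R = "hn (k + 1) \<gamma>"
  have "supb k (Bc (k + 1) ?R) (fjet \<gamma>)"
    unfolding supb_def by (intro allI impI fjet_le_Bc[OF rapid_hs[OF assms] order_refl]) simp
  moreover have "Bc (k + 1) ?R \<ge> 0" using Bc_ge1[OF hn_nonneg, of "k + 1" "k + 1" \<gamma>] by linarith
  ultimately show ?thesis by blast
qed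

text \<open>The approximations start from truncations, whose energy relative to
  \<open>trunc K \<alpha>\<close> is at most the tail of the data beyond K. The estimate passes to
  the limit by \<open>hn_limit\<close> and gives continuity at time 0 from the right.\<close>

lemma local_existence:
  assumes n: "n \<ge> 4" and b0: "b0 > 0" and R0: "R0 \<ge> 0"
  shows "\<exists>T>0. \<exists>R\<ge>0. \<forall>\<alpha>. hs n \<alpha> \<longrightarrow> symm \<alpha> \<longrightarrow> hn n \<alpha> \<le> R0 \<longrightarrow> (\<forall>x. b0 \<le> fser \<alpha> x) \<longrightarrow>
      (\<exists>c. hsol n R T c \<and> c 0 = \<alpha> \<and> (\<forall>t\<in>{0..T}. \<forall>x. 2 / 3 * b0 \<le> fser (c t) x) \<and>
        (\<forall>e>0. \<exists>d>0. \<forall>t\<in>{0..T}. t < d \<longrightarrow> hn n (\<lambda>k. c t k - \<alpha> k) < e))"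
proof -
  \<comment> \<open>Truncation may lower the data by b0 / 16 and the evolution keeps three quarters:
    3/4 times 15/16 is still above 2/3.\<close>
  define b1 where "b1 = 15 / 16 * b0"
  have b1: "b1 > 0" using b0 by (simp add: b1_def)
  obtain T R where T: "T > 0" and R: "R \<ge> 0" and ex: "\<And>\<epsilon> \<alpha>. 0 < \<epsilon> \<Longrightarrow> \<epsilon> \<le> 1 \<Longrightarrow> rapid \<alpha> \<Longrightarrow> symm \<alpha> \<Longrightarrow> hn n \<alpha> \<le> R0 \<Longrightarrow> (\<forall>x. b1 \<le> fser \<alpha> x) \<Longrightarrow>
       \<exists>a. esol \<epsilon> T a \<and> a 0 = \<alpha> \<and> (\<forall>t\<in>{0..T}. hn n (a t) \<le> R \<and> (\<forall>x. 3 / 4 * b1 \<le> fser (a t) x))"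
    using esol_exists[OF n b1 R0] by blast
  have b: "2 / 3 * b0 > 0" using b0 by simp
  obtain C where C: "C \<ge> 0" and Cl: "\<And>\<Gamma>. \<Gamma> \<ge> 0 \<Longrightarrow> \<exists>D\<ge>0. \<forall>\<epsilon> \<tau> a \<gamma>. 0 \<le> \<epsilon> \<longrightarrow> \<epsilon> \<le> 1 \<longrightarrow> esol \<epsilon> \<tau> a \<longrightarrow>
     (\<forall>t\<in>{0..\<tau>}. hn n (a t) \<le> R \<and> (\<forall>x. 2 / 3 * b0 \<le> fser (a t) x)) \<longrightarrow> rapid \<gamma> \<longrightarrow> symm \<gamma> \<longrightarrow> supb (n + 5) \<Gamma> (fjet \<gamma>) \<longrightarrow>
     (\<forall>t\<in>{0..\<tau>}. hn n (\<lambda>k. a t k - \<gamma> k) \<le> C * hn n (\<lambda>k. a 0 k - \<gamma> k) + D * t)"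
    using approx_close_to_data[OF n b R] by (elim exE conjE) blast
  show ?thesis
  proof (rule exI[of _ T], rule conjI[OF T], rule exI[of _ R], rule conjI[OF R], intro allI impI)
    fix \<alpha> assume h: "hs n \<alpha>" and s: "symm \<alpha>" and hR: "hn n \<alpha> \<le> R0" and low: "\<forall>x. b0 \<le> fser \<alpha> x"
    have n1: "1 \<le> n" and b16: "b0 / 16 > 0" using n b0 by auto
    obtain \<delta> where \<delta>: "\<delta> > 0" "\<And>d x. hs n d \<Longrightarrow> hn n d \<le> 1 \<Longrightarrow> hn 0 d \<le> \<delta> \<Longrightarrow> \<bar>fser d x\<bar> \<le> b0 / 16"
      using fser_small[OF n1 zero_le_one b16] by blast
    have "min 1 \<delta> > 0" using \<delta>(1) by simp
    from trunc_tail[OF h this] obtain N0 where N0: "\<And>K. K \<ge> N0 \<Longrightarrow> hn n (\<lambda>k. \<alpha> k - trunc K \<alpha> k) \<le> min 1 \<delta>" by blast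
    have ht: "hs n (\<lambda>k. \<alpha> k - trunc K \<alpha> k)" for K by (rule hs_diff(1)[OF h rapid_hs[OF trunc_rapid]])
    have tl: "b1 \<le> fser (trunc (N + N0) \<alpha>) x" for N x
    proof -
      have "\<bar>fser (\<lambda>k. \<alpha> k - trunc (N + N0) \<alpha> k) x\<bar> \<le> b0 / 16"
      proof (rule \<delta>(2)[OF ht])
        show "hn n (\<lambda>k. \<alpha> k - trunc (N + N0) \<alpha> k) \<le> 1" using N0[of "N + N0"] by simp
        show "hn 0 (\<lambda>k. \<alpha> k - trunc (N + N0) \<alpha> k) \<le> \<delta>" using hs_mono(2)[OF ht, of 0 "N + N0"] N0[of "N + N0"] by simp
      qed
      moreover have "fser (\<lambda>k. \<alpha> k - trunc (N + N0) \<alpha> k) x = fser \<alpha> x - fser (trunc (N + N0) \<alpha>) x"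
        by (rule fser_diff[OF hs_asum(1)[OF h] rapid_asum[OF trunc_rapid, of 0], of 0]) (use n in simp)
      moreover have "b0 \<le> fser \<alpha> x" using low by blast
      ultimately show ?thesis unfolding b1_def by linarith
    qed
    have "\<forall>N. \<exists>a. esol (1 / (real N + 1)) T a \<and> a 0 = trunc (N + N0) \<alpha> \<and> (\<forall>t\<in>{0..T}. hn n (a t) \<le> R \<and> (\<forall>x. 3 / 4 * b1 \<le> fser (a t) x))"
      by (rule allI, rule ex[OF _ _ trunc_rapid trunc_symm[OF s]]) (use tl order_trans[OF hn_trunc_le[OF h] hR] in auto)
    from choice[OF this] obtain A where A: "\<And>N. esol (1 / (real N + 1)) T (A N)" "\<And>N. A N 0 = trunc (N + N0) \<alpha>"
      "\<And>N. \<forall>t\<in>{0..T}. hn n (A N t) \<le> R \<and> (\<forall>x. 3 / 4 * b1 \<le> fser (A N t) x)" by blast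
    have A3: "hn n (A N t) \<le> R \<and> (\<forall>x. 2 / 3 * b0 \<le> fser (A N t) x)" if "t \<in> {0..T}" for N t
    proof -
      have "2 / 3 * b0 \<le> 3 / 4 * b1" using b0 by (simp add: b1_def)
      then show ?thesis using A(3)[of N, THEN bspec, OF that] by (blast intro: order_trans)
    qed
    obtain c where c: "hsol n R T c" "c 0 = \<alpha>" "\<And>t k. t \<in> {0..T} \<Longrightarrow> (\<lambda>N. A N t k) \<longlonglongrightarrow> c t k" "\<forall>t\<in>{0..T}. \<forall>x. 2 / 3 * b0 \<le> fser (c t) x"
      using approx_limit[OF n b T R h A(1,2) A3] by blast
    have "\<exists>d>0. \<forall>t\<in>{0..T}. t < d \<longrightarrow> hn n (\<lambda>k. c t k - \<alpha> k) < e" if e: "e > 0" for e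
    proof -
      \<comment> \<open>With this tail and \<open>t < d\<close>, the sums
        \<open>C * \<eta> + \<eta>\<close> and \<open>D * t\<close> are at most and below e / 4;
        \<open>hn_triangle\<close> doubles them.\<close>
      define \<eta> where "\<eta> = e / (4 * (C + 1))"
      have \<eta>: "\<eta> > 0" using e C by (simp add: \<eta>_def)
      obtain K where K: "hn n (\<lambda>k. \<alpha> k - trunc K \<alpha> k) \<le> \<eta>" using trunc_tail[OF h \<eta>] by blast
      let ?\<gamma> = "trunc K \<alpha>"
      obtain \<Gamma> where \<Gamma>: "\<Gamma> \<ge> 0" "supb (n + 5) \<Gamma> (fjet ?\<gamma>)" using supb_fjet[OF trunc_rapid] by blast
      obtain D where D: "D \<ge> 0" "\<forall>\<epsilon> \<tau> a \<gamma>. 0 \<le> \<epsilon> \<longrightarrow> \<epsilon> \<le> 1 \<longrightarrow> esol \<epsilon> \<tau> a \<longrightarrow>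
     (\<forall>t\<in>{0..\<tau>}. hn n (a t) \<le> R \<and> (\<forall>x. 2 / 3 * b0 \<le> fser (a t) x)) \<longrightarrow> rapid \<gamma> \<longrightarrow> symm \<gamma> \<longrightarrow> supb (n + 5) \<Gamma> (fjet \<gamma>) \<longrightarrow>
     (\<forall>t\<in>{0..\<tau>}. hn n (\<lambda>k. a t k - \<gamma> k) \<le> C * hn n (\<lambda>k. a 0 k - \<gamma> k) + D * t)"
        using Cl[OF \<Gamma>(1)] by (elim exE conjE)
      have cg: "hs n (\<lambda>k. c t k - ?\<gamma> k)" "hn n (\<lambda>k. c t k - ?\<gamma> k) \<le> C * \<eta> + D * t" if t: "t \<in> {0..T}" for t
      proof -
        have bnd: "hn n (\<lambda>k. A N t k - ?\<gamma> k) \<le> C * \<eta> + D * t" if N: "N \<ge> K" for N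
        proof -
          have "hn n (\<lambda>k. A N t k - ?\<gamma> k) \<le> C * hn n (\<lambda>k. A N 0 k - ?\<gamma> k) + D * t"
          proof -
            have bb: "\<forall>t\<in>{0..T}. hn n (A N t) \<le> R \<and> (\<forall>x. 2 / 3 * b0 \<le> fser (A N t) x)" using A3 by blast
            have ee: "0 \<le> 1 / (real N + 1)" "1 / (real N + 1) \<le> 1" by auto
            show ?thesis
              using D(2)[THEN spec, THEN spec, THEN spec, THEN spec, THEN mp, THEN mp, THEN mp, THEN mp, THEN mp, THEN mp, THEN mp,
                OF ee A(1) bb trunc_rapid trunc_symm[OF s] \<Gamma>(2)] t by blast
          qed
          also have "hn n (\<lambda>k. A N 0 k - ?\<gamma> k) \<le> hn n (\<lambda>k. \<alpha> k - ?\<gamma> k)"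
            unfolding A(2) by (rule hn_termwise(2)[OF ht]) (use N in \<open>auto simp: trunc_def\<close>)
          then have "C * hn n (\<lambda>k. A N 0 k - ?\<gamma> k) + D * t \<le> C * \<eta> + D * t" using K C by (intro add_right_mono mult_left_mono) auto
          finally show ?thesis .
        qed
        have l: "(\<lambda>N. A N t k - ?\<gamma> k) \<longlonglongrightarrow> c t k - ?\<gamma> k" for k by (intro tendsto_intros c(3) t)
        have "\<forall>\<^sub>F N in sequentially. hs n (\<lambda>k. A N t k - ?\<gamma> k) \<and> hn n (\<lambda>k. A N t k - ?\<gamma> k) \<le> C * \<eta> + D * t"
          by (rule eventually_sequentiallyI[of K], rule conjI[OF rapid_hs[OF rapid_diff[OF esol_rapid[OF A(1) t] trunc_rapid]] bnd])
        from hn_limit[OF l this] show "hs n (\<lambda>k. c t k - ?\<gamma> k)" "hn n (\<lambda>k. c t k - ?\<gamma> k) \<le> C * \<eta> + D * t" by auto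
      qed
      define d where "d = e / (4 * (D + 1))"
      have d: "d > 0" using e D(1) by (simp add: d_def)
      have "hn n (\<lambda>k. c t k - \<alpha> k) < e" if t: "t \<in> {0..T}" "t < d" for t
      proof -
        have ht': "hs n (\<lambda>k. ?\<gamma> k - \<alpha> k)" using ht[of K] by (simp add: hs_def norm_minus_commute)
        have "hn n (\<lambda>k. c t k - \<alpha> k) \<le> 2 * hn n (\<lambda>k. c t k - ?\<gamma> k) + 2 * hn n (\<lambda>k. ?\<gamma> k - \<alpha> k)"
          by (rule hn_triangle(2)[OF cg(1)[OF t(1)] ht'])
        also have "\<dots> \<le> 2 * (C * \<eta> + D * t) + 2 * \<eta>" unfolding hn_commute[of n ?\<gamma> \<alpha>] by (intro add_mono mult_left_mono cg(2)[OF t(1)] K) auto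
        also have "\<dots> = 2 * ((C + 1) * \<eta>) + 2 * (D * t)" by (simp add: algebra_simps)
        also have "(C + 1) * \<eta> = e / 4"
        proof -
          have "q * (e / (4 * q)) = e / 4" if "q > 0" for q using that by simp
          from this[of "C + 1"] show ?thesis unfolding \<eta>_def using C by simp
        qed
        also have "D * t < e / 4"
        proof -
          have "D * t \<le> D * d" using t D(1) by (intro mult_left_mono) auto
          also have "D * d < (D + 1) * d" using d by simp
          also have "\<dots> = e / 4"
          proof -
            have "q * (e / (4 * q)) = e / 4" if "q > 0" for q using that by simp
            from this[of "D + 1"] show ?thesis unfolding d_def using D(1) by simp
          qed
          finally show ?thesis .
        qed
        finally show ?thesis by simp
      qed
      then show ?thesis using d by blast
    qed
    then show "\<exists>c. hsol n R T c \<and> c 0 = \<alpha> \<and> (\<forall>t\<in>{0..T}. \<forall>x. 2 / 3 * b0 \<le> fser (c t) x) \<and>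
        (\<forall>e>0. \<exists>d>0. \<forall>t\<in>{0..T}. t < d \<longrightarrow> hn n (\<lambda>k. c t k - \<alpha> k) < e)"
      using c by blast
  qed
qed

section \<open>Uniqueness and strong continuity\<close>

definition fbound :: "nat \<Rightarrow> real \<Rightarrow> real" where
  "fbound n R = 1 + (1 + kap ^ 3) * sqrt (2 ^ n * Zw * R)"

lemma fser_fbound:
  assumes h: "hs n a" "hn n a \<le> R" and n: "n \<ge> 4" and R: "R \<ge> 0"
  shows "fbound n R \<ge> 1" "\<bar>fser a x\<bar> \<le> fbound n R" "\<bar>fser (dd 3 a) x\<bar> \<le> fbound n R"
proof -
  let ?s = "sqrt (2 ^ n * Zw * hn n a)" and ?S = "sqrt (2 ^ n * Zw * R)"
  have sS: "0 \<le> ?s" "?s \<le> ?S" using h(2) Zw_nonneg hn_nonneg[of n a] by (auto intro!: mult_left_mono)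
  have S0: "0 \<le> ?S" using sS by linarith
  have k: "kap ^ 3 \<ge> 0" using kap_pos by simp
  have k3: "kap ^ 3 * ?s \<le> kap ^ 3 * ?S" by (rule mult_left_mono[OF sS(2) k])
  have kS: "0 \<le> kap ^ 3 * ?S" by (rule mult_nonneg_nonneg[OF k S0])
  have e: "fbound n R = 1 + ?S + kap ^ 3 * ?S" by (simp add: fbound_def distrib_right)
  show "fbound n R \<ge> 1" unfolding e using sS kS by linarith
  have "\<bar>fser a x\<bar> \<le> ?s" using fser_dd_le[OF h(1), of 0 x] n by simp
  then show "\<bar>fser a x\<bar> \<le> fbound n R" unfolding e using sS kS by linarith
  have "\<bar>fser (dd 3 a) x\<bar> \<le> kap ^ 3 * ?s" using fser_dd_le[OF h(1), of 3 x] n by simp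
  then show "\<bar>fser (dd 3 a) x\<bar> \<le> fbound n R" unfolding e using sS k3 by linarith
qed

lemma hsolD:
  assumes "hsol n R T c" "t \<in> {0..T}"
  shows "hs n (c t)" "symm (c t)" "hn n (c t) \<le> R"
  using assms by (auto simp: hsol_def)

lemma hsol_mono: "hsol n R T c \<Longrightarrow> R \<le> R' \<Longrightarrow> hsol n R' T c"
  by (fastforce simp: hsol_def)

lemma hn0_integral:
  assumes "hs n d" "symm d" "1 \<le> n"
  shows "integral {0..L} (\<lambda>x. (fser d x)\<^sup>2) = L * hn 0 d"
proof -
  have a: "asum 0 d" by (rule hs_asum(1)[OF assms(1)]) (use assms(3) in simp)
  have "(\<Sum>\<^sub>\<infinity>k. L * (cmod (d k))\<^sup>2) = integral {0..L} (\<lambda>x. (fser d x)\<^sup>2)" by (rule infsumI[OF parseval[OF a assms(2)]])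
  then show ?thesis unfolding hn_def by (simp add: hw_def infsum_cmult_right')
qed

text \<open>\<open>stability\<close> with zero residuals, read on coefficients through Parseval. It
  serves uniqueness as well as dependence on the data.\<close>

lemma hsol_stable:
  assumes n: "n \<ge> 4" and a: "a > 0" and R: "R \<ge> 0" and T: "T \<ge> 0"
  shows "\<exists>C\<ge>0. \<forall>c c'. hsol n R T c \<longrightarrow> hsol n R T c' \<longrightarrow> (\<forall>t\<in>{0..T}. \<forall>x. a \<le> fser (c t) x) \<longrightarrow>
    (\<forall>t\<in>{0..T}. hn 0 (\<lambda>k. c t k - c' t k) \<le> C * hn 0 (\<lambda>k. c 0 k - c' 0 k))"
proof -
  have "hs n (\<lambda>_. 0)" "hn n (\<lambda>_. 0) \<le> R" using R by (auto simp: hs_def hn_def)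
  then have B: "fbound n R \<ge> 1" using fser_fbound(1)[OF _ _ n R] by blast
  obtain C where C: "C \<ge> 0" "\<forall>T' u u1 u2 u3 v v1 v2 v3 r r' \<rho>. classical_sol T' u u1 u2 u3 r \<longrightarrow> classical_sol T' v v1 v2 v3 r' \<longrightarrow> T' \<le> T \<longrightarrow>
     (\<forall>t\<in>{0..T'}. \<forall>x. a \<le> u t x \<and> \<bar>u t x\<bar> \<le> fbound n R \<and> \<bar>v t x\<bar> \<le> fbound n R \<and> \<bar>u3 t x\<bar> \<le> fbound n R \<and> \<bar>v3 t x\<bar> \<le> fbound n R) \<longrightarrow>
     (\<forall>t\<in>{0..T'}. integral {0..L} (\<lambda>x. (r t x)\<^sup>2) \<le> \<rho> \<and> integral {0..L} (\<lambda>x. (r' t x)\<^sup>2) \<le> \<rho>) \<longrightarrow>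
     (\<forall>t\<in>{0..T'}. integral {0..L} (\<lambda>x. (u t x - v t x)\<^sup>2) \<le> C * (integral {0..L} (\<lambda>x. (u 0 x - v 0 x)\<^sup>2) + \<rho>))"
    using stability[OF a B T] by (elim exE conjE)
  show ?thesis
  proof (rule exI[of _ C], rule conjI[OF C(1)], intro allI impI ballI)
    fix c c' t
    assume c: "hsol n R T c" and c': "hsol n R T c'" and low: "\<forall>t\<in>{0..T}. \<forall>x. a \<le> fser (c t) x" and t: "t \<in> {0..T}"
    have s: "classical_sol T (\<lambda>t. fser (c t)) (\<lambda>t. fser (dd 1 (c t))) (\<lambda>t. fser (dd 2 (c t))) (\<lambda>t. fser (dd 3 (c t))) (\<lambda>_ _. 0)"
      "classical_sol T (\<lambda>t. fser (c' t)) (\<lambda>t. fser (dd 1 (c' t))) (\<lambda>t. fser (dd 2 (c' t))) (\<lambda>t. fser (dd 3 (c' t))) (\<lambda>_ _. 0)"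
      using c c' by (auto simp: hsol_def)
    have b: "\<forall>t\<in>{0..T}. \<forall>x. a \<le> fser (c t) x \<and> \<bar>fser (c t) x\<bar> \<le> fbound n R \<and> \<bar>fser (c' t) x\<bar> \<le> fbound n R
       \<and> \<bar>fser (dd 3 (c t)) x\<bar> \<le> fbound n R \<and> \<bar>fser (dd 3 (c' t)) x\<bar> \<le> fbound n R"
    proof (intro ballI allI)
      fix s x assume s: "s \<in> {0..T}"
      show "a \<le> fser (c s) x \<and> \<bar>fser (c s) x\<bar> \<le> fbound n R \<and> \<bar>fser (c' s) x\<bar> \<le> fbound n R
       \<and> \<bar>fser (dd 3 (c s)) x\<bar> \<le> fbound n R \<and> \<bar>fser (dd 3 (c' s)) x\<bar> \<le> fbound n R"
        using low s fser_fbound(2,3)[OF hsolD(1)[OF c s] hsolD(3)[OF c s] n R, of x]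
          fser_fbound(2,3)[OF hsolD(1)[OF c' s] hsolD(3)[OF c' s] n R, of x] by blast
    qed
    have I: "integral {0..L} (\<lambda>x. (fser (c s) x - fser (c' s) x)\<^sup>2) = L * hn 0 (\<lambda>k. c s k - c' s k)" if s: "s \<in> {0..T}" for s
    proof -
      have "fser (\<lambda>k. c s k - c' s k) x = fser (c s) x - fser (c' s) x" for x
        by (rule fser_diff[OF hs_asum(1)[OF hsolD(1)[OF c s], of 0] hs_asum(1)[OF hsolD(1)[OF c' s], of 0]]) (use n in auto)
      moreover have "integral {0..L} (\<lambda>x. (fser (\<lambda>k. c s k - c' s k) x)\<^sup>2) = L * hn 0 (\<lambda>k. c s k - c' s k)"
        by (rule hn0_integral[OF hs_diff(1)[OF hsolD(1)[OF c s] hsolD(1)[OF c' s]] symm_diff[OF hsolD(2)[OF c s] hsolD(2)[OF c' s]]]) (use n in auto)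
      ultimately show ?thesis by simp
    qed
    have z: "0 \<in> {0..T}" using T by simp
    have r: "\<forall>t\<in>{0..T}. integral {0..L} (\<lambda>x. ((\<lambda>_ _. 0 :: real) t x)\<^sup>2) \<le> 0 \<and> integral {0..L} (\<lambda>x. ((\<lambda>_ _. 0 :: real) t x)\<^sup>2) \<le> 0"
      by simp
    have "integral {0..L} (\<lambda>x. (fser (c t) x - fser (c' t) x)\<^sup>2) \<le> C * (integral {0..L} (\<lambda>x. (fser (c 0) x - fser (c' 0) x)\<^sup>2) + 0)"
      by (rule C(2)[rule_format, OF s order_refl b[rule_format] r[rule_format] t])
    then have "L * hn 0 (\<lambda>k. c t k - c' t k) \<le> L * (C * hn 0 (\<lambda>k. c 0 k - c' 0 k))"
      unfolding I[OF t] I[OF z] by (simp add: mult_ac)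
    then show "hn 0 (\<lambda>k. c t k - c' t k) \<le> C * hn 0 (\<lambda>k. c 0 k - c' 0 k)" using L_pos by simp
  qed
qed

lemma hsol_R_nonneg: assumes "hsol n R T c" "T \<ge> 0" shows "R \<ge> 0"
proof -
  have "hn n (c 0) \<le> R" by (rule hsolD(3)[OF assms(1)]) (use assms(2) in simp)
  then show ?thesis using hn_nonneg[of n "c 0"] by linarith
qed

text \<open>Stability under the common bound \<open>max R R'\<close> with zero initial difference.
  The lower bound is asked of c alone, because the competitor is arbitrary.\<close>

lemma hsol_unique:
  assumes n: "n \<ge> 4" and a: "a > 0" and c: "hsol n R T c" and c': "hsol n R' T c'"
    and low: "\<forall>t\<in>{0..T}. \<forall>x. a \<le> fser (c t) x" and e: "c 0 = c' 0" and t: "t \<in> {0..T}"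
  shows "c t = c' t"
proof -
  have T: "T \<ge> 0" using t by simp
  let ?R = "max R R'"
  have R: "?R \<ge> 0" using hsol_R_nonneg[OF c T] by simp
  have h: "hsol n ?R T c" "hsol n ?R T c'" by (rule hsol_mono[OF c], simp, rule hsol_mono[OF c'], simp)
  obtain C where C: "\<forall>c c'. hsol n ?R T c \<longrightarrow> hsol n ?R T c' \<longrightarrow> (\<forall>t\<in>{0..T}. \<forall>x. a \<le> fser (c t) x) \<longrightarrow>
    (\<forall>t\<in>{0..T}. hn 0 (\<lambda>k. c t k - c' t k) \<le> C * hn 0 (\<lambda>k. c 0 k - c' 0 k))"
    using hsol_stable[OF n a R T] by (elim exE conjE)
  have "hn 0 (\<lambda>k. c t k - c' t k) \<le> C * hn 0 (\<lambda>k. c 0 k - c' 0 k)"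
    by (rule C[rule_format, OF h low[rule_format] t])
  also have "\<dots> = 0" by (simp add: e hn_def)
  finally have z: "hn 0 (\<lambda>k. c t k - c' t k) \<le> 0" .
  have d: "hs 0 (\<lambda>k. c t k - c' t k)" by (rule hs_mono(1)[OF hs_diff(1)[OF hsolD(1)[OF h(1) t] hsolD(1)[OF h(2) t]]]) simp
  show ?thesis
  proof
    fix k
    have "(cmod (c t k - c' t k))\<^sup>2 \<le> 0" using order_trans[OF hn_term_le[OF d, of k] z] by (simp add: hw_def)
    then show "c t k = c' t k" by simp
  qed
qed

section \<open>Translation and reversal of time\<close>

lemma hsol_shift:
  assumes c: "hsol n R T c" and t0: "0 \<le> t0" "t0 + S \<le> T"
  shows "hsol n R S (\<lambda>s. c (t0 + s))"
proof -
  have m: "t0 + s \<in> {0..T}" if "s \<in> {0..S}" for s using that t0 by auto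
  have cc: "continuous_on ({0..S} \<times> UNIV) (\<lambda>p. f (t0 + fst p) (snd p))"
    if "continuous_on ({0..T} \<times> UNIV) (\<lambda>p. f (fst p) (snd p))" for f :: "real \<Rightarrow> real \<Rightarrow> real"
  proof -
    have "continuous_on ({0..S} \<times> UNIV) ((\<lambda>p. f (fst p) (snd p)) \<circ> (\<lambda>p. (t0 + fst p, snd p)))"
      by (rule continuous_on_compose, intro continuous_intros, rule continuous_on_subset[OF that]) (use m in auto)
    then show ?thesis by (simp add: o_def)
  qed
  have dt: "((\<lambda>s. fser (c (t0 + s)) x) has_real_derivative (fser (c (t0 + s)) x ^ 3 * fser (dd 3 (c (t0 + s))) x + 0)) (at s within {0..S})"
    if s: "s \<in> {0..S}" for s x
  proof -
    have "((\<lambda>t. fser (c t) x) has_real_derivative (fser (c (t0 + s)) x ^ 3 * fser (dd 3 (c (t0 + s))) x + 0)) (at (t0 + s) within {0..T})"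
      using c m[OF s] by (simp add: hsol_def classical_sol_def)
    then have "((\<lambda>t. fser (c t) x) has_real_derivative (fser (c (t0 + s)) x ^ 3 * fser (dd 3 (c (t0 + s))) x + 0)) (at (t0 + s) within (+) t0 ` {0..S})"
      by (rule has_field_derivative_subset) (rule image_subsetI, erule m)
    moreover have "((\<lambda>s. t0 + s) has_real_derivative 1) (at s within {0..S})" by (auto intro!: derivative_eq_intros)
    ultimately show ?thesis using DERIV_image_chain[of "\<lambda>t. fser (c t) x" _ "\<lambda>s. t0 + s"] by (fastforce simp: o_def)
  qed
  show ?thesis
    using c dt unfolding hsol_def classical_sol_def case_prod_unfold by (auto intro!: cc m)
qed

text \<open>The coefficients of the function reflected at the origin.\<close>

definition mirror :: "(int \<Rightarrow> complex) \<Rightarrow> int \<Rightarrow> complex" where "mirror a k = a (- k)"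

lemma mirror_infsum: "(\<Sum>\<^sub>\<infinity>k::int. f (- k)) = (\<Sum>\<^sub>\<infinity>k. f k)" for f :: "int \<Rightarrow> real"
  by (rule infsum_reindex_bij_betw[of uminus UNIV UNIV f]) (auto intro: bij_betwI[of _ _ _ uminus])

lemma mirror_hn: "hn n (mirror a) = hn n a"
  using mirror_infsum[of "\<lambda>k. hw n k * (cmod (a k))\<^sup>2"] by (simp add: hn_def mirror_def hw_def)

lemma mirror_hs: "hs n a \<Longrightarrow> hs n (mirror a)"
proof (rule hs_I(1))
  fix F :: "int set" assume h: "hs n a" "finite F"
  have "(\<Sum>k\<in>F. hw n k * (cmod (mirror a k))\<^sup>2) = (\<Sum>k\<in>uminus ` F. hw n k * (cmod (a k))\<^sup>2)"
    by (subst sum.reindex) (auto simp: mirror_def hw_def)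
  also have "\<dots> \<le> hn n a" using h by (intro hn_finite_le) auto
  finally show "(\<Sum>k\<in>F. hw n k * (cmod (mirror a k))\<^sup>2) \<le> hn n a" .
qed

lemma mirror_symm: "symm a \<Longrightarrow> symm (mirror a)" by (simp add: symm_def mirror_def)

lemma mirror_fser: "fser (dd j (mirror a)) x = (-1) ^ j * fser (dd j a) (- x)"
proof -
  have "fser (dd j (mirror a)) x = (\<Sum>\<^sub>\<infinity>k. Re (dd j (mirror a) (- k) * cis (kap * real_of_int (- k) * x)))"
    unfolding fser_def by (rule mirror_infsum[symmetric])
  also have "\<dots> = (\<Sum>\<^sub>\<infinity>k. (-1) ^ j * Re (dd j a k * cis (kap * real_of_int k * (- x))))"
  proof (rule infsum_cong)
    fix k
    have "dd j (mirror a) (- k) = (-1) ^ j * dd j a k" 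
    proof -
      have "\<i> * complex_of_real (kap * real_of_int (- k)) = (-1) * (\<i> * complex_of_real (kap * real_of_int k))" by simp
      then show ?thesis unfolding dd_def mirror_def by (simp only: power_mult_distrib minus_minus mult.assoc)
    qed
    moreover have "Re ((-1) ^ j * z) = (-1) ^ j * Re z" for z by (cases "even j") auto
    ultimately show "Re (dd j (mirror a) (- k) * cis (kap * real_of_int (- k) * x)) = (-1) ^ j * Re (dd j a k * cis (kap * real_of_int k * (- x)))"
      by (simp add: mult.assoc)
  qed
  also have "\<dots> = (-1) ^ j * fser (dd j a) (- x)" unfolding fser_def by (rule infsum_cmult_right')
  finally show ?thesis .
qed

text \<open>Reflection changes the sign of the third derivative and reversal that of the time
  derivative, so the equation is preserved.\<close>

lemma hsol_reverse:
  assumes n: "n \<ge> 4" and c: "hsol n R T c" and t0: "S \<le> t0" "t0 \<le> T"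
  shows "hsol n R S (\<lambda>s. mirror (c (t0 - s)))"
proof -
  have m: "t0 - s \<in> {0..T}" if "s \<in> {0..S}" for s using that t0 by auto
  have cc: "continuous_on ({0..S} \<times> UNIV) (\<lambda>p. f (t0 - fst p) (- snd p))"
    if "continuous_on ({0..T} \<times> UNIV) (\<lambda>p. f (fst p) (snd p))" for f :: "real \<Rightarrow> real \<Rightarrow> real"
  proof -
    have "continuous_on ({0..S} \<times> UNIV) ((\<lambda>p. f (fst p) (snd p)) \<circ> (\<lambda>p. (t0 - fst p, - snd p)))"
      by (rule continuous_on_compose, intro continuous_intros, rule continuous_on_subset[OF that]) (use t0 in auto)
    then show ?thesis by (simp add: o_def)
  qed
  have dt: "((\<lambda>s. fser (c (t0 - s)) y) has_real_derivative - (fser (c (t0 - s)) y ^ 3 * fser (dd 3 (c (t0 - s))) y)) (at s within {0..S})"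
    if s: "s \<in> {0..S}" for s y
  proof -
    have "((\<lambda>t. fser (c t) y) has_real_derivative (fser (c (t0 - s)) y ^ 3 * fser (dd 3 (c (t0 - s))) y + 0)) (at (t0 - s) within {0..T})"
      using c m[OF s] by (simp add: hsol_def classical_sol_def)
    then have "((\<lambda>t. fser (c t) y) has_real_derivative (fser (c (t0 - s)) y ^ 3 * fser (dd 3 (c (t0 - s))) y + 0)) (at (t0 - s) within (-) t0 ` {0..S})"
      by (rule has_field_derivative_subset) (rule image_subsetI, erule m)
    moreover have "((\<lambda>s. t0 - s) has_real_derivative -1) (at s within {0..S})" by (auto intro!: derivative_eq_intros)
    ultimately show ?thesis using DERIV_image_chain[of "\<lambda>t. fser (c t) y" _ "\<lambda>s. t0 - s"] by (fastforce simp: o_def)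
  qed
  have r0: "fser (mirror a) x = fser a (- x)" for a x using mirror_fser[of 0 a x] by simp
  have r3: "fser (dd 3 (mirror a)) x = - fser (dd 3 a) (- x)" for a x using mirror_fser[of 3 a x] by simp
  have rh: "hs n (mirror (c (t0 - s)))" if "s \<in> {0..S}" for s by (rule mirror_hs[OF hsolD(1)[OF c m[OF that]]])
  have dx: "(fser (dd j (mirror (c (t0 - s)))) has_real_derivative fser (dd (Suc j) (mirror (c (t0 - s)))) x) (at x)"
    if "s \<in> {0..S}" "j \<le> 2" for s j x
    by (rule fser_deriv_dd[OF hs_asum(1)[OF rh[OF that(1)]]]) (use that n in simp)
  have "classical_sol S (\<lambda>s. fser (mirror (c (t0 - s)))) (\<lambda>s. fser (dd 1 (mirror (c (t0 - s))))) (\<lambda>s. fser (dd 2 (mirror (c (t0 - s)))))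
     (\<lambda>s. fser (dd 3 (mirror (c (t0 - s))))) (\<lambda>_ _. 0)"
    unfolding classical_sol_def case_prod_unfold
  proof (intro conjI ballI allI)
    show "continuous_on ({0..S} \<times> UNIV) (\<lambda>p. fser (mirror (c (t0 - fst p))) (snd p))" unfolding r0
      using c by (intro cc) (simp add: hsol_def classical_sol_def case_prod_unfold)
    show "continuous_on ({0..S} \<times> UNIV) (\<lambda>p. fser (dd 3 (mirror (c (t0 - fst p)))) (snd p))" unfolding r3
      using c by (intro continuous_intros cc) (simp add: hsol_def classical_sol_def case_prod_unfold)
    fix s x assume s: "s \<in> {0..S}"
    show "((\<lambda>s. fser (mirror (c (t0 - s))) x) has_real_derivative (fser (mirror (c (t0 - s))) x ^ 3 * fser (dd 3 (mirror (c (t0 - s)))) x + 0)) (at s within {0..S})"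
      unfolding r0 r3 using dt[OF s, of "- x"] by simp
  qed (use dx[of _ 0] dx[of _ 1] dx[of _ 2] in \<open>simp_all add: fser_periodic numeral_2_eq_2 numeral_3_eq_3\<close>)
  then show ?thesis unfolding hsol_def using rh mirror_symm[OF hsolD(2)[OF c m]] hsolD(3)[OF c m] by (simp add: mirror_hn)
qed

section \<open>Strong continuity in the Sobolev norm\<close>

definition hcont :: "nat \<Rightarrow> real \<Rightarrow> (real \<Rightarrow> int \<Rightarrow> complex) \<Rightarrow> bool" where
  "hcont n T c \<longleftrightarrow> (\<forall>t\<in>{0..T}. \<forall>e>0. \<exists>d>0. \<forall>t'\<in>{0..T}. \<bar>t' - t\<bar> < d \<longrightarrow> hn n (\<lambda>k. c t' k - c t k) < e)"

text \<open>At any time the solution can be restarted by \<open>local_existence\<close>; the new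
  solution is continuous at its starting time and agrees with the old one by uniqueness. R and b
  being the same at all times, one restart length T1 serves for all of them.\<close>

lemma hsol_hcont:
  assumes n: "n \<ge> 4" and b: "b > 0" and c: "hsol n R T c" and low: "\<forall>t\<in>{0..T}. \<forall>x. b \<le> fser (c t) x"
  shows "hcont n T c"
  unfolding hcont_def
proof (intro ballI allI impI)
  fix t and e :: real assume t: "t \<in> {0..T}" and e: "e > 0"
  have R: "R \<ge> 0" using hsol_R_nonneg[OF c] t by simp
  obtain T1 R1 where T1: "T1 > 0" and "R1 \<ge> 0" and ex: "\<forall>\<alpha>. hs n \<alpha> \<longrightarrow> symm \<alpha> \<longrightarrow> hn n \<alpha> \<le> R \<longrightarrow> (\<forall>x. b \<le> fser \<alpha> x) \<longrightarrow>
      (\<exists>c. hsol n R1 T1 c \<and> c 0 = \<alpha> \<and> (\<forall>t\<in>{0..T1}. \<forall>x. 2 / 3 * b \<le> fser (c t) x) \<and>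
        (\<forall>e>0. \<exists>d>0. \<forall>t\<in>{0..T1}. t < d \<longrightarrow> hn n (\<lambda>k. c t k - \<alpha> k) < e))"
    using local_existence[OF n b R] by (elim exE conjE)
  \<comment> \<open>Stated for an arbitrary solution so that it applies both to the forward
    translate of c and to its reversal.\<close>
  have loc: "\<exists>d>0. d \<le> T1 \<and> (\<forall>s\<in>{0..S}. s < d \<longrightarrow> hn n (\<lambda>k. a s k - a 0 k) < e)"
    if a: "hsol n R S a" and la: "\<forall>s\<in>{0..S}. \<forall>x. b \<le> fser (a s) x" and S: "S \<ge> 0" for S a
  proof -
    have z: "0 \<in> {0..S}" using S by simp
    obtain a1 where a1: "hsol n R1 T1 a1" "a1 0 = a 0" "\<forall>e>0. \<exists>d>0. \<forall>t\<in>{0..T1}. t < d \<longrightarrow> hn n (\<lambda>k. a1 t k - a 0 k) < e"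
      using ex[rule_format, OF hsolD[OF a z] la[rule_format, OF z]] by blast
    obtain d where d: "d > 0" "\<forall>t\<in>{0..T1}. t < d \<longrightarrow> hn n (\<lambda>k. a1 t k - a 0 k) < e" using a1(3) e by blast
    have "hn n (\<lambda>k. a s k - a 0 k) < e" if s: "s \<in> {0..S}" "s < min d T1" for s
    proof -
      have h1: "hsol n R s a" using hsol_shift[OF a, of 0 s] s by simp
      have h2: "hsol n R1 s a1" using hsol_shift[OF a1(1), of 0 s] s by simp
      have "a s = a1 s"
        by (rule hsol_unique[OF n b h1 h2]) (use la s a1(2) in auto)
      then show ?thesis using d(2) s by simp
    qed
    then show ?thesis using d(1) T1 by (intro exI[of _ "min d T1"]) auto
  qed
  have "hsol n R (T - t) (\<lambda>s. c (t + s))" by (rule hsol_shift[OF c]) (use t in auto)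
  from loc[OF this] obtain d1 where d1: "d1 > 0" "\<forall>s\<in>{0..T - t}. s < d1 \<longrightarrow> hn n (\<lambda>k. c (t + s) k - c t k) < e"
    using low t by auto
  have "hsol n R t (\<lambda>s. mirror (c (t - s)))" by (rule hsol_reverse[OF n c]) (use t in auto)
  moreover have "\<forall>s\<in>{0..t}. \<forall>x. b \<le> fser (mirror (c (t - s))) x" using low t mirror_fser[of 0] by auto
  moreover have "t \<ge> 0" using t by simp
  ultimately have "\<exists>d>0. d \<le> T1 \<and> (\<forall>s\<in>{0..t}. s < d \<longrightarrow> hn n (\<lambda>k. mirror (c (t - s)) k - mirror (c (t - 0)) k) < e)" by (rule loc)
  then obtain d2 where d2: "d2 > 0" "\<forall>s\<in>{0..t}. s < d2 \<longrightarrow> hn n (\<lambda>k. mirror (c (t - s)) k - mirror (c (t - 0)) k) < e"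
    by (elim exE conjE)
  have d2': "hn n (\<lambda>k. c (t - s) k - c t k) < e" if "s \<in> {0..t}" "s < d2" for s
  proof -
    have "(\<lambda>k. mirror (c (t - s)) k - mirror (c (t - 0)) k) = mirror (\<lambda>k. c (t - s) k - c t k)" by (auto simp: mirror_def)
    then show ?thesis using d2(2) that mirror_hn[of n "\<lambda>k. c (t - s) k - c t k"] by force
  qed
  have "hn n (\<lambda>k. c t' k - c t k) < e" if t': "t' \<in> {0..T}" "\<bar>t' - t\<bar> < min d1 d2" for t'
  proof (cases "t \<le> t'")
    case True
    then show ?thesis using d1(2)[rule_format, of "t' - t"] t' by auto
  next
    case False
    then show ?thesis using d2'[of "t - t'"] t' by auto
  qed
  then show "\<exists>d>0. \<forall>t'\<in>{0..T}. \<bar>t' - t\<bar> < d \<longrightarrow> hn n (\<lambda>k. c t' k - c t k) < e"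
    using d1(1) d2(1) by (intro exI[of _ "min d1 d2"]) auto
qed

text \<open>Continuity bounds the norm near each time, and finitely many such neighbourhoods cover
  the interval. This supplies the constant R that \<open>hsol\<close> asks of an arbitrary
  solution.\<close>

lemma hcont_bounded:
  assumes h: "\<And>t. t \<in> {0..T} \<Longrightarrow> hs n (c t)" and c: "hcont n T c"
  shows "\<exists>R\<ge>0. \<forall>t\<in>{0..T}. hn n (c t) \<le> R"
proof -
  have "\<exists>d>0. \<forall>t'\<in>{0..T}. \<bar>t' - t\<bar> < d \<longrightarrow> hn n (c t') \<le> 2 + 2 * hn n (c t)" if t: "t \<in> {0..T}" for t
  proof -
    obtain d where d: "d > 0" "\<forall>t'\<in>{0..T}. \<bar>t' - t\<bar> < d \<longrightarrow> hn n (\<lambda>k. c t' k - c t k) < 1"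
      using c t unfolding hcont_def by (meson zero_less_one)
    have "hn n (c t') \<le> 2 + 2 * hn n (c t)" if t': "t' \<in> {0..T}" "\<bar>t' - t\<bar> < d" for t'
      using hn_triangle(2)[of n "c t'" "c t" "\<lambda>_. 0"] hs_diff(1)[OF h[OF t'(1)] h[OF t]] h[OF t] d(2) t' by fastforce
    then show ?thesis using d(1) by blast
  qed
  then obtain d where d: "\<And>t. t \<in> {0..T} \<Longrightarrow> d t > 0"
    "\<And>t t'. t \<in> {0..T} \<Longrightarrow> t' \<in> {0..T} \<Longrightarrow> \<bar>t' - t\<bar> < d t \<Longrightarrow> hn n (c t') \<le> 2 + 2 * hn n (c t)" by metis
  have "{0..T} \<subseteq> (\<Union>t\<in>{0..T}. ball t (d t))" using d(1) by force
  then obtain F where F: "F \<subseteq> {0..T}" "finite F" "{0..T} \<subseteq> (\<Union>t\<in>F. ball t (d t))"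
    by (rule compactE_image[OF compact_Icc, rotated]) auto
  have "hn n (c t) \<le> (\<Sum>s\<in>F. 2 + 2 * hn n (c s))" if t: "t \<in> {0..T}" for t
  proof -
    obtain s where s: "s \<in> F" "t \<in> ball s (d s)" using F(3) t by blast
    have "hn n (c t) \<le> 2 + 2 * hn n (c s)" using d(2)[of s t] s F(1) t by (auto simp: dist_real_def abs_minus_commute)
    also have "\<dots> \<le> (\<Sum>s\<in>F. 2 + 2 * hn n (c s))" by (rule member_le_sum[OF s(1) _ F(2)]) (simp add: hn_nonneg)
    finally show ?thesis .
  qed
  moreover have "0 \<le> (\<Sum>s\<in>F. 2 + 2 * hn n (c s))" by (intro sum_nonneg) (simp add: hn_nonneg)
  ultimately show ?thesis by blast
qed

text \<open>Sobolev embedding makes closeness in time uniform in x; continuity in x at the fixed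
  time t does the rest.\<close>

lemma hcont_joint:
  assumes h: "\<And>t. t \<in> {0..T} \<Longrightarrow> hs n (c t)" and c: "hcont n T c" and j: "j + 1 \<le> n"
  shows "continuous_on ({0..T} \<times> UNIV) (\<lambda>(t, x). fser (dd j (c t)) x)"
  unfolding continuous_on_iff
proof (intro ballI allI impI, clarify)
  fix t x and e :: real assume t: "t \<in> {0..T}" and e: "e > 0"
  define M where "M = kap ^ j * sqrt (2 ^ n * Zw) + 1"
  have "0 \<le> kap ^ j * sqrt (2 ^ n * Zw)" using kap_pos Zw_nonneg by simp
  then have M: "M > 0" "kap ^ j * sqrt (2 ^ n * Zw) \<le> M" by (auto simp: M_def)
  have e2: "(e / (2 * M))\<^sup>2 > 0" using e M by simp
  obtain d1 where d1: "d1 > 0" "\<forall>t'\<in>{0..T}. \<bar>t' - t\<bar> < d1 \<longrightarrow> hn n (\<lambda>k. c t' k - c t k) < (e / (2 * M))\<^sup>2"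
    using c t e2 unfolding hcont_def by blast
  have aj: "asum 0 (dd j (c s))" if "s \<in> {0..T}" for s by (rule asum_dd[OF hs_asum(1)[OF h[OF that]]]) (use j in simp)
  have "continuous_on UNIV (fser (dd j (c t)))" by (rule fser_cont[OF aj[OF t]])
  then obtain d2 where d2: "d2 > 0" "\<forall>x'. dist x' x < d2 \<longrightarrow> dist (fser (dd j (c t)) x') (fser (dd j (c t)) x) < e / 2"
    using e unfolding continuous_on_iff by (metis UNIV_I half_gt_zero)
  have "dist (fser (dd j (c t')) x') (fser (dd j (c t)) x) < e" if p: "t' \<in> {0..T}" "dist (t', x') (t, x) < min d1 d2" for t' x'
  proof -
    have "dist t' t < d1" "dist x' x < d2" using p(2) dist_fst_le[of "(t', x')" "(t, x)"] dist_snd_le[of "(t', x')" "(t, x)"] by auto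
    then have h1: "hn n (\<lambda>k. c t' k - c t k) < (e / (2 * M))\<^sup>2" and h2: "dist (fser (dd j (c t)) x') (fser (dd j (c t)) x) < e / 2"
      using d1(2) d2(2) p(1) by (auto simp: dist_real_def)
    have "fser (dd j (\<lambda>k. c t' k - c t k)) x' = fser (dd j (c t')) x' - fser (dd j (c t)) x'"
      unfolding dd_diff by (rule fser_diff[OF aj[OF p(1)] aj[OF t]])
    then have "\<bar>fser (dd j (c t')) x' - fser (dd j (c t)) x'\<bar> \<le> kap ^ j * sqrt (2 ^ n * Zw * hn n (\<lambda>k. c t' k - c t k))"
      using fser_dd_le[OF hs_diff(1)[OF h[OF p(1)] h[OF t]] j, of x'] by simp
    also have "\<dots> = kap ^ j * sqrt (2 ^ n * Zw) * sqrt (hn n (\<lambda>k. c t' k - c t k))" by (simp add: real_sqrt_mult)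
    also have "\<dots> \<le> M * sqrt (hn n (\<lambda>k. c t' k - c t k))" using M(2) by (intro mult_right_mono) (simp_all add: hn_nonneg)
    also have "\<dots> \<le> M * (e / (2 * M))"
    proof (rule mult_left_mono)
      have "sqrt (hn n (\<lambda>k. c t' k - c t k)) \<le> sqrt ((e / (2 * M))\<^sup>2)" using h1 by (intro real_sqrt_le_mono) simp
      also have "\<dots> = e / (2 * M)" using e M(1) by (intro real_sqrt_unique) auto
      finally show "sqrt (hn n (\<lambda>k. c t' k - c t k)) \<le> e / (2 * M)" .
    qed (use M in simp)
    also have "\<dots> = e / 2" using M(1) by simp
    finally show ?thesis using h2 unfolding dist_real_def by linarith
  qed
  then show "\<exists>d>0. \<forall>x'\<in>{0..T} \<times> UNIV. dist x' (t, x) < d \<longrightarrow>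
      dist (case x' of (t, x) \<Rightarrow> fser (dd j (c t)) x) (fser (dd j (c t)) x) < e"
    using d1(1) d2(1) by (intro exI[of _ "min d1 d2"]) auto
qed

section \<open>Harry Dym solutions\<close>

text \<open>Uniqueness is claimed among all solutions of the class, so an arbitrary one has to be
  expressed by coefficients. Being classical it is continuous in x, hence equal to its Fourier
  series everywhere, and the initial condition, given almost everywhere, becomes an identity of
  coefficients.\<close>

lemma dym_solution_hsol:
  assumes w: "dym_solution L n T w0 w" and n: "n \<ge> 4" and T: "T \<ge> 0" and w0: "sobolev L (real n) w0"
  obtains R c where "hsol n R T c" "\<And>t x. t \<in> {0..T} \<Longrightarrow> w x t = fser (c t) x" "c 0 = fcoeff L w0"
proof -
  define c where "c t = fcoeff L (\<lambda>x. w x t)" for t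
  have n1: "1 \<le> n" using n by simp
  have sob: "sobolev L (real n) (\<lambda>x. w x t)" if "t \<in> {0..T}" for t using w that by (auto simp: dym_solution_def cont_Hs_def)
  have hc: "hs n (c t)" if "t \<in> {0..T}" for t using sob[OF that] by (simp add: sobolev_eq c_def)
  have sc: "symm (c t)" for t unfolding c_def by (rule symm_fcoeff)
  have eq: "(\<lambda>x. w x t) = fser (c t)" if t: "t \<in> {0..T}" for t
  proof -
    have "diff3 (\<lambda>x. w x t)" using w t by (simp add: dym_solution_def)
    then have "continuous_on UNIV (\<lambda>x. w x t)"
      by (intro continuous_at_imp_continuous_on ballI) (auto simp: diff3_def intro: differentiable_imp_continuous_within)
    then show ?thesis unfolding c_def by (rule sobolev_cont_rep[OF sob[OF t] n1])
  qed
  have weq: "w x t = fser (c t) x" if "t \<in> {0..T}" for t x using fun_cong[OF eq[OF that]] .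
  have dx: "(fser (dd j (c t)) has_real_derivative fser (dd (Suc j) (c t)) x) (at x)" if "t \<in> {0..T}" "j \<le> 2" for t j x
    by (rule fser_deriv_dd[OF hs_asum(1)[OF hc[OF that(1)]]]) (use that n in simp)
  have dv: "deriv (fser (dd j (c t))) = fser (dd (Suc j) (c t))" if "t \<in> {0..T}" "j \<le> 2" for t j
    by (rule ext, rule DERIV_imp_deriv, rule dx[OF that])
  have d3: "deriv (deriv (deriv (fser (c t)))) = fser (dd 3 (c t))" if "t \<in> {0..T}" for t
    using dv[OF that, of 0] dv[OF that, of 1] dv[OF that, of 2] by (simp add: numeral_2_eq_2 numeral_3_eq_3)
  have hcon: "hcont n T c" unfolding hcont_def
  proof (intro ballI allI impI)
    fix t and e :: real assume t: "t \<in> {0..T}" and e: "e > 0"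
    then have "sqrt e > 0" by simp
    then obtain d where d: "d > 0" "\<forall>t'\<in>{0..T}. \<bar>t' - t\<bar> < d \<longrightarrow> hnorm L (real n) (\<lambda>x. w x t' - w x t) < sqrt e"
      using w t unfolding dym_solution_def cont_Hs_def by blast
    have "hn n (\<lambda>k. c t' k - c t k) < e" if t': "t' \<in> {0..T}" "\<bar>t' - t\<bar> < d" for t'
      using d(2)[rule_format, OF t'] unfolding hnorm_eq sobolev_fcoeff_diff[OF sob[OF t'(1)] sob[OF t]] c_def by simp
    then show "\<exists>d>0. \<forall>t'\<in>{0..T}. \<bar>t' - t\<bar> < d \<longrightarrow> hn n (\<lambda>k. c t' k - c t k) < e" using d(1) by blast
  qed
  obtain R where R: "R \<ge> 0" "\<forall>t\<in>{0..T}. hn n (c t) \<le> R" using hcont_bounded[OF hc hcon] by blast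
  have dt: "((\<lambda>t. fser (c t) x) has_real_derivative (fser (c t) x ^ 3 * fser (dd 3 (c t)) x + 0)) (at t within {0..T})"
    if t: "t \<in> {0..T}" for t x
  proof -
    have "((\<lambda>s. w x s) has_real_derivative ((w x t) ^ 3 * deriv (deriv (deriv (\<lambda>y. w y t))) x)) (at t within {0..T})"
      using w t by (simp add: dym_solution_def)
    then have "((\<lambda>s. w x s) has_real_derivative (fser (c t) x ^ 3 * fser (dd 3 (c t)) x + 0)) (at t within {0..T})"
      unfolding eq[OF t] weq[OF t] d3[OF t] by simp
    then show ?thesis
      by (rule has_field_derivative_transform_within[OF _ zero_less_one t]) (rule weq)
  qed
  have h: "hsol n R T c" unfolding hsol_def classical_sol_def
    using hc sc R(2) dx[of _ 0] dx[of _ 1] dx[of _ 2] dt hcont_joint[OF hc hcon, of 0] hcont_joint[OF hc hcon, of 3] n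
    by (simp add: fser_periodic numeral_2_eq_2 numeral_3_eq_3)
  have z: "0 \<in> {0..T}" using T by simp
  have "AE x in lborel. fser (c 0) x = fser (fcoeff L w0) x"
  proof -
    have "AE x in lborel. w x 0 = w0 x" using w by (simp add: dym_solution_def)
    with sobolev_rep[OF w0 n1] show ?thesis by eventually_elim (use weq[OF z] in simp)
  qed
  moreover have a: "asum 0 (c 0)" "asum 0 (fcoeff L w0)"
    using hs_asum(1)[OF hc[OF z], of 0] hs_asum(1)[of n "fcoeff L w0" 0] w0 n by (auto simp: sobolev_eq)
  ultimately have "fser (c 0) = fser (fcoeff L w0)" by (intro continuous_AE_eq fser_cont)
  then have c0: "c 0 = fcoeff L w0" by (rule fser_eq_iff[OF a(1) sc a(2) symm_fcoeff])
  show thesis by (rule that[of R c], rule h, erule weq, rule c0)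
qed

lemma hsol_dym_solution:
  assumes n: "n \<ge> 4" and c: "hsol n R T c" and hc: "hcont n T c" and T: "T \<ge> 0" and w0: "sobolev L (real n) w0" and e: "c 0 = fcoeff L w0"
  shows "dym_solution L n T w0 (\<lambda>x t. fser (c t) x)"
proof -
  have n1: "1 \<le> n" using n by simp
  note h = hsolD(1)[OF c] and s = hsolD(2)[OF c]
  have dx: "(fser (dd j (c t)) has_real_derivative fser (dd (Suc j) (c t)) x) (at x)" if "t \<in> {0..T}" "j \<le> 2" for t j x
    by (rule fser_deriv_dd[OF hs_asum(1)[OF h[OF that(1)]]]) (use that n in simp)
  have dv: "deriv (fser (dd j (c t))) = fser (dd (Suc j) (c t))" if "t \<in> {0..T}" "j \<le> 2" for t j
    by (rule ext, rule DERIV_imp_deriv, rule dx[OF that])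
  have d1: "deriv (fser (c t)) = fser (dd 1 (c t))" and d2: "deriv (fser (dd 1 (c t))) = fser (dd 2 (c t))"
    and d3: "deriv (fser (dd 2 (c t))) = fser (dd 3 (c t))" if "t \<in> {0..T}" for t
    using dv[OF that, of 0] dv[OF that, of 1] dv[OF that, of 2] by (simp_all add: numeral_2_eq_2 numeral_3_eq_3)
  have "cont_Hs L (real n) T (\<lambda>x t. fser (c t) x)" unfolding cont_Hs_def
  proof (intro conjI ballI allI impI)
    fix t assume t: "t \<in> {0..T}"
    show "sobolev L (real n) (\<lambda>x. fser (c t) x)" by (rule fser_sobolev[OF h[OF t] n1 s[OF t]])
    fix e :: real assume e: "e > 0"
    then have "e\<^sup>2 > 0" by simp
    then obtain d where d: "d > 0" "\<forall>t'\<in>{0..T}. \<bar>t' - t\<bar> < d \<longrightarrow> hn n (\<lambda>k. c t' k - c t k) < e\<^sup>2"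
      using hc t unfolding hcont_def by blast
    have "hnorm L (real n) (\<lambda>x. fser (c t') x - fser (c t) x) < e" if t': "t' \<in> {0..T}" "\<bar>t' - t\<bar> < d" for t'
    proof -
      have a: "asum 0 (c t')" "asum 0 (c t)" by (rule hs_asum(1)[OF h[OF t'(1)]], use n in simp, rule hs_asum(1)[OF h[OF t]], use n in simp)
      have "fcoeff L (\<lambda>x. fser (c t') x - fser (c t) x) = (\<lambda>k. c t' k - c t k)"
        unfolding sobolev_fcoeff_diff[OF fser_sobolev[OF h[OF t'(1)] n1 s[OF t'(1)]] fser_sobolev[OF h[OF t] n1 s[OF t]]]
        by (simp add: fcoeff_fser[OF a(1) s[OF t'(1)]] fcoeff_fser[OF a(2) s[OF t]])
      then have "hnorm L (real n) (\<lambda>x. fser (c t') x - fser (c t) x) = sqrt (hn n (\<lambda>k. c t' k - c t k))" by (simp add: hnorm_eq)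
      also have "\<dots> < sqrt (e\<^sup>2)" using d(2) t' by (intro real_sqrt_less_mono) auto
      finally show ?thesis using e by simp
    qed
    then show "\<exists>d>0. \<forall>t'\<in>{0..T}. \<bar>t' - t\<bar> < d \<longrightarrow> hnorm L (real n) (\<lambda>x. fser (c t') x - fser (c t) x) < e" using d(1) by blast
  qed
  moreover have "diff3 (\<lambda>x. fser (c t) x)" if t: "t \<in> {0..T}" for t
  proof -
    have "\<forall>x. (fser (c t) has_real_derivative fser (dd 1 (c t)) x) (at x)" "\<forall>x. (fser (dd 1 (c t)) has_real_derivative fser (dd 2 (c t)) x) (at x)"
      "\<forall>x. (fser (dd 2 (c t)) has_real_derivative fser (dd 3 (c t)) x) (at x)"
      using dx[OF t, of 0] dx[OF t, of 1] dx[OF t, of 2] by (simp_all add: numeral_2_eq_2 numeral_3_eq_3)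
    then show ?thesis unfolding diff3_def d1[OF t] d2[OF t] real_differentiable_def by blast
  qed
  moreover have "((\<lambda>s. fser (c s) x) has_real_derivative (fser (c t) x ^ 3 * deriv (deriv (deriv (\<lambda>y. fser (c t) y))) x)) (at t within {0..T})"
    if t: "t \<in> {0..T}" for t x
    unfolding d1[OF t] d2[OF t] d3[OF t] using c t by (simp add: hsol_def classical_sol_def)
  moreover have "AE x in lborel. fser (c 0) x = w0 x" using sobolev_rep[OF w0 n1] unfolding e by eventually_elim simp
  ultimately show ?thesis unfolding dym_solution_def by blast
qed

text \<open>Interpolation for real n' by cutting where \<open>1 + k^2\<close> passes N: below, the
  weight is at most \<open>N powr n'\<close>; above, it is at most \<open>N powr (n' - n)\<close>
  times the weight of order n. N is fixed first for the high frequencies, then \<open>\<eta>\<close>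
  for the low ones.\<close>

lemma hnorm_small:
  assumes n': "0 \<le> n'" "n' < real n" and n: "n \<ge> 1" and R: "R \<ge> 0" and \<epsilon>: "\<epsilon> > 0"
  shows "\<exists>\<eta>>0. \<forall>d. hs n d \<longrightarrow> symm d \<longrightarrow> hn n d \<le> R \<longrightarrow> hn 0 d \<le> \<eta> \<longrightarrow> hnorm L n' (fser d) \<le> \<epsilon>"
proof -
  let ?q = "n' - real n"
  have "((\<lambda>N. N powr ?q) \<longlongrightarrow> 0) at_top" by (rule tendsto_neg_powr) (use n' filterlim_ident in auto)
  moreover have q: "\<epsilon>\<^sup>2 / (2 * (R + 1)) > 0" using \<epsilon> R by simp
  ultimately have "\<forall>\<^sub>F N in at_top. N powr ?q < \<epsilon>\<^sup>2 / (2 * (R + 1))" by (rule order_tendstoD(2))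
  then obtain N where N: "N \<ge> 1" "N powr ?q < \<epsilon>\<^sup>2 / (2 * (R + 1))"
    using eventually_conj[OF eventually_ge_at_top[of "1 :: real"]] eventually_happens[of _ "at_top :: real filter"] by fastforce
  have NR: "N powr ?q * R \<le> \<epsilon>\<^sup>2 / 2"
  proof -
    have "N powr ?q * R \<le> \<epsilon>\<^sup>2 / (2 * (R + 1)) * (R + 1)" using N R q by (intro mult_mono) auto
    also have "\<dots> = \<epsilon>\<^sup>2 / 2" using R by (simp add: field_simps)
    finally show ?thesis .
  qed
  define \<eta> where "\<eta> = \<epsilon>\<^sup>2 / (2 * N powr n')"
  have Np: "N powr n' > 0" using N by simp
  have \<eta>: "\<eta> > 0" using \<epsilon> Np by (simp add: \<eta>_def)
  have "hnorm L n' (fser d) \<le> \<epsilon>" if d: "hs n d" "symm d" "hn n d \<le> R" "hn 0 d \<le> \<eta>" for d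
  proof -
    have a: "asum 0 d" by (rule hs_asum(1)[OF d(1)]) (use n in simp)
    have h0: "hs 0 d" by (rule hs_mono(1)[OF d(1)]) simp
    have trm: "(1 + (real_of_int k)\<^sup>2) powr n' \<le> N powr n' + N powr ?q * hw n k" for k
    proof (cases "1 + (real_of_int k)\<^sup>2 \<le> N")
      case True
      then have "(1 + (real_of_int k)\<^sup>2) powr n' \<le> N powr n'" using n' by (intro powr_mono2) auto
      moreover have "0 \<le> N powr ?q * hw n k" using hw_pos[of n k] by simp
      ultimately show ?thesis by linarith
    next
      case False
      let ?y = "1 + (real_of_int k)\<^sup>2"
      have y: "?y > 0" using False N by linarith
      have "?y powr n' = ?y powr ?q * ?y powr real n" by (simp flip: powr_add)
      also have "?y powr real n = hw n k" unfolding hw_def using y by (rule powr_realpow)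
      also have "?y powr ?q * hw n k \<le> N powr ?q * hw n k"
        using False N n' hw_pos[of n k] by (intro mult_right_mono powr_mono2') auto
      finally show ?thesis using Np by linarith
    qed
    have "(\<Sum>\<^sub>\<infinity>k::int. (1 + (real_of_int k)\<^sup>2) powr n' * (cmod (d k))\<^sup>2)
      \<le> (\<Sum>\<^sub>\<infinity>k. N powr n' * (hw 0 k * (cmod (d k))\<^sup>2) + N powr ?q * (hw n k * (cmod (d k))\<^sup>2))" (is "_ \<le> infsum ?g _")
    proof (rule infsum_mono)
      show g: "?g summable_on UNIV" using h0 d(1) unfolding hs_def by (intro summable_on_add summable_on_cmult_right)
      have le: "(1 + (real_of_int k)\<^sup>2) powr n' * (cmod (d k))\<^sup>2 \<le> ?g k" for k
        using mult_right_mono[OF trm[of k], of "(cmod (d k))\<^sup>2"] by (simp add: hw_def[of 0] distrib_right mult.assoc)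
      then show "\<And>k. (1 + (real_of_int k)\<^sup>2) powr n' * (cmod (d k))\<^sup>2 \<le> ?g k" .
      show "(\<lambda>k. (1 + (real_of_int k)\<^sup>2) powr n' * (cmod (d k))\<^sup>2) summable_on UNIV"
        by (rule summable_on_real_le(1)[OF g]) (use le in simp)
    qed
    also have "\<dots> = N powr n' * hn 0 d + N powr ?q * hn n d"
      using h0 d(1) unfolding hs_def hn_def by (simp add: infsum_add summable_on_cmult_right infsum_cmult_right')
    also have "\<dots> \<le> N powr n' * \<eta> + N powr ?q * R" using d(3,4) by (intro add_mono mult_left_mono) auto
    also have "\<dots> \<le> \<epsilon>\<^sup>2" using NR Np by (simp add: \<eta>_def)
    finally have "hnorm L n' (fser d) \<le> sqrt (\<epsilon>\<^sup>2)"
      unfolding hnorm_def fcoeff_fser[OF a d(2)] by (rule real_sqrt_le_mono)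
    then show ?thesis using \<epsilon> by simp
  qed
  then show ?thesis using \<eta> by blast
qed

lemma sobolev_fser_ge:
  assumes "sobolev L (real n) f" "n \<ge> 1" "\<And>x. f x > a"
  shows "a \<le> fser (fcoeff L f) x"
proof (rule continuous_AE_ge[of "fser (fcoeff L f)" a])
  show "continuous_on UNIV (fser (fcoeff L f))"
    using assms by (intro fser_cont[OF hs_asum(1)[of n _ 0]]) (auto simp: sobolev_eq)
  show "AE x in lborel. a \<le> fser (fcoeff L f) x"
    using sobolev_rep[OF assms(1,2)] by eventually_elim (metis assms(3) less_imp_le)
qed

end

theorem theorem8:
  fixes L a0 :: real and n :: nat and u0 :: "real \<Rightarrow> real"
  assumes "L > 0" and "n \<ge> 4" and "a0 > 0"
    and "sobolev L (real n) u0" and "\<forall>x. u0 x > a0"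
  shows "\<exists>T>0. \<exists>u. dym_solution L n T u0 u
           \<and> (\<forall>x. \<forall>t\<in>{0..T}. u x t > a0 / 2)
           \<and> (\<forall>w. dym_solution L n T u0 w \<longrightarrow> (\<forall>x. \<forall>t\<in>{0..T}. w x t = u x t))
           \<and> (\<forall>n' \<epsilon>. 0 \<le> n' \<and> n' < real n \<and> \<epsilon> > 0 \<longrightarrow>
                (\<exists>\<delta>>0. \<forall>v0. sobolev L (real n) v0 \<and> (\<forall>x. v0 x > a0)
                      \<and> hnorm L (real n) (\<lambda>x. v0 x - u0 x) \<le> \<delta> \<longrightarrow>
                    (\<exists>v. dym_solution L n T v0 v)
                    \<and> (\<forall>v. dym_solution L n T v0 v \<longrightarrow>
                         (\<exists>M<\<epsilon>. \<forall>t\<in>{0..T}. hnorm L n' (\<lambda>x. u x t - v x t) \<le> M))))"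
proof -
  interpret circle L by unfold_locales (rule assms(1))
  note n = assms(2) and sob = assms(4)
  have n1: "1 \<le> n" and b: "2 / 3 * a0 > 0" using n assms(3) by auto
  \<comment> \<open>Large enough for all data with \<open>hn\<close> distance at most 1 from u0, by
    the triangle inequality with factor 2; one time T then serves u and every v.\<close>
  define R0 where "R0 = 2 * hn n (fcoeff L u0) + 2"
  have R0: "R0 \<ge> 0" by (simp add: R0_def hn_nonneg)
  obtain T R where T: "T > 0" and R: "R \<ge> 0" and ex: "\<forall>\<alpha>. hs n \<alpha> \<longrightarrow> symm \<alpha> \<longrightarrow> hn n \<alpha> \<le> R0 \<longrightarrow> (\<forall>x. a0 \<le> fser \<alpha> x) \<longrightarrow>
      (\<exists>c. hsol n R T c \<and> c 0 = \<alpha> \<and> (\<forall>t\<in>{0..T}. \<forall>x. 2 / 3 * a0 \<le> fser (c t) x) \<and>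
        (\<forall>e>0. \<exists>d>0. \<forall>t\<in>{0..T}. t < d \<longrightarrow> hn n (\<lambda>k. c t k - \<alpha> k) < e))"
    using local_existence[OF n assms(3) R0] by (elim exE conjE)
  have T0: "T \<ge> 0" using T by simp
  have sol: "\<exists>c. hsol n R T c \<and> c 0 = fcoeff L f \<and> (\<forall>t\<in>{0..T}. \<forall>x. 2 / 3 * a0 \<le> fser (c t) x) \<and> dym_solution L n T f (\<lambda>x t. fser (c t) x)
     \<and> (\<forall>w. dym_solution L n T f w \<longrightarrow> (\<forall>x. \<forall>t\<in>{0..T}. w x t = fser (c t) x))"
    if f: "sobolev L (real n) f" "\<forall>x. f x > a0" "hn n (fcoeff L f) \<le> R0" for f
  proof -
    have hf: "hs n (fcoeff L f)" using f(1) by (simp add: sobolev_eq)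
    obtain c where c: "hsol n R T c" "c 0 = fcoeff L f" "\<forall>t\<in>{0..T}. \<forall>x. 2 / 3 * a0 \<le> fser (c t) x"
      using ex[rule_format, OF hf symm_fcoeff f(3) sobolev_fser_ge[OF f(1) n1 f(2)[rule_format]]] by blast
    have d: "dym_solution L n T f (\<lambda>x t. fser (c t) x)"
      by (rule hsol_dym_solution[OF n c(1) hsol_hcont[OF n b c(1,3)] T0 f(1) c(2)])
    have "w x t = fser (c t) x" if w: "dym_solution L n T f w" and t: "t \<in> {0..T}" for w x t
    proof -
      obtain R' c' where c': "hsol n R' T c'" "\<And>t x. t \<in> {0..T} \<Longrightarrow> w x t = fser (c' t) x" "c' 0 = fcoeff L f"
        using dym_solution_hsol[OF w n T0 f(1)] by blast
      have "c t = c' t" by (rule hsol_unique[OF n b c(1) c'(1) c(3) _ t]) (simp add: c(2) c'(3))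
      then show ?thesis using c'(2)[OF t] by simp
    qed
    then show ?thesis using c d by blast
  qed
  have "hn n (fcoeff L u0) \<le> R0" using hn_nonneg[of n "fcoeff L u0"] by (simp add: R0_def)
  from sol[OF sob assms(5) this] obtain c where c: "hsol n R T c" "c 0 = fcoeff L u0" "\<forall>t\<in>{0..T}. \<forall>x. 2 / 3 * a0 \<le> fser (c t) x"
    "dym_solution L n T u0 (\<lambda>x t. fser (c t) x)"
    "\<forall>w. dym_solution L n T u0 w \<longrightarrow> (\<forall>x. \<forall>t\<in>{0..T}. w x t = fser (c t) x)" by blast
  have pos: "fser (c t) x > a0 / 2" if "t \<in> {0..T}" for t x
  proof -
    have "2 / 3 * a0 \<le> fser (c t) x" using c(3) that by blast
    then show ?thesis using assms(3) by linarith
  qed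
  obtain C where C: "C \<ge> 0" "\<forall>c c'. hsol n R T c \<longrightarrow> hsol n R T c' \<longrightarrow> (\<forall>t\<in>{0..T}. \<forall>x. 2 / 3 * a0 \<le> fser (c t) x) \<longrightarrow>
    (\<forall>t\<in>{0..T}. hn 0 (\<lambda>k. c t k - c' t k) \<le> C * hn 0 (\<lambda>k. c 0 k - c' 0 k))"
    using hsol_stable[OF n b R T0] by (elim exE conjE)
  have stab: "\<exists>\<delta>>0. \<forall>v0. sobolev L (real n) v0 \<and> (\<forall>x. v0 x > a0) \<and> hnorm L (real n) (\<lambda>x. v0 x - u0 x) \<le> \<delta> \<longrightarrow>
        (\<exists>v. dym_solution L n T v0 v) \<and> (\<forall>v. dym_solution L n T v0 v \<longrightarrow>
           (\<exists>M<\<epsilon>. \<forall>t\<in>{0..T}. hnorm L n' (\<lambda>x. fser (c t) x - v x t) \<le> M))"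
    if n': "0 \<le> n'" "n' < real n" and \<epsilon>: "\<epsilon> > 0" for n' \<epsilon>
  proof -
    have R4: "4 * R \<ge> 0" and \<epsilon>2: "\<epsilon> / 2 > 0" using R \<epsilon> by auto
    obtain \<eta> where \<eta>: "\<eta> > 0" "\<And>d. hs n d \<Longrightarrow> symm d \<Longrightarrow> hn n d \<le> 4 * R \<Longrightarrow> hn 0 d \<le> \<eta> \<Longrightarrow> hnorm L n' (fser d) \<le> \<epsilon> / 2"
      using hnorm_small[OF n' n1 R4 \<epsilon>2] by blast
    \<comment> \<open>\<open>C * \<delta> \<le> \<eta>\<close> makes the mean-square distance small
      at all times; \<open>\<delta> \<le> 1\<close> puts v0 in the range of R0 and gives
      \<open>\<delta>\<^sup>2 \<le> \<delta>\<close>, as \<open>hn\<close> is a squared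
      norm.\<close>
    define \<delta> where "\<delta> = min 1 (\<eta> / (C + 1))"
    have \<delta>: "\<delta> > 0" "\<delta> \<le> 1" using \<eta>(1) C(1) by (auto simp: \<delta>_def)
    have C\<delta>: "C * \<delta> \<le> \<eta>"
    proof -
      have "C * \<delta> \<le> (C + 1) * (\<eta> / (C + 1))" using C(1) \<delta>(1) by (intro mult_mono) (auto simp: \<delta>_def)
      then show ?thesis using C(1) by simp
    qed
    show ?thesis
    proof (rule exI[of _ \<delta>], rule conjI[OF \<delta>(1)], intro allI impI, elim conjE)
      fix v0 assume v0: "sobolev L (real n) v0" "\<forall>x. v0 x > a0" "hnorm L (real n) (\<lambda>x. v0 x - u0 x) \<le> \<delta>"
      let ?d = "\<lambda>k. fcoeff L v0 k - fcoeff L u0 k"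
      have hs: "hs n (fcoeff L v0)" "hs n (fcoeff L u0)" using v0(1) sob by (auto simp: sobolev_eq)
      have "sqrt (hn n ?d) \<le> \<delta>" using v0(3) unfolding hnorm_eq sobolev_fcoeff_diff[OF v0(1) sob] .
      then have "hn n ?d \<le> \<delta>\<^sup>2" using hn_nonneg \<delta>(1) by (simp add: sqrt_le_D)
      also have "\<dots> \<le> \<delta>" using \<delta> by (simp add: power2_eq_square mult_left_le)
      finally have hd: "hn n ?d \<le> \<delta>" .
      have "hn n (fcoeff L v0) \<le> 2 * hn n ?d + 2 * hn n (fcoeff L u0)"
        using hn_triangle(2)[of n "fcoeff L v0" "fcoeff L u0" "\<lambda>_. 0"] hs_diff(1)[OF hs] hs(2) by simp
      then have "hn n (fcoeff L v0) \<le> R0" using hd \<delta>(2) by (simp add: R0_def)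
      from sol[OF v0(1,2) this] obtain c' where c': "hsol n R T c'" "c' 0 = fcoeff L v0"
        "dym_solution L n T v0 (\<lambda>x t. fser (c' t) x)"
        "\<forall>w. dym_solution L n T v0 w \<longrightarrow> (\<forall>x. \<forall>t\<in>{0..T}. w x t = fser (c' t) x)" by blast
      have est: "hnorm L n' (\<lambda>x. fser (c t) x - v x t) \<le> \<epsilon> / 2" if v: "dym_solution L n T v0 v" and t: "t \<in> {0..T}" for v t
      proof -
        let ?e = "\<lambda>k. c t k - c' t k"
        note h = hsolD[OF c(1) t] and h' = hsolD[OF c'(1) t]
        have "fser ?e x = fser (c t) x - fser (c' t) x" for x
          by (rule fser_diff[OF hs_asum(1)[OF h(1), of 0] hs_asum(1)[OF h'(1), of 0]]) (use n in auto)
        then have e: "(\<lambda>x. fser (c t) x - v x t) = fser ?e" using c'(4) v t by (auto simp: fun_eq_iff)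
        have "hn 0 ?e \<le> C * hn 0 (\<lambda>k. c 0 k - c' 0 k)" by (rule C(2)[rule_format, OF c(1) c'(1) c(3)[rule_format] t])
        also have "hn 0 (\<lambda>k. c 0 k - c' 0 k) = hn 0 ?d" unfolding c(2) c'(2) by (rule hn_commute)
        also have "hn 0 ?d \<le> hn n ?d" by (rule hs_mono(2)[OF hs_diff(1)[OF hs]]) simp
        also have "\<dots> \<le> \<delta>" by (rule hd)
        also note C\<delta>
        finally have "hn 0 ?e \<le> \<eta>" using C(1) by (simp add: mult_left_mono)
        moreover have "hn n ?e \<le> 4 * R" using hs_diff(2)[OF h(1) h'(1)] h(3) h'(3) by linarith
        ultimately show ?thesis unfolding e using \<eta>(2)[OF hs_diff(1)[OF h(1) h'(1)] symm_diff[OF h(2) h'(2)]] by blast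
      qed
      \<comment> \<open>The bound \<open>M = \<epsilon> / 2\<close>, uniform in t, makes the
        supremum strictly smaller than \<open>\<epsilon>\<close>.\<close>
      show "(\<exists>v. dym_solution L n T v0 v) \<and> (\<forall>v. dym_solution L n T v0 v \<longrightarrow>
           (\<exists>M<\<epsilon>. \<forall>t\<in>{0..T}. hnorm L n' (\<lambda>x. fser (c t) x - v x t) \<le> M))"
        using c'(3) est \<epsilon> by (intro conjI exI[of _ "\<lambda>x t. fser (c' t) x"] allI impI exI[of _ "\<epsilon> / 2"]) auto
    qed
  qed
  show ?thesis
    by (rule exI[of _ T], rule conjI[OF T], rule exI[of _ "\<lambda>x t. fser (c t) x"], rule conjI[OF c(4)], rule conjI, intro allI ballI, erule pos,
      rule conjI[OF c(5)], intro allI impI, elim conjE, rule stab)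
qed

end
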